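(* Let $\{n_i\}_{i=1}^N$ be a sequence of integers with $n_i\ge 2$ for all $1\le i\le N$, where $N$ is finite or infinite. Let $F(n_i)$ be the free group with standard generators $\{g_{i,j}\}_{j=1}^{n_i}$, and let $G=\times_{i=1}^N F(n_i)$ be the direct product of the groups $F(n_i)$ (the restricted direct product when $N=\infty$), with each $F(n_i)$ identified with its canonical image in $G$. Let $\lambda$ be the left regular representation of $G$ and let $\mathcal M=L(G)\cong\otimes_{i=1}^N L(F(n_i))$ be the group von Neumann algebra of $G$. Let $\mathcal A$ be the abelian von Neumann subalgebra of $\mathcal M$ generated by the unitaries $\{\lambda(g_{i,1}) : 1\le i\le N\}$. Then $\mathcal A$ is a maximal injective von Neumann subalgebra of $\mathcal M$, and $\mathcal A$ is not contained in any hyperfinite subfactor of $\mathcal M$.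
   Context: A von Neumann algebra $\mathcal R\subset\mathcal B(\mathcal H)$ is injective if it is the range of a norm one projection from $\mathcal B(\mathcal H)$ onto $\mathcal R$. A maximal injective von Neumann subalgebra of $\mathcal M$ is an injective von Neumann subalgebra of $\mathcal M$ that is not properly contained in any injective von Neumann subalgebra of $\mathcal M$. The restricted direct product consists of the sequences $(x_i)_i$ with $x_i\in F(n_i)$ and $x_i=e$ for all but finitely many $i$. When $N=\infty$ the index range $1\le i\le N$ means all integers $i\ge1$, and $\otimes_{i=1}^\infty L(F(n_i))$ is the infinite tensor product taken with respect to the canonical traces. *)

theory Defs
  imports "HOL-Analysis.Analysis" "HOL-Algebra.Product_Groups"
begin

section \<open>Free groups\<close>

text \<open>
  The free group on a set \<open>S\<close> consists of the reduced words in letters \<open>(s, b)\<close> with \<open>s \<in> S\<close>;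
  the letter \<open>(s, False)\<close> stands for \<open>s\<close> and \<open>(s, True)\<close> for its inverse. The product is
  concatenation followed by reduction.
\<close>

definition flip_letter :: "'s \<times> bool \<Rightarrow> 's \<times> bool" where
  "flip_letter a = (fst a, \<not> snd a)"

definition reduced :: "('s \<times> bool) list \<Rightarrow> bool" where
  "reduced w \<longleftrightarrow> successively (\<lambda>a b. b \<noteq> flip_letter a) w"

fun red_cons :: "'s \<times> bool \<Rightarrow> ('s \<times> bool) list \<Rightarrow> ('s \<times> bool) list" where
  "red_cons a [] = [a]"
| "red_cons a (b # w) = (if b = flip_letter a then w else a # b # w)"

definition free_group :: "'s set \<Rightarrow> ('s \<times> bool) list monoid" where
  "free_group S =
     \<lparr>carrier = {w. set w \<subseteq> S \<times> UNIV \<and> reduced w}, mult = foldr red_cons, one = []\<rparr>"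

definition free_gen :: "'s \<Rightarrow> ('s \<times> bool) list" where
  "free_gen s = [(s, False)]"

lemma flip_flip [simp]: "flip_letter (flip_letter a) = a"
  by (simp add: flip_letter_def)

lemma fst_flip [simp]: "fst (flip_letter a) = fst a"
  by (simp add: flip_letter_def)

lemma reduced_red_cons: "reduced w \<Longrightarrow> reduced (red_cons a w)"
  by (cases w) (auto simp: reduced_def successively_Cons)

lemma red_cons_flip: "reduced w \<Longrightarrow> red_cons (flip_letter a) (red_cons a w) = w"
proof (cases w)
  case (Cons b v)
  then show "reduced w \<Longrightarrow> ?thesis"
    by (cases v) (auto simp: reduced_def successively_Cons)
qed auto

lemma red_cons_flip': "reduced w \<Longrightarrow> red_cons a (red_cons (flip_letter a) w) = w"
  using red_cons_flip[of w "flip_letter a"] by simp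

lemma reduced_foldr: "reduced w \<Longrightarrow> reduced (foldr red_cons u w)"
  by (induction u) (auto intro: reduced_red_cons)

lemma red_cons_reduced: "reduced (a # w) \<Longrightarrow> red_cons a w = a # w"
  by (cases w) (auto simp: reduced_def)

lemma reduced_tl: "reduced (a # w) \<Longrightarrow> reduced w"
  by (auto simp: reduced_def successively_Cons)

lemma set_red_cons: "set (red_cons a w) \<subseteq> insert a (set w)"
  by (cases w) auto

lemma set_foldr_red_cons: "set (foldr red_cons u w) \<subseteq> set u \<union> set w"
proof (induction u)
  case (Cons a u)
  then show ?case using set_red_cons[of a "foldr red_cons u w"] by auto
qed simp

lemma foldr_red_cons_step:
  assumes "reduced w"
  shows "foldr red_cons (red_cons a v) w = red_cons a (foldr red_cons v w)"
proof (cases v)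
  case (Cons b v')
  then show ?thesis
    using red_cons_flip'[OF reduced_foldr[OF assms], of a v'] by auto
qed simp

lemma foldr_red_cons_assoc:
  assumes "reduced w"
  shows "foldr red_cons (foldr red_cons u v) w = foldr red_cons u (foldr red_cons v w)"
  by (induction u) (auto simp: foldr_red_cons_step[OF assms])

lemma foldr_red_cons_Nil: "reduced w \<Longrightarrow> foldr red_cons w [] = w"
proof (induction w)
  case (Cons a w)
  then show ?case using red_cons_reduced[of a w] reduced_tl[of a w] by simp
qed simp

lemma foldr_red_cons_inverse:
  "reduced u \<Longrightarrow> foldr red_cons (rev (map flip_letter u)) u = []"
proof (induction u)
  case (Cons a u)
  then show ?case using reduced_tl[of a u] by simp
qed simp

lemma reduced_inverse: "reduced u \<Longrightarrow> reduced (rev (map flip_letter u))"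
  unfolding reduced_def
  by (simp only: successively_rev successively_map flip_flip) (metis (mono_tags, lifting) flip_flip successively_mono)

lemma group_free_group: "group (free_group S)"
proof (rule groupI)
  fix x y z
  assume "x \<in> carrier (free_group S)" "y \<in> carrier (free_group S)"
  then show "x \<otimes>\<^bsub>free_group S\<^esub> y \<in> carrier (free_group S)"
    using set_foldr_red_cons[of x y] by (auto simp: free_group_def intro: reduced_foldr)
next
  fix x
  assume x: "x \<in> carrier (free_group S)"
  show "\<exists>y\<in>carrier (free_group S). y \<otimes>\<^bsub>free_group S\<^esub> x = \<one>\<^bsub>free_group S\<^esub>"
    using x reduced_inverse[of x] foldr_red_cons_inverse[of x]
    by (intro bexI[of _ "rev (map flip_letter x)"]) (auto simp: free_group_def flip_letter_def)
qed (auto simp: free_group_def foldr_red_cons_assoc, auto simp: reduced_def)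

text \<open>The defining universal property of the free group.\<close>

lemma free_group_universal:
  fixes \<phi> :: "'s \<Rightarrow> 'h"
  assumes "group H" and \<phi>: "\<And>s. s \<in> S \<Longrightarrow> \<phi> s \<in> carrier H"
  shows "\<exists>h \<in> hom (free_group S) H. \<forall>s\<in>S. h (free_gen s) = \<phi> s"
    and "\<lbrakk>h \<in> hom (free_group S) H; k \<in> hom (free_group S) H;
          \<forall>s\<in>S. h (free_gen s) = k (free_gen s); w \<in> carrier (free_group S)\<rbrakk> \<Longrightarrow> h w = k w"
proof -
  interpret H: group H by fact
  define l where "l a = (if snd a then inv\<^bsub>H\<^esub> \<phi> (fst a) else \<phi> (fst a))" for a :: "'s \<times> bool"
  define h0 where "h0 w = foldr (\<lambda>a y. l a \<otimes>\<^bsub>H\<^esub> y) w \<one>\<^bsub>H\<^esub>" for w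
  have l: "l a \<in> carrier H" if "fst a \<in> S" for a
    using \<phi> that by (auto simp: l_def)
  have lf: "l a \<otimes>\<^bsub>H\<^esub> l (flip_letter a) = \<one>\<^bsub>H\<^esub>" if "fst a \<in> S" for a
    using \<phi> that by (auto simp: l_def flip_letter_def)
  have h0c: "h0 w \<in> carrier H" if "set w \<subseteq> S \<times> UNIV" for w
    using that by (induction w) (auto simp: h0_def l)
  have hr: "h0 (red_cons a w) = l a \<otimes>\<^bsub>H\<^esub> h0 w" if "fst a \<in> S" "set w \<subseteq> S \<times> UNIV" for a w
  proof (cases w)
    case (Cons b v)
    have "l a \<otimes>\<^bsub>H\<^esub> (l (flip_letter a) \<otimes>\<^bsub>H\<^esub> h0 v) = h0 v"
      using that Cons h0c[of v] lf[of a] l[of a] l[of "flip_letter a"]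
      by (simp flip: H.m_assoc)
    then show ?thesis using Cons by (auto simp: h0_def)
  qed (simp add: h0_def)
  have "h0 (foldr red_cons u w) = h0 u \<otimes>\<^bsub>H\<^esub> h0 w"
    if "set u \<subseteq> S \<times> UNIV" "set w \<subseteq> S \<times> UNIV" for u w
    using that
  proof (induction u)
    case Nil
    then show ?case using h0c[of w] by (simp add: h0_def)
  next
    case (Cons a u)
    then have "set (foldr red_cons u w) \<subseteq> S \<times> UNIV"
      using set_foldr_red_cons[of u w] by auto
    moreover have "h0 (a # u) = l a \<otimes>\<^bsub>H\<^esub> h0 u" by (simp add: h0_def)
    ultimately show ?case
      using Cons hr[of a "foldr red_cons u w"] l[of a] h0c[of u] h0c[of w]
      by (auto simp: H.m_assoc)
  qed
  then have "h0 \<in> hom (free_group S) H"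
    by (auto simp: hom_def free_group_def h0c)
  moreover have "\<forall>s\<in>S. h0 (free_gen s) = \<phi> s"
    using \<phi> by (auto simp: h0_def l_def free_gen_def)
  ultimately show "\<exists>h \<in> hom (free_group S) H. \<forall>s\<in>S. h (free_gen s) = \<phi> s" by blast
next
  assume h: "h \<in> hom (free_group S) H" and k: "k \<in> hom (free_group S) H"
    and eq: "\<forall>s\<in>S. h (free_gen s) = k (free_gen s)" and w: "w \<in> carrier (free_group S)"
  interpret H: group H by fact
  interpret F: group "free_group S" by (rule group_free_group)
  interpret h: group_hom "free_group S" H h
    using h by unfold_locales
  interpret k: group_hom "free_group S" H k
    using k by unfold_locales
  have gen: "free_gen s \<in> carrier (free_group S)" if "s \<in> S" for s
    using that by (auto simp: free_gen_def free_group_def reduced_def)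
  have inv: "[(s, True)] = inv\<^bsub>free_group S\<^esub> free_gen s" if "s \<in> S" for s
    by (rule sym, rule F.inv_equality)
      (use that in \<open>auto simp: free_gen_def free_group_def reduced_def flip_letter_def\<close>)
  have letter: "h [a] = k [a]" if "fst a \<in> S" for a
  proof (cases a)
    case (Pair s b)
    have "h [(s, True)] = k [(s, True)]"
      using that Pair eq gen[of s] by (simp add: inv)
    then show ?thesis
      using that Pair eq by (cases b) (auto simp: free_gen_def)
  qed
  show "h w = k w" using w
  proof (induction w)
    case Nil
    then show ?case using h.hom_one k.hom_one by (simp add: free_group_def)
  next
    case (Cons a w)
    then have w: "w \<in> carrier (free_group S)" and a: "[a] \<in> carrier (free_group S)" "fst a \<in> S"
      and red: "red_cons a w = a # w"
      using reduced_tl[of a w] red_cons_reduced[of a w]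
      by (auto simp: free_group_def reduced_def)
    have "a # w = [a] \<otimes>\<^bsub>free_group S\<^esub> w"
      using red by (simp add: free_group_def)
    then show ?case
      using h.hom_mult[OF a(1) w] k.hom_mult[OF a(1) w] letter[OF a(2)] Cons.IH[OF w] by simp
  qed
qed


section \<open>The Hilbert space of square-summable functions on a set\<close>

text \<open>
  Elements of \<open>\<ell>\<^sup>2(X)\<close> are functions on the ambient type that vanish off \<open>X\<close>, so that they add and
  scale pointwise.
\<close>

definition ell2 :: "'x set \<Rightarrow> ('x \<Rightarrow> complex) set" where
  "ell2 X = {f. (\<forall>x. x \<notin> X \<longrightarrow> f x = 0) \<and> (\<lambda>x. (cmod (f x))\<^sup>2) summable_on X}"

definition ell2_inner :: "('x \<Rightarrow> complex) \<Rightarrow> ('x \<Rightarrow> complex) \<Rightarrow> complex" where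
  "ell2_inner f g = (\<Sum>\<^sub>\<infinity>x. cnj (f x) * g x)"

definition ell2_norm :: "('x \<Rightarrow> complex) \<Rightarrow> real" where
  "ell2_norm f = sqrt (\<Sum>\<^sub>\<infinity>x. (cmod (f x))\<^sup>2)"


section \<open>Bounded operators\<close>

type_synonym 'x operator = "('x \<Rightarrow> complex) \<Rightarrow> ('x \<Rightarrow> complex)"

text \<open>
  \<open>bounded_ops X\<close> is \<open>\<B>(\<ell>\<^sup>2(X))\<close>. Operators are normalised to be \<open>0\<close> outside \<open>\<ell>\<^sup>2(X)\<close>, so that
  two bounded operators on \<open>\<ell>\<^sup>2(X)\<close> coincide iff they are equal as HOL functions.
\<close>

definition bounded_ops :: "'x set \<Rightarrow> 'x operator set" where
  "bounded_ops X = {T.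
     (\<forall>f\<in>ell2 X. T f \<in> ell2 X) \<and>
     (\<forall>f. f \<notin> ell2 X \<longrightarrow> T f = (\<lambda>x. 0)) \<and>
     (\<forall>f\<in>ell2 X. \<forall>g\<in>ell2 X. \<forall>a b.
        T (\<lambda>x. a * f x + b * g x) = (\<lambda>x. a * T f x + b * T g x)) \<and>
     (\<exists>C. \<forall>f\<in>ell2 X. ell2_norm (T f) \<le> C * ell2_norm f)}"

definition op_norm :: "'x set \<Rightarrow> 'x operator \<Rightarrow> real" where
  "op_norm X T = (SUP f\<in>{f \<in> ell2 X. ell2_norm f \<le> 1}. ell2_norm (T f))"

definition op_id :: "'x set \<Rightarrow> 'x operator" where
  "op_id X f = (if f \<in> ell2 X then f else (\<lambda>x. 0))"

definition op_lincomb :: "complex \<Rightarrow> 'x operator \<Rightarrow> complex \<Rightarrow> 'x operator \<Rightarrow> 'x operator" where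
  "op_lincomb a S b T = (\<lambda>f x. a * S f x + b * T f x)"

definition is_adjoint :: "'x set \<Rightarrow> 'x operator \<Rightarrow> 'x operator \<Rightarrow> bool" where
  "is_adjoint X S T \<longleftrightarrow> S \<in> bounded_ops X \<and>
     (\<forall>f\<in>ell2 X. \<forall>g\<in>ell2 X. ell2_inner (S f) g = ell2_inner f (T g))"

text \<open>The coarsest topology on \<open>\<B>(\<ell>\<^sup>2(X))\<close> that makes all matrix coefficients continuous.\<close>

definition weak_op_topology :: "'x set \<Rightarrow> 'x operator topology" where
  "weak_op_topology X = topology_generated_by
     {{T \<in> bounded_ops X. ell2_inner f (T g) \<in> U} | f g U. f \<in> ell2 X \<and> g \<in> ell2 X \<and> open U}"


section \<open>Von Neumann algebras\<close>

definition star_subalgebra :: "'x set \<Rightarrow> 'x operator set \<Rightarrow> bool" where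
  "star_subalgebra X R \<longleftrightarrow>
     R \<subseteq> bounded_ops X \<and> R \<noteq> {} \<and>
     (\<forall>S\<in>R. \<forall>T\<in>R. \<forall>a b. op_lincomb a S b T \<in> R) \<and>
     (\<forall>S\<in>R. \<forall>T\<in>R. S \<circ> T \<in> R) \<and>
     (\<forall>T\<in>R. \<exists>S\<in>R. is_adjoint X S T)"

definition von_neumann_algebra :: "'x set \<Rightarrow> 'x operator set \<Rightarrow> bool" where
  "von_neumann_algebra X R \<longleftrightarrow>
     star_subalgebra X R \<and> op_id X \<in> R \<and> closedin (weak_op_topology X) R"

definition vn_subalgebra :: "'x set \<Rightarrow> 'x operator set \<Rightarrow> 'x operator set \<Rightarrow> bool" where
  "vn_subalgebra X R M \<longleftrightarrow> von_neumann_algebra X R \<and> R \<subseteq> M"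

definition vn_generated :: "'x set \<Rightarrow> 'x operator set \<Rightarrow> 'x operator set" where
  "vn_generated X S = \<Inter> {R. von_neumann_algebra X R \<and> S \<subseteq> R}"

definition norm_one_projection ::
    "'x set \<Rightarrow> 'x operator set \<Rightarrow> ('x operator \<Rightarrow> 'x operator) \<Rightarrow> bool" where
  "norm_one_projection X R E \<longleftrightarrow>
     (\<forall>S\<in>bounded_ops X. \<forall>T\<in>bounded_ops X. \<forall>a b.
        E (op_lincomb a S b T) = op_lincomb a (E S) b (E T)) \<and>
     E ` bounded_ops X = R \<and>
     (\<forall>T\<in>bounded_ops X. E (E T) = E T) \<and>
     (SUP T\<in>{T \<in> bounded_ops X. op_norm X T \<le> 1}. ereal (op_norm X (E T))) = 1"

definition injective_vn :: "'x set \<Rightarrow> 'x operator set \<Rightarrow> bool" where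
  "injective_vn X R \<longleftrightarrow> von_neumann_algebra X R \<and> (\<exists>E. norm_one_projection X R E)"

definition maximal_injective :: "'x set \<Rightarrow> 'x operator set \<Rightarrow> 'x operator set \<Rightarrow> bool" where
  "maximal_injective X A M \<longleftrightarrow>
     vn_subalgebra X A M \<and> injective_vn X A \<and>
     \<not> (\<exists>R. vn_subalgebra X R M \<and> injective_vn X R \<and> A \<subset> R)"

definition vn_factor :: "'x set \<Rightarrow> 'x operator set \<Rightarrow> bool" where
  "vn_factor X R \<longleftrightarrow> von_neumann_algebra X R \<and>
     {T \<in> R. \<forall>S\<in>R. S \<circ> T = T \<circ> S} = {\<lambda>f x. c * op_id X f x | c. True}"

definition finite_dim :: "'x operator set \<Rightarrow> bool" where
  "finite_dim F \<longleftrightarrow> (\<exists>B. finite B \<and> B \<subseteq> F \<and> (\<forall>T\<in>F. \<exists>c. T = (\<lambda>f x. \<Sum>S\<in>B. c S * S f x)))"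

text \<open>
  Hyperfinite in the sense of Murray and von Neumann; finite-dimensional algebras are included.
\<close>

definition hyperfinite :: "'x set \<Rightarrow> 'x operator set \<Rightarrow> bool" where
  "hyperfinite X R \<longleftrightarrow> von_neumann_algebra X R \<and>
     (\<exists>F :: nat \<Rightarrow> 'x operator set.
        (\<forall>k. star_subalgebra X (F k) \<and> finite_dim (F k) \<and> F k \<subseteq> F (Suc k)) \<and>
        R = weak_op_topology X closure_of (\<Union>k. F k))"


section \<open>Group von Neumann algebras\<close>

definition left_regular :: "('g, 'm) monoid_scheme \<Rightarrow> 'g \<Rightarrow> 'g operator" where
  "left_regular G g f =
     (if f \<in> ell2 (carrier G)
      then (\<lambda>x. if x \<in> carrier G then f (inv\<^bsub>G\<^esub> g \<otimes>\<^bsub>G\<^esub> x) else 0)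
      else (\<lambda>x. 0))"

definition group_vn :: "('g, 'm) monoid_scheme \<Rightarrow> 'g operator set" where
  "group_vn G = vn_generated (carrier G) (left_regular G ` carrier G)"


section \<open>Direct products of free groups\<close>

definition index_range :: "enat \<Rightarrow> nat set" where
  "index_range N = {i. 1 \<le> i \<and> enat i \<le> N}"

text \<open>
  \<open>sum_group\<close> is the restricted direct product; its elements are extensional families on the
  index set.
\<close>

definition prod_free_groups :: "enat \<Rightarrow> (nat \<Rightarrow> nat) \<Rightarrow> (nat \<Rightarrow> (nat \<times> bool) list) monoid" where
  "prod_free_groups N n = sum_group (index_range N) (\<lambda>i. free_group {1..n i})"

text \<open>The canonical image in the product of the standard generator with number \<open>j\<close> of factor \<open>i\<close>.\<close>

definition std_gen :: "enat \<Rightarrow> (nat \<Rightarrow> nat) \<Rightarrow> nat \<Rightarrow> nat \<Rightarrow> nat \<Rightarrow> (nat \<times> bool) list" where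
  "std_gen N n i j =
     (\<lambda>k\<in>index_range N. if k = i then free_gen j else \<one>\<^bsub>free_group {1..n k}\<^esub>)"

end

theory Submission
  imports Defs
begin

text \<open>
  The proof follows the state argument of Boutonnet and Carderi. Let \<open>A \<subseteq> Q \<subseteq> L(G)\<close> with \<open>Q\<close> amenable,
  and let \<open>\<phi>\<close> be a \<open>Q\<close>-central state on the bounded operators that restricts to the trace on \<open>L(G)\<close>.
  On the diagonal operators \<open>\<phi>\<close> is a finitely additive measure on \<open>G\<close> that is invariant under the
  subgroup \<open>\<Lambda>\<close> generated by the \<open>g\<^sub>i\<^sub>,\<^sub>1\<close>. Let \<open>Z\<close> consist of the elements whose \<open>i\<close>-th component, as a
  reduced word, does not begin with \<open>g\<^sub>i\<^sub>,\<^sub>1\<close> or its inverse. Its translates by powers of \<open>g\<^sub>i\<^sub>,\<^sub>1\<close> are disjoint, so \<open>Z\<close> is a null set.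
  If the \<open>i\<close>-th component of \<open>h\<close> is not a power of \<open>g\<^sub>i\<^sub>,\<^sub>1\<close>, then translation by \<open>h\<close> maps the complement of
  one translate of \<open>Z\<close> into another one. Together with centrality this gives \<open>\<phi>(a \<lambda>(h)) = 0\<close>
  for \<open>a \<in> Q\<close>: the elements of \<open>Q\<close> are supported on \<open>\<Lambda>\<close> and hence lie in \<open>A\<close>.

  For injective \<open>Q\<close> the state is \<open>\<tau> \<circ> E \<circ> \<theta>\<close>, where \<open>E\<close> is the norm one projection, a bimodule map by
  Tomiyama's theorem, and \<open>\<theta>\<close> extends the compression to the closure of \<open>Q \<delta>\<^sub>e\<close> to an amplification on
  the whole space, so that \<open>\<theta>\<close> restricts to the conditional expectation on \<open>L(G)\<close>. For hyperfinite \<open>Q\<close>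
  it is a limit of normalised matrix traces. That \<open>A\<close> itself is injective follows by averaging over its
  generators and then applying \<open>\<theta>\<close>; and \<open>A\<close> is abelian but not scalar, so it is not a factor.
\<close>


section \<open>Hilbert spaces: projections and the Riesz representation theorem\<close>

text \<open>The trace composed with a norm one projection E onto Q is Q-central, but it is known to
  be the trace only on Q. The argument needs the trace on all of L(G), because the coefficient of
  \<open>a\<close> at \<open>h\<close> is read off as the value at \<open>star a * L h\<close>. This
  obstacle is the reason for \<theta>, which maps L(G) into Q preserving the trace; E then fixes the
  result. In the hyperfinite case the obstacle appears as a density: the matrix trace of a
  finite-dimensional subalgebra is the trace weighted by a central element. Both are removed by one
  device, the iteration \<open>resid\<close>, which decomposes the identity into pieces
  \<open>r * K * r\<close>. Functionals are real valued, contractive and 1 at 1; this suffices for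
  the calculus of null sets, and imaginary parts of coefficients come from \<open>ii * a\<close> in
  place of \<open>a\<close>. L(G) enters as a part of the commutant of the right translations, whose
  elements are determined by one vector each. An element lies outside \<Lambda> as soon as one
  coordinate is bad, so the combinatorics takes place in a single free group whether N is finite or
  infinite.\<close>

text \<open>
  Throughout, Hilbert spaces are \<^emph>\<open>real\<close>: the complex structure is an operator of its own, the
  inner product is the real part of the complex one, and complex linearity of an operator means
  that it commutes with the complex structure.
\<close>

lemma parallelogram:
  fixes x y :: "'a::real_inner"
  shows "(norm (x - y))\<^sup>2 = 2 * (norm x)\<^sup>2 + 2 * (norm y)\<^sup>2 - (norm (x + y))\<^sup>2"
  by (simp add: power2_norm_eq_inner inner_simps inner_commute)

lemma closest_point_subspace:
  fixes S :: "'a::{real_inner,banach} set"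
  assumes S: "subspace S" "closed S"
  obtains y where "y \<in> S" "\<And>z. z \<in> S \<Longrightarrow> norm (x - y) \<le> norm (x - z)"
proof -
  define d where "d = (INF z\<in>S. norm (x - z))"
  have ne: "S \<noteq> {}" using subspace_0[OF S(1)] by auto
  have bdd: "bdd_below ((\<lambda>z. norm (x - z)) ` S)" by (rule bdd_belowI[of _ 0]) auto
  have d0: "0 \<le> d" unfolding d_def by (rule cINF_greatest) (use ne in auto)
  have dle: "d \<le> norm (x - z)" if "z \<in> S" for z
    unfolding d_def by (rule cINF_lower[OF bdd that])
  have "\<exists>z\<in>S. norm (x - z) < d + 1 / Suc n" for n
    using cInf_lessD[of "(\<lambda>z. norm (x - z)) ` S" "d + 1 / Suc n"] ne by (auto simp: d_def)
  then obtain z where z: "\<And>n. z n \<in> S" "\<And>n. norm (x - z n) < d + 1 / Suc n" by metis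
  \<comment> \<open>The midpoint of \<open>z m\<close> and \<open>z n\<close> lies in
    \<open>S\<close> and so has distance at least \<open>d\<close> from \<open>x\<close>; the
    parallelogram law converts this into closeness of the two.\<close>
  have par: "(norm (z m - z n))\<^sup>2 \<le> 4 * (2 * d + 1) * (1 / Suc N)" if "N \<le> m" "N \<le> n" for m n N
  proof -
    let ?e = "1 / Suc N :: real"
    have e: "norm (x - z k) \<le> d + ?e" if "N \<le> k" for k
      using z(2)[of k] that by (smt (verit) frac_le of_nat_0_less_iff of_nat_mono Suc_le_mono zero_less_Suc)
    have "(1/2) *\<^sub>R (z m + z n) \<in> S"
      by (intro subspace_scale subspace_add S z)
    then have "d \<le> norm (x - (1/2) *\<^sub>R (z m + z n))" by (rule dle)
    also have "\<dots> = norm ((1/2) *\<^sub>R ((x - z m) + (x - z n)))"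
      by (simp add: algebra_simps scaleR_2[symmetric])
    also have "\<dots> = norm ((x - z m) + (x - z n)) / 2" by simp
    finally have "2 * d \<le> norm ((x - z m) + (x - z n))" by simp
    then have "(2 * d)\<^sup>2 \<le> (norm ((x - z m) + (x - z n)))\<^sup>2"
      using d0 by (intro power_mono) auto
    moreover have "(norm (z m - z n))\<^sup>2 = (norm ((x - z m) - (x - z n)))\<^sup>2"
      by (simp add: norm_minus_commute)
    moreover have "(norm (x - z m))\<^sup>2 \<le> (d + ?e)\<^sup>2" "(norm (x - z n))\<^sup>2 \<le> (d + ?e)\<^sup>2"
      using e that by (intro power_mono; simp)+
    ultimately have "(norm (z m - z n))\<^sup>2 \<le> 4 * (d + ?e)\<^sup>2 - (2 * d)\<^sup>2"
      unfolding parallelogram[of "x - z m" "x - z n"] by linarith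
    also have "\<dots> = 4 * (2 * d * ?e + ?e * ?e)" by (simp add: power2_eq_square algebra_simps)
    also have "?e * ?e \<le> ?e" by (rule mult_left_le) auto
    finally show ?thesis by (simp add: algebra_simps)
  qed
  have "Cauchy z"
  proof (rule CauchyI)
    fix e :: real assume e: "0 < e"
    have "(\<lambda>N. 4 * (2 * d + 1) * (1 / Suc N)) \<longlonglongrightarrow> 4 * (2 * d + 1) * 0"
      by (intro tendsto_intros LIMSEQ_Suc lim_1_over_n)
    then have "\<forall>\<^sub>F N in sequentially. 4 * (2 * d + 1) * (1 / Suc N) < e\<^sup>2"
      using e by (intro order_tendstoD) auto
    then obtain N where N: "4 * (2 * d + 1) * (1 / Suc N) < e\<^sup>2"
      by (auto simp: eventually_sequentially)
    show "\<exists>M. \<forall>m\<ge>M. \<forall>n\<ge>M. norm (z m - z n) < e"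
    proof (intro exI allI impI)
      fix m n assume "N \<le> m" "N \<le> n"
      then show "norm (z m - z n) < e"
        using par[of N m n] N e by (intro power2_less_imp_less[of _ e]) auto
    qed
  qed
  then obtain y where y: "z \<longlonglongrightarrow> y" by (auto simp: Cauchy_convergent_iff convergent_def)
  have "y \<in> S" using S(2) z(1) y by (meson closed_sequentially)
  moreover have "norm (x - y) \<le> d"
  proof (rule LIMSEQ_le)
    show "(\<lambda>n. norm (x - z n)) \<longlonglongrightarrow> norm (x - y)" by (intro tendsto_intros y)
    have "(\<lambda>n. d + 1 / Suc n) \<longlonglongrightarrow> d + 0" by (intro tendsto_intros LIMSEQ_Suc lim_1_over_n)
    then show "(\<lambda>n. d + 1 / Suc n) \<longlonglongrightarrow> d" by simp
    show "\<exists>N. \<forall>n\<ge>N. norm (x - z n) \<le> d + 1 / Suc n" using z(2) less_imp_le by blast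
  qed
  ultimately show thesis using that dle by force
qed

lemma orthogonal_decomposition:
  fixes S :: "'a::{real_inner,banach} set"
  assumes S: "subspace S" "closed S"
  shows "\<exists>!y. y \<in> S \<and> (\<forall>z\<in>S. inner (x - y) z = 0)"
proof -
  obtain y where y: "y \<in> S" "\<And>z. z \<in> S \<Longrightarrow> norm (x - y) \<le> norm (x - z)"
    using closest_point_subspace[OF S] by blast
  have "inner (x - y) z = 0" if z: "z \<in> S" for z
  proof (cases "z = 0")
    case False
    \<comment> \<open>The value that minimises the distance from \<open>x\<close> to the line
      \<open>y + t *\<^sub>R z\<close>.\<close>
    define t where "t = inner (x - y) z / inner z z"
    have "y + t *\<^sub>R z \<in> S" by (intro subspace_add subspace_scale S y z)
    then have "(norm (x - y))\<^sup>2 \<le> (norm (x - (y + t *\<^sub>R z)))\<^sup>2" using y(2) by (intro power_mono) auto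
    also have "x - (y + t *\<^sub>R z) = (x - y) - t *\<^sub>R z" by simp
    also have "(norm \<dots>)\<^sup>2 = (norm (x - y))\<^sup>2 - 2 * t * inner (x - y) z + t\<^sup>2 * inner z z"
      unfolding power2_norm_eq_inner
      by (simp add: inner_diff_left inner_diff_right inner_commute power2_eq_square)
    also have "t\<^sup>2 * inner z z = t * inner (x - y) z"
      using False by (simp add: t_def power2_eq_square)
    finally have "t * inner (x - y) z \<le> 0" by simp
    moreover have "t * inner (x - y) z = (inner (x - y) z)\<^sup>2 / inner z z"
      by (simp add: t_def power2_eq_square)
    ultimately show ?thesis using False
      by (metis inner_gt_zero_iff divide_le_0_iff not_less power2_eq_iff_nonneg zero_le_power2
          zero_eq_power2 le_less)
  qed simp
  moreover have "y' = y" if "y' \<in> S" "\<forall>z\<in>S. inner (x - y') z = 0" "\<forall>z\<in>S. inner (x - y) z = 0" for y'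
  proof -
    have "y' - y \<in> S" using that(1) y(1) S by (simp add: subspace_diff)
    then have "inner ((x - y) - (x - y')) (y' - y) = 0" using that by (simp add: inner_diff_left)
    then show ?thesis by simp
  qed
  ultimately show ?thesis using y(1) by blast
qed

lemma riesz:
  fixes f :: "'a::{real_inner,banach} \<Rightarrow> real"
  assumes "bounded_linear f"
  obtains y where "\<And>x. f x = inner x y"
proof -
  interpret f: bounded_linear f by fact
  define S where "S = {x. f x = 0}"
  have S: "subspace S" "closed S"
    unfolding S_def by (auto simp: subspace_def f.add f.scaleR intro!: closed_Collect_eq f.continuous_on continuous_intros)
  show thesis
  proof (cases "\<forall>x. f x = 0")
    case True
    then show ?thesis using that[of 0] by simp
  next
    case False
    then obtain x where x: "f x \<noteq> 0" by blast
    obtain y where y: "y \<in> S" "\<forall>z\<in>S. inner (x - y) z = 0"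
      using orthogonal_decomposition[OF S, of x] by blast
    define u where "u = x - y"
    have fu: "f u \<noteq> 0" using x y(1) by (simp add: u_def f.diff S_def)
    then have u0: "inner u u \<noteq> 0" using f.zero by auto
    have "f z = inner z ((f u / inner u u) *\<^sub>R u)" for z
    proof -
      have "z - (f z / f u) *\<^sub>R u \<in> S" using fu by (simp add: S_def f.diff f.scaleR)
      then have "inner u (z - (f z / f u) *\<^sub>R u) = 0" using y(2) by (simp add: u_def)
      then have "inner z u = (f z / f u) * inner u u" by (simp add: inner_diff_right inner_commute)
      then show ?thesis using fu u0 by simp
    qed
    then show ?thesis using that by blast
  qed
qed


section \<open>The algebra of bounded operators\<close>

text \<open>A copy of the bounded linear maps in which \<open>*\<close> is composition, so that
  operators can be handled with ring notation and powers.\<close>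

typedef (overloaded) 'a endo = "UNIV :: ('a::real_normed_vector \<Rightarrow>\<^sub>L 'a) set"
  by simp

setup_lifting type_definition_endo

instantiation endo :: (real_normed_vector) real_normed_vector
begin

lift_definition zero_endo :: "'a endo" is 0 .
lift_definition plus_endo :: "'a endo \<Rightarrow> 'a endo \<Rightarrow> 'a endo" is plus .
lift_definition minus_endo :: "'a endo \<Rightarrow> 'a endo \<Rightarrow> 'a endo" is minus .
lift_definition uminus_endo :: "'a endo \<Rightarrow> 'a endo" is uminus .
lift_definition scaleR_endo :: "real \<Rightarrow> 'a endo \<Rightarrow> 'a endo" is scaleR .
lift_definition norm_endo :: "'a endo \<Rightarrow> real" is norm .
definition dist_endo :: "'a endo \<Rightarrow> 'a endo \<Rightarrow> real" where "dist_endo S T = norm (S - T)"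
definition sgn_endo :: "'a endo \<Rightarrow> 'a endo" where "sgn_endo T = scaleR (inverse (norm T)) T"
definition uniformity_endo :: "('a endo \<times> 'a endo) filter" where
  "uniformity_endo = (INF e\<in>{0 <..}. principal {(x, y). dist x y < e})"
definition open_endo :: "'a endo set \<Rightarrow> bool" where
  "open_endo S = (\<forall>x\<in>S. \<forall>\<^sub>F (x', y) in uniformity. x' = x \<longrightarrow> y \<in> S)"

instance
proof
  fix a b :: real and S T U :: "'a endo"
  show "S + T + U = S + (T + U)" by transfer (simp add: add.assoc)
  show "S + T = T + S" by transfer (simp add: add.commute)
  show "0 + T = T" by transfer simp
  show "- T + T = 0" by transfer simp
  show "S - T = S + - T" by transfer simp
  show "a *\<^sub>R (S + T) = a *\<^sub>R S + a *\<^sub>R T" by transfer (simp add: scaleR_add_right)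
  show "(a + b) *\<^sub>R T = a *\<^sub>R T + b *\<^sub>R T" by transfer (simp add: scaleR_add_left)
  show "a *\<^sub>R b *\<^sub>R T = (a * b) *\<^sub>R T" by transfer simp
  show "1 *\<^sub>R T = T" by transfer simp
  show "dist S T = norm (S - T)" by (rule dist_endo_def)
  show "sgn T = inverse (norm T) *\<^sub>R T" by (rule sgn_endo_def)
  show "(uniformity :: ('a endo \<times> 'a endo) filter) = (INF e\<in>{0 <..}. principal {(x, y). dist x y < e})"
    by (rule uniformity_endo_def)
  show "open X = (\<forall>x\<in>X. \<forall>\<^sub>F (x', y) in uniformity. x' = x \<longrightarrow> y \<in> X)" for X :: "'a endo set"
    by (rule open_endo_def)
  show "(norm T = 0) = (T = 0)" by transfer simp
  show "norm (S + T) \<le> norm S + norm T" by transfer (rule norm_triangle_ineq)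
  show "norm (a *\<^sub>R T) = \<bar>a\<bar> * norm T" by transfer simp
qed

end

text \<open>The unital normed algebra class would demand \<open>0 \<noteq> 1\<close>, which fails
  over the zero space; for the same reason \<open>norm_one_endo\<close> below is an
  inequality.\<close>

instantiation endo :: (real_normed_vector) "{real_normed_algebra, monoid_mult}"
begin

lift_definition one_endo :: "'a endo" is id_blinfun .
lift_definition times_endo :: "'a endo \<Rightarrow> 'a endo \<Rightarrow> 'a endo" is blinfun_compose .

instance
proof
  fix a :: real and S T U :: "'a endo"
  show "S * T * U = S * (T * U)" by transfer (rule blinfun_eqI, simp)
  show "(S + T) * U = S * U + T * U" by transfer (rule blinfun_eqI, simp add: blinfun.bilinear_simps)
  show "S * (T + U) = S * T + S * U" by transfer (rule blinfun_eqI, simp add: blinfun.bilinear_simps)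
  show "a *\<^sub>R S * T = a *\<^sub>R (S * T)" by transfer (rule blinfun_eqI, simp add: blinfun.bilinear_simps)
  show "S * a *\<^sub>R T = a *\<^sub>R (S * T)" by transfer (rule blinfun_eqI, simp add: blinfun.bilinear_simps)
  show "norm (S * T) \<le> norm S * norm T" by transfer (rule norm_blinfun_compose)
  show "1 * T = T" by transfer (rule blinfun_eqI, simp)
  show "T * 1 = T" by transfer (rule blinfun_eqI, simp)
qed

end

instance endo :: (banach) banach
proof
  fix X :: "nat \<Rightarrow> 'a endo"
  assume "Cauchy X"
  then have "Cauchy (\<lambda>n. Rep_endo (X n))"
    by (auto simp: Cauchy_def dist_norm norm_endo.rep_eq minus_endo.rep_eq)
  then obtain L where "(\<lambda>n. Rep_endo (X n)) \<longlonglongrightarrow> L"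
    by (auto simp: Cauchy_convergent_iff convergent_def)
  then have "X \<longlonglongrightarrow> Abs_endo L"
    by (auto simp: LIMSEQ_def dist_norm norm_endo.rep_eq minus_endo.rep_eq Abs_endo_inverse)
  then show "convergent X" by (auto simp: convergent_def)
qed

lift_definition ap :: "'a::real_normed_vector endo \<Rightarrow> 'a \<Rightarrow> 'a"  (infixr "\<cdot>" 80) is blinfun_apply .

lemma endo_eqI: "(\<And>x. S \<cdot> x = T \<cdot> x) \<Longrightarrow> S = T"
  by transfer (rule blinfun_eqI)

lemma bounded_bilinear_ap: "bounded_bilinear ap"
proof
  fix a b :: 'a and S T :: "'a endo" and r
  show "(S + T) \<cdot> a = S \<cdot> a + T \<cdot> a" by transfer (simp add: blinfun.bilinear_simps)
  show "S \<cdot> (a + b) = S \<cdot> a + S \<cdot> b" by transfer (simp add: blinfun.bilinear_simps)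
  show "(r *\<^sub>R S) \<cdot> a = r *\<^sub>R (S \<cdot> a)" by transfer (simp add: blinfun.bilinear_simps)
  show "S \<cdot> (r *\<^sub>R a) = r *\<^sub>R (S \<cdot> a)" by transfer (simp add: blinfun.bilinear_simps)
  show "\<exists>K. \<forall>(S::'a endo) a. norm (S \<cdot> a) \<le> norm S * norm a * K"
    by (rule exI[of _ 1], transfer) (simp add: norm_blinfun)
qed

interpretation ap: bounded_bilinear ap by (rule bounded_bilinear_ap)

lemma ap_mult [simp]: "(S * T) \<cdot> x = S \<cdot> T \<cdot> x"
  by transfer simp

lemma ap_one [simp]: "1 \<cdot> x = x"
  by transfer simp

lemma norm_ap: "norm (T \<cdot> x) \<le> norm T * norm x"
  by transfer (rule norm_blinfun)

lemmas ap_simps = ap.add_left ap.add_right ap.diff_left ap.diff_right ap.minus_left ap.minus_right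
  ap.zero_left ap.zero_right ap.scaleR_left ap.scaleR_right

declare ap.zero_left [simp] ap.zero_right [simp]

lemma endo_bound:
  assumes "0 \<le> C" "\<And>x. norm (T \<cdot> x) \<le> C * norm x"
  shows "norm T \<le> C"
  using assms by transfer (rule norm_blinfun_bound)

lemma norm_one_endo: "norm (1 :: 'a::real_normed_vector endo) \<le> 1"
  by (rule endo_bound) auto

definition endo_of :: "('a::real_normed_vector \<Rightarrow> 'a) \<Rightarrow> 'a endo" where
  "endo_of f = Abs_endo (Blinfun f)"

lemma ap_endo_of: "bounded_linear f \<Longrightarrow> endo_of f \<cdot> x = f x"
  by (simp add: endo_of_def ap.rep_eq Abs_endo_inverse bounded_linear_Blinfun_apply)

lemma bounded_linear_ap: "bounded_linear (\<lambda>x. T \<cdot> x)"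
  by (rule ap.bounded_linear_right)

section \<open>Adjoints\<close>

lemma adjoint_exists:
  fixes T :: "'a::{real_inner,banach} endo"
  shows "\<exists>S. \<forall>x y. inner (T \<cdot> x) y = inner x (S \<cdot> y)"
proof -
  have "\<exists>z. \<forall>x. inner (T \<cdot> x) y = inner x z" for y
  proof -
    have "bounded_linear (\<lambda>x. inner (T \<cdot> x) y)"
      by (intro bounded_linear_compose[OF bounded_linear_inner_left bounded_linear_ap])
    then show ?thesis using riesz by metis
  qed
  then obtain s where s: "\<And>x y. inner (T \<cdot> x) y = inner x (s y)" by metis
  have eqI: "a = b" if "\<And>x. inner x a = inner x b" for a b :: 'a
    using that[of "a - b"] by (metis inner_diff_right inner_eq_zero_iff right_minus_eq)
  have "bounded_linear s"
  proof (rule bounded_linear_intro)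
    show "s (x + y) = s x + s y" for x y
      by (rule eqI) (simp add: s[symmetric] inner_add_right)
    show "s (r *\<^sub>R x) = r *\<^sub>R s x" for r x
      by (rule eqI) (simp add: s[symmetric])
    show "norm (s y) \<le> norm y * norm T" for y
    proof (cases "s y = 0")
      case False
      have "(norm (s y))\<^sup>2 = inner (T \<cdot> s y) y" by (simp add: s power2_norm_eq_inner)
      also have "\<dots> \<le> norm (T \<cdot> s y) * norm y" by (rule norm_cauchy_schwarz)
      also have "\<dots> \<le> norm T * norm (s y) * norm y"
        by (intro mult_right_mono norm_ap) auto
      finally show ?thesis using False by (simp add: power2_eq_square mult.commute)
    qed simp
  qed
  then have "\<forall>x y. inner (T \<cdot> x) y = inner x (endo_of s \<cdot> y)" by (simp add: ap_endo_of s)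
  then show ?thesis by blast
qed

definition star :: "'a::{real_inner,banach} endo \<Rightarrow> 'a endo" where
  "star T = (SOME S. \<forall>x y. inner (T \<cdot> x) y = inner x (S \<cdot> y))"

lemma inner_star: "inner (T \<cdot> x) y = inner x (star T \<cdot> y)"
  using someI_ex[OF adjoint_exists[of T]] unfolding star_def by blast

lemma inner_eqI: "(\<And>x. inner x a = inner x b) \<Longrightarrow> a = (b :: 'a::real_inner)"
  by (metis inner_diff_right inner_eq_zero_iff right_minus_eq)

lemma star_eqI:
  assumes "\<And>x y. inner (T \<cdot> x) y = inner x (S \<cdot> y)"
  shows "star T = S"
  by (rule endo_eqI, rule inner_eqI) (metis assms inner_star)

lemma inner_star': "inner x (T \<cdot> y) = inner (star T \<cdot> x) y"
  by (metis inner_commute inner_star)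

lemma star_star [simp]: "star (star T) = T"
  by (rule star_eqI) (metis inner_commute inner_star)

lemma star_mult [simp]: "star (S * T) = star T * star S"
  by (rule star_eqI) (simp add: inner_star)

lemma star_add [simp]: "star (S + T) = star S + star T"
  by (rule star_eqI) (simp add: inner_star ap_simps inner_add_left inner_add_right)

lemma star_diff [simp]: "star (S - T) = star S - star T"
  by (rule star_eqI) (simp add: inner_star ap_simps inner_diff_left inner_diff_right)

lemma star_minus [simp]: "star (- T) = - star T"
  by (rule star_eqI) (simp add: inner_star ap_simps)

lemma star_scaleR [simp]: "star (r *\<^sub>R T) = r *\<^sub>R star T"
  by (rule star_eqI) (simp add: inner_star ap_simps)

lemma star_one [simp]: "star 1 = 1"
  by (rule star_eqI) simp

lemma star_zero [simp]: "star 0 = 0"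
  by (rule star_eqI) simp

lemma star_sum [simp]: "star (\<Sum>i\<in>I. T i) = (\<Sum>i\<in>I. star (T i))"
  by (induction I rule: infinite_finite_induct) auto

lemma norm_star [simp]: "norm (star T) = norm T"
proof -
  have "norm (star T) \<le> norm T" for T :: "'a endo"
  proof (rule endo_bound)
    fix y
    show "norm (star T \<cdot> y) \<le> norm T * norm y"
    proof (cases "star T \<cdot> y = 0")
      case False
      have "(norm (star T \<cdot> y))\<^sup>2 = inner (T \<cdot> star T \<cdot> y) y" by (simp add: inner_star power2_norm_eq_inner)
      also have "\<dots> \<le> norm (T \<cdot> star T \<cdot> y) * norm y" by (rule norm_cauchy_schwarz)
      also have "\<dots> \<le> norm T * norm (star T \<cdot> y) * norm y"
        by (intro mult_right_mono norm_ap) auto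
      finally show ?thesis using False by (simp add: power2_eq_square mult.commute)
    qed simp
  qed simp
  from this[of T] this[of "star T"] show ?thesis by simp
qed

lemma tendsto_star: "(X \<longlongrightarrow> L) F \<Longrightarrow> ((\<lambda>n. star (X n)) \<longlongrightarrow> star L) F"
  by (rule Lim_transform_bound[where g = "\<lambda>n. X n - L", THEN LIM_zero_cancel])
    (auto intro: LIM_zero simp flip: star_diff)

section \<open>Orthogonal projections as operators\<close>

definition proj :: "'a::{real_inner,banach} set \<Rightarrow> 'a endo" where
  "proj S = endo_of (\<lambda>x. THE y. y \<in> S \<and> (\<forall>z\<in>S. inner (x - y) z = 0))"

context
  fixes S :: "'a::{real_inner,banach} set"
  assumes S: "subspace S" "closed S"
begin

lemma proj_props: "proj S \<cdot> x \<in> S" "z \<in> S \<Longrightarrow> inner (x - proj S \<cdot> x) z = 0"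
  and proj_eqI: "y \<in> S \<Longrightarrow> (\<And>z. z \<in> S \<Longrightarrow> inner (x - y) z = 0) \<Longrightarrow> proj S \<cdot> x = y"
proof -
  define p where "p x = (THE y. y \<in> S \<and> (\<forall>z\<in>S. inner (x - y) z = 0))" for x
  have p: "p x \<in> S" "z \<in> S \<Longrightarrow> inner (x - p x) z = 0" for x z
    using theI'[OF orthogonal_decomposition[OF S, of x]] unfolding p_def by auto
  have pI: "p x = y" if "y \<in> S" "\<And>z. z \<in> S \<Longrightarrow> inner (x - y) z = 0" for x y
    unfolding p_def by (rule the1_equality[OF orthogonal_decomposition[OF S]]) (use that in blast)
  have "bounded_linear p"
  proof (rule bounded_linear_intro)
    show "p (x + y) = p x + p y" for x y
    proof (rule pI)
      show "inner (x + y - (p x + p y)) z = 0" if "z \<in> S" for z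
        using p(2)[OF that, of x] p(2)[OF that, of y] by (simp add: inner_simps)
    qed (intro subspace_add S p)
    show "p (r *\<^sub>R x) = r *\<^sub>R p x" for r x
    proof (rule pI)
      show "inner (r *\<^sub>R x - r *\<^sub>R p x) z = 0" if "z \<in> S" for z
        using p(2)[OF that, of x] by (simp flip: scaleR_diff_right)
    qed (intro subspace_scale S p)
    show "norm (p x) \<le> norm x * 1" for x
    proof -
      have "inner (x - p x) (p x) = 0" by (rule p) (rule p)
      then have "norm (p x) * norm (p x) = inner x (p x)"
        by (simp add: inner_diff_left flip: power2_eq_square power2_norm_eq_inner)
      also have "\<dots> \<le> norm x * norm (p x)" by (rule norm_cauchy_schwarz)
      finally show ?thesis
        by (cases "norm (p x) = 0") auto
    qed
  qed
  then have eq: "proj S \<cdot> x = p x" for x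
    unfolding proj_def p_def by (rule ap_endo_of)
  show "proj S \<cdot> x \<in> S" "z \<in> S \<Longrightarrow> inner (x - proj S \<cdot> x) z = 0"
    using p by (auto simp: eq)
  show "y \<in> S \<Longrightarrow> (\<And>z. z \<in> S \<Longrightarrow> inner (x - y) z = 0) \<Longrightarrow> proj S \<cdot> x = y"
    using pI by (simp add: eq)
qed

lemma proj_id: "x \<in> S \<Longrightarrow> proj S \<cdot> x = x"
  by (rule proj_eqI) auto

lemma proj_fixed_iff: "proj S \<cdot> x = x \<longleftrightarrow> x \<in> S"
  using proj_id proj_props(1) by metis

lemma proj_idem: "proj S * proj S = proj S"
  by (rule endo_eqI) (simp add: proj_id proj_props)

lemma star_proj: "star (proj S) = proj S"
proof (rule star_eqI)
  fix x y
  have "inner (x - proj S \<cdot> x) (proj S \<cdot> y) = 0" "inner (y - proj S \<cdot> y) (proj S \<cdot> x) = 0"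
    by (intro proj_props)+
  then show "inner (proj S \<cdot> x) y = inner x (proj S \<cdot> y)"
    by (simp add: inner_diff_left) (metis inner_commute)
qed

text \<open>Invariance under \<open>T\<close> keeps \<open>T \<cdot> proj S \<cdot> x\<close> in
  \<open>S\<close>; invariance under \<open>star T\<close> keeps the remainder orthogonal to
  \<open>S\<close>.\<close>

lemma proj_commute:
  assumes T: "\<And>x. x \<in> S \<Longrightarrow> T \<cdot> x \<in> S" "\<And>x. x \<in> S \<Longrightarrow> star T \<cdot> x \<in> S"
  shows "T * proj S = proj S * T"
proof (rule endo_eqI)
  fix x
  have "proj S \<cdot> T \<cdot> x = T \<cdot> proj S \<cdot> x"
  proof (rule proj_eqI)
    show "T \<cdot> proj S \<cdot> x \<in> S" by (intro T proj_props)
    show "inner (T \<cdot> x - T \<cdot> proj S \<cdot> x) z = 0" if "z \<in> S" for z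
      using proj_props(2)[OF T(2)[OF that], of x]
      by (simp add: inner_star ap.diff_right[symmetric])
  qed
  then show "(T * proj S) \<cdot> x = (proj S * T) \<cdot> x" by simp
qed

end


section \<open>Limits along an ultrafilter\<close>

text \<open>Zorn's lemma for the proper filters below \<open>sequentially\<close>, with finer
  filters counted as larger. A maximal one decides every \<open>P\<close>: unless
  \<open>\<not> P\<close> holds eventually, adjoining \<open>P\<close> leaves it proper and hence
  changes nothing.\<close>

lemma exists_ultrafilter:
  "\<exists>U::nat filter. U \<noteq> bot \<and> U \<le> sequentially \<and> (\<forall>P. eventually P U \<or> eventually (\<lambda>x. \<not> P x) U)"
proof -
  define A where "A = {F::nat filter. F \<noteq> bot \<and> F \<le> sequentially}"
  have "\<exists>m\<in>A. \<forall>a\<in>A. a \<le> m \<longrightarrow> a = m"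
  proof (rule predicate_Zorn[of A "\<lambda>F G. G \<le> F"])
    show "partial_order_on A (relation_of (\<lambda>F G. G \<le> F) A)"
      by (rule partial_order_on_relation_ofI) auto
    fix C assume C: "C \<in> Chains (relation_of (\<lambda>F G. G \<le> F) A)"
    then have CA: "C \<subseteq> A" by (auto simp: Chains_def relation_of_def)
    from C have lin: "F \<le> G \<or> G \<le> F" if "F \<in> C" "G \<in> C" for F G
      using that unfolding Chains_def relation_of_def by blast
    show "\<exists>u\<in>A. \<forall>a\<in>C. u \<le> a"
    proof (cases "C = {}")
      case True
      then show ?thesis by (auto simp: A_def intro!: exI[of _ sequentially])
    next
      case False
      \<comment> \<open>A chain is directed, so what holds eventually for its infimum already does
        so for one of its members.\<close>
      have "eventually P (Inf C) \<longleftrightarrow> (\<exists>b\<in>C. eventually P b)" for P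
        by (rule eventually_Inf_base[OF False]) (use lin in \<open>force simp: inf_absorb1 inf_absorb2\<close>)
      then have "Inf C \<noteq> bot"
        using CA by (auto simp: trivial_limit_def A_def)
      moreover have "Inf C \<le> sequentially"
        using False CA by (auto simp: A_def intro: Inf_lower2)
      ultimately show ?thesis by (auto simp: A_def intro: Inf_lower)
    qed
  qed
  then obtain U where U: "U \<noteq> bot" "U \<le> sequentially"
    and max: "\<And>F. F \<noteq> bot \<Longrightarrow> F \<le> U \<Longrightarrow> F = U"
    by (auto simp: A_def)
  have "eventually P U" if "\<not> eventually (\<lambda>x. \<not> P x) U" for P
  proof -
    have "inf U (principal {x. P x}) \<noteq> bot"
      using that by (simp add: trivial_limit_def eventually_inf_principal)
    then have "inf U (principal {x. P x}) = U" by (rule max) simp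
    moreover have "eventually P (inf U (principal {x. P x}))"
      by (simp add: eventually_inf_principal)
    ultimately show ?thesis by simp
  qed
  then show ?thesis using U by blast
qed

definition ultra :: "nat filter" where
  "ultra = (SOME U. U \<noteq> bot \<and> U \<le> sequentially \<and> (\<forall>P. eventually P U \<or> eventually (\<lambda>x. \<not> P x) U))"

lemma ultra: "ultra \<noteq> bot" "ultra \<le> sequentially" "eventually P ultra \<or> eventually (\<lambda>x. \<not> P x) ultra"
  using someI_ex[OF exists_ultrafilter] unfolding ultra_def by blast+

lemma ultra_not_bot [simp]: "ultra \<noteq> bot" by (rule ultra)

lemma tendsto_ultra: "(X \<longlongrightarrow> L) sequentially \<Longrightarrow> (X \<longlongrightarrow> L) ultra"
  by (rule tendsto_mono[OF ultra(2)])

lemma ultra_convergent: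
  fixes X :: "nat \<Rightarrow> real"
  assumes "\<And>n. \<bar>X n\<bar> \<le> C"
  shows "\<exists>l. (X \<longlongrightarrow> l) ultra"
proof -
  have "filtermap X ultra \<noteq> bot" by (simp add: filtermap_bot_iff)
  moreover have "eventually (\<lambda>x. x \<in> {-C..C}) (filtermap X ultra)"
    using assms by (auto simp: eventually_filtermap abs_le_iff intro!: always_eventually) (metis minus_le_iff)
  ultimately obtain l where l: "inf (nhds l) (filtermap X ultra) \<noteq> bot"
    using compact_Icc[of "-C" C] unfolding compact_filter by blast
  have "eventually (\<lambda>n. X n \<in> S) ultra" if "open S" "l \<in> S" for S
  proof (rule ccontr)
    assume "\<not> ?thesis"
    then have "eventually (\<lambda>x. x \<notin> S) (filtermap X ultra)"
      using ultra(3)[of "\<lambda>n. X n \<in> S"] by (auto simp: eventually_filtermap)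
    moreover have "eventually (\<lambda>x. x \<in> S) (nhds l)" using that by (rule eventually_nhds_in_open)
    ultimately have "eventually (\<lambda>x. False) (inf (nhds l) (filtermap X ultra))"
      by (auto simp: eventually_inf)
    then show False using l by (simp add: trivial_limit_def)
  qed
  then show ?thesis by (auto simp: tendsto_def)
qed

text \<open>Weak operator convergence along one fixed ultrafilter. Bounded sequences always
  converge, and limits respect sums and multiplication by a fixed operator on either side, so that
  maps defined as limits inherit linearity and bimodule properties.\<close>

definition wlim :: "(nat \<Rightarrow> 'a::{real_inner,banach} endo) \<Rightarrow> 'a endo \<Rightarrow> bool" where
  "wlim X L \<longleftrightarrow> (\<forall>f g. ((\<lambda>n. inner f (X n \<cdot> g)) \<longlongrightarrow> inner f (L \<cdot> g)) ultra)"

lemma wlimD: "wlim X L \<Longrightarrow> ((\<lambda>n. inner f (X n \<cdot> g)) \<longlongrightarrow> inner f (L \<cdot> g)) ultra"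
  by (simp add: wlim_def)

lemma wlim_unique: "wlim X L \<Longrightarrow> wlim X L' \<Longrightarrow> L = L'"
  by (rule endo_eqI, rule inner_eqI) (metis tendsto_unique ultra(1) wlim_def)

text \<open>Bounded matrix coefficients converge along the ultrafilter, and Riesz turns the limiting
  bilinear form into an operator.\<close>

lemma wlim_bounded:
  assumes X: "\<And>n. norm (X n) \<le> C"
  shows "\<exists>L. wlim X L \<and> norm L \<le> C"
proof -
  have C: "0 \<le> C" using X[of 0] norm_ge_zero order_trans by blast
  have bd: "\<bar>inner f (X n \<cdot> g)\<bar> \<le> norm f * (C * norm g)" for f g n
  proof -
    have "\<bar>inner f (X n \<cdot> g)\<bar> \<le> norm f * norm (X n \<cdot> g)" by (rule Cauchy_Schwarz_ineq2)
    also have "norm (X n \<cdot> g) \<le> norm (X n) * norm g" by (rule norm_ap)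
    also have "\<dots> \<le> C * norm g" by (intro mult_right_mono X) auto
    finally show ?thesis by (simp add: mult_left_mono)
  qed
  then have "\<exists>l. ((\<lambda>n. inner f (X n \<cdot> g)) \<longlongrightarrow> l) ultra" for f g by (rule ultra_convergent)
  then obtain B where B: "\<And>f g. ((\<lambda>n. inner f (X n \<cdot> g)) \<longlongrightarrow> B f g) ultra" by metis
  have Bb: "\<bar>B f g\<bar> \<le> norm f * (C * norm g)" for f g
    by (rule tendsto_upperbound[OF tendsto_rabs[OF B]]) (use bd in auto)
  have "\<exists>y. \<forall>f. B f g = inner f y" for g
  proof -
    have "bounded_linear (\<lambda>f. B f g)"
    proof (rule bounded_linear_intro)
      show "B (f + h) g = B f g + B h g" for f h
        by (rule tendsto_unique[OF ultra(1) B])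
          (simp add: inner_add_left, intro tendsto_intros B)
      show "B (r *\<^sub>R f) g = r *\<^sub>R B f g" for r f
        by (rule tendsto_unique[OF ultra(1) B])
          (simp, intro tendsto_intros B)
      show "norm (B f g) \<le> norm f * (C * norm g)" for f using Bb by simp
    qed
    then show ?thesis using riesz by metis
  qed
  then obtain l where l: "\<And>f g. B f g = inner f (l g)" by metis
  have "bounded_linear l"
  proof (rule bounded_linear_intro)
    show "l (g + h) = l g + l h" for g h
    proof (rule inner_eqI)
      show "inner f (l (g + h)) = inner f (l g + l h)" for f
        unfolding inner_add_right l[symmetric]
        by (rule tendsto_unique[OF ultra(1) B])
          (simp add: inner_add_right ap.add_right, intro tendsto_intros B)
    qed
    show "l (r *\<^sub>R g) = r *\<^sub>R l g" for r g
    proof (rule inner_eqI)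
      show "inner f (l (r *\<^sub>R g)) = inner f (r *\<^sub>R l g)" for f
        unfolding inner_scaleR_right l[symmetric]
        by (rule tendsto_unique[OF ultra(1) B])
          (simp add: ap.scaleR_right, intro tendsto_intros B)
    qed
    show "norm (l g) \<le> norm g * C" for g
    proof (cases "norm (l g) = 0")
      case False
      have "norm (l g) * norm (l g) \<le> norm (l g) * (C * norm g)"
        using Bb[of "l g" g] unfolding l by (simp flip: power2_eq_square power2_norm_eq_inner)
      then show ?thesis using False by (simp add: mult.commute)
    qed (use C in simp)
  qed
  then have ap: "endo_of l \<cdot> g = l g" for g by (rule ap_endo_of)
  have "norm (endo_of l) \<le> C"
  proof (rule endo_bound[OF C])
    fix g
    show "norm (endo_of l \<cdot> g) \<le> C * norm g"
    proof (cases "norm (l g) = 0")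
      case False
      have "norm (l g) * norm (l g) \<le> norm (l g) * (C * norm g)"
        using Bb[of "l g" g] unfolding l by (simp flip: power2_eq_square power2_norm_eq_inner)
      then show ?thesis using False by (simp add: ap)
    qed (use C ap in simp)
  qed
  moreover have "wlim X (endo_of l)" unfolding wlim_def ap l[symmetric] using B by blast
  ultimately show ?thesis by blast
qed

definition ulim :: "(nat \<Rightarrow> 'a::{real_inner,banach} endo) \<Rightarrow> 'a endo" where
  "ulim X = (THE L. wlim X L)"

lemma ulim_eqI: "wlim X L \<Longrightarrow> ulim X = L"
  unfolding ulim_def using wlim_unique by blast

lemma ulim:
  assumes "\<And>n. norm (X n) \<le> C"
  shows "wlim X (ulim X)" "norm (ulim X) \<le> C"
proof -
  obtain L where L: "wlim X L" "norm L \<le> C" using wlim_bounded[of X C, OF assms] by blast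
  then show "wlim X (ulim X)" "norm (ulim X) \<le> C" by (simp_all add: ulim_eqI[OF L(1)])
qed

lemma wlim_const: "wlim (\<lambda>n. T) T"
  by (simp add: wlim_def)

lemma wlim_add: "wlim X L \<Longrightarrow> wlim Y M \<Longrightarrow> wlim (\<lambda>n. X n + Y n) (L + M)"
  by (simp add: wlim_def ap_simps inner_add_right tendsto_add)

lemma wlim_diff: "wlim X L \<Longrightarrow> wlim Y M \<Longrightarrow> wlim (\<lambda>n. X n - Y n) (L - M)"
  by (simp add: wlim_def ap_simps inner_diff_right tendsto_diff)

lemma wlim_scaleR: "wlim X L \<Longrightarrow> wlim (\<lambda>n. r *\<^sub>R X n) (r *\<^sub>R L)"
  by (simp add: wlim_def ap_simps tendsto_mult_left)

lemma wlim_mult_left: "wlim X L \<Longrightarrow> wlim (\<lambda>n. T * X n) (T * L)"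
  by (simp add: wlim_def inner_star')

lemma wlim_mult_right: "wlim X L \<Longrightarrow> wlim (\<lambda>n. X n * T) (L * T)"
  by (simp add: wlim_def)

lemma tendsto_imp_wlim: "X \<longlonglongrightarrow> L \<Longrightarrow> wlim X L"
  unfolding wlim_def by (intro allI tendsto_ultra tendsto_intros ap.tendsto)


section \<open>Square-summable sequences with values in a Hilbert space\<close>

text \<open>Used in two ways: with values in the Hilbert space at hand as its amplification, and
  with complex values as a model of \<open>ell2 X\<close> for countably infinite
  \<open>X\<close>.\<close>

typedef (overloaded) 'a l2 = "{f :: nat \<Rightarrow> 'a::real_inner. summable (\<lambda>n. (norm (f n))\<^sup>2)}"
  morphisms coord mk_l2
  by (rule exI[of _ "\<lambda>n. 0"]) simp

setup_lifting type_definition_l2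

lemma summable_coord: "summable (\<lambda>n. (norm (coord f n))\<^sup>2)"
  using coord[of f] by simp

lemma l2_eqI: "(\<And>n. coord f n = coord g n) \<Longrightarrow> f = g"
  by (simp add: coord_inject[symmetric] fun_eq_iff)

lemma square_summable_add:
  fixes f g :: "nat \<Rightarrow> 'a::real_inner"
  assumes "summable (\<lambda>n. (norm (f n))\<^sup>2)" "summable (\<lambda>n. (norm (g n))\<^sup>2)"
  shows "summable (\<lambda>n. (norm (f n + g n))\<^sup>2)"
proof (rule summable_comparison_test')
  show "summable (\<lambda>n. 2 * (norm (f n))\<^sup>2 + 2 * (norm (g n))\<^sup>2)"
    by (intro summable_add summable_mult assms)
  show "norm ((norm (f n + g n))\<^sup>2) \<le> 2 * (norm (f n))\<^sup>2 + 2 * (norm (g n))\<^sup>2" for n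
  proof -
    have "(norm (f n + g n))\<^sup>2 = 2 * (norm (f n))\<^sup>2 + 2 * (norm (g n))\<^sup>2 - (norm (f n - g n))\<^sup>2"
      using parallelogram[of "f n" "- g n"] by simp
    moreover have "0 \<le> (norm (f n - g n))\<^sup>2" by simp
    ultimately show ?thesis unfolding real_norm_def abs_of_nonneg[OF zero_le_power2] by linarith
  qed
qed

lemma square_summable_scaleR:
  fixes f :: "nat \<Rightarrow> 'a::real_inner"
  assumes "summable (\<lambda>n. (norm (f n))\<^sup>2)"
  shows "summable (\<lambda>n. (norm (r *\<^sub>R f n))\<^sup>2)"
  using summable_mult[OF assms, of "r\<^sup>2"] by (simp add: power_mult_distrib)

lemma summable_inner_coord: "summable (\<lambda>n. inner (coord f n) (coord g n))"
proof (rule summable_comparison_test')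
  show "summable (\<lambda>n. (norm (coord f n))\<^sup>2 + (norm (coord g n))\<^sup>2)"
    by (intro summable_add summable_coord)
  show "norm (inner (coord f n) (coord g n)) \<le> (norm (coord f n))\<^sup>2 + (norm (coord g n))\<^sup>2" for n
  proof -
    have "\<bar>inner (coord f n) (coord g n)\<bar> \<le> norm (coord f n) * norm (coord g n)"
      by (rule Cauchy_Schwarz_ineq2)
    also have "\<dots> \<le> (norm (coord f n))\<^sup>2 + (norm (coord g n))\<^sup>2"
      using sum_squares_bound[of "norm (coord f n)" "norm (coord g n)"]
        mult_nonneg_nonneg[OF norm_ge_zero[of "coord f n"] norm_ge_zero[of "coord g n"]]
      by linarith
    finally show ?thesis by simp
  qed
qed

instantiation l2 :: (real_inner) real_inner
begin

lift_definition zero_l2 :: "'a l2" is "\<lambda>n. 0" by simp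
lift_definition plus_l2 :: "'a l2 \<Rightarrow> 'a l2 \<Rightarrow> 'a l2" is "\<lambda>f g n. f n + g n"
  by (rule square_summable_add)
lift_definition uminus_l2 :: "'a l2 \<Rightarrow> 'a l2" is "\<lambda>f n. - f n" by simp
lift_definition minus_l2 :: "'a l2 \<Rightarrow> 'a l2 \<Rightarrow> 'a l2" is "\<lambda>f g n. f n - g n"
  using square_summable_add[of _ "\<lambda>n. - _ n"] by simp
lift_definition scaleR_l2 :: "real \<Rightarrow> 'a l2 \<Rightarrow> 'a l2" is "\<lambda>r f n. r *\<^sub>R f n"
  by (rule square_summable_scaleR)
definition inner_l2 :: "'a l2 \<Rightarrow> 'a l2 \<Rightarrow> real" where
  "inner_l2 f g = (\<Sum>n. inner (coord f n) (coord g n))"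
definition norm_l2 :: "'a l2 \<Rightarrow> real" where "norm_l2 f = sqrt (inner f f)"
definition dist_l2 :: "'a l2 \<Rightarrow> 'a l2 \<Rightarrow> real" where "dist_l2 f g = norm (f - g)"
definition sgn_l2 :: "'a l2 \<Rightarrow> 'a l2" where "sgn_l2 f = scaleR (inverse (norm f)) f"
definition uniformity_l2 :: "('a l2 \<times> 'a l2) filter" where
  "uniformity_l2 = (INF e\<in>{0 <..}. principal {(x, y). dist x y < e})"
definition open_l2 :: "'a l2 set \<Rightarrow> bool" where
  "open_l2 S = (\<forall>x\<in>S. \<forall>\<^sub>F (x', y) in uniformity. x' = x \<longrightarrow> y \<in> S)"

instance
proof
  fix a b :: real and f g h :: "'a l2"
  show "f + g + h = f + (g + h)" by transfer (simp add: add.assoc)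
  show "f + g = g + f" by transfer (simp add: add.commute)
  show "0 + f = f" by transfer simp
  show "- f + f = 0" by transfer simp
  show "f - g = f + - g" by transfer simp
  show "a *\<^sub>R (f + g) = a *\<^sub>R f + a *\<^sub>R g" by transfer (simp add: scaleR_add_right)
  show "(a + b) *\<^sub>R f = a *\<^sub>R f + b *\<^sub>R f" by transfer (simp add: scaleR_add_left)
  show "a *\<^sub>R b *\<^sub>R f = (a * b) *\<^sub>R f" by transfer simp
  show "1 *\<^sub>R f = f" by transfer simp
  show "dist f g = norm (f - g)" by (rule dist_l2_def)
  show "sgn f = inverse (norm f) *\<^sub>R f" by (rule sgn_l2_def)
  show "(uniformity :: ('a l2 \<times> 'a l2) filter) = (INF e\<in>{0 <..}. principal {(x, y). dist x y < e})"
    by (rule uniformity_l2_def)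
  show "open X = (\<forall>x\<in>X. \<forall>\<^sub>F (x', y) in uniformity. x' = x \<longrightarrow> y \<in> X)" for X :: "'a l2 set"
    by (rule open_l2_def)
  show "inner f g = inner g f" by (simp add: inner_l2_def inner_commute)
  show "inner (f + g) h = inner f h + inner g h"
    by (simp add: inner_l2_def plus_l2.rep_eq inner_add_left suminf_add summable_inner_coord)
  show "inner (a *\<^sub>R f) g = a * inner f g"
    by (simp add: inner_l2_def scaleR_l2.rep_eq suminf_mult summable_inner_coord)
  show "0 \<le> inner f f"
    by (simp add: inner_l2_def suminf_nonneg summable_inner_coord)
  show "(inner f f = 0) = (f = 0)"
  proof
    assume "inner f f = 0"
    then have "\<forall>n. inner (coord f n) (coord f n) = 0"
      by (simp add: inner_l2_def suminf_eq_zero_iff summable_inner_coord)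
    then show "f = 0" by (intro l2_eqI) (simp add: zero_l2.rep_eq)
  qed (simp add: inner_l2_def zero_l2.rep_eq)
  show "norm f = sqrt (inner f f)" by (rule norm_l2_def)
qed

end

lemma coord_simps [simp]:
  "coord 0 n = 0" "coord (f + g) n = coord f n + coord g n" "coord (- f) n = - coord f n"
  "coord (f - g) n = coord f n - coord g n" "coord (r *\<^sub>R f) n = r *\<^sub>R coord f n"
  by (simp_all add: zero_l2.rep_eq plus_l2.rep_eq uminus_l2.rep_eq minus_l2.rep_eq scaleR_l2.rep_eq)

lemma coord_sum [simp]: "coord (\<Sum>i\<in>I. f i) n = (\<Sum>i\<in>I. coord (f i) n)"
  by (induction I rule: infinite_finite_induct) auto

lemma norm_l2_sq: "(norm f)\<^sup>2 = (\<Sum>n. (norm (coord f n))\<^sup>2)" for f :: "'a::real_inner l2"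
  by (simp add: power2_norm_eq_inner inner_l2_def)

lemma norm_coord_le: "norm (coord f n) \<le> norm f"
proof -
  have "(norm (coord f n))\<^sup>2 \<le> (norm f)\<^sup>2"
    unfolding norm_l2_sq using sum_le_suminf[OF summable_coord, of "{n}" f] by simp
  then show ?thesis by (rule power2_le_imp_le) simp
qed

text \<open>Operators given coordinatewise are built through this: one bound on the partial sums
  yields both square summability and the norm estimate.\<close>

lemma mk_l2_bounded:
  fixes f :: "nat \<Rightarrow> 'a::real_inner"
  assumes "\<And>p. (\<Sum>n<p. (norm (f n))\<^sup>2) \<le> C\<^sup>2" "0 \<le> C"
  shows "coord (mk_l2 f) = f" "norm (mk_l2 f) \<le> C"
proof -
  have s: "summable (\<lambda>n. (norm (f n))\<^sup>2)"
    by (rule summableI_nonneg_bounded) (use assms in auto)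
  then show c: "coord (mk_l2 f) = f" by (simp add: mk_l2_inverse)
  have "(norm (mk_l2 f))\<^sup>2 \<le> C\<^sup>2"
    unfolding norm_l2_sq c by (rule suminf_le_const[OF s]) (rule assms)
  then show "norm (mk_l2 f) \<le> C" using assms(2) by (rule power2_le_imp_le)
qed

lemma sum_coord_le: "(\<Sum>n<p. (norm (coord f n))\<^sup>2) \<le> (norm f)\<^sup>2"
  unfolding norm_l2_sq by (rule sum_le_suminf[OF summable_coord]) auto

instance l2 :: ("{real_inner, banach}") banach
proof
  fix X :: "nat \<Rightarrow> 'a l2"
  assume C: "Cauchy X"
  have "Cauchy (\<lambda>m. coord (X m) n)" for n
  proof (rule CauchyI)
    fix e :: real assume "0 < e"
    then obtain M where "\<forall>m\<ge>M. \<forall>k\<ge>M. norm (X m - X k) < e" using CauchyD[OF C] by blast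
    then show "\<exists>M. \<forall>m\<ge>M. \<forall>k\<ge>M. norm (coord (X m) n - coord (X k) n) < e"
      using norm_coord_le[of "X _ - X _" n] by (metis coord_simps(4) le_less_trans)
  qed
  then have "\<exists>l. (\<lambda>m. coord (X m) n) \<longlonglongrightarrow> l" for n
    by (simp add: Cauchy_convergent_iff convergent_def)
  then obtain l where l: "\<And>n. (\<lambda>m. coord (X m) n) \<longlonglongrightarrow> l n" by metis
  \<comment> \<open>The Cauchy bound holds for every finite partial sum; the limit in
    \<open>k\<close> is taken there, with \<open>p\<close> fixed.\<close>
  have tail: "\<exists>M. \<forall>m\<ge>M. \<forall>p. (\<Sum>n<p. (norm (coord (X m) n - l n))\<^sup>2) \<le> e\<^sup>2" if e: "0 < e" for e
  proof -
    obtain M where M: "\<And>m k. m \<ge> M \<Longrightarrow> k \<ge> M \<Longrightarrow> norm (X m - X k) < e"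
      using CauchyD[OF C e] by blast
    have "(\<Sum>n<p. (norm (coord (X m) n - l n))\<^sup>2) \<le> e\<^sup>2" if m: "M \<le> m" for m p
    proof (rule LIMSEQ_le_const2)
      show "(\<lambda>k. \<Sum>n<p. (norm (coord (X m) n - coord (X k) n))\<^sup>2) \<longlonglongrightarrow> (\<Sum>n<p. (norm (coord (X m) n - l n))\<^sup>2)"
        by (intro tendsto_intros l)
      have "(\<Sum>n<p. (norm (coord (X m) n - coord (X k) n))\<^sup>2) \<le> e\<^sup>2" if "M \<le> k" for k
        using sum_coord_le[of "X m - X k" p] M[OF m that] power_mono[of "norm (X m - X k)" e 2]
        by simp
      then show "\<exists>N. \<forall>k\<ge>N. (\<Sum>n<p. (norm (coord (X m) n - coord (X k) n))\<^sup>2) \<le> e\<^sup>2" by blast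
    qed
    then show ?thesis by blast
  qed
  obtain M where M: "\<And>p. (\<Sum>n<p. (norm (coord (X M) n - l n))\<^sup>2) \<le> 1\<^sup>2"
    using tail[of 1] by auto
  \<comment> \<open>Square summability of \<open>l\<close> comes from that of the difference
    \<open>X M - l\<close>, which has the bound 1.\<close>
  define L where "L = X M - mk_l2 (\<lambda>n. coord (X M) n - l n)"
  have L: "coord L n = l n" for n
    using mk_l2_bounded(1)[OF M] by (simp add: L_def)
  have "X \<longlonglongrightarrow> L"
  proof (rule metric_LIMSEQ_I)
    fix e :: real assume "0 < e"
    then obtain K where K: "\<And>m p. m \<ge> K \<Longrightarrow> (\<Sum>n<p. (norm (coord (X m - L) n))\<^sup>2) \<le> (e/2)\<^sup>2"
      using tail[of "e/2"] by (auto simp: L)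
    have "norm (X m - L) < e" if "m \<ge> K" for m
      using mk_l2_bounded(2)[of "coord (X m - L)" "e/2"] K[OF that] \<open>0 < e\<close> by (simp add: coord_inverse)
    then show "\<exists>K. \<forall>m\<ge>K. dist (X m) L < e" by (auto simp: dist_norm)
  qed
  then show "convergent X" by (auto simp: convergent_def)
qed


section \<open>Commutants and the bicommutant theorem\<close>

lemma subspace_closure:
  fixes S :: "'a::real_normed_vector set"
  assumes "subspace S"
  shows "subspace (closure S)"
  unfolding subspace_def
proof (intro conjI ballI allI)
  show "0 \<in> closure S" using subspace_0[OF assms] closure_subset by blast
  fix x assume "x \<in> closure S"
  then obtain f where f: "\<And>n. f n \<in> S" "f \<longlonglongrightarrow> x" by (auto simp: closure_sequential)
  show "r *\<^sub>R x \<in> closure S" for r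
    unfolding closure_sequential
    using f subspace_scale[OF assms] by (intro exI[of _ "\<lambda>n. r *\<^sub>R f n"]) (auto intro!: tendsto_intros)
  fix y assume "y \<in> closure S"
  then obtain g where g: "\<And>n. g n \<in> S" "g \<longlonglongrightarrow> y" by (auto simp: closure_sequential)
  show "x + y \<in> closure S"
    unfolding closure_sequential
    using f g subspace_add[OF assms] by (intro exI[of _ "\<lambda>n. f n + g n"]) (auto intro!: tendsto_intros)
qed

text \<open>Operators are only real linear, so this agrees with the complex commutant for sets that
  contain \<open>ii\<close>.\<close>

definition commutant :: "'a::real_normed_vector endo set \<Rightarrow> 'a endo set" where
  "commutant S = {T. \<forall>A\<in>S. T * A = A * T}"

definition star_closed :: "'a::{real_inner,banach} endo set \<Rightarrow> bool" where
  "star_closed S \<longleftrightarrow> (\<forall>T\<in>S. star T \<in> S)"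

lemma commutantI: "(\<And>A. A \<in> S \<Longrightarrow> T * A = A * T) \<Longrightarrow> T \<in> commutant S"
  by (simp add: commutant_def)

lemma commutantD: "T \<in> commutant S \<Longrightarrow> A \<in> S \<Longrightarrow> T * A = A * T"
  by (simp add: commutant_def)

lemma commutant_antimono: "S \<subseteq> S' \<Longrightarrow> commutant S' \<subseteq> commutant S"
  by (auto simp: commutant_def)

lemma bicommutant_superset: "S \<subseteq> commutant (commutant S)"
  by (auto simp: commutant_def)

lemma commutant_triple [simp]: "commutant (commutant (commutant S)) = commutant S"
  by (rule equalityI[OF commutant_antimono[OF bicommutant_superset] bicommutant_superset])

lemma commutant_Un: "commutant (S \<union> S') = commutant S \<inter> commutant S'"
  by (auto simp: commutant_def)

lemma commutant_one [simp]: "1 \<in> commutant S"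
  and commutant_zero [simp]: "0 \<in> commutant S"
  and commutant_mult: "T \<in> commutant S \<Longrightarrow> T' \<in> commutant S \<Longrightarrow> T * T' \<in> commutant S"
  and commutant_add: "T \<in> commutant S \<Longrightarrow> T' \<in> commutant S \<Longrightarrow> T + T' \<in> commutant S"
  and commutant_diff: "T \<in> commutant S \<Longrightarrow> T' \<in> commutant S \<Longrightarrow> T - T' \<in> commutant S"
  and commutant_minus: "T \<in> commutant S \<Longrightarrow> - T \<in> commutant S"
  and commutant_scaleR: "T \<in> commutant S \<Longrightarrow> r *\<^sub>R T \<in> commutant S"
proof -
  show "T * T' \<in> commutant S" if "T \<in> commutant S" "T' \<in> commutant S"
  proof (rule commutantI)
    fix A assume "A \<in> S"
    then have "T * A = A * T" "T' * A = A * T'" using that by (auto simp: commutant_def)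
    then show "T * T' * A = A * (T * T')" by (metis mult.assoc)
  qed
qed (auto simp: commutant_def algebra_simps)

lemma commutant_sum: "(\<And>i. i \<in> I \<Longrightarrow> T i \<in> commutant S) \<Longrightarrow> (\<Sum>i\<in>I. T i) \<in> commutant S"
  by (induction I rule: infinite_finite_induct) (auto intro: commutant_add)

lemma star_closed_commutant:
  assumes "star_closed S"
  shows "star_closed (commutant S)"
  unfolding star_closed_def
proof (intro ballI commutantI)
  fix T A assume "T \<in> commutant S" "A \<in> S"
  then have "T * star A = star A * T" using assms by (auto simp: star_closed_def commutant_def)
  then have "star (T * star A) = star (star A * T)" by simp
  then show "star T * A = A * star T" by simp
qed

lemma star_closedD: "star_closed S \<Longrightarrow> T \<in> S \<Longrightarrow> star T \<in> S"
  by (simp add: star_closed_def)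

lemma commutant_wlim:
  assumes "\<And>n. X n \<in> commutant S" "wlim X L"
  shows "L \<in> commutant S"
proof (rule commutantI)
  fix A assume "A \<in> S"
  then have "(\<lambda>n. X n * A) = (\<lambda>n. A * X n)" using assms(1) by (auto simp: commutant_def)
  then show "L * A = A * L"
    using wlim_mult_left[OF assms(2), of A] wlim_mult_right[OF assms(2), of A] wlim_unique by metis
qed

lemma proj_in_commutant:
  assumes S: "subspace S" "closed S" and C: "star_closed C"
    and inv: "\<And>T x. T \<in> C \<Longrightarrow> x \<in> S \<Longrightarrow> T \<cdot> x \<in> S"
  shows "proj S \<in> commutant C"
proof (rule commutantI)
  fix T assume "T \<in> C"
  then show "proj S * T = T * proj S"
    using proj_commute[OF S, of T] inv C by (metis star_closedD)
qed

text \<open>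
  The amplification of the Hilbert space is \<open>'a l2\<close>; finitely many vectors are packed into one
  element of it.
\<close>

lemma bicommutant_approx:
  fixes Q :: "'a::{real_inner,banach} endo set" and x :: "nat \<Rightarrow> 'a"
  assumes add: "\<And>S T. S \<in> Q \<Longrightarrow> T \<in> Q \<Longrightarrow> S + T \<in> Q"
    and mult: "\<And>S T. S \<in> Q \<Longrightarrow> T \<in> Q \<Longrightarrow> S * T \<in> Q"
    and scale: "\<And>r T. T \<in> Q \<Longrightarrow> r *\<^sub>R T \<in> Q"
    and one: "1 \<in> Q" and star: "star_closed Q"
    and T: "T \<in> commutant (commutant Q)" and e: "0 < e"
  shows "\<exists>q\<in>Q. \<forall>j<k. norm ((T - q) \<cdot> x j) < e"
proof -
  define iota :: "nat \<Rightarrow> 'a \<Rightarrow> 'a l2" where "iota j v = mk_l2 (\<lambda>n. if n = j then v else 0)" for j v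
  have sumj: "(\<Sum>n<p. (norm (if n = j then v else 0))\<^sup>2) \<le> (norm v)\<^sup>2" for p j :: nat and v :: 'a
  proof -
    have "(\<Sum>n<p. (norm (if n = j then v else 0))\<^sup>2) = (\<Sum>n<p. if n = j then (norm v)\<^sup>2 else 0)"
      by (rule sum.cong) auto
    also have "\<dots> \<le> (norm v)\<^sup>2" by (cases "j < p") (simp_all add: sum.delta)
    finally show ?thesis .
  qed
  have iota: "coord (iota j v) n = (if n = j then v else 0)" "norm (iota j v) \<le> norm v" for j v n
    unfolding iota_def using mk_l2_bounded[OF sumj[of j v]] by (auto simp: fun_eq_iff)
  have blin: "bounded_linear (iota j)" for j
    by (rule bounded_linear_intro[where K = 1]) (auto intro!: l2_eqI simp: iota)
  define amap :: "'a endo \<Rightarrow> 'a l2 \<Rightarrow> 'a l2" where "amap S f = mk_l2 (\<lambda>n. S \<cdot> coord f n)" for S f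
  define amp where "amp S = endo_of (amap S)" for S
  have ampb: "(\<Sum>n<p. (norm (S \<cdot> coord f n))\<^sup>2) \<le> (norm S * norm f)\<^sup>2"
    for S :: "'a endo" and p and f :: "'a l2"
  proof -
    have "(\<Sum>n<p. (norm (S \<cdot> coord f n))\<^sup>2) \<le> (\<Sum>n<p. (norm S)\<^sup>2 * (norm (coord f n))\<^sup>2)"
      by (rule sum_mono) (metis norm_ap norm_ge_zero power_mono power_mult_distrib)
    also have "\<dots> \<le> (norm S)\<^sup>2 * (norm f)\<^sup>2"
      unfolding sum_distrib_left[symmetric] by (intro mult_left_mono sum_coord_le) auto
    finally show ?thesis by (simp add: power_mult_distrib)
  qed
  have amp0: "coord (amap S f) n = S \<cdot> coord f n" "norm (amap S f) \<le> norm S * norm f" for S f n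
    unfolding amap_def using mk_l2_bounded[OF ampb[of S f]] by (auto simp: fun_eq_iff)
  have "bounded_linear (amap S)" for S
    by (rule bounded_linear_intro[where K = "norm S"])
      (auto intro!: l2_eqI simp: amp0 ap_simps mult.commute[of "norm _" "norm S"])
  then have amp: "coord (amp S \<cdot> f) n = S \<cdot> coord f n" for S f n
    unfolding amp_def by (simp add: ap_endo_of amp0)
  have star_amp: "star (amp S) = amp (star S)" for S
    by (rule star_eqI) (simp add: inner_l2_def amp inner_star)
  have amp_iota: "amp S \<cdot> iota j v = iota j (S \<cdot> v)" for S j v
    by (rule l2_eqI) (simp add: amp iota)
  define Xi where "Xi S = (\<Sum>j<k. iota j (S \<cdot> x j))" for S
  have amp_Xi: "amp S \<cdot> Xi S' = Xi (S * S')" for S S'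
    by (simp add: Xi_def ap.sum_right amp_iota)
  have cXi: "coord (Xi S) j = (if j < k then S \<cdot> x j else 0)" for S j
    by (auto simp: Xi_def iota sum.delta')
  define S where "S = closure (Xi ` Q)"
  have "Xi ` Q \<noteq> {}" using one by auto
  have lin: "Xi A + Xi B = Xi (A + B)" "r *\<^sub>R Xi A = Xi (r *\<^sub>R A)" for A B r
    by (rule l2_eqI, simp add: cXi ap_simps)+
  have "0 \<in> Q" using scale[OF one, of 0] by simp
  moreover have "Xi 0 = 0" by (rule l2_eqI) (simp add: cXi)
  ultimately have "subspace (Xi ` Q)"
    unfolding subspace_def using add scale by (auto simp: lin image_iff)
  then have S: "subspace S" "closed S"
    unfolding S_def by (auto intro: subspace_closure)
  define P where "P = proj S"
  have inv: "amp q \<cdot> f \<in> S" if "q \<in> Q" "f \<in> S" for q f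
  proof -
    have "(\<lambda>f. amp q \<cdot> f) ` closure (Xi ` Q) \<subseteq> closure ((\<lambda>f. amp q \<cdot> f) ` (Xi ` Q))"
      by (rule closure_bounded_linear_image_subset[OF bounded_linear_ap])
    also have "\<dots> \<subseteq> S"
      unfolding S_def using mult[OF that(1)] by (intro closure_mono) (auto simp: amp_Xi)
    finally show ?thesis using that(2) by (auto simp: S_def)
  qed
  have comm: "amp q * P = P * amp q" if "q \<in> Q" for q
    unfolding P_def
    by (rule proj_commute[OF S]) (use inv that star in \<open>auto simp: star_amp star_closed_def\<close>)
  \<comment> \<open>The matrix entries of \<open>P\<close>. As \<open>P\<close> commutes with the
    amplification of \<open>Q\<close>, they lie in the commutant of \<open>Q\<close> and so commute
    with \<open>T\<close>; hence \<open>P\<close> fixes \<open>Xi T\<close> because it fixes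
    \<open>Xi 1\<close>.\<close>
  define E where "E i j = endo_of (\<lambda>v. coord (P \<cdot> iota j v) i)" for i j
  have blc: "bounded_linear (\<lambda>f::'a l2. coord f i)" for i
    by (rule bounded_linear_intro[where K = 1]) (auto simp: norm_coord_le)
  have E: "E i j \<cdot> v = coord (P \<cdot> iota j v) i" for i j v
    unfolding E_def
    by (rule ap_endo_of) (intro bounded_linear_compose[OF blc] bounded_linear_compose[OF bounded_linear_ap] blin)
  have "E i j \<in> commutant Q" for i j
  proof (intro commutantI endo_eqI)
    fix q v assume "q \<in> Q"
    then have "P \<cdot> amp q \<cdot> iota j v = amp q \<cdot> P \<cdot> iota j v"
      using comm by (metis ap_mult)
    then show "(E i j * q) \<cdot> v = (q * E i j) \<cdot> v"
      by (simp add: E amp_iota amp)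
  qed
  then have ET: "E i j \<cdot> T \<cdot> v = T \<cdot> E i j \<cdot> v" for i j v
    using T by (metis ap_mult commutantD)
  have P1: "P \<cdot> Xi 1 = Xi 1"
    unfolding P_def by (rule proj_id[OF S]) (use one in \<open>auto simp: S_def intro!: closure_subset[THEN subsetD]\<close>)
  have PX: "coord (P \<cdot> Xi A) i = (\<Sum>j<k. E i j \<cdot> A \<cdot> x j)" for A i
    by (simp add: Xi_def ap.sum_right E)
  have "P \<cdot> Xi T = Xi T"
  proof (rule l2_eqI)
    fix i
    have "coord (P \<cdot> Xi T) i = T \<cdot> (\<Sum>j<k. E i j \<cdot> 1 \<cdot> x j)"
      by (simp add: PX ET ap.sum_right)
    also have "\<dots> = T \<cdot> coord (P \<cdot> Xi 1) i" by (simp only: PX)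
    also have "\<dots> = coord (Xi T) i" by (simp add: P1 cXi)
    finally show "coord (P \<cdot> Xi T) i = coord (Xi T) i" .
  qed
  then have "Xi T \<in> closure (Xi ` Q)" unfolding P_def using proj_fixed_iff[OF S] by (simp add: S_def)
  then obtain q where q: "q \<in> Q" "dist (Xi q) (Xi T) < e"
    unfolding closure_approachable using e by blast
  have "norm ((T - q) \<cdot> x j) < e" if "j < k" for j
    using norm_coord_le[of "Xi q - Xi T" j] q(2) that
    by (simp add: cXi dist_norm ap_simps norm_minus_commute)
  then show ?thesis using q(1) by blast
qed


section \<open>Positive operators and square roots\<close>

definition pos :: "'a::{real_inner,banach} endo \<Rightarrow> bool" where
  "pos T \<longleftrightarrow> star T = T \<and> (\<forall>x. 0 \<le> inner x (T \<cdot> x))"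

lemma endo_bound_square:
  assumes "0 \<le> C" "\<And>x. (norm (T \<cdot> x))\<^sup>2 \<le> C\<^sup>2 * (norm x)\<^sup>2"
  shows "norm T \<le> C"
  using assms by (intro endo_bound) (auto simp flip: power_mult_distrib dest: power2_le_imp_le)

lemma norm_projection_le:
  assumes p: "star p = p" "p * p = p"
  shows "norm (p \<cdot> f) \<le> norm f"
proof -
  have "p \<cdot> p \<cdot> f = p \<cdot> f" using arg_cong[OF p(2), of "\<lambda>T. T \<cdot> f"] by simp
  then have "(norm (p \<cdot> f))\<^sup>2 = inner f (p \<cdot> f)"
    by (simp add: power2_norm_eq_inner inner_star[of p] p(1))
  also have "\<dots> \<le> norm f * norm (p \<cdot> f)" by (rule norm_cauchy_schwarz)
  finally show ?thesis
    by (cases "norm (p \<cdot> f) = 0") (auto simp: power2_eq_square)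
qed

text \<open>From \<open>T - T * T = T * (1 - T) * T + (1 - T) * T * (1 - T)\<close>, where both
  summands are positive.\<close>

lemma pos_square_le:
  assumes "pos T" "pos (1 - T)"
  shows "(norm (T \<cdot> x))\<^sup>2 \<le> inner x (T \<cdot> x)"
proof -
  have sa: "inner (T \<cdot> x) y = inner x (T \<cdot> y)" for x y
    using assms(1) by (simp add: inner_star pos_def)
  have "0 \<le> inner (T \<cdot> x) ((1 - T) \<cdot> T \<cdot> x)" using assms(2) by (simp add: pos_def)
  moreover have "0 \<le> inner (x - T \<cdot> x) (T \<cdot> (x - T \<cdot> x))" using assms(1) by (simp add: pos_def)
  ultimately show ?thesis
    by (simp add: power2_norm_eq_inner ap_simps inner_diff_left inner_diff_right sa)
qed

text \<open>A fixed point of the map that sends \<open>X\<close> to half of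
  \<open>(1 - a) + X * X\<close> satisfies \<open>(1 - X) * (1 - X) = a\<close>. The iteration is
  dominated, in norms and in increments, by the scalar iteration with 1 in place of
  \<open>1 - a\<close>, which increases and is bounded by 1. Each iterate is a polynomial in
  \<open>a\<close> and so stays in the commutant.\<close>

lemma commutant_sqrt:
  fixes a :: "'a::{real_inner,banach} endo"
  assumes a: "a \<in> commutant S" "star a = a" "norm (1 - a) \<le> 1"
  obtains X where "X \<in> commutant S" "star X = X" "norm X \<le> 1" "(1 - X) * (1 - X) = a"
proof -
  define X where "X = rec_nat 0 (\<lambda>_ Y. (1/2) *\<^sub>R ((1 - a) + Y * Y))"
  define x :: "nat \<Rightarrow> real" where "x = rec_nat 0 (\<lambda>_ y. (1 + y\<^sup>2) / 2)"
  have X: "X 0 = 0" "\<And>n. X (Suc n) = (1/2) *\<^sub>R ((1 - a) + X n * X n)" by (simp_all add: X_def)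
  have x: "x 0 = 0" "\<And>n. x (Suc n) = (1 + (x n)\<^sup>2) / 2" by (simp_all add: x_def)
  have x01: "0 \<le> x n \<and> x n \<le> 1" for n
    by (induction n) (auto simp: x power_le_one add_nonneg_nonneg)
  have xmono: "x n \<le> x (Suc n)" for n
    using zero_le_power2[of "1 - x n"] by (simp add: x power2_diff)
  have Xin: "X n \<in> commutant S" "star (X n) = X n" for n
    by (induction n) (auto simp: X a intro!: commutant_scaleR commutant_add commutant_diff commutant_mult)
  have Xn: "norm (X n) \<le> x n" for n
  proof (induction n)
    case (Suc n)
    have "norm (X n * X n) \<le> norm (X n) * norm (X n)" by (rule norm_mult_ineq)
    also have "\<dots> \<le> x n * x n" using Suc x01[of n] by (intro mult_mono) auto
    finally have "norm ((1 - a) + X n * X n) \<le> 1 + (x n)\<^sup>2" 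
      using norm_triangle_ineq[of "1 - a" "X n * X n"] a(3) by (simp add: power2_eq_square)
    then show ?case by (simp add: X x)
  qed (simp add: X x)
  have Xd: "norm (X (Suc n) - X n) \<le> x (Suc n) - x n" for n
  proof (induction n)
    case 0
    then show ?case using a(3) by (simp add: X x)
  next
    case (Suc n)
    let ?d = "X (Suc n) - X n"
    \<comment> \<open>By \<open>Y * Y - Z * Z = Y * (Y - Z) + (Y - Z) * Z\<close>.\<close>
    have "X (Suc (Suc n)) - X (Suc n) = (1/2) *\<^sub>R (X (Suc n) * ?d + ?d * X n)"
      unfolding X(2)[of "Suc n"] X(2)[of n, symmetric] by (subst X(2)[of n]) (simp add: algebra_simps)
    also have "norm \<dots> \<le> (1/2) * (x (Suc n) * (x (Suc n) - x n) + (x (Suc n) - x n) * x n)"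
    proof -
      have "norm (X (Suc n) * ?d) \<le> x (Suc n) * (x (Suc n) - x n)"
        by (rule order_trans[OF norm_mult_ineq mult_mono]) (use Suc Xn x01 in auto)
      moreover have "norm (?d * X n) \<le> (x (Suc n) - x n) * x n"
        by (rule order_trans[OF norm_mult_ineq mult_mono]) (use Suc Xn x01 xmono in auto)
      ultimately show ?thesis
        using norm_triangle_ineq[of "X (Suc n) * ?d" "?d * X n"] by simp
    qed
    also have "\<dots> = ((x (Suc n))\<^sup>2 - (x n)\<^sup>2) / 2" by (simp add: algebra_simps power2_eq_square)
    also have "\<dots> = x (Suc (Suc n)) - x (Suc n)"
      unfolding x(2)[of "Suc n"] by (subst (3) x(2)) (simp add: field_simps)
    finally show ?case .
  qed
  have "incseq x" using xmono by (rule incseq_SucI)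
  have "convergent x"
    using Bseq_monoseq_convergent[of x] BseqI'[of x 1] x01 \<open>incseq x\<close> incseq_imp_monoseq by auto
  then have "Cauchy x" by (rule convergent_Cauchy)
  have le: "norm (X m - X n) \<le> x m - x n" if "n \<le> m" for m n
    using that
  proof (induction m rule: dec_induct)
    case (step m)
    then show ?case using Xd[of m] norm_triangle_ineq[of "X (Suc m) - X m" "X m - X n"] by simp
  qed simp
  have le': "norm (X m - X n) \<le> \<bar>x m - x n\<bar>" for m n
    using le[of n m] le[of m n] by (cases "n \<le> m") (auto simp: norm_minus_commute)
  have "Cauchy X"
  proof (rule CauchyI)
    fix e :: real assume "0 < e"
    then obtain M where "\<forall>m\<ge>M. \<forall>n\<ge>M. norm (x m - x n) < e"
      using CauchyD[OF \<open>Cauchy x\<close>] by blast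
    then show "\<exists>M. \<forall>m\<ge>M. \<forall>n\<ge>M. norm (X m - X n) < e"
      using le' by (metis le_less_trans real_norm_def)
  qed
  then obtain L where L: "X \<longlonglongrightarrow> L" by (auto simp: Cauchy_convergent_iff convergent_def)
  have "(\<lambda>n. X (Suc n)) \<longlonglongrightarrow> (1/2) *\<^sub>R ((1 - a) + L * L)"
    unfolding X by (intro tendsto_intros L)
  then have LL: "L = (1/2) *\<^sub>R ((1 - a) + L * L)"
    using LIMSEQ_Suc[OF L] LIMSEQ_unique by blast
  have "2 *\<^sub>R L = (1 - a) + L * L" by (subst LL) simp
  then have "(1 - L) * (1 - L) = a" by (simp add: algebra_simps scaleR_2)
  moreover have "L \<in> commutant S"
    by (rule commutant_wlim[OF Xin(1) tendsto_imp_wlim[OF L]])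
  moreover have "star L = L"
    using tendsto_star[OF L] Xin(2) L LIMSEQ_unique by simp
  moreover have "norm L \<le> 1"
    by (rule LIMSEQ_le_const2[OF tendsto_norm[OF L]]) (use Xn x01 order_trans in blast)
  ultimately show thesis using that by blast
qed

text \<open>
  The symmetry is the sign of \<open>b\<close>: it multiplies the absolute value \<open>c = 1 - X\<close>, a square root
  of \<open>b\<^sup>2\<close>, back to \<open>b\<close>.
\<close>

lemma symmetry_approx:
  fixes b :: "'a::{real_inner,banach} endo"
  assumes S: "star_closed S" and b: "b \<in> commutant S" "star b = b" "norm b \<le> 1"
  obtains s where "s \<in> commutant S" "star s = s" "s * s = 1" "norm (b - (1/2) *\<^sub>R s) \<le> 1/2"
proof -
  have bx: "norm (b \<cdot> x) \<le> norm x" for x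
    using norm_ap[of b x] b(3) by (meson mult_left_le_one_le norm_ge_zero order_trans)
  have sab: "inner (b \<cdot> x) y = inner x (b \<cdot> y)" for x y by (simp add: inner_star b)
  have "norm (1 - b * b) \<le> 1"
  proof (rule endo_bound_square)
    fix x
    have "(norm ((1 - b * b) \<cdot> x))\<^sup>2 = (norm x)\<^sup>2 - 2 * (norm (b \<cdot> x))\<^sup>2 + (norm (b \<cdot> b \<cdot> x))\<^sup>2"
      by (simp add: power2_norm_eq_inner ap_simps inner_diff_left inner_diff_right sab)
    also have "(norm (b \<cdot> b \<cdot> x))\<^sup>2 \<le> (norm (b \<cdot> x))\<^sup>2" by (intro power_mono bx) auto
    also have "(norm x)\<^sup>2 - 2 * (norm (b \<cdot> x))\<^sup>2 + (norm (b \<cdot> x))\<^sup>2 \<le> 1\<^sup>2 * (norm x)\<^sup>2" by simp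
    finally show "(norm ((1 - b * b) \<cdot> x))\<^sup>2 \<le> 1\<^sup>2 * (norm x)\<^sup>2" by simp
  qed simp
  \<comment> \<open>Adding \<open>b\<close> to \<open>S\<close> makes the square root commute with
    \<open>b\<close>.\<close>
  moreover have "b * b \<in> commutant (S \<union> {b})"
    unfolding commutant_Un using commutant_mult[OF b(1) b(1)] by (simp add: commutant_def mult.assoc)
  ultimately obtain X where X: "X \<in> commutant (S \<union> {b})" "star X = X" "norm X \<le> 1"
    "(1 - X) * (1 - X) = b * b"
    using b(2) commutant_sqrt[of "b * b" "S \<union> {b}"] by auto
  define c where "c = 1 - X"
  have c: "c \<in> commutant S" "c * b = b * c" "star c = c" "c * c = b * b"
    using X by (auto simp: c_def commutant_Un commutant_diff commutant_def algebra_simps)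
  have sac: "inner (c \<cdot> x) y = inner x (c \<cdot> y)" for x y by (simp add: inner_star c)
  have Xx: "norm (X \<cdot> x) \<le> norm x" for x
    using norm_ap[of X x] X(3) by (meson mult_left_le_one_le norm_ge_zero order_trans)
  have "pos c"
    unfolding pos_def
  proof (intro conjI allI c)
    fix x
    have "inner x (X \<cdot> x) \<le> norm x * norm (X \<cdot> x)" by (rule norm_cauchy_schwarz)
    also have "\<dots> \<le> norm x * norm x" by (intro mult_left_mono Xx) auto
    finally show "0 \<le> inner x (c \<cdot> x)"
      by (simp add: c_def ap_simps inner_diff_right flip: power2_eq_square power2_norm_eq_inner)
  qed
  moreover have "pos (1 - c)"
    unfolding pos_def
  proof (intro conjI allI)
    fix x
    have "(norm (c \<cdot> x))\<^sup>2 = (norm (b \<cdot> x))\<^sup>2"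
      by (simp add: power2_norm_eq_inner sac sab flip: ap_mult) (simp add: c)
    then have "norm (c \<cdot> x) = norm (b \<cdot> x)" by simp
    then have "norm x * norm (c \<cdot> x) \<le> norm x * norm x" by (intro mult_left_mono) (auto simp: bx)
    then have "inner x (c \<cdot> x) \<le> norm x * norm x" using norm_cauchy_schwarz order_trans by blast
    then show "0 \<le> inner x ((1 - c) \<cdot> x)"
      by (simp add: ap_simps inner_diff_right flip: power2_eq_square power2_norm_eq_inner)
  qed (simp add: c)
  ultimately have csq: "(norm (c \<cdot> x))\<^sup>2 \<le> inner x (c \<cdot> x)" for x by (rule pos_square_le)
  \<comment> \<open>The sign is 1 on the kernel of \<open>c - b\<close> and -1 on its orthogonal
    complement.\<close>
  define N where "N = {x. (c - b) \<cdot> x = 0}"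
  have N: "subspace N" "closed N"
    unfolding N_def by (auto simp: subspace_def ap_simps intro!: closed_Collect_eq continuous_intros
        bounded_linear.continuous_on[OF bounded_linear_ap])
  have cb: "c - b \<in> commutant S" by (intro commutant_diff c b)
  define p where "p = proj N"
  have pS: "p \<in> commutant S"
    unfolding p_def
  proof (rule proj_in_commutant[OF N S])
    fix T x assume "T \<in> S" "x \<in> N"
    then show "T \<cdot> x \<in> N"
      using cb unfolding N_def by (metis (mono_tags, lifting) ap_mult commutantD mem_Collect_eq ap.zero_right)
  qed
  have p: "star p = p" "p * p = p" unfolding p_def by (simp_all add: star_proj proj_idem N)
  have "(c - b) * p = 0"
    using proj_props(1)[OF N] by (intro endo_eqI) (simp add: p_def N_def)
  then have "star ((c - b) * p) = 0" by simp
  then have pcb: "p * c = p * b" by (simp add: p c b algebra_simps)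
  have "(c + b) \<cdot> x \<in> N" for x
  proof -
    have "(c - b) * (c + b) = 0" by (simp add: algebra_simps c)
    then show ?thesis unfolding N_def by (metis (mono_tags) ap_mult ap.zero_left mem_Collect_eq)
  qed
  then have "p * (c + b) = c + b"
    unfolding p_def by (intro endo_eqI) (simp add: proj_id[OF N])
  then have 2: "2 *\<^sub>R (p * c) = c + b" by (simp add: distrib_left pcb scaleR_2)
  define s where "s = 2 *\<^sub>R p - 1"
  have s: "s \<in> commutant S" "star s = s" "s * s = 1"
    unfolding s_def by (intro commutant_diff commutant_scaleR pS commutant_one)
      (simp_all add: p algebra_simps scaleR_2)
  have sc: "s * c = b" using 2 by (simp add: s_def algebra_simps)
  have sx: "norm (s \<cdot> x) = norm x" for x
  proof -
    have "(norm (s \<cdot> x))\<^sup>2 = inner x ((s * s) \<cdot> x)"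
      unfolding power2_norm_eq_inner by (simp add: inner_star s(2))
    then show ?thesis by (simp add: s(3) power2_norm_eq_inner[symmetric])
  qed
  have "norm (b - (1/2) *\<^sub>R s) \<le> 1/2"
  proof (rule endo_bound_square)
    fix x
    \<comment> \<open>Since \<open>b = s * c\<close> with \<open>s\<close> isometric, only the
      distance of \<open>c\<close> from one half counts, and \<open>c\<close> lies between 0 and
      1.\<close>
    have "(b - (1/2) *\<^sub>R s) \<cdot> x = s \<cdot> (c \<cdot> x - (1/2) *\<^sub>R x)"
      by (simp add: ap_simps flip: sc)
    then have "(norm ((b - (1/2) *\<^sub>R s) \<cdot> x))\<^sup>2 = (norm (c \<cdot> x - (1/2) *\<^sub>R x))\<^sup>2"
      by (simp add: sx)
    also have "\<dots> = (norm (c \<cdot> x))\<^sup>2 - inner x (c \<cdot> x) + (1/4) * (norm x)\<^sup>2"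
      by (simp add: power2_norm_eq_inner inner_diff_left inner_diff_right inner_commute[of "c \<cdot> x" x] field_simps)
    also have "\<dots> \<le> (1/2)\<^sup>2 * (norm x)\<^sup>2" using csq[of x] by (simp add: power2_eq_square)
    finally show "(norm ((b - (1/2) *\<^sub>R s) \<cdot> x))\<^sup>2 \<le> (1/2)\<^sup>2 * (norm x)\<^sup>2" .
  qed simp
  then show thesis using that s by blast
qed

text \<open>Iterates \<open>symmetry_approx\<close>: twice the remainder is again a selfadjoint
  contraction of the commutant, so each further symmetry halves the error. This does the work of the
  spectral theorem.\<close>

lemma selfadjoint_in_closed_span_symmetries:
  fixes b :: "'a::{real_inner,banach} endo"
  assumes S: "star_closed S" and V: "subspace V" "closed V"
    and sym: "\<And>s. s \<in> commutant S \<Longrightarrow> star s = s \<Longrightarrow> s * s = 1 \<Longrightarrow> s \<in> V"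
    and b: "b \<in> commutant S" "star b = b"
  shows "b \<in> V"
proof -
  have approx: "\<exists>v\<in>V. norm (b - v) \<le> (1/2)^n"
    if "b \<in> commutant S" "star b = b" "norm b \<le> 1" for b n
    using that
  proof (induction n arbitrary: b)
    case 0
    then show ?case using subspace_0[OF V(1)] by (intro bexI[of _ 0]) auto
  next
    case (Suc n)
    obtain s where s: "s \<in> commutant S" "star s = s" "s * s = 1" "norm (b - (1/2) *\<^sub>R s) \<le> 1/2"
      using symmetry_approx[OF S Suc.prems] .
    let ?b = "2 *\<^sub>R (b - (1/2) *\<^sub>R s)"
    have "\<exists>v\<in>V. norm (?b - v) \<le> (1/2)^n"
      using s Suc.prems by (intro Suc.IH) (auto intro!: commutant_scaleR commutant_diff)
    then obtain v where v: "v \<in> V" "norm (?b - v) \<le> (1/2)^n" by blast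
    have "b - ((1/2) *\<^sub>R s + (1/2) *\<^sub>R v) = (1/2) *\<^sub>R (?b - v)" by (simp add: algebra_simps)
    then have "norm (b - ((1/2) *\<^sub>R s + (1/2) *\<^sub>R v)) \<le> (1/2)^Suc n" using v(2) by simp
    moreover have "(1/2) *\<^sub>R s + (1/2) *\<^sub>R v \<in> V"
      using s v sym by (intro subspace_add[OF V(1)] subspace_scale[OF V(1)]) auto
    ultimately show ?case by blast
  qed
  have unit: "b \<in> V" if b: "b \<in> commutant S" "star b = b" "norm b \<le> 1" for b
  proof -
    obtain v where v: "\<And>n. v n \<in> V" "\<And>n. norm (b - v n) \<le> (1/2)^n"
      using approx[OF b] by metis
    have "(\<lambda>n. v n - b) \<longlonglongrightarrow> 0"
      by (rule Lim_null_comparison[of _ "\<lambda>n. (1/2)^n"])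
        (use v in \<open>auto simp: norm_minus_commute intro!: always_eventually LIMSEQ_power_zero\<close>)
    then have "v \<longlonglongrightarrow> b" by (rule LIM_zero_cancel)
    then show ?thesis using V(2) v(1) by (meson closed_sequentially)
  qed
  define r where "r = inverse (1 + norm b)"
  have "0 < 1 + norm b" by (simp add: add_pos_nonneg)
  then have "norm (r *\<^sub>R b) \<le> 1" and r: "(1 + norm b) * r = 1"
    by (simp_all add: r_def field_simps)
  then have "r *\<^sub>R b \<in> V" using b by (intro unit) (auto intro!: commutant_scaleR)
  then have "(1 + norm b) *\<^sub>R (r *\<^sub>R b) \<in> V" by (rule subspace_scale[OF V(1)])
  then show ?thesis by (simp add: r)
qed


section \<open>Decomposing the identity\<close>

text \<open>What remains of 1 after the pieces \<open>r * K * r\<close> are removed. Conjugating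
  with the residual itself keeps it a polynomial in the \<open>K n\<close>, hence in every commutant
  that contains them; it stays between 0 and 1 since \<open>r * K * r\<close> is at most
  \<open>r * r\<close>, which is at most \<open>r\<close>.\<close>

primrec resid :: "(nat \<Rightarrow> 'a::{real_inner,banach} endo) \<Rightarrow> nat \<Rightarrow> 'a endo" where
  "resid K 0 = 1"
| "resid K (Suc n) = resid K n - resid K n * K n * resid K n"

context
  fixes K :: "nat \<Rightarrow> 'a::{real_inner,banach} endo"
  assumes K: "\<And>n. pos (K n)" "\<And>n. pos (1 - K n)"
begin

lemma resid_pos: "pos (resid K n) \<and> pos (1 - resid K n)"
proof (induction n)
  case 0
  show ?case by (simp add: pos_def)
next
  case (Suc n)
  let ?r = "resid K n"
  have sr: "star ?r = ?r" "star (K n) = K n" using Suc K by (auto simp: pos_def)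
  have sa: "inner x (?r \<cdot> y) = inner (?r \<cdot> x) y" for x y by (simp add: inner_star' sr)
  have "0 \<le> inner x (resid K (Suc n) \<cdot> x)" for x
  proof -
    have "0 \<le> inner (?r \<cdot> x) ((1 - K n) \<cdot> ?r \<cdot> x)" using K by (simp add: pos_def)
    then have "inner (?r \<cdot> x) (K n \<cdot> ?r \<cdot> x) \<le> (norm (?r \<cdot> x))\<^sup>2"
      by (simp add: ap_simps inner_diff_right power2_norm_eq_inner)
    also have "\<dots> \<le> inner x (?r \<cdot> x)" using Suc by (intro pos_square_le) auto
    finally show ?thesis by (simp add: ap_simps inner_diff_right sa)
  qed
  moreover have "0 \<le> inner x ((1 - resid K (Suc n)) \<cdot> x)" for x
  proof -
    have "0 \<le> inner x ((1 - ?r) \<cdot> x)" using Suc by (simp add: pos_def)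
    moreover have "0 \<le> inner (?r \<cdot> x) (K n \<cdot> ?r \<cdot> x)" using K by (simp add: pos_def)
    ultimately show ?thesis by (simp add: ap_simps inner_diff_right sa)
  qed
  ultimately show ?case by (simp add: pos_def sr mult.assoc)
qed

lemma star_resid: "star (resid K n) = resid K n"
  using resid_pos by (simp add: pos_def)

lemma resid_sum: "(\<Sum>n<m. resid K n * K n * resid K n) = 1 - resid K m"
  by (induction m) auto

lemma resid_commutant: "(\<And>n. K n \<in> commutant S) \<Longrightarrow> resid K n \<in> commutant S"
  by (induction n) (auto intro!: commutant_diff commutant_mult)

lemma norm_resid: "norm (resid K n) \<le> 1"
proof (rule endo_bound)
  fix x
  have "(norm (resid K n \<cdot> x))\<^sup>2 \<le> inner x (resid K n \<cdot> x)"
    using resid_pos by (intro pos_square_le) auto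
  also have "\<dots> \<le> norm x * norm (resid K n \<cdot> x)" by (rule norm_cauchy_schwarz)
  finally show "norm (resid K n \<cdot> x) \<le> 1 * norm x"
    by (cases "norm (resid K n \<cdot> x) = 0") (auto simp: power2_eq_square)
qed simp

lemma resid_decreasing: "inner x (resid K (n + k) \<cdot> x) \<le> inner x (resid K n \<cdot> x)"
proof (induction k)
  case (Suc k)
  have "0 \<le> inner (resid K (n + k) \<cdot> x) (K (n + k) \<cdot> resid K (n + k) \<cdot> x)"
    using K by (simp add: pos_def)
  then show ?case using Suc by (simp add: ap_simps inner_diff_right inner_star' star_resid)
qed simp

text \<open>The pieces telescope to \<open>1 - resid K m\<close>, so their sums stay below the
  identity. In particular the terms tend to 0, and this is what later makes the residuals
  small.\<close>

lemma resid_summable: "summable (\<lambda>n. inner (resid K n \<cdot> x) (K n \<cdot> resid K n \<cdot> x))"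
proof (rule summableI_nonneg_bounded)
  show "0 \<le> inner (resid K n \<cdot> x) (K n \<cdot> resid K n \<cdot> x)" for n using K by (simp add: pos_def)
  show "(\<Sum>n<m. inner (resid K n \<cdot> x) (K n \<cdot> resid K n \<cdot> x)) \<le> inner x x" for m
  proof -
    have "(\<Sum>n<m. inner (resid K n \<cdot> x) (K n \<cdot> resid K n \<cdot> x)) =
        inner x ((\<Sum>n<m. resid K n * K n * resid K n) \<cdot> x)"
      by (simp add: ap.sum_left inner_sum_right inner_star' star_resid)
    also have "\<dots> = inner x x - inner x (resid K m \<cdot> x)"
      unfolding resid_sum by (simp add: ap_simps inner_diff_right)
    finally show ?thesis using resid_pos[of m] by (simp add: pos_def)
  qed
qed

end


section \<open>Hypertraces over a group algebra\<close>

lemma endo_bound_inner: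
  fixes T :: "'a::{real_inner,banach} endo"
  assumes "0 \<le> C" "\<And>f g. \<bar>inner f (T \<cdot> g)\<bar> \<le> C * (norm f * norm g)"
  shows "norm T \<le> C"
proof (rule endo_bound[OF assms(1)])
  fix g
  have "norm (T \<cdot> g) * norm (T \<cdot> g) \<le> C * (norm (T \<cdot> g) * norm g)"
    using assms(2)[of "T \<cdot> g" g] by (simp flip: power2_norm_eq_inner power2_eq_square)
  then show "norm (T \<cdot> g) \<le> C * norm g"
    by (cases "norm (T \<cdot> g) = 0") (auto simp: assms(1) mult.left_commute[of C])
qed

lemma bounded_linear_vanish_closure:
  assumes F: "bounded_linear F" and x: "x \<in> closure (span S)" and S: "\<And>s. s \<in> S \<Longrightarrow> F s = 0"
  shows "F x = 0"
proof -
  interpret F: bounded_linear F by fact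
  have "closed {x. F x = 0}" by (intro closed_Collect_eq F.continuous_on continuous_intros)
  moreover have "span S \<subseteq> {x. F x = 0}"
    using S by (intro span_minimal) (auto simp: subspace_def F.zero F.add F.scaleR)
  ultimately show ?thesis using x closure_minimal by blast
qed

text \<open>The assumption says that the sum of the \<open>t i * star (t i)\<close> is at most 1.
  Cauchy-Schwarz is applied to each term and then to the sum.\<close>

lemma sum_conj_bound:
  fixes T :: "'a::{real_inner,banach} endo"
  assumes t: "\<And>f. (\<Sum>i\<in>I. (norm (star (t i) \<cdot> f))\<^sup>2) \<le> (norm f)\<^sup>2"
  shows "norm (\<Sum>i\<in>I. t i * T * star (t i)) \<le> norm T"
proof (rule endo_bound_inner)
  fix f g
  let ?a = "\<lambda>f i. norm (star (t i) \<cdot> f)"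
  have "\<bar>inner f ((\<Sum>i\<in>I. t i * T * star (t i)) \<cdot> g)\<bar> = \<bar>\<Sum>i\<in>I. inner (star (t i) \<cdot> f) (T \<cdot> star (t i) \<cdot> g)\<bar>"
    by (simp add: ap.sum_left inner_sum_right inner_star')
  also have "\<dots> \<le> (\<Sum>i\<in>I. norm T * (?a f i * ?a g i))"
  proof (rule order_trans[OF sum_abs sum_mono])
    fix i
    have "\<bar>inner (star (t i) \<cdot> f) (T \<cdot> star (t i) \<cdot> g)\<bar> \<le> ?a f i * norm (T \<cdot> star (t i) \<cdot> g)"
      by (rule Cauchy_Schwarz_ineq2)
    also have "\<dots> \<le> ?a f i * (norm T * ?a g i)" by (intro mult_left_mono norm_ap) auto
    finally show "\<bar>inner (star (t i) \<cdot> f) (T \<cdot> star (t i) \<cdot> g)\<bar> \<le> norm T * (?a f i * ?a g i)"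
      by (simp add: ac_simps)
  qed
  also have "\<dots> = norm T * (\<Sum>i\<in>I. ?a f i * ?a g i)" by (simp add: sum_distrib_left)
  also have "(\<Sum>i\<in>I. ?a f i * ?a g i) \<le> norm f * norm g"
  proof (rule power2_le_imp_le)
    have "(\<Sum>i\<in>I. ?a f i * ?a g i)\<^sup>2 \<le> (\<Sum>i\<in>I. (?a f i)\<^sup>2) * (\<Sum>i\<in>I. (?a g i)\<^sup>2)"
      by (rule Cauchy_Schwarz_ineq_sum)
    also have "\<dots> \<le> (norm f)\<^sup>2 * (norm g)\<^sup>2" by (intro mult_mono t sum_nonneg) auto
    finally show "(\<Sum>i\<in>I. ?a f i * ?a g i)\<^sup>2 \<le> (norm f * norm g)\<^sup>2" by (simp add: power_mult_distrib)
  qed simp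
  finally show "\<bar>inner f ((\<Sum>i\<in>I. t i * T * star (t i)) \<cdot> g)\<bar> \<le> norm T * (norm f * norm g)"
    by (simp add: mult_left_mono)
qed simp

text \<open>
  The regular representations of \<open>G\<close>: \<open>\<delta> g\<close> are the basis vectors, \<open>ii\<close> is the complex unit, \<open>J\<close>
  the antiunitary with \<open>J (\<delta> g) = \<delta> (g\<inverse>)\<close>, and \<open>P S\<close> the multiplication by the indicator of \<open>S\<close>.
\<close>

locale group_rep = group G for G (structure) +
  fixes ii :: "'h::{real_inner,banach} endo" and \<delta> :: "'a \<Rightarrow> 'h"
    and L R :: "'a \<Rightarrow> 'h endo" and J :: "'h endo" and P :: "'a set \<Rightarrow> 'h endo"
  assumes ii: "ii * ii = -1" "star ii = - ii"
    and norm_\<delta>: "g \<in> carrier G \<Longrightarrow> norm (\<delta> g) = 1"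
    and total: "(\<And>g. g \<in> carrier G \<Longrightarrow> inner (\<delta> g) f = 0 \<and> inner (ii \<cdot> \<delta> g) f = 0) \<Longrightarrow> f = 0"
    and L_ii: "g \<in> carrier G \<Longrightarrow> L g * ii = ii * L g"
    and R_ii: "g \<in> carrier G \<Longrightarrow> R g * ii = ii * R g"
    and star_L: "g \<in> carrier G \<Longrightarrow> star (L g) = L (inv g)"
    and star_R: "g \<in> carrier G \<Longrightarrow> star (R g) = R (inv g)"
    and L_mult: "g \<in> carrier G \<Longrightarrow> h \<in> carrier G \<Longrightarrow> L g * L h = L (g \<otimes> h)"
    and R_mult: "g \<in> carrier G \<Longrightarrow> h \<in> carrier G \<Longrightarrow> R g * R h = R (g \<otimes> h)"
    and L_one: "L \<one> = 1" and R_one: "R \<one> = 1"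
    and LR: "g \<in> carrier G \<Longrightarrow> h \<in> carrier G \<Longrightarrow> L g * R h = R h * L g"
    and L_\<delta>: "g \<in> carrier G \<Longrightarrow> h \<in> carrier G \<Longrightarrow> L g \<cdot> \<delta> h = \<delta> (g \<otimes> h)"
    and R_\<delta>: "g \<in> carrier G \<Longrightarrow> h \<in> carrier G \<Longrightarrow> R g \<cdot> \<delta> h = \<delta> (h \<otimes> inv g)"
    and J_\<delta>: "g \<in> carrier G \<Longrightarrow> J \<cdot> \<delta> g = \<delta> (inv g)"
    and J_ii: "J * ii = - (ii * J)" and star_J: "star J = J"
    and P_ii: "P S * ii = ii * P S" and star_P: "star (P S) = P S"
    and P_mult: "P S * P S' = P (S \<inter> S')"
    and P_Un: "S \<inter> S' = {} \<Longrightarrow> P (S \<union> S') = P S + P S'"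
    and P_carrier: "P (carrier G) = 1"
    and P_\<delta>: "g \<in> carrier G \<Longrightarrow> P S \<cdot> \<delta> g = (if g \<in> S then \<delta> g else 0)"
    and L_P: "g \<in> carrier G \<Longrightarrow> S \<subseteq> carrier G \<Longrightarrow> L g * P S = P ((\<otimes>) g ` S) * L g"
begin

definition clin :: "'h endo set" where "clin = commutant {ii}"

text \<open>This contains L(G). Commuting with the right translations makes an element recoverable
  from its value at \<open>vac\<close>, see \<open>rvn_vac_g\<close>.\<close>

definition rvn :: "'h endo set" where "rvn = commutant (insert ii (R ` carrier G))"

abbreviation vac :: 'h where "vac \<equiv> \<delta> \<one>"

lemma rvn_clin: "rvn \<subseteq> clin"
  unfolding rvn_def clin_def by (rule commutant_antimono) auto

lemma clin_simps:
  "1 \<in> clin" "T \<in> clin \<Longrightarrow> T' \<in> clin \<Longrightarrow> T * T' \<in> clin" "T \<in> clin \<Longrightarrow> T' \<in> clin \<Longrightarrow> T + T' \<in> clin"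
  "T \<in> clin \<Longrightarrow> T' \<in> clin \<Longrightarrow> T - T' \<in> clin" "T \<in> clin \<Longrightarrow> r *\<^sub>R T \<in> clin"
  "g \<in> carrier G \<Longrightarrow> L g \<in> clin" "g \<in> carrier G \<Longrightarrow> R g \<in> clin" "P S \<in> clin" "ii \<in> clin"
  by (auto simp: clin_def intro: commutant_mult commutant_add commutant_diff commutant_scaleR)
    (auto simp: commutant_def L_ii R_ii P_ii)

lemma star_clin:
  assumes "T \<in> clin"
  shows "star T \<in> clin"
proof -
  have "star (T * ii) = star (ii * T)" using assms by (simp add: clin_def commutant_def)
  then show ?thesis by (simp add: clin_def commutant_def ii)
qed

lemma R_star: "star_closed (insert ii (insert (- ii) (R ` carrier G)))"
  by (auto simp: star_closed_def ii star_R)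

text \<open>The adjoint of \<open>ii\<close> is added to make the set star closed; the commutant
  stays the same.\<close>

lemma rvn_alt: "rvn = commutant (insert ii (insert (- ii) (R ` carrier G)))"
  by (auto simp: rvn_def commutant_def)

lemma star_rvn: "T \<in> rvn \<Longrightarrow> star T \<in> rvn"
  using star_closed_commutant[OF R_star] by (auto simp: rvn_alt star_closed_def)

lemma rvn_simps:
  "1 \<in> rvn" "T \<in> rvn \<Longrightarrow> T' \<in> rvn \<Longrightarrow> T * T' \<in> rvn" "T \<in> rvn \<Longrightarrow> T' \<in> rvn \<Longrightarrow> T - T' \<in> rvn"
  "T \<in> rvn \<Longrightarrow> T' \<in> rvn \<Longrightarrow> T + T' \<in> rvn" "T \<in> rvn \<Longrightarrow> r *\<^sub>R T \<in> rvn"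
  "g \<in> carrier G \<Longrightarrow> L g \<in> rvn" "ii \<in> rvn"
  by (auto simp: rvn_def intro: commutant_mult commutant_add commutant_diff commutant_scaleR)
    (auto simp: commutant_def L_ii R_ii LR)

section \<open>The trace vector and the conjugation \<open>J\<close>\<close>

lemma rvn_vac_g:
  assumes "x \<in> rvn" "g \<in> carrier G"
  shows "x \<cdot> \<delta> g = R (inv g) \<cdot> x \<cdot> vac"
proof -
  have "\<delta> g = R (inv g) \<cdot> vac" using assms by (simp add: R_\<delta>)
  moreover have "x * R (inv g) = R (inv g) * x" using assms by (auto simp: rvn_def commutant_def)
  ultimately show ?thesis by (metis ap_mult)
qed

text \<open>Argued through the adjoint: every \<open>star T \<cdot> f\<close> is orthogonal to the
  total family.\<close>

lemma endo_zeroI: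
  assumes "T \<in> clin" "\<And>g. g \<in> carrier G \<Longrightarrow> T \<cdot> \<delta> g = 0"
  shows "T = 0"
proof -
  have "star T = 0"
  proof (rule endo_eqI)
    fix f
    have "T \<cdot> ii \<cdot> \<delta> g = 0" if "g \<in> carrier G" for g
      using assms that by (metis (no_types) ap_mult ap.zero_right clin_def commutantD singletonI)
    then show "star T \<cdot> f = 0 \<cdot> f"
      using assms by (simp add: total inner_star')
  qed
  then show ?thesis by (metis star_star star_zero)
qed

lemma separating:
  assumes "x \<in> rvn" "x \<cdot> vac = 0"
  shows "x = 0"
proof (rule endo_zeroI)
  show "x \<in> clin" using assms rvn_clin by auto
  show "x \<cdot> \<delta> g = 0" if "g \<in> carrier G" for g
    using rvn_vac_g[OF assms(1) that] assms(2) by simp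
qed

text \<open>The conjugation of Tomita's theory for the trace. The coefficient of
  \<open>x \<cdot> vac\<close> at the inverse of \<open>g\<close> is conjugate to that of
  \<open>star x \<cdot> vac\<close> at \<open>g\<close>, because \<open>star x\<close> commutes with
  \<open>R g\<close>; real and imaginary parts are compared separately.\<close>

lemma J_star:
  assumes x: "x \<in> rvn"
  shows "J \<cdot> x \<cdot> vac = star x \<cdot> vac"
proof -
  have x': "star x \<in> rvn" by (rule star_rvn[OF x])
  have xi: "T * ii = ii * T" if "T \<in> rvn" for T using that by (simp add: rvn_def commutant_def)
  have "J \<cdot> x \<cdot> vac - star x \<cdot> vac = 0"
  proof (rule total)
    fix g assume g: "g \<in> carrier G"
    have xg: "star x \<cdot> \<delta> (inv g) = R g \<cdot> star x \<cdot> vac"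
      using rvn_vac_g[OF x', of "inv g"] g by simp
    have 1: "inner (\<delta> (inv g)) (x \<cdot> vac) = inner (\<delta> g) (star x \<cdot> vac)"
    proof -
      have "inner (\<delta> (inv g)) (x \<cdot> vac) = inner (R g \<cdot> star x \<cdot> vac) vac"
        by (simp add: inner_star' xg)
      also have "\<dots> = inner (star x \<cdot> vac) (\<delta> g)" using g by (simp add: inner_star star_R R_\<delta>)
      finally show ?thesis by (simp add: inner_commute)
    qed
    have 2: "inner (ii \<cdot> \<delta> (inv g)) (x \<cdot> vac) = - inner (ii \<cdot> \<delta> g) (star x \<cdot> vac)"
    proof -
      have "inner (ii \<cdot> \<delta> (inv g)) (x \<cdot> vac) = inner (ii \<cdot> star x \<cdot> \<delta> (inv g)) vac"
        using xi[OF x'] by (metis ap_mult inner_star')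
      also have "\<dots> = inner (ii \<cdot> R g \<cdot> star x \<cdot> vac) vac"
        by (simp add: xg)
      also have "\<dots> = inner (R g \<cdot> ii \<cdot> star x \<cdot> vac) vac"
        using R_ii[OF g] by (metis ap_mult)
      also have "\<dots> = inner (ii \<cdot> star x \<cdot> vac) (\<delta> g)" using g by (simp add: inner_star star_R R_\<delta>)
      also have "\<dots> = - inner (ii \<cdot> \<delta> g) (star x \<cdot> vac)"
        by (simp add: inner_star[of ii] ii ap_simps inner_commute)
      finally show ?thesis .
    qed
    have J2: "inner (ii \<cdot> \<delta> g) (J \<cdot> v) = - inner (ii \<cdot> \<delta> (inv g)) v" for v
    proof -
      have "J \<cdot> ii \<cdot> \<delta> g = - (ii \<cdot> \<delta> (inv g))"
        using J_\<delta>[OF g] arg_cong[OF J_ii, of "\<lambda>T. T \<cdot> \<delta> g"] by (simp add: ap_simps)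
      then show ?thesis by (simp add: inner_star' star_J)
    qed
    show "inner (\<delta> g) (J \<cdot> x \<cdot> vac - star x \<cdot> vac) = 0 \<and> inner (ii \<cdot> \<delta> g) (J \<cdot> x \<cdot> vac - star x \<cdot> vac) = 0"
      using 1 2 J2 g by (simp add: inner_diff_right inner_star'[of _ J] star_J J_\<delta>)
  qed
  then show ?thesis by simp
qed

text \<open>Both sides are pairings of \<open>x \<cdot> vac\<close> with
  \<open>y \<cdot> vac\<close> through \<open>J\<close>, which is symmetric for the real inner
  product.\<close>

lemma trace:
  assumes "x \<in> rvn" "y \<in> rvn"
  shows "inner vac (x \<cdot> y \<cdot> vac) = inner vac (y \<cdot> x \<cdot> vac)"
proof -
  have "inner vac (x \<cdot> y \<cdot> vac) = inner (J \<cdot> x \<cdot> vac) (y \<cdot> vac)"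
    using assms by (simp add: inner_star' J_star)
  also have "\<dots> = inner (J \<cdot> y \<cdot> vac) (x \<cdot> vac)"
    by (metis inner_commute inner_star star_J)
  also have "\<dots> = inner vac (y \<cdot> x \<cdot> vac)"
    using assms by (simp add: inner_star'[of _ y] J_star)
  finally show ?thesis .
qed

lemma norm_star_vac:
  assumes "x \<in> rvn"
  shows "norm (star x \<cdot> vac) = norm (x \<cdot> vac)"
proof -
  have "inner (star x \<cdot> vac) (star x \<cdot> vac) = inner (x \<cdot> vac) (x \<cdot> vac)"
    using trace[OF assms star_rvn[OF assms]] by (simp add: inner_star'[of vac])
  then show ?thesis by (simp add: norm_eq_sqrt_inner)
qed

text \<open>The real part of a \<open>Q\<close>-central state on all complex linear operators that
  extends the trace of \<open>rvn\<close>. Positivity is encoded by contractivity, as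
  \<open>\<phi> 1 = 1\<close> follows from the last clause.\<close>

definition hypertrace :: "'h endo set \<Rightarrow> ('h endo \<Rightarrow> real) \<Rightarrow> bool" where
  "hypertrace Q \<phi> \<longleftrightarrow>
     (\<forall>S\<in>clin. \<forall>T\<in>clin. \<phi> (S + T) = \<phi> S + \<phi> T) \<and> (\<forall>T\<in>clin. \<forall>r. \<phi> (r *\<^sub>R T) = r * \<phi> T) \<and>
     (\<forall>T\<in>clin. \<bar>\<phi> T\<bar> \<le> norm T) \<and> (\<forall>a\<in>Q. \<forall>T\<in>clin. \<phi> (a * T) = \<phi> (T * a)) \<and>
     (\<forall>x\<in>rvn. \<phi> x = inner vac (x \<cdot> vac))"

section \<open>Null sets of a hypertrace\<close>

context
  fixes Q \<phi>
  assumes Q: "Q \<subseteq> rvn" "star_closed Q" and \<phi>: "hypertrace Q \<phi>"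
begin

lemma \<phi>_add: "S \<in> clin \<Longrightarrow> T \<in> clin \<Longrightarrow> \<phi> (S + T) = \<phi> S + \<phi> T"
  and \<phi>_scale: "T \<in> clin \<Longrightarrow> \<phi> (r *\<^sub>R T) = r * \<phi> T"
  and \<phi>_norm: "T \<in> clin \<Longrightarrow> \<bar>\<phi> T\<bar> \<le> norm T"
  and \<phi>_central: "a \<in> Q \<Longrightarrow> T \<in> clin \<Longrightarrow> \<phi> (a * T) = \<phi> (T * a)"
  and \<phi>_trace: "x \<in> rvn \<Longrightarrow> \<phi> x = inner vac (x \<cdot> vac)"
  using \<phi> by (auto simp: hypertrace_def)

lemma \<phi>_diff: "S \<in> clin \<Longrightarrow> T \<in> clin \<Longrightarrow> \<phi> (S - T) = \<phi> S - \<phi> T"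
  using \<phi>_add[of "S - T" T] by (simp add: clin_simps)

lemma \<phi>_one: "\<phi> 1 = 1"
  using norm_\<delta>[OF one_closed] by (simp add: \<phi>_trace rvn_simps power2_norm_eq_inner[symmetric])

text \<open>
  Since \<open>\<phi> 1 = 1\<close>, a contractive functional cannot charge \<open>T * P S\<close> when it does not charge
  \<open>P S\<close>: the norm of \<open>(1 - P S) + c T (P S)\<close> is \<open>1 + O(c\<^sup>2)\<close>, while the functional takes the value
  \<open>1 + c \<phi> (T * P S)\<close>.
\<close>

lemma null_aux:
  assumes p: "star p = p" "p * p = p" and c: "\<And>c. \<bar>1 + c * \<psi>\<bar> \<le> norm (1 - p + c *\<^sub>R (T * p))"
  shows "\<psi> = 0"
proof (rule ccontr)
  assume \<psi>: "\<psi> \<noteq> 0"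
  let ?t = "norm T"
  \<comment> \<open>The two summands act on the orthogonal parts \<open>f - p \<cdot> f\<close> and
    \<open>p \<cdot> f\<close>, so Cauchy-Schwarz in the plane applies.\<close>
  have bound: "norm (1 - p + c *\<^sub>R (T * p)) \<le> sqrt (1 + c\<^sup>2 * ?t\<^sup>2)" for c
  proof (rule endo_bound_square)
    fix f
    let ?u = "norm (f - p \<cdot> f)" and ?v = "norm (p \<cdot> f)"
    have "inner (f - p \<cdot> f) (p \<cdot> f) = 0"
      using arg_cong[OF p(2), of "\<lambda>T. T \<cdot> f"] by (simp add: inner_diff_left inner_star[of p] p(1))
    then have pyth: "?u\<^sup>2 + ?v\<^sup>2 = (norm f)\<^sup>2"
      by (simp add: power2_norm_eq_inner inner_diff_left inner_diff_right inner_commute)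
    have "norm ((1 - p + c *\<^sub>R (T * p)) \<cdot> f) \<le> ?u + \<bar>c\<bar> * norm (T \<cdot> p \<cdot> f)"
      by (simp add: ap_simps norm_triangle_le)
    also have "norm (T \<cdot> p \<cdot> f) \<le> ?t * ?v" by (rule norm_ap)
    finally have "norm ((1 - p + c *\<^sub>R (T * p)) \<cdot> f) \<le> ?u + \<bar>c\<bar> * (?t * ?v)" by (simp add: mult_left_mono)
    then have "(norm ((1 - p + c *\<^sub>R (T * p)) \<cdot> f))\<^sup>2 \<le> (?u + \<bar>c\<bar> * (?t * ?v))\<^sup>2" by (intro power_mono) auto
    also have "\<dots> \<le> (1 + c\<^sup>2 * ?t\<^sup>2) * (?u\<^sup>2 + ?v\<^sup>2)"
    proof -
      have "(1 + c\<^sup>2 * ?t\<^sup>2) * (?u\<^sup>2 + ?v\<^sup>2) - (?u + \<bar>c\<bar> * (?t * ?v))\<^sup>2 = (?v - \<bar>c\<bar> * ?t * ?u)\<^sup>2"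
        by (simp add: power2_eq_square algebra_simps)
      then show ?thesis by (metis diff_ge_0_iff_ge zero_le_power2)
    qed
    finally show "(norm ((1 - p + c *\<^sub>R (T * p)) \<cdot> f))\<^sup>2 \<le> (sqrt (1 + c\<^sup>2 * ?t\<^sup>2))\<^sup>2 * (norm f)\<^sup>2"
      by (simp add: pyth)
  qed simp
  \<comment> \<open>Chosen so that \<open>s * ?t\<^sup>2 \<le> 1\<close>: at
    \<open>c = s * \<psi>\<close> the quadratic error is at most half of the linear gain.\<close>
  define s where "s = 1 / (1 + ?t\<^sup>2)"
  have s: "0 < s" "s * ?t\<^sup>2 \<le> 1"
    by (auto simp: s_def add_pos_nonneg divide_le_eq)
  have "\<bar>1 + (s * \<psi>) * \<psi>\<bar> \<le> sqrt (1 + (s * \<psi>)\<^sup>2 * ?t\<^sup>2)"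
    using c[of "s * \<psi>"] bound[of "s * \<psi>"] by linarith
  then have "(1 + (s * \<psi>) * \<psi>)\<^sup>2 \<le> 1 + (s * \<psi>)\<^sup>2 * ?t\<^sup>2"
    by (metis abs_le_square_iff abs_ge_zero abs_of_nonneg add_nonneg_nonneg mult_nonneg_nonneg
        real_sqrt_ge_zero real_sqrt_pow2 zero_le_one zero_le_power2)
  then have "2 * (s * \<psi>\<^sup>2) + (s * \<psi>\<^sup>2)\<^sup>2 \<le> (s * \<psi>\<^sup>2) * (s * ?t\<^sup>2)"
    by (simp add: power2_eq_square algebra_simps)
  also have "\<dots> \<le> (s * \<psi>\<^sup>2) * 1" using s by (intro mult_left_mono) auto
  finally have "s * \<psi>\<^sup>2 + (s * \<psi>\<^sup>2)\<^sup>2 \<le> 0" by simp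
  moreover have "0 < s * \<psi>\<^sup>2" using s(1) \<psi> by simp
  ultimately show False using zero_le_power2[of "s * \<psi>\<^sup>2"] by linarith
qed

lemma null:
  assumes "\<phi> (P S) = 0" "T \<in> clin"
  shows "\<phi> (T * P S) = 0" "\<phi> (P S * T) = 0"
proof -
  have P: "star (P S) = P S" "P S * P S = P S" by (simp_all add: star_P P_mult)
  show "\<phi> (T * P S) = 0"
  proof (rule null_aux[OF P])
    fix c
    have "\<phi> (1 - P S + c *\<^sub>R (T * P S)) = 1 + c * \<phi> (T * P S)"
      using assms by (simp add: \<phi>_add \<phi>_diff \<phi>_scale \<phi>_one clin_simps)
    then show "\<bar>1 + c * \<phi> (T * P S)\<bar> \<le> norm (1 - P S + c *\<^sub>R (T * P S))"
      using assms \<phi>_norm[of "1 - P S + c *\<^sub>R (T * P S)"] by (simp add: clin_simps)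
  qed
  show "\<phi> (P S * T) = 0"
  proof (rule null_aux[OF P])
    fix c
    have "\<phi> (1 - P S + c *\<^sub>R (P S * T)) = 1 + c * \<phi> (P S * T)"
      using assms by (simp add: \<phi>_add \<phi>_diff \<phi>_scale \<phi>_one clin_simps)
    \<comment> \<open>Taking adjoints brings \<open>P S * T\<close> into the shape of
      \<open>null_aux\<close>, with \<open>star T\<close> for \<open>T\<close>.\<close>
    moreover have "norm (1 - P S + c *\<^sub>R (star T * P S)) = norm (1 - P S + c *\<^sub>R (P S * T))"
      by (subst norm_star[symmetric]) (simp add: star_P)
    ultimately show "\<bar>1 + c * \<phi> (P S * T)\<bar> \<le> norm (1 - P S + c *\<^sub>R (star T * P S))"
      using assms \<phi>_norm[of "1 - P S + c *\<^sub>R (P S * T)"] by (simp add: clin_simps)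
  qed
qed

text \<open>Translating the set conjugates \<open>P S\<close> by \<open>L g\<close>, which
  centrality undoes.\<close>

lemma \<phi>_translate:
  assumes "g \<in> carrier G" "L g \<in> Q" "S \<subseteq> carrier G"
  shows "\<phi> (P ((\<otimes>) g ` S)) = \<phi> (P S)"
proof -
  have g: "L (inv g) \<in> Q" using assms Q by (metis star_L star_closed_def)
  have "P ((\<otimes>) g ` S) = P ((\<otimes>) g ` S) * (L g * L (inv g))"
    using assms by (simp add: L_mult L_one)
  also have "\<dots> = L g * (P S * L (inv g))" using assms by (simp add: L_P mult.assoc[symmetric])
  finally have "\<phi> (P ((\<otimes>) g ` S)) = \<phi> (P S * L (inv g) * L g)"
    using assms by (simp only:) (intro \<phi>_central clin_simps; simp)
  then show ?thesis using assms by (simp add: mult.assoc L_mult L_one)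
qed

lemma norm_P: "norm (P S) \<le> 1"
  by (rule endo_bound) (simp_all add: norm_projection_le star_P P_mult)

text \<open>The translates by powers of \<open>\<alpha>\<close> are pairwise disjoint, since
  shifting back reduces each pair to \<open>Z\<close> and one translate. They have equal mass, while
  \<open>\<phi>\<close> is bounded by 1 on every union.\<close>

lemma \<phi>_wandering:
  assumes \<alpha>: "\<alpha> \<in> carrier G" "L \<alpha> \<in> Q" and Z: "Z \<subseteq> carrier G"
    and disj: "\<And>k::nat. 0 < k \<Longrightarrow> Z \<inter> (\<otimes>) (\<alpha> [^] k) ` Z = {}"
    and pow: "\<And>k::nat. L (\<alpha> [^] k) \<in> Q"
  shows "\<phi> (P Z) = 0"
proof -
  define Y where "Y k = (\<otimes>) (\<alpha> [^] k) ` Z" for k :: nat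
  have Yc: "Y k \<subseteq> carrier G" for k using \<alpha> Z by (auto simp: Y_def)
  have Yd: "Y k \<inter> Y l = {}" if "k < l" for k l
  proof -
    have "Y l = (\<otimes>) (\<alpha> [^] k) ` ((\<otimes>) (\<alpha> [^] (l - k)) ` Z)"
      unfolding Y_def image_image using that \<alpha> Z
      by (intro image_cong refl) (subst m_assoc[symmetric], auto simp: nat_pow_mult)
    moreover have "inj_on ((\<otimes>) (\<alpha> [^] k)) (carrier G)" using \<alpha> by (simp add: inj_on_def)
    moreover have "(\<otimes>) (\<alpha> [^] (l - k)) ` Z \<subseteq> carrier G" using \<alpha> Z by auto
    ultimately have "Y k \<inter> Y l = (\<otimes>) (\<alpha> [^] k) ` (Z \<inter> (\<otimes>) (\<alpha> [^] (l - k)) ` Z)"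
      unfolding Y_def using Z by (metis inj_on_image_Int)
    then show ?thesis using disj[of "l - k"] that by simp
  qed
  have "\<phi> (P (\<Union>k<m. Y k)) = real m * \<phi> (P Z)" for m
  proof (induction m)
    case 0
    have "P {} = 0" using P_Un[of "{}" "{}"] by simp
    then show ?case using \<phi>_scale[of 1 0] by (simp add: clin_simps)
  next
    case (Suc m)
    have U: "(\<Union>k<Suc m. Y k) = (\<Union>k<m. Y k) \<union> Y m" by (auto simp: less_Suc_eq)
    have "(\<Union>k<m. Y k) \<inter> Y m = {}" using Yd by auto
    then have "\<phi> (P (\<Union>k<Suc m. Y k)) = \<phi> (P (\<Union>k<m. Y k)) + \<phi> (P (Y m))"
      unfolding U by (simp add: P_Un \<phi>_add clin_simps)
    also have "\<phi> (P (Y m)) = \<phi> (P Z)"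
      unfolding Y_def using \<alpha> Z pow by (intro \<phi>_translate) auto
    finally show ?case using Suc by (simp add: algebra_simps)
  qed
  then have le: "real m * \<bar>\<phi> (P Z)\<bar> \<le> 1" for m
    using \<phi>_norm[of "P (\<Union>k<m. Y k)"] norm_P[of "\<Union>k<m. Y k"] by (simp add: clin_simps abs_mult)
  show ?thesis
  proof (rule ccontr)
    assume "\<phi> (P Z) \<noteq> 0"
    then obtain m where "1 < real m * \<bar>\<phi> (P Z)\<bar>" using reals_Archimedean3 by (meson zero_less_abs_iff)
    then show False using le[of m] by simp
  qed
qed

text \<open>
  If left translation by \<open>h\<close> carries the complement of a null set into a null set, then \<open>h\<close> is
  orthogonal to \<open>Q\<close>.
\<close>

lemma coefficient_zero:
  assumes Z: "Z \<subseteq> carrier G" "\<phi> (P Z) = 0" and h: "h \<in> carrier G"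
    and l: "l \<in> carrier G" "L l \<in> Q" and r: "r \<in> carrier G" "L r \<in> Q"
    and hZ: "\<And>x. x \<in> carrier G \<Longrightarrow> r \<otimes> x \<notin> Z \<Longrightarrow> inv l \<otimes> (h \<otimes> x) \<in> Z"
    and a: "a \<in> Q"
  shows "inner (\<delta> h) (a \<cdot> vac) = 0"
proof -
  \<comment> \<open>The complement of \<open>D\<close> is a translate of \<open>Z\<close>, hence
    null, and \<open>h\<close> maps \<open>D\<close> into the null set \<open>l Z\<close>.\<close>
  define D where "D = {x \<in> carrier G. r \<otimes> x \<notin> Z}"
  have r': "inv r \<in> carrier G" "L (inv r) \<in> Q" using r Q by (auto simp: star_closed_def simp flip: star_L)
  have D: "carrier G - D = (\<otimes>) (inv r) ` Z"
  proof (intro equalityI subsetI)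
    fix x assume "x \<in> carrier G - D"
    then have x: "x \<in> carrier G" "r \<otimes> x \<in> Z" by (auto simp: D_def)
    then have "x = inv r \<otimes> (r \<otimes> x)" using r by (simp add: m_assoc[symmetric])
    then show "x \<in> (\<otimes>) (inv r) ` Z" using x by blast
  next
    fix x assume "x \<in> (\<otimes>) (inv r) ` Z"
    then obtain z where z: "z \<in> Z" "x = inv r \<otimes> z" by blast
    then have zc: "z \<in> carrier G" using Z by auto
    then have "r \<otimes> x = z" using z r by (simp add: m_assoc[symmetric])
    then show "x \<in> carrier G - D" using z r zc by (simp add: D_def)
  qed
  have null_Dc: "\<phi> (P (carrier G - D)) = 0"
    unfolding D using \<phi>_translate[OF r' Z(1)] Z(2) by simp
  have null_lZ: "\<phi> (P ((\<otimes>) l ` Z)) = 0" using \<phi>_translate[OF l Z(1)] Z(2) by simp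
  have hD: "(\<otimes>) h ` D \<subseteq> (\<otimes>) l ` Z"
  proof
    fix y assume "y \<in> (\<otimes>) h ` D"
    then obtain x where x: "x \<in> carrier G" "r \<otimes> x \<notin> Z" "y = h \<otimes> x" by (auto simp: D_def)
    then have "y = l \<otimes> (inv l \<otimes> (h \<otimes> x))" using l h by (simp add: m_assoc[symmetric])
    then show "y \<in> (\<otimes>) l ` Z" using hZ x by blast
  qed
  have a': "star a \<in> Q" using a Q by (simp add: star_closed_def)
  have ac: "star a \<in> clin" "star a \<in> rvn" using a' Q rvn_clin by auto
  have "P (carrier G) = P D + P (carrier G - D)"
    by (subst P_Un[symmetric]) (auto simp: D_def intro!: arg_cong[of _ _ P])
  then have one: "P D + P (carrier G - D) = 1" by (simp add: P_carrier)
  \<comment> \<open>\<open>L h\<close> is cut along \<open>D\<close>. The part off \<open>D\<close>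
    is null; on \<open>D\<close> the projection moves to the left of \<open>L h\<close> as that of a
    subset of \<open>l Z\<close>, and centrality takes \<open>star a\<close> out of its way.\<close>
  have "\<phi> (star a * L h) = \<phi> (star a * L h * (P D + P (carrier G - D)))" by (simp add: one)
  also have "\<dots> = \<phi> (star a * L h * P D) + \<phi> (star a * L h * P (carrier G - D))"
    using ac h by (simp add: distrib_left \<phi>_add clin_simps)
  also have "\<phi> (star a * L h * P (carrier G - D)) = 0"
    using ac h by (intro null null_Dc clin_simps)
  also have "star a * L h * P D = star a * (P ((\<otimes>) h ` D) * L h)"
    using h by (simp add: mult.assoc L_P D_def)
  also have "\<phi> \<dots> = \<phi> (P ((\<otimes>) h ` D) * L h * star a)"
    using a' h by (intro \<phi>_central clin_simps)
  also have "P ((\<otimes>) h ` D) * L h * star a = P ((\<otimes>) l ` Z) * (P ((\<otimes>) h ` D) * L h * star a)"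
    using hD by (simp add: mult.assoc[symmetric] P_mult Int_absorb1)
  also have "\<phi> \<dots> = 0" using ac h by (intro null null_lZ clin_simps)
  finally have "\<phi> (star a * L h) = 0" by simp
  then have "inner vac (star a \<cdot> L h \<cdot> vac) = 0" using ac h by (simp add: \<phi>_trace rvn_simps)
  then show ?thesis using h by (simp add: L_\<delta> inner_star'[of vac] inner_commute)
qed

end

text \<open>Combinations of the \<open>L g\<close> with \<open>g\<close> in \<open>H\<close> commute
  with \<open>T\<close>. Only the vector \<open>a \<cdot> vac\<close>, not the operator
  \<open>a\<close>, is approximated by them, so the matrix coefficients of the commutator are
  expressed as continuous functions of that vector.\<close>

lemma in_bicommutant:
  assumes a: "a \<in> rvn" and T: "T \<in> clin" and H: "H \<subseteq> carrier G"
    and coef: "\<And>g. g \<in> carrier G - H \<Longrightarrow> inner (\<delta> g) (a \<cdot> vac) = 0 \<and> inner (ii \<cdot> \<delta> g) (a \<cdot> vac) = 0"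
    and comm: "\<And>g. g \<in> H \<Longrightarrow> T * L g = L g * T"
  shows "a * T = T * a"
proof -
  let ?W = "{v. \<exists>g\<in>H. v = \<delta> g \<or> v = ii \<cdot> \<delta> g}"
  define W where "W = closure (span ?W)"
  have W: "subspace W" "closed W" unfolding W_def by (auto intro: subspace_closure)
  \<comment> \<open>No coefficient survives: those at \<open>H\<close> by orthogonality to
    \<open>W\<close>, the others because neither \<open>a \<cdot> vac\<close> nor a vector of
    \<open>W\<close> has any.\<close>
  have "a \<cdot> vac - proj W \<cdot> a \<cdot> vac = 0"
  proof (rule total)
    fix g assume g: "g \<in> carrier G"
    let ?u = "a \<cdot> vac - proj W \<cdot> a \<cdot> vac"
    have base: "v \<in> W" if "v \<in> ?W" for v
      unfolding W_def using that by (intro closure_subset[THEN subsetD] span_base)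
    show "inner (\<delta> g) ?u = 0 \<and> inner (ii \<cdot> \<delta> g) ?u = 0"
    proof (cases "g \<in> H")
      case True
      then show ?thesis
        using proj_props(2)[OF W base, of "\<delta> g"] proj_props(2)[OF W base, of "ii \<cdot> \<delta> g"]
        by (auto simp: inner_commute)
    next
      case False
      define w where "w = proj W \<cdot> a \<cdot> vac"
      have "w \<in> W" unfolding w_def by (rule proj_props[OF W])
      have Pii: "P H \<cdot> ii \<cdot> v = ii \<cdot> P H \<cdot> v" for v using P_ii by (metis ap_mult)
      have "(P H - 1) \<cdot> w = 0"
        using \<open>w \<in> W\<close> unfolding W_def
        by (rule bounded_linear_vanish_closure[OF bounded_linear_ap]) (use H in \<open>auto simp: ap_simps P_\<delta> Pii\<close>)
      then have "inner u w = inner (P H \<cdot> u) w" for u by (simp add: ap_simps inner_star star_P)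
      moreover have "P H \<cdot> u = 0" if "u \<in> {\<delta> g, ii \<cdot> \<delta> g}" for u
        using that g False by (auto simp: P_\<delta> Pii)
      ultimately have "inner u w = 0" if "u \<in> {\<delta> g, ii \<cdot> \<delta> g}" for u
        using that by (metis inner_zero_left)
      then show ?thesis using coef[of g] g False by (auto simp: inner_diff_right w_def)
    qed
  qed
  then have aW: "a \<cdot> vac \<in> W" using proj_props(1)[OF W, of "a \<cdot> vac"] by simp
  have key: "inner (\<delta> x) ((a * S - S * a) \<cdot> \<delta> y) = 0"
    if S: "S \<in> clin" "\<And>g. g \<in> H \<Longrightarrow> S * L g = L g * S" and x: "x \<in> carrier G" and y: "y \<in> carrier G" for S x y
  proof -
    have ap: "R g \<cdot> ii \<cdot> v = ii \<cdot> R g \<cdot> v" if "g \<in> carrier G" for g v using R_ii[OF that] by (metis ap_mult)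
    have Jii: "J \<cdot> ii \<cdot> v = - (ii \<cdot> J \<cdot> v)" for v
      using arg_cong[OF J_ii, of "\<lambda>T. T \<cdot> v"] by (simp add: ap_simps)
    have Sii: "S \<cdot> ii \<cdot> v = ii \<cdot> S \<cdot> v" for v using S(1) by (simp add: clin_def commutant_def flip: ap_mult)
    \<comment> \<open>At \<open>a \<cdot> vac\<close> this is a matrix coefficient of
      \<open>a * S - S * a\<close>: the vectors \<open>star a \<cdot> \<delta> x\<close> and
      \<open>a \<cdot> \<delta> y\<close> are right translates of
      \<open>J \<cdot> a \<cdot> vac\<close> and \<open>a \<cdot> vac\<close>.\<close>
    define F where "F v = inner (R (inv x) \<cdot> J \<cdot> v) (S \<cdot> \<delta> y) - inner (star S \<cdot> \<delta> x) (R (inv y) \<cdot> v)" for v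
    have "bounded_linear F"
      unfolding F_def
      by (intro bounded_linear_sub bounded_linear_compose[OF bounded_linear_inner_left]
          bounded_linear_compose[OF bounded_linear_inner_right] bounded_linear_compose[OF bounded_linear_ap]
          bounded_linear_ap)
    then have "F (a \<cdot> vac) = 0"
      using aW unfolding W_def
    proof (rule bounded_linear_vanish_closure)
      have F\<delta>: "inner (\<delta> (inv g \<otimes> x)) (S \<cdot> v) = inner (\<delta> x) (S \<cdot> L g \<cdot> v)" if "g \<in> H" for g v
      proof -
        have g: "g \<in> carrier G" using that H by auto
        have "inner (\<delta> x) (S \<cdot> L g \<cdot> v) = inner (\<delta> x) (L g \<cdot> S \<cdot> v)"
          using S(2)[OF that] by (metis ap_mult)
        then show ?thesis using g x by (simp add: inner_star'[of _ "L g"] star_L L_\<delta>)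
      qed
      fix v assume "v \<in> ?W"
      then obtain g where g: "g \<in> H" "v = \<delta> g \<or> v = ii \<cdot> \<delta> g" by blast
      then have gc: "g \<in> carrier G" using H by auto
      have iis: "inner (ii \<cdot> u) w = - inner u (ii \<cdot> w)" for u w by (simp add: inner_star ii ap_simps)
      have Lii: "L g \<cdot> ii \<cdot> w = ii \<cdot> L g \<cdot> w" for w using L_ii[OF gc] by (metis ap_mult)
      from g(2) show "F v = 0"
      proof
        assume v: "v = \<delta> g"
        show ?thesis
          using F\<delta>[OF g(1), of "\<delta> y"] gc x y
          by (simp add: F_def v J_\<delta> R_\<delta> inner_star[of "star S"] L_\<delta>)
      next
        assume v: "v = ii \<cdot> \<delta> g"
        show ?thesis
          using F\<delta>[OF g(1), of "ii \<cdot> \<delta> y"] gc x y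
          by (simp add: F_def v Jii ap J_\<delta> R_\<delta> inner_star[of "star S"] L_\<delta> Lii ap_simps iis Sii)
      qed
    qed
    moreover have "inner (\<delta> x) (a \<cdot> S \<cdot> \<delta> y) = inner (R (inv x) \<cdot> J \<cdot> a \<cdot> vac) (S \<cdot> \<delta> y)"
      using rvn_vac_g[OF star_rvn[OF a] x] by (simp add: J_star[OF a] inner_star')
    moreover have "inner (\<delta> x) (S \<cdot> a \<cdot> \<delta> y) = inner (star S \<cdot> \<delta> x) (R (inv y) \<cdot> a \<cdot> vac)"
      using rvn_vac_g[OF a y] by (simp add: inner_star')
    ultimately show ?thesis by (simp add: F_def ap_simps inner_diff_right)
  qed
  have ac: "a \<in> clin" using a rvn_clin by blast
  have "a * T - T * a = 0"
  proof (rule endo_zeroI)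
    show "a * T - T * a \<in> clin" using ac T by (intro clin_simps)
    fix y assume y: "y \<in> carrier G"
    show "(a * T - T * a) \<cdot> \<delta> y = 0"
    proof (rule total)
      fix x assume x: "x \<in> carrier G"
      have ai: "a * ii = ii * a" using ac by (simp add: clin_def commutant_def)
      \<comment> \<open>Imaginary parts of coefficients are, up to sign, real parts with
        \<open>ii * T\<close> for \<open>T\<close>.\<close>
      have "inner (\<delta> x) ((a * (ii * T) - ii * T * a) \<cdot> \<delta> y) = 0"
      proof (rule key[OF _ _ x y])
        show "ii * T \<in> clin" using T by (intro clin_simps)
        show "ii * T * L g = L g * (ii * T)" if "g \<in> H" for g
          using comm[OF that] L_ii[of g] that H by (metis mult.assoc subsetD)
      qed
      moreover have "a * (ii * T) - ii * T * a = ii * (a * T - T * a)"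
        using ai by (simp add: right_diff_distrib mult.assoc[symmetric])
      ultimately have "inner (\<delta> x) (ii \<cdot> (a * T - T * a) \<cdot> \<delta> y) = 0" by simp
      then have "inner (ii \<cdot> \<delta> x) ((a * T - T * a) \<cdot> \<delta> y) = 0"
        by (simp add: inner_star ii ap.minus_left)
      then show "inner (\<delta> x) ((a * T - T * a) \<cdot> \<delta> y) = 0 \<and> inner (ii \<cdot> \<delta> x) ((a * T - T * a) \<cdot> \<delta> y) = 0"
        using key[OF T comm x y] by blast
    qed
  qed
  then show ?thesis by simp
qed

end


section \<open>Extending a corner to the von Neumann algebra\<close>

text \<open>\<open>Q\<close> is a von Neumann algebra because it contains \<open>ii\<close> and is
  its own star closed bicommutant; \<open>gs\<close> enumerates the group with infinite
  repetition.\<close>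

locale vn_sub = group_rep G ii \<delta> L R J P
  for G (structure) and ii :: "'h::{real_inner,banach} endo" and \<delta> L R J P +
  fixes Q :: "'h endo set" and gs :: "nat \<Rightarrow> 'a"
  assumes Q_star: "star_closed Q" and Q_bicomm: "commutant (commutant Q) = Q"
    and ii_Q: "ii \<in> Q" and Q_rvn: "Q \<subseteq> rvn"
    and gs: "gs n \<in> carrier G" "g \<in> carrier G \<Longrightarrow> \<exists>k\<ge>n. gs k = g"
begin

lemma Q_simps:
  "1 \<in> Q" "S \<in> Q \<Longrightarrow> T \<in> Q \<Longrightarrow> S * T \<in> Q" "S \<in> Q \<Longrightarrow> T \<in> Q \<Longrightarrow> S + T \<in> Q"
  "S \<in> Q \<Longrightarrow> T \<in> Q \<Longrightarrow> S - T \<in> Q" "S \<in> Q \<Longrightarrow> r *\<^sub>R S \<in> Q" "S \<in> Q \<Longrightarrow> star S \<in> Q"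
  using commutant_mult[of S "commutant Q" T] commutant_add[of S "commutant Q" T]
    commutant_diff[of S "commutant Q" T] commutant_scaleR[of S "commutant Q" r] commutant_one[of "commutant Q"]
    Q_star
  by (auto simp: Q_bicomm star_closed_def)

abbreviation Q' :: "'h endo set" where "Q' \<equiv> commutant Q"

lemma Q'_star: "T \<in> Q' \<Longrightarrow> star T \<in> Q'"
  using star_closed_commutant[OF Q_star] by (simp add: star_closed_def)

lemma Q'_clin: "Q' \<subseteq> clin"
  using ii_Q by (auto simp: clin_def commutant_def)

lemma R_Q': "g \<in> carrier G \<Longrightarrow> R g \<in> Q'"
  using Q_rvn by (intro commutantI) (auto simp: rvn_def commutant_def)

lemma swap: "c \<in> Q' \<Longrightarrow> q \<in> Q \<Longrightarrow> c \<cdot> q \<cdot> v = q \<cdot> c \<cdot> v"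
  by (metis ap_mult commutantD)

section \<open>The cyclic subspace of \<open>Q\<close> and a decomposition of the identity along its
  translates\<close>

definition cyc :: "'h set" where "cyc = closure ((\<lambda>q. q \<cdot> vac) ` Q)"

text \<open>The Jones projection: for \<open>x\<close> in \<open>rvn\<close>,
  \<open>e * x * e\<close> is the conditional expectation of \<open>x\<close> onto \<open>Q\<close>
  as seen on \<open>cyc\<close>. The rest of the construction undoes this restriction to
  \<open>cyc\<close>.\<close>

definition e :: "'h endo" where "e = proj cyc"

lemma span_Q: "span ((\<lambda>q. q \<cdot> vac) ` Q) = (\<lambda>q. q \<cdot> vac) ` Q"
proof -
  have "0 \<in> Q" using Q_simps(4)[of 1 1] Q_simps(1) by simp
  then have "subspace ((\<lambda>q. q \<cdot> vac) ` Q)"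
    by (auto simp: subspace_def ap_simps[symmetric] intro: Q_simps)
      (metis ap.zero_left image_eqI)
  then show ?thesis by (rule span_eq_iff[THEN iffD2])
qed

lemma cyc: "subspace cyc" "closed cyc"
  unfolding cyc_def by (subst span_Q[symmetric], auto intro: subspace_closure)

lemma cyc_vanish: "bounded_linear F \<Longrightarrow> v \<in> cyc \<Longrightarrow> (\<And>q. q \<in> Q \<Longrightarrow> F (q \<cdot> vac) = 0) \<Longrightarrow> F v = 0"
  using bounded_linear_vanish_closure[of F v "(\<lambda>q. q \<cdot> vac) ` Q"] by (auto simp: span_Q cyc_def)

lemma Q_cyc: "q \<in> Q \<Longrightarrow> q \<cdot> vac \<in> cyc"
  unfolding cyc_def by (intro closure_subset[THEN subsetD] imageI)

lemma vac_cyc: "vac \<in> cyc"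
  using Q_cyc[OF Q_simps(1)] by simp

lemma e_basic: "star e = e" "e * e = e" "e \<cdot> v \<in> cyc" "v \<in> cyc \<Longrightarrow> e \<cdot> v = v"
  unfolding e_def by (simp_all add: star_proj proj_idem proj_props proj_id cyc)

lemma e_Q': "e \<in> Q'"
  unfolding e_def
proof (rule proj_in_commutant[OF cyc Q_star])
  fix T x assume T: "T \<in> Q" and x: "x \<in> cyc"
  have "(\<lambda>v. T \<cdot> v) ` cyc \<subseteq> closure ((\<lambda>v. T \<cdot> v) ` (\<lambda>q. q \<cdot> vac) ` Q)"
    unfolding cyc_def by (rule closure_bounded_linear_image_subset[OF bounded_linear_ap])
  also have "\<dots> \<subseteq> cyc"
    unfolding cyc_def using T by (intro closure_mono) (auto simp: Q_simps simp flip: ap_mult)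
  finally show "T \<cdot> x \<in> cyc" using x by (simp add: image_subset_iff)
qed

text \<open>The projection onto the translate of \<open>cyc\<close> by \<open>R (gs n)\<close>. The
  translates together contain every \<open>\<delta> g\<close>, so a decomposition along them can
  exhaust the identity.\<close>

definition K :: "nat \<Rightarrow> 'h endo" where "K n = R (gs n) * e * star (R (gs n))"

lemma inner_K: "inner f (K n \<cdot> f) = (norm (e \<cdot> star (R (gs n)) \<cdot> f))\<^sup>2"
proof -
  have "inner f (K n \<cdot> f) = inner (star (R (gs n)) \<cdot> f) ((e * e) \<cdot> star (R (gs n)) \<cdot> f)"
    by (simp add: K_def inner_star' e_basic(2))
  then show ?thesis by (simp add: inner_star'[of _ e] e_basic(1) power2_norm_eq_inner)
qed

lemma norm_R: "g \<in> carrier G \<Longrightarrow> norm (star (R g) \<cdot> f) = norm f"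
proof -
  assume g: "g \<in> carrier G"
  have "R g * star (R g) = 1" using g by (simp add: star_R R_mult R_one)
  then have "inner (star (R g) \<cdot> f) (star (R g) \<cdot> f) = inner f f"
    by (metis ap_mult ap_one inner_star')
  then show ?thesis by (simp add: norm_eq_sqrt_inner)
qed

lemma norm_e: "norm (e \<cdot> f) \<le> norm f"
  by (rule norm_projection_le) (simp_all add: e_basic)

lemma K_pos: "pos (K n)" "pos (1 - K n)"
proof -
  have s: "star (K n) = K n" by (simp add: K_def e_basic mult.assoc)
  then show "pos (K n)" by (simp add: pos_def inner_K)
  have "(norm (e \<cdot> star (R (gs n)) \<cdot> f))\<^sup>2 \<le> (norm f)\<^sup>2" for f
    using norm_e[of "star (R (gs n)) \<cdot> f"] by (simp add: norm_R gs power_mono)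
  then show "pos (1 - K n)"
    by (simp add: pos_def s ap_simps inner_diff_right inner_K power2_norm_eq_inner)
qed

lemma K_Q': "K n \<in> Q'"
  unfolding K_def by (intro commutant_mult R_Q' e_Q' Q'_star gs)

abbreviation r :: "nat \<Rightarrow> 'h endo" where "r \<equiv> resid K"

lemmas r_simps = star_resid[of K, OF K_pos] resid_sum[of K, OF K_pos] norm_resid[of K, OF K_pos]

lemma r_Q': "r n \<in> Q'"
  by (intro resid_commutant[of K, OF K_pos] K_Q')

text \<open>A factor of the piece \<open>r n * K n * r n\<close> that lies in \<open>Q'\<close> and
  lives on \<open>cyc\<close>. So \<open>t n * T * star (t n)\<close> depends only on the corner
  \<open>e * T * e\<close> and respects multiplication of \<open>T\<close> by
  \<open>Q\<close>.\<close>

definition t :: "nat \<Rightarrow> 'h endo" where "t n = r n * R (gs n) * e"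

lemma t_Q': "t n \<in> Q'"
  unfolding t_def by (intro commutant_mult R_Q' e_Q' r_Q' gs)

lemma t_e: "t n * e = t n"
  by (simp add: t_def mult.assoc e_basic)

lemma e_t: "e * star (t n) = star (t n)"
  by (simp add: t_def e_basic mult.assoc[symmetric])

lemma t_star: "t n * star (t n) = r n * K n * r n"
proof -
  have "t n * star (t n) = r n * R (gs n) * (e * e) * star (R (gs n)) * r n"
    by (simp only: t_def star_mult e_basic(1) r_simps mult.assoc)
  then show ?thesis by (simp only: e_basic(2) K_def mult.assoc)
qed

lemma t_sum: "(\<Sum>n<m. t n * star (t n)) = 1 - r m"
  by (simp add: t_star r_simps)

text \<open>Each \<open>g\<close> occurs infinitely often in \<open>gs\<close>, which drives the residual to \<open>0\<close>.\<close>

lemma r_\<delta>: "g \<in> carrier G \<Longrightarrow> (\<lambda>n. r n \<cdot> \<delta> g) \<longlonglongrightarrow> 0"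
proof -
  assume g: "g \<in> carrier G"
  have sq: "(norm (r n \<cdot> f))\<^sup>2 \<le> inner f (r n \<cdot> f)" for n f
    using resid_pos[of K n, OF K_pos] by (intro pos_square_le) auto
  have sm: "(\<lambda>n. inner (r n \<cdot> \<delta> g) (K n \<cdot> r n \<cdot> \<delta> g)) \<longlonglongrightarrow> 0"
    by (rule summable_LIMSEQ_zero[OF resid_summable[of K, OF K_pos]])
  show ?thesis
  proof (rule LIMSEQ_I)
    fix \<epsilon> :: real assume \<epsilon>: "0 < \<epsilon>"
    \<comment> \<open>A fourth power, as two square roots follow: from the quadratic form of
      \<open>K k\<close> to the norm of \<open>?v\<close>, and from that of \<open>r k\<close> to
      the norm of \<open>r n \<cdot> \<delta> g\<close>.\<close>
    define \<eta> where "\<eta> = (\<epsilon>\<^sup>2)\<^sup>2"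
    have "0 < \<eta>" using \<epsilon> by (simp add: \<eta>_def)
    then have "\<forall>\<^sub>F n in sequentially. inner (r n \<cdot> \<delta> g) (K n \<cdot> r n \<cdot> \<delta> g) < \<eta>"
      using sm by (rule order_tendstoD(2)[rotated])
    then obtain N where N: "\<And>n. n \<ge> N \<Longrightarrow> inner (r n \<cdot> \<delta> g) (K n \<cdot> r n \<cdot> \<delta> g) < \<eta>"
      by (auto simp: eventually_sequentially)
    \<comment> \<open>\<open>R (inv g)\<close> maps \<open>vac\<close> to \<open>\<delta> g\<close>,
      so the projection \<open>K k\<close> fixes \<open>\<delta> g\<close>.\<close>
    obtain k where k: "k \<ge> N" "gs k = inv g" using gs(2)[of "inv g" N] g by auto
    let ?v = "e \<cdot> star (R (gs k)) \<cdot> r k \<cdot> \<delta> g"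
    have "(norm ?v)\<^sup>2 < (\<epsilon>\<^sup>2)\<^sup>2" using N[OF k(1)] by (simp add: inner_K \<eta>_def)
    then have v: "norm ?v < \<epsilon>\<^sup>2" by (rule power2_less_imp_less) simp
    have "inner (\<delta> g) (r k \<cdot> \<delta> g) = inner (R (gs k) \<cdot> vac) (r k \<cdot> \<delta> g)"
      using g by (simp add: k R_\<delta>)
    also have "\<dots> = inner (e \<cdot> vac) (star (R (gs k)) \<cdot> r k \<cdot> \<delta> g)"
      by (simp add: inner_star e_basic vac_cyc)
    also have "\<dots> = inner vac ?v" by (simp add: inner_star e_basic)
    also have "\<dots> \<le> norm vac * norm ?v" by (rule norm_cauchy_schwarz)
    finally have *: "inner (\<delta> g) (r k \<cdot> \<delta> g) < \<epsilon>\<^sup>2" using v by (simp add: norm_\<delta>)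
    have "norm (r n \<cdot> \<delta> g - 0) < \<epsilon>" if "n \<ge> k" for n
    proof -
      have "(norm (r n \<cdot> \<delta> g))\<^sup>2 \<le> inner (\<delta> g) (r k \<cdot> \<delta> g)"
        using sq[of n "\<delta> g"] resid_decreasing[of K "\<delta> g" k "n - k", OF K_pos] that by simp
      then have "(norm (r n \<cdot> \<delta> g))\<^sup>2 < \<epsilon>\<^sup>2" using * by simp
      then show ?thesis using \<epsilon> by (simp add: power2_less_imp_less)
    qed
    then show "\<exists>M. \<forall>n\<ge>M. norm (r n \<cdot> \<delta> g - 0) < \<epsilon>" by blast
  qed
qed

lemma r_wlim: "wlim r 0"
proof -
  obtain Z where Z: "wlim r Z" using wlim_bounded[of r 1] r_simps(3) by blast
  have "Z = 0"
  proof (rule endo_zeroI)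
    show "Z \<in> clin" using commutant_wlim[of r Q Z] r_Q' Z Q'_clin by blast
    fix g assume g: "g \<in> carrier G"
    show "Z \<cdot> \<delta> g = 0"
    proof (rule inner_eqI)
      fix f
      have "((\<lambda>n. inner f (r n \<cdot> \<delta> g)) \<longlongrightarrow> inner f 0) ultra"
        by (intro tendsto_ultra tendsto_intros r_\<delta> g)
      then show "inner f (Z \<cdot> \<delta> g) = inner f 0"
        using wlimD[OF Z] tendsto_unique[OF ultra(1)] by blast
    qed
  qed
  then show ?thesis using Z by simp
qed

section \<open>The extension of corners\<close>

definition psum :: "'h endo \<Rightarrow> nat \<Rightarrow> 'h endo" where "psum T m = (\<Sum>n<m. t n * T * star (t n))"

text \<open>Informally the sum of all \<open>t n * T * star (t n)\<close>. The partial sums are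
  bounded by \<open>norm T\<close>, so the limit exists, and as the pieces for \<open>T = 1\<close>
  add up to 1, \<open>Q\<close> is fixed.\<close>

definition \<theta> :: "'h endo \<Rightarrow> 'h endo" where "\<theta> T = ulim (psum T)"

lemma norm_psum: "norm (psum T m) \<le> norm T"
  unfolding psum_def
proof (rule sum_conj_bound)
  fix f
  have "(\<Sum>n<m. (norm (star (t n) \<cdot> f))\<^sup>2) = inner f ((\<Sum>n<m. t n * star (t n)) \<cdot> f)"
    by (simp add: ap.sum_left inner_sum_right inner_star' power2_norm_eq_inner)
  also have "\<dots> \<le> (norm f)\<^sup>2"
    using resid_pos[of K m, OF K_pos]
    by (simp add: t_sum ap_simps inner_diff_right pos_def power2_norm_eq_inner)
  finally show "(\<Sum>n<m. (norm (star (t n) \<cdot> f))\<^sup>2) \<le> (norm f)\<^sup>2" .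
qed

lemma \<theta>_wlim: "wlim (psum T) (\<theta> T)" and norm_\<theta>: "norm (\<theta> T) \<le> norm T"
  unfolding \<theta>_def using ulim[of "psum T", OF norm_psum] by auto

lemma \<theta>_eqI: "wlim (psum T) S \<Longrightarrow> \<theta> T = S"
  using \<theta>_wlim wlim_unique by blast

lemma \<theta>_add: "\<theta> (S + T) = \<theta> S + \<theta> T"
proof (rule \<theta>_eqI)
  have "psum (S + T) = (\<lambda>m. psum S m + psum T m)"
    by (simp add: psum_def fun_eq_iff sum.distrib algebra_simps)
  then show "wlim (psum (S + T)) (\<theta> S + \<theta> T)" by (simp add: wlim_add[OF \<theta>_wlim \<theta>_wlim])
qed

lemma \<theta>_scaleR: "\<theta> (x *\<^sub>R T) = x *\<^sub>R \<theta> T"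
proof (rule \<theta>_eqI)
  have "psum (x *\<^sub>R T) = (\<lambda>m. x *\<^sub>R psum T m)" by (simp add: psum_def fun_eq_iff scaleR_sum_right)
  then show "wlim (psum (x *\<^sub>R T)) (x *\<^sub>R \<theta> T)" by (simp add: wlim_scaleR[OF \<theta>_wlim])
qed

lemma \<theta>_left: "a \<in> Q \<Longrightarrow> \<theta> (a * T) = a * \<theta> T"
proof (rule \<theta>_eqI)
  assume a: "a \<in> Q"
  have "t n * a = a * t n" for n using commutantD[OF t_Q' a] .
  then have "t n * (a * T) * star (t n) = a * (t n * T * star (t n))" for n by (metis mult.assoc)
  then have "psum (a * T) = (\<lambda>m. a * psum T m)" by (simp add: psum_def fun_eq_iff sum_distrib_left)
  then show "wlim (psum (a * T)) (a * \<theta> T)" by (simp add: wlim_mult_left[OF \<theta>_wlim])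
qed

lemma \<theta>_right: "a \<in> Q \<Longrightarrow> \<theta> (T * a) = \<theta> T * a"
proof (rule \<theta>_eqI)
  assume a: "a \<in> Q"
  have "star (t n) * a = a * star (t n)" for n using commutantD[OF Q'_star[OF t_Q'] a] .
  then have "t n * (T * a) * star (t n) = (t n * T * star (t n)) * a" for n by (simp add: mult.assoc)
  then have "psum (T * a) = (\<lambda>m. psum T m * a)" by (simp add: psum_def fun_eq_iff sum_distrib_right)
  then show "wlim (psum (T * a)) (\<theta> T * a)" by (simp add: wlim_mult_right[OF \<theta>_wlim])
qed

lemma \<theta>_one: "\<theta> 1 = 1"
proof (rule \<theta>_eqI)
  have "psum 1 = (\<lambda>m. 1 - r m)" by (simp add: psum_def fun_eq_iff t_sum)
  then show "wlim (psum 1) 1" using wlim_diff[OF wlim_const r_wlim, of 1] by simp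
qed

lemma \<theta>_Q: "a \<in> Q \<Longrightarrow> \<theta> a = a"
  using \<theta>_left[of a 1] by (simp add: \<theta>_one)

lemma \<theta>_clin:
  assumes "T \<in> clin"
  shows "\<theta> T \<in> clin"
  unfolding clin_def
proof (rule commutant_wlim[OF _ \<theta>_wlim])
  fix m
  have "t n \<in> clin" "star (t n) \<in> clin" for n using t_Q' Q'_clin star_clin by blast+
  then show "psum T m \<in> commutant {ii}"
    unfolding psum_def clin_def[symmetric] using assms
    by (auto simp: clin_def intro!: commutant_sum commutant_mult)
qed

text \<open>The vectors \<open>q \<cdot> vac\<close> are dense in the range of
  \<open>e\<close>.\<close>

lemma corner_zeroI:
  assumes D: "e * D * e = D" and z: "\<And>q1 q2. q1 \<in> Q \<Longrightarrow> q2 \<in> Q \<Longrightarrow> inner (q1 \<cdot> vac) (D \<cdot> q2 \<cdot> vac) = 0"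
  shows "D = 0"
proof -
  have De: "e \<cdot> D \<cdot> e \<cdot> v = D \<cdot> v" for v using arg_cong[OF D, of "\<lambda>T. T \<cdot> v"] by simp
  have Dc: "D \<cdot> v \<in> cyc" for v using e_basic(3)[of "D \<cdot> e \<cdot> v"] by (simp add: De)
  have "D \<cdot> q \<cdot> vac = 0" if q: "q \<in> Q" for q
  proof -
    have "inner (D \<cdot> q \<cdot> vac) (D \<cdot> q \<cdot> vac) = 0"
      by (rule cyc_vanish[of "\<lambda>v. inner v (D \<cdot> q \<cdot> vac)"])
        (use z q Dc in \<open>auto intro: bounded_linear_inner_left\<close>)
    then show ?thesis by simp
  qed
  then have "D \<cdot> e \<cdot> v = 0" for v
    using cyc_vanish[OF bounded_linear_ap e_basic(3)] by blast
  then show ?thesis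
    using De by (intro endo_eqI) (metis ap.zero_left ap.zero_right)
qed

text \<open>On \<open>cyc\<close> the conjugation serves the corner of \<open>Q'\<close> as well as
  \<open>Q\<close>: in the pairing with \<open>q \<cdot> vac\<close>, \<open>q\<close> moves past
  the corner and \<open>J_star\<close> applies to \<open>q\<close>.\<close>

lemma J_corner:
  assumes s: "s \<in> Q'"
  shows "star (e * s * e) \<cdot> vac = J \<cdot> (e * s * e) \<cdot> vac"
proof -
  let ?s = "e * s * e"
  have sQ: "?s \<in> Q'" by (intro commutant_mult e_Q' s)
  have Jc: "J \<cdot> v \<in> cyc" if "v \<in> cyc" for v
  proof -
    have "(\<lambda>v. J \<cdot> v) ` cyc \<subseteq> closure ((\<lambda>v. J \<cdot> v) ` (\<lambda>q. q \<cdot> vac) ` Q)"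
      unfolding cyc_def by (rule closure_bounded_linear_image_subset[OF bounded_linear_ap])
    also have "\<dots> \<subseteq> cyc"
      unfolding cyc_def
    proof (rule closure_mono, safe)
      fix q assume "q \<in> Q"
      then have "J \<cdot> q \<cdot> vac = star q \<cdot> vac" "star q \<in> Q" using Q_rvn by (auto simp: J_star Q_simps)
      then show "J \<cdot> q \<cdot> vac \<in> (\<lambda>q. q \<cdot> vac) ` Q" by auto
    qed
    finally show ?thesis using that by (simp add: image_subset_iff)
  qed
  define v where "v = star ?s \<cdot> vac - J \<cdot> ?s \<cdot> vac"
  have "star ?s \<cdot> vac \<in> cyc" "?s \<cdot> vac \<in> cyc" by (simp_all add: e_basic)
  then have vc: "v \<in> cyc" unfolding v_def by (intro subspace_diff cyc Jc)
  have "inner v v = 0"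
  proof (rule cyc_vanish[OF bounded_linear_inner_left vc])
    fix q assume q: "q \<in> Q"
    then have qJ: "J \<cdot> q \<cdot> vac = star q \<cdot> vac" using Q_rvn by (auto simp: J_star)
    have "inner (q \<cdot> vac) (star ?s \<cdot> vac) = inner (?s \<cdot> q \<cdot> vac) vac" by (rule inner_star[symmetric])
    also have "\<dots> = inner (q \<cdot> ?s \<cdot> vac) vac" by (simp only: swap[OF sQ q])
    also have "\<dots> = inner (?s \<cdot> vac) (J \<cdot> q \<cdot> vac)" by (simp only: inner_star[of q] qJ)
    also have "\<dots> = inner (q \<cdot> vac) (J \<cdot> ?s \<cdot> vac)"
      by (metis inner_commute inner_star star_J)
    finally show "inner (q \<cdot> vac) v = 0" by (simp add: v_def inner_diff_right)
  qed
  then show ?thesis by (simp add: v_def)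
qed

text \<open>
  The corner \<open>e T e\<close> of an operator as below commutes with \<open>e Q' e\<close>, so that \<open>\<theta>\<close> extends it to an
  element of the bicommutant.
\<close>

lemma \<theta>_in_Q:
  assumes T: "\<And>q1 q2 p. q1 \<in> Q \<Longrightarrow> q2 \<in> Q \<Longrightarrow> p \<in> Q \<Longrightarrow>
     inner (q1 \<cdot> vac) (T \<cdot> q2 \<cdot> p \<cdot> vac) = inner (q1 \<cdot> star p \<cdot> vac) (T \<cdot> q2 \<cdot> vac)"
  shows "\<theta> T \<in> Q" "inner vac (\<theta> T \<cdot> vac) = inner vac (T \<cdot> vac)"
proof -
  define S where "S = e * T * e"
  have eS: "e * S = S" "S * e = S" by (simp_all add: S_def mult.assoc e_basic) (simp add: e_basic mult.assoc[symmetric])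
  have eQ: "e \<cdot> q \<cdot> vac = q \<cdot> vac" if "q \<in> Q" for q by (rule e_basic(4)[OF Q_cyc[OF that]])
  have comm: "S * (e * s * e) = (e * s * e) * S" if s: "s \<in> Q'" for s
  proof -
    let ?s = "e * s * e"
    have sQ1: "?s \<in> Q'" by (intro commutant_mult e_Q' s)
    note sQ = sQ1 Q'_star[OF sQ1]
    have ee: "e \<cdot> e \<cdot> v = e \<cdot> v" for v using arg_cong[OF e_basic(2), of "\<lambda>T. T \<cdot> v"] by simp
    have se: "e \<cdot> ?s \<cdot> v = ?s \<cdot> v" "star ?s \<cdot> e \<cdot> v = star ?s \<cdot> v" "e \<cdot> star ?s \<cdot> v = star ?s \<cdot> v" for v
      by (simp_all add: ee e_basic(1))
    have "S * ?s - ?s * S = 0"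
    proof (rule corner_zeroI)
      have "e * (S * ?s - ?s * S) * e = (e * S) * (e * s * (e * e)) - ((e * e) * s * e) * (S * e)"
        by (simp add: algebra_simps)
      then show "e * (S * ?s - ?s * S) * e = S * ?s - ?s * S" by (simp only: eS e_basic(2))
      fix q1 q2 assume q: "q1 \<in> Q" "q2 \<in> Q"
      \<comment> \<open>The assumption says that the corner of \<open>T\<close> commutes with right
        multiplication by \<open>p\<close>. It extends from \<open>p \<cdot> vac\<close> to all of
        \<open>cyc\<close> by continuity; at \<open>?s \<cdot> vac\<close> it is the wanted
        commutation, since \<open>J\<close> produces \<open>star ?s \<cdot> vac\<close>
        there.\<close>
      define F where "F v = inner (q1 \<cdot> vac) (T \<cdot> q2 \<cdot> v) - inner (q1 \<cdot> J \<cdot> v) (T \<cdot> q2 \<cdot> vac)" for v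
      have "F (?s \<cdot> vac) = 0"
      proof (rule cyc_vanish)
        show "bounded_linear F"
          unfolding F_def
          by (intro bounded_linear_sub bounded_linear_compose[OF bounded_linear_inner_left]
              bounded_linear_compose[OF bounded_linear_inner_right] bounded_linear_compose[OF bounded_linear_ap]
              bounded_linear_ap)
        show "?s \<cdot> vac \<in> cyc" by (simp add: e_basic)
        fix p assume p: "p \<in> Q"
        then have "J \<cdot> p \<cdot> vac = star p \<cdot> vac" using Q_rvn by (auto simp: J_star)
        then show "F (p \<cdot> vac) = 0" using T[OF q p] by (simp add: F_def)
      qed
      moreover have "inner (q1 \<cdot> vac) ((S * ?s) \<cdot> q2 \<cdot> vac) = inner (q1 \<cdot> vac) (T \<cdot> q2 \<cdot> ?s \<cdot> vac)"
      proof -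
        have "inner (q1 \<cdot> vac) ((S * ?s) \<cdot> q2 \<cdot> vac) = inner (e \<cdot> q1 \<cdot> vac) (T \<cdot> e \<cdot> ?s \<cdot> q2 \<cdot> vac)"
          by (simp only: ap_mult S_def inner_star'[of _ e] e_basic(1))
        from this[unfolded se eQ[OF q(1)]] show ?thesis by (simp only: swap[OF sQ(1) q(2)])
      qed
      moreover have "inner (q1 \<cdot> vac) ((?s * S) \<cdot> q2 \<cdot> vac) = inner (q1 \<cdot> J \<cdot> ?s \<cdot> vac) (T \<cdot> q2 \<cdot> vac)"
      proof -
        have "inner (q1 \<cdot> vac) ((?s * S) \<cdot> q2 \<cdot> vac) = inner (e \<cdot> star ?s \<cdot> q1 \<cdot> vac) (T \<cdot> e \<cdot> q2 \<cdot> vac)"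
          by (simp only: ap_mult[of ?s S] inner_star'[of _ ?s]) (simp only: S_def ap_mult inner_star'[of _ e] e_basic(1))
        from this[unfolded se eQ[OF q(2)]] show ?thesis by (simp only: swap[OF sQ(2) q(1)] J_corner[OF s])
      qed
      ultimately show "inner (q1 \<cdot> vac) ((S * ?s - ?s * S) \<cdot> q2 \<cdot> vac) = 0"
        by (simp only: F_def ap.diff_left inner_diff_right)
    qed
    then show ?thesis by simp
  qed
  have tS: "t n * T * star (t n) = t n * S * star (t n)" for n
  proof -
    have "t n * S * star (t n) = (t n * e) * T * (e * star (t n))" by (simp add: S_def mult.assoc)
    then show ?thesis by (simp only: t_e e_t)
  qed
  then have psum: "psum T m = (\<Sum>n<m. t n * S * star (t n))" for m by (simp add: psum_def)
  \<comment> \<open>Each \<open>star (t i) * c * t j\<close> lies in the corner of \<open>Q'\<close>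
    and hence commutes with \<open>S\<close>; summing over \<open>i\<close> and \<open>j\<close>
    moves \<open>S\<close> across \<open>c\<close>.\<close>
  have main: "psum T m * c * (1 - r l) = (1 - r m) * c * psum T l" if c: "c \<in> Q'" for c m l
  proof -
    have "t i * S * star (t i) * c * (t j * star (t j)) = (t i * star (t i)) * c * (t j * S * star (t j))" for i j
    proof -
      have "star (t i) * c * t j \<in> Q'" by (intro commutant_mult t_Q' Q'_star c)
      from comm[OF this] have "S * (e * (star (t i) * c * t j) * e) = e * (star (t i) * c * t j) * e * S" .
      moreover have "e * (star (t i) * c * t j) * e = star (t i) * c * t j"
        using e_t[of i] t_e[of j] by (metis mult.assoc)
      ultimately have "S * (star (t i) * c * t j) = star (t i) * c * t j * S" by simp
      then have "t i * (S * (star (t i) * c * t j)) * star (t j) = t i * (star (t i) * c * t j * S) * star (t j)"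
        by simp
      then show ?thesis by (simp only: mult.assoc)
    qed
    then have "(\<Sum>i<m. \<Sum>j<l. t i * S * star (t i) * c * (t j * star (t j))) =
        (\<Sum>i<m. \<Sum>j<l. (t i * star (t i)) * c * (t j * S * star (t j)))" by simp
    moreover have "psum T m * c = (\<Sum>i<m. t i * S * star (t i) * c)"
      by (simp only: psum sum_distrib_right)
    moreover have "(1 - r m) * c = (\<Sum>i<m. t i * star (t i) * c)"
      by (simp only: t_sum[symmetric] sum_distrib_right)
    ultimately show ?thesis by (simp only: psum t_sum[symmetric] sum_product)
  qed
  \<comment> \<open>Products are continuous for \<open>wlim\<close> in each factor separately, so
    the limit in \<open>l\<close> is taken first and that in \<open>m\<close> afterwards.\<close>
  have main2: "psum T m * c = (1 - r m) * c * \<theta> T" if c: "c \<in> Q'" for c m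
  proof -
    have "wlim (\<lambda>l. psum T m * c * (1 - r l)) (psum T m * c * (1 - 0))"
      by (intro wlim_mult_left wlim_diff wlim_const r_wlim)
    then have "wlim (\<lambda>l. (1 - r m) * c * psum T l) (psum T m * c)" by (simp add: main[OF c])
    then show ?thesis using wlim_mult_left[OF \<theta>_wlim[of T], of "(1 - r m) * c"] wlim_unique by blast
  qed
  have "\<theta> T \<in> commutant Q'"
  proof (rule commutantI)
    fix c assume c: "c \<in> Q'"
    have "wlim (\<lambda>m. (1 - r m) * (c * \<theta> T)) ((1 - 0) * (c * \<theta> T))"
      by (intro wlim_mult_right wlim_diff wlim_const r_wlim)
    then have "wlim (\<lambda>m. psum T m * c) (c * \<theta> T)" by (simp add: main2[OF c] mult.assoc)
    then show "\<theta> T * c = c * \<theta> T"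
      using wlim_mult_right[OF \<theta>_wlim[of T], of c] wlim_unique by blast
  qed
  then show "\<theta> T \<in> Q" by (simp add: Q_bicomm)
  \<comment> \<open>The corner of \<open>\<theta> T\<close> is that of \<open>T\<close>:
    \<open>S\<close> commutes with \<open>e * t i * e\<close>, and then the pieces add up to
    \<open>1 - r m\<close>.\<close>
  have "e * psum T m * e = S * (1 - r m) * e" for m
  proof -
    have "e * (t i * S * star (t i)) * e = S * (t i * star (t i)) * e" for i
    proof -
      have "e * (t i * S * star (t i)) * e = (e * t i * e) * S * (star (t i) * e)"
      proof -
        have "e * (S * X) = S * X" for X using eS(1) by (simp add: mult.assoc[symmetric])
        then show ?thesis by (simp only: mult.assoc)
      qed
      also have "\<dots> = S * (e * t i * e) * (star (t i) * e)" by (simp only: comm[OF t_Q'])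
      also have "\<dots> = (S * e) * (t i * e) * star (t i) * e" by (simp only: mult.assoc)
      finally show ?thesis by (simp only: eS t_e mult.assoc)
    qed
    then have "(\<Sum>i<m. e * (t i * S * star (t i)) * e) = (\<Sum>i<m. S * (t i * star (t i)) * e)" by simp
    then show ?thesis by (simp only: psum t_sum[symmetric] sum_distrib_left sum_distrib_right)
  qed
  moreover have "wlim (\<lambda>m. S * (1 - r m) * e) (S * (1 - 0) * e)"
    by (intro wlim_mult_right wlim_mult_left wlim_diff wlim_const r_wlim)
  ultimately have "wlim (\<lambda>m. e * psum T m * e) S" by (simp only: diff_zero mult_1_right eS)
  moreover have "wlim (\<lambda>m. e * psum T m * e) (e * \<theta> T * e)"
    by (intro wlim_mult_right wlim_mult_left \<theta>_wlim)
  ultimately have ee: "e * \<theta> T * e = e * T * e"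
    unfolding S_def by (rule wlim_unique[symmetric])
  have "inner vac ((e * A * e) \<cdot> vac) = inner vac (A \<cdot> vac)" for A
    by (simp add: inner_star'[of _ e] e_basic vac_cyc)
  then show "inner vac (\<theta> T \<cdot> vac) = inner vac (T \<cdot> vac)" using ee by metis
qed

text \<open>The assumption of \<open>\<theta>_in_Q\<close> is the trace property for
  \<open>star q1 * T * q2\<close> and \<open>p\<close>.\<close>

lemma \<theta>_rvn:
  assumes "T \<in> rvn"
  shows "\<theta> T \<in> Q" "inner vac (\<theta> T \<cdot> vac) = inner vac (T \<cdot> vac)"
proof -
  have *: "inner (q1 \<cdot> vac) (T \<cdot> q2 \<cdot> p \<cdot> vac) = inner (q1 \<cdot> star p \<cdot> vac) (T \<cdot> q2 \<cdot> vac)"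
    if q: "q1 \<in> Q" "q2 \<in> Q" "p \<in> Q" for q1 q2 p
  proof -
    have r: "star q1 * T * q2 \<in> rvn" "p \<in> rvn"
      using q assms Q_rvn by (auto intro!: rvn_simps intro: star_rvn)
    have "inner (q1 \<cdot> vac) (T \<cdot> q2 \<cdot> p \<cdot> vac) = inner vac ((star q1 * T * q2) \<cdot> p \<cdot> vac)"
      by (simp add: inner_star[of q1])
    also have "\<dots> = inner vac (p \<cdot> (star q1 * T * q2) \<cdot> vac)" by (rule trace[OF r])
    also have "\<dots> = inner (q1 \<cdot> star p \<cdot> vac) (T \<cdot> q2 \<cdot> vac)"
      by (simp add: inner_star[of q1] inner_star[of "star p"])
    finally show ?thesis .
  qed
  show "\<theta> T \<in> Q" "inner vac (\<theta> T \<cdot> vac) = inner vac (T \<cdot> vac)"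
    using \<theta>_in_Q[OF *] by auto
qed

text \<open>In the abelian case right multiplication by \<open>p\<close> is left multiplication,
  with which \<open>T\<close> commutes. So \<theta> projects \<open>Q'\<close> onto
  \<open>Q\<close>, and a projection onto \<open>Q\<close> only has to reach \<open>Q'\<close>
  first.\<close>

lemma \<theta>_abelian:
  assumes ab: "\<And>p q. p \<in> Q \<Longrightarrow> q \<in> Q \<Longrightarrow> p * q = q * p" and T: "T \<in> Q'"
  shows "\<theta> T \<in> Q"
proof (rule \<theta>_in_Q)
  fix q1 q2 p assume q: "q1 \<in> Q" "q2 \<in> Q" "p \<in> Q"
  have "inner (q1 \<cdot> star p \<cdot> vac) (T \<cdot> q2 \<cdot> vac) = inner (star p \<cdot> q1 \<cdot> vac) (T \<cdot> q2 \<cdot> vac)"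
    using ab[OF q(1) Q_simps(6)[OF q(3)]] by (metis ap_mult)
  also have "\<dots> = inner (q1 \<cdot> vac) (p \<cdot> T \<cdot> q2 \<cdot> vac)" by (simp add: inner_star)
  also have "p \<cdot> T \<cdot> q2 \<cdot> vac = T \<cdot> q2 \<cdot> p \<cdot> vac"
    using swap[OF T q(3)] ab[OF q(2,3)] by (metis ap_mult)
  finally show "inner (q1 \<cdot> vac) (T \<cdot> q2 \<cdot> p \<cdot> vac) = inner (q1 \<cdot> star p \<cdot> vac) (T \<cdot> q2 \<cdot> vac)" by simp
qed

end


section \<open>Norm one projections are bimodule maps\<close>

lemma norm_pythagoras:
  fixes p :: "'a::{real_inner,banach} endo"
  assumes p: "star p = p" "p * p = p"
  shows "norm ((1 - p) * S + p * T) \<le> sqrt ((norm S)\<^sup>2 + (norm T)\<^sup>2)"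
proof (rule endo_bound_square)
  fix f
  have pp: "p \<cdot> p \<cdot> v = p \<cdot> v" for v using arg_cong[OF p(2), of "\<lambda>T. T \<cdot> v"] by simp
  have split: "(norm (v - p \<cdot> v + p \<cdot> w))\<^sup>2 \<le> (norm v)\<^sup>2 + (norm w)\<^sup>2" for v w
  proof -
    have "inner (v - p \<cdot> v) (p \<cdot> u) = 0" for u by (simp add: inner_diff_left inner_star[of p] p(1) pp)
    moreover have "inner (p \<cdot> u) (v - p \<cdot> v) = 0" for u using calculation by (simp add: inner_commute)
    ultimately have "(norm (v - p \<cdot> v + p \<cdot> u))\<^sup>2 = (norm (v - p \<cdot> v))\<^sup>2 + (norm (p \<cdot> u))\<^sup>2" for u
      by (simp add: power2_norm_eq_inner inner_add_left inner_add_right)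
    from this[of v] this[of w] have "(norm v)\<^sup>2 = (norm (v - p \<cdot> v))\<^sup>2 + (norm (p \<cdot> v))\<^sup>2"
      and *: "(norm (v - p \<cdot> v + p \<cdot> w))\<^sup>2 = (norm (v - p \<cdot> v))\<^sup>2 + (norm (p \<cdot> w))\<^sup>2" by simp_all
    moreover have "(norm (p \<cdot> w))\<^sup>2 \<le> (norm w)\<^sup>2"
      by (intro power_mono norm_projection_le p) simp
    ultimately show ?thesis using zero_le_power2[of "norm (p \<cdot> v)"] by linarith
  qed
  have "((1 - p) * S + p * T) \<cdot> f = S \<cdot> f - p \<cdot> S \<cdot> f + p \<cdot> T \<cdot> f" by (simp add: ap_simps)
  then have "(norm (((1 - p) * S + p * T) \<cdot> f))\<^sup>2 \<le> (norm (S \<cdot> f))\<^sup>2 + (norm (T \<cdot> f))\<^sup>2"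
    using split by simp
  also have "\<dots> \<le> (norm S * norm f)\<^sup>2 + (norm T * norm f)\<^sup>2"
    by (intro add_mono power_mono norm_ap) auto
  finally show "(norm (((1 - p) * S + p * T) \<cdot> f))\<^sup>2 \<le> (sqrt ((norm S)\<^sup>2 + (norm T)\<^sup>2))\<^sup>2 * (norm f)\<^sup>2"
    by (simp add: power_mult_distrib algebra_simps)
qed simp

lemma norm_symmetric_projection:
  fixes p :: "'a::{real_inner,banach} endo"
  assumes p: "star p = p" "p * p = p"
  shows "norm (p * T) \<le> norm T" "norm ((1 - p) * T) \<le> norm T"
  using norm_pythagoras[OF p, of 0 T] norm_pythagoras[OF p, of T 0] by simp_all

context group_rep
begin

text \<open>
  Tomiyama's argument: a contractive idempotent moves nothing from \<open>(1 - p) clin\<close> into \<open>p Q\<close>, for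
  adding a large multiple \<open>c z\<close> of \<open>z = p E ((1 - p) T)\<close> increases the norm of \<open>(1 - p) T\<close> to at most
  \<open>sqrt (norm T ^ 2 + c\<^sup>2 norm z ^ 2)\<close>, but that of its image to at least \<open>(1 + c) norm z\<close>.
\<close>

lemma tomiyama_projection:
  assumes add: "\<And>S T. S \<in> clin \<Longrightarrow> T \<in> clin \<Longrightarrow> E (S + T) = E S + E T"
    and scale: "\<And>x T. T \<in> clin \<Longrightarrow> E (x *\<^sub>R T) = x *\<^sub>R E T"
    and contr: "\<And>T. T \<in> clin \<Longrightarrow> norm (E T) \<le> norm T"
    and range: "\<And>T. T \<in> clin \<Longrightarrow> E T \<in> commutant S"
    and idem: "\<And>q. q \<in> commutant S \<Longrightarrow> E q = q"
    and S: "ii \<in> S"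
    and p: "p \<in> commutant S" "star p = p" "p * p = p" and T: "T \<in> clin"
  shows "E (p * T) = p * E T"
proof -
  have Qc: "commutant S \<subseteq> clin" using S by (auto simp: clin_def commutant_def)
  \<comment> \<open>Stated for every projection because it is applied to \<open>p\<close> and to
    \<open>1 - p\<close>.\<close>
  have z0: "p * E ((1 - p) * T) = 0" if p: "p \<in> commutant S" "star p = p" "p * p = p" for p
  proof (rule ccontr)
    define z where "z = p * E ((1 - p) * T)"
    assume "p * E ((1 - p) * T) \<noteq> 0"
    then have z: "norm z > 0" by (simp add: z_def)
    have pc: "(1 - p) * T \<in> clin" using p Qc T by (intro clin_simps) auto
    have zQ: "z \<in> commutant S" unfolding z_def by (intro commutant_mult p range pc)
    have pz: "p * z = z" by (simp add: z_def p mult.assoc[symmetric])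
    have bd: "(1 + c)\<^sup>2 * (norm z)\<^sup>2 \<le> (norm T)\<^sup>2 + c\<^sup>2 * (norm z)\<^sup>2" if c: "0 \<le> c" for c
    proof -
      have "E ((1 - p) * T + c *\<^sub>R z) = E ((1 - p) * T) + c *\<^sub>R z"
        using zQ Qc pc by (subst add) (auto simp: scale idem clin_simps)
      then have "p * E ((1 - p) * T + c *\<^sub>R z) = z + c *\<^sub>R z"
        by (simp add: distrib_left pz flip: z_def)
      also have "\<dots> = (1 + c) *\<^sub>R z" by (simp add: scaleR_add_left)
      finally have "norm ((1 + c) *\<^sub>R z) = norm (p * E ((1 - p) * T + c *\<^sub>R z))" by simp
      also have "\<dots> \<le> norm (E ((1 - p) * T + c *\<^sub>R z))" by (intro norm_symmetric_projection p)
      also have "\<dots> \<le> norm ((1 - p) * T + c *\<^sub>R z)"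
        using zQ Qc by (intro contr clin_simps(3,5) pc) auto
      also have "(1 - p) * T + c *\<^sub>R z = (1 - p) * T + p * (c *\<^sub>R z)" by (simp add: pz)
      also have "norm \<dots> \<le> sqrt ((norm T)\<^sup>2 + (norm (c *\<^sub>R z))\<^sup>2)" by (rule norm_pythagoras[OF p(2,3)])
      finally have "((1 + c) * norm z)\<^sup>2 \<le> (sqrt ((norm T)\<^sup>2 + (norm (c *\<^sub>R z))\<^sup>2))\<^sup>2"
        using c by (intro power_mono) auto
      then show ?thesis by (simp add: power_mult_distrib)
    qed
    \<comment> \<open>With this \<open>c\<close> the bound becomes \<open>(norm z)\<^sup>2 + 2 *
      (norm T)\<^sup>2 \<le> (norm T)\<^sup>2\<close> once the terms in \<open>c\<^sup>2\<close>
      cancel.\<close>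
    define c where "c = (norm T)\<^sup>2 / (norm z)\<^sup>2"
    have c: "c * (norm z)\<^sup>2 = (norm T)\<^sup>2" "0 \<le> c" using z by (simp_all add: c_def)
    have "(1 + c)\<^sup>2 * (norm z)\<^sup>2 = (norm z)\<^sup>2 + 2 * (c * (norm z)\<^sup>2) + c\<^sup>2 * (norm z)\<^sup>2"
      by (simp add: power2_eq_square algebra_simps)
    then have "(norm z)\<^sup>2 + 2 * (norm T)\<^sup>2 \<le> (norm T)\<^sup>2"
      using bd[OF c(2)] unfolding c(1) by linarith
    moreover have "0 < (norm z)\<^sup>2" using z by simp
    ultimately show False using zero_le_power2[of "norm T"] by linarith
  qed
  have Tp: "p * T \<in> clin" "(1 - p) * T \<in> clin" using p Qc T by (auto intro!: clin_simps)
  have q: "1 - p \<in> commutant S" "star (1 - p) = 1 - p" "(1 - p) * (1 - p) = 1 - p"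
    using p by (auto intro: commutant_diff simp: algebra_simps)
  have "(1 - p) * E (p * T) = 0" using z0[OF q] by simp
  then have "E (p * T) = p * E (p * T)" by (simp add: algebra_simps)
  also have "\<dots> = p * (E (p * T) + E ((1 - p) * T))" by (simp add: distrib_left z0[OF p])
  also have "E (p * T) + E ((1 - p) * T) = E T"
    using Tp by (simp add: add[symmetric] algebra_simps)
  finally show ?thesis .
qed

text \<open>The module property passes from projections \<open>p\<close> to symmetries
  \<open>2 *\<^sub>R p - 1\<close>, from these to selfadjoint elements as norm limits of their
  combinations, and by complex linearity of \<open>E\<close> to all elements.\<close>

lemma tomiyama_left:
  assumes add: "\<And>S T. S \<in> clin \<Longrightarrow> T \<in> clin \<Longrightarrow> E (S + T) = E S + E T"
    and scale: "\<And>x T. T \<in> clin \<Longrightarrow> E (x *\<^sub>R T) = x *\<^sub>R E T"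
    and Eii: "\<And>T. T \<in> clin \<Longrightarrow> E (ii * T) = ii * E T"
    and contr: "\<And>T. T \<in> clin \<Longrightarrow> norm (E T) \<le> norm T"
    and range: "\<And>T. T \<in> clin \<Longrightarrow> E T \<in> commutant S"
    and idem: "\<And>q. q \<in> commutant S \<Longrightarrow> E q = q"
    and S: "ii \<in> S" "star_closed S" "ii \<in> commutant S"
    and a: "a \<in> commutant S" and T: "T \<in> clin"
  shows "E (a * T) = a * E T"
proof -
  have Qc: "commutant S \<subseteq> clin" using S by (auto simp: clin_def commutant_def)
  have diff: "E (A - B) = E A - E B" if "A \<in> clin" "B \<in> clin" for A B
    using add[of "A - B" B] that by (simp add: clin_simps)
  define V where "V = {a \<in> commutant S. E (a * T) = a * E T}"
  have V: "subspace V"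
    unfolding subspace_def V_def
    using Qc T scale[of 0 0] by (auto simp: add scale clin_simps commutant_add commutant_scaleR algebra_simps subset_iff)
  have "closed V"
    unfolding closed_sequential_limits
  proof (intro allI impI, elim conjE)
    fix x l assume x: "\<forall>n. x n \<in> V" and l: "x \<longlonglongrightarrow> l"
    have lS: "l \<in> commutant S"
      by (rule commutant_wlim[OF _ tendsto_imp_wlim[OF l]]) (use x in \<open>auto simp: V_def\<close>)
    have "(\<lambda>n. E (x n * T) - E (l * T)) \<longlonglongrightarrow> 0"
    proof (rule Lim_null_comparison)
      have "(\<lambda>n. norm (x n - l) * norm T) \<longlonglongrightarrow> 0 * norm T"
        using l by (intro tendsto_intros tendsto_norm_zero LIM_zero)
      then show "(\<lambda>n. norm (x n - l) * norm T) \<longlonglongrightarrow> 0" by simp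
      show "\<forall>\<^sub>F n in sequentially. norm (E (x n * T) - E (l * T)) \<le> norm (x n - l) * norm T"
      proof (intro always_eventually allI)
        fix n
        have xn: "x n \<in> clin" "l \<in> clin" using x lS Qc by (auto simp: V_def)
        then have "norm (E (x n * T) - E (l * T)) = norm (E ((x n - l) * T))"
          using T by (simp add: left_diff_distrib diff clin_simps)
        also have "\<dots> \<le> norm ((x n - l) * T)" using xn T by (intro contr clin_simps)
        also have "\<dots> \<le> norm (x n - l) * norm T" by (rule norm_mult_ineq)
        finally show "norm (E (x n * T) - E (l * T)) \<le> norm (x n - l) * norm T" .
      qed
    qed
    then have "(\<lambda>n. E (x n * T)) \<longlonglongrightarrow> E (l * T)" by (rule LIM_zero_cancel)
    moreover have "(\<lambda>n. E (x n * T)) = (\<lambda>n. x n * E T)" using x by (simp add: V_def)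
    moreover have "(\<lambda>n. x n * E T) \<longlonglongrightarrow> l * E T" by (intro tendsto_intros l)
    ultimately show "l \<in> V" using lS LIMSEQ_unique by (auto simp: V_def)
  qed
  have sym: "s \<in> V" if s: "s \<in> commutant S" "star s = s" "s * s = 1" for s
  proof -
    let ?p = "(1/2) *\<^sub>R (1 + s)"
    have "(1 + s) * (1 + s) = 2 *\<^sub>R (1 + s)" using s(3) by (simp add: algebra_simps scaleR_2)
    then have pp: "?p * ?p = ?p" by simp
    have "E (?p * T) = ?p * E T"
      by (rule tomiyama_projection[OF add scale contr range idem S(1) _ _ pp T])
        (use s in \<open>auto intro!: commutant_scaleR commutant_add\<close>)
    then have "?p \<in> V" using s by (auto simp: V_def intro!: commutant_scaleR commutant_add)
    moreover have "1 \<in> V" by (simp add: V_def)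
    ultimately have "2 *\<^sub>R ?p - 1 \<in> V" by (rule subspace_diff[OF V subspace_scale[OF V]])
    then show ?thesis by (simp add: algebra_simps)
  qed
  have sa: "b \<in> V" if "b \<in> commutant S" "star b = b" for b
    using selfadjoint_in_closed_span_symmetries[OF S(2) V \<open>closed V\<close> sym] that by blast
  have sS: "star a \<in> commutant S" using star_closed_commutant[OF S(2)] a by (simp add: star_closed_def)
  let ?h = "a + star a" and ?k = "a - star a"
  have "?h \<in> V" using a sS by (intro sa) (auto intro: commutant_add)
  have com: "ii * x = x * ii" if "x \<in> commutant S" for x using that S by (simp add: commutant_def)
  have kS: "?k \<in> commutant S" using a sS by (rule commutant_diff)
  \<comment> \<open>\<open>?k\<close> is skew, so \<open>ii * ?k\<close> is selfadjoint; complex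
    linearity of \<open>E\<close> then cancels \<open>ii\<close>.\<close>
  have "ii * ?k \<in> V"
    using S kS com[OF kS] by (intro sa commutant_mult) (auto simp: ii algebra_simps)
  then have "E (ii * ?k * T) = ii * ?k * E T" by (simp add: V_def)
  moreover have "E (ii * ?k * T) = ii * E (?k * T)"
    using kS Qc T by (simp add: mult.assoc Eii clin_simps subset_iff)
  ultimately have "ii * (ii * E (?k * T)) = ii * (ii * (?k * E T))" by (simp add: mult.assoc)
  moreover have "ii * (ii * X) = - X" for X by (simp add: mult.assoc[symmetric] ii)
  ultimately have "E (?k * T) = ?k * E T" by (simp only: neg_equal_iff_equal)
  then have "?k \<in> V" using kS by (simp add: V_def)
  from \<open>?h \<in> V\<close> this have "(1/2) *\<^sub>R (?h + ?k) \<in> V" by (rule subspace_scale[OF V subspace_add[OF V]])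
  then show ?thesis by (simp add: V_def scaleR_2[symmetric])
qed

text \<open>The left version for the conjugated map
  \<open>T \<mapsto> star (E (star T))\<close>.\<close>

lemma tomiyama_right:
  assumes add: "\<And>S T. S \<in> clin \<Longrightarrow> T \<in> clin \<Longrightarrow> E (S + T) = E S + E T"
    and scale: "\<And>x T. T \<in> clin \<Longrightarrow> E (x *\<^sub>R T) = x *\<^sub>R E T"
    and Eii: "\<And>T. T \<in> clin \<Longrightarrow> E (ii * T) = ii * E T"
    and contr: "\<And>T. T \<in> clin \<Longrightarrow> norm (E T) \<le> norm T"
    and range: "\<And>T. T \<in> clin \<Longrightarrow> E T \<in> commutant S"
    and idem: "\<And>q. q \<in> commutant S \<Longrightarrow> E q = q"
    and S: "ii \<in> S" "star_closed S" "ii \<in> commutant S"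
    and a: "a \<in> commutant S" and T: "T \<in> clin"
  shows "E (T * a) = E T * a"
proof -
  define F where "F T = star (E (star T))" for T
  have Qc: "commutant S \<subseteq> clin" using S by (auto simp: clin_def commutant_def)
  have sS: "star x \<in> commutant S" if "x \<in> commutant S" for x
    using star_closed_commutant[OF S(2)] that by (simp add: star_closed_def)
  have com: "T * ii = ii * T" if "T \<in> clin" for T using that by (simp add: clin_def commutant_def)
  have "F (star a * star T) = star a * F (star T)"
  proof (rule tomiyama_left[of F S])
    fix T assume T: "T \<in> clin"
    have sT: "star T \<in> clin" by (rule star_clin[OF T])
    then have ET: "E (star T) \<in> clin" using range Qc by blast
    have "star (ii * T) = (- 1) *\<^sub>R (ii * star T)" by (simp add: ii com[OF sT])
    then have "F (ii * T) = star ((- 1) *\<^sub>R (ii * E (star T)))"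
      unfolding F_def by (simp only: scale[OF clin_simps(2)[OF clin_simps(9) sT]] Eii[OF sT])
    then show "F (ii * T) = ii * F T"
      using com[OF star_clin[OF ET]] by (simp add: F_def ii)
    show "norm (F T) \<le> norm T" using contr[OF sT] by (simp add: F_def)
  qed (use S add scale range idem a T in \<open>auto simp: F_def star_clin sS intro: add\<close>)
  then have "star (F (star a * star T)) = star (star a * F (star T))" by simp
  then show ?thesis by (simp add: F_def)
qed

end


section \<open>Hypertraces from norm one projections\<close>

context vn_sub
begin

text \<open>Centrality: \<open>E\<close> and \<theta> are bimodule maps over \<open>Q\<close>, and
  the values of \<open>E\<close> lie in \<open>rvn\<close>, where the vector state is a trace. On
  \<open>rvn\<close> the map \<theta> already lands in \<open>Q\<close>, which \<open>E\<close>
  fixes.\<close>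

lemma hypertrace_from_projection:
  assumes add: "\<And>S T. S \<in> clin \<Longrightarrow> T \<in> clin \<Longrightarrow> E (S + T) = E S + E T"
    and scale: "\<And>x T. T \<in> clin \<Longrightarrow> E (x *\<^sub>R T) = x *\<^sub>R E T"
    and Eii: "\<And>T. T \<in> clin \<Longrightarrow> E (ii * T) = ii * E T"
    and contr: "\<And>T. T \<in> clin \<Longrightarrow> norm (E T) \<le> norm T"
    and range: "\<And>T. T \<in> clin \<Longrightarrow> E T \<in> Q"
    and idem: "\<And>q. q \<in> Q \<Longrightarrow> E q = q"
  shows "hypertrace Q (\<lambda>T. inner vac (E (\<theta> T) \<cdot> vac))"
proof -
  have iiQ': "ii \<in> Q'" using Q_rvn by (auto simp: rvn_def commutant_def)
  have sQ': "star_closed Q'" using Q'_star by (simp add: star_closed_def)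
  have r: "\<And>T. T \<in> clin \<Longrightarrow> E T \<in> commutant Q'" and i: "\<And>q. q \<in> commutant Q' \<Longrightarrow> E q = q"
    and iQ: "ii \<in> commutant Q'" using range idem ii_Q by (simp_all add: Q_bicomm)
  note bimod = tomiyama_left[OF add scale Eii contr r i iiQ' sQ' iQ, unfolded Q_bicomm]
    tomiyama_right[OF add scale Eii contr r i iiQ' sQ' iQ, unfolded Q_bicomm]
  show ?thesis
    unfolding hypertrace_def
  proof (intro conjI ballI allI)
    show "inner vac (E (\<theta> (S + T)) \<cdot> vac) = inner vac (E (\<theta> S) \<cdot> vac) + inner vac (E (\<theta> T) \<cdot> vac)"
      if "S \<in> clin" "T \<in> clin" for S T
      using that by (simp add: \<theta>_add add \<theta>_clin ap_simps inner_add_right)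
    show "inner vac (E (\<theta> (x *\<^sub>R T)) \<cdot> vac) = x * inner vac (E (\<theta> T) \<cdot> vac)" if "T \<in> clin" for T x
      using that by (simp add: \<theta>_scaleR scale \<theta>_clin ap_simps)
    show "\<bar>inner vac (E (\<theta> T) \<cdot> vac)\<bar> \<le> norm T" if "T \<in> clin" for T
    proof -
      have "\<bar>inner vac (E (\<theta> T) \<cdot> vac)\<bar> \<le> norm vac * norm (E (\<theta> T) \<cdot> vac)" by (rule Cauchy_Schwarz_ineq2)
      also have "\<dots> \<le> norm vac * (norm (E (\<theta> T)) * norm vac)" by (intro mult_left_mono norm_ap) auto
      also have "\<dots> = norm (E (\<theta> T))" by (simp add: norm_\<delta>)
      also have "\<dots> \<le> norm T" using contr[OF \<theta>_clin[OF that]] norm_\<theta>[of T] by simp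
      finally show ?thesis .
    qed
    show "inner vac (E (\<theta> (a * T)) \<cdot> vac) = inner vac (E (\<theta> (T * a)) \<cdot> vac)" if "a \<in> Q" "T \<in> clin" for a T
    proof -
      have "a \<in> rvn" "E (\<theta> T) \<in> rvn" using that range[OF \<theta>_clin] Q_rvn by auto
      from trace[OF this] show ?thesis
        using that by (simp add: \<theta>_left \<theta>_right bimod \<theta>_clin)
    qed
    show "inner vac (E (\<theta> x) \<cdot> vac) = inner vac (x \<cdot> vac)" if "x \<in> rvn" for x
      using \<theta>_rvn[OF that] by (simp add: idem)
  qed
qed

end


section \<open>Hypertraces from finite-dimensional approximation\<close>

lemma orthonormal_expansion:
  fixes V :: "'a::real_inner set"
  assumes V: "finite V" "pairwise orthogonal V" "\<And>v. v \<in> V \<Longrightarrow> norm v = 1" and u: "u \<in> span V"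
  shows "u = (\<Sum>v\<in>V. inner v u *\<^sub>R v)"
proof -
  define d where "d = u - (\<Sum>v\<in>V. inner v u *\<^sub>R v)"
  have "orthogonal d y" if y: "y \<in> V" for y
  proof -
    have "inner (\<Sum>v\<in>V. inner v u *\<^sub>R v) y = (\<Sum>v\<in>V. if v = y then inner y u else 0)"
      unfolding inner_sum_left using V y
      by (intro sum.cong refl) (auto simp: pairwise_def orthogonal_def power2_norm_eq_inner[symmetric])
    also have "\<dots> = inner u y" using V(1) y by (simp add: inner_commute)
    finally show ?thesis by (simp add: d_def orthogonal_def inner_diff_left)
  qed
  then have "orthogonal d y" if "y \<in> span V" for y using that by (rule orthogonal_to_span[rotated])
  moreover have "d \<in> span V" unfolding d_def by (intro span_diff u span_sum span_scale span_base)
  ultimately have "orthogonal d d" by blast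
  then have "d = 0" by (simp add: orthogonal_def)
  then show ?thesis by (simp add: d_def)
qed

lemma orthonormal_basis_exists:
  fixes W :: "'a::real_inner set"
  assumes "finite W"
  obtains V where "finite V" "pairwise orthogonal V" "\<And>v. v \<in> V \<Longrightarrow> norm v = 1" "span V = span W"
proof -
  obtain C where C: "finite C" "span C = span W" "pairwise orthogonal C"
    using basis_orthogonal[OF assms] by blast
  define V where "V = (\<lambda>v. inverse (norm v) *\<^sub>R v) ` (C - {0})"
  have "finite V" using C by (simp add: V_def)
  moreover have "pairwise orthogonal V"
    using C(3) by (auto simp: V_def pairwise_def orthogonal_def)
  moreover have "norm v = 1" if "v \<in> V" for v
  proof -
    from that obtain x where "v = inverse (norm x) *\<^sub>R x" "x \<in> C - {0}" unfolding V_def by (rule imageE)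
    then show ?thesis by simp
  qed
  moreover have "span V = span C"
  proof (rule antisym)
    show "span V \<subseteq> span C"
      unfolding V_def by (intro span_minimal image_subsetI span_scale span_base subspace_span) auto
    have "c \<in> span V" if "c \<in> C" for c
    proof (cases "c = 0")
      case False
      then have "norm c *\<^sub>R (inverse (norm c) *\<^sub>R c) \<in> span V"
        using that by (intro span_scale span_base) (auto simp: V_def)
      then show ?thesis using False by simp
    qed (simp add: span_zero)
    then show "span C \<subseteq> span V" by (intro span_minimal) auto
  qed
  ultimately show thesis using that C(2) by blast
qed

context group_rep
begin

text \<open>
  For an orthonormal basis \<open>v = b\<^sub>v vac\<close> of \<open>F vac\<close>, compression to \<open>F vac\<close> followed by the matrix
  trace is \<open>F\<close>-central, and on \<open>rvn\<close> it is \<open>x \<mapsto> \<tau> (x w)\<close> with \<open>w = \<Sum> b\<^sub>v (b\<^sub>v)\<^sup>*\<close> central in \<open>F\<close>. The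
  density \<open>w\<close> is removed by decomposing the identity along multiples of \<open>w\<close>.
\<close>

lemma finite_dim_trace:
  assumes F: "F \<subseteq> rvn" "1 \<in> F" and star_F: "star_closed F"
    and add: "\<And>S T. S \<in> F \<Longrightarrow> T \<in> F \<Longrightarrow> S + T \<in> F" and mult: "\<And>S T. S \<in> F \<Longrightarrow> T \<in> F \<Longrightarrow> S * T \<in> F"
    and scale: "\<And>x T. T \<in> F \<Longrightarrow> x *\<^sub>R T \<in> F"
    and B: "finite B" "F \<subseteq> span B" and \<epsilon>: "0 < (\<epsilon>::real)"
  shows "\<exists>(I :: (nat \<times> 'h) set) \<eta>. finite I \<and> (\<Sum>j\<in>I. (norm (\<eta> j))\<^sup>2) \<le> 1 \<and>
     (\<forall>a\<in>F. \<forall>T. (\<Sum>j\<in>I. inner (\<eta> j) ((a * T) \<cdot> \<eta> j)) = (\<Sum>j\<in>I. inner (\<eta> j) ((T * a) \<cdot> \<eta> j))) \<and>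
     (\<forall>x\<in>rvn. \<bar>(\<Sum>j\<in>I. inner (\<eta> j) (x \<cdot> \<eta> j)) - inner vac (x \<cdot> vac)\<bar> \<le> \<epsilon> * norm x)"
proof -
  have Fs: "star a \<in> F" if "a \<in> F" for a using star_F that by (simp add: star_closed_def)
  have "0 \<in> F" using scale[OF F(2), of 0] by simp
  then have subF: "subspace F" using add scale by (auto simp: subspace_def)
  obtain B' where B': "B' \<subseteq> F" "independent B'" "F \<subseteq> span B'"
    using maximal_independent_subset[of F] by blast
  have finB': "finite B'" using independent_span_bound[OF B(1) B'(2)] B' B(2) by blast
  have spB': "span B' = F" using B' subF by (simp add: span_minimal subset_antisym)
  define W where "W = (\<lambda>b. b \<cdot> vac) ` B'"
  have "span W = (\<lambda>b. b \<cdot> vac) ` F"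
    unfolding W_def spB'[symmetric]
    by (rule linear_span_image[symmetric, symmetric]) (rule bounded_linear.linear[OF ap.bounded_linear_left])
  moreover have "finite W" using finB' by (simp add: W_def)
  ultimately obtain V where V: "finite V" "pairwise orthogonal V" "\<And>v. v \<in> V \<Longrightarrow> norm v = 1"
    and spV: "span V = (\<lambda>b. b \<cdot> vac) ` F" using orthonormal_basis_exists[of W] by metis
  have expand: "a \<cdot> vac = (\<Sum>v\<in>V. inner v (a \<cdot> vac) *\<^sub>R v)" if "a \<in> F" for a
    by (rule orthonormal_expansion[OF V]) (use that in \<open>auto simp: spV\<close>)
  have "\<exists>b\<in>F. b \<cdot> vac = v" if "v \<in> V" for v using span_base[OF that] by (auto simp: spV)
  then obtain b where b: "\<And>v. v \<in> V \<Longrightarrow> b v \<in> F" "\<And>v. v \<in> V \<Longrightarrow> b v \<cdot> vac = v" by metis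
  \<comment> \<open>\<open>vac\<close> separates \<open>rvn\<close>, so the expansion of
    \<open>a \<cdot> vac\<close> lifts to \<open>a\<close>.\<close>
  have coeff: "a = (\<Sum>v\<in>V. inner v (a \<cdot> vac) *\<^sub>R b v)" if a: "a \<in> F" for a
  proof -
    have "(\<Sum>v\<in>V. inner v (a \<cdot> vac) *\<^sub>R b v) \<in> F"
      by (intro subspace_sum[OF subF] scale b)
    then have "a - (\<Sum>v\<in>V. inner v (a \<cdot> vac) *\<^sub>R b v) \<in> rvn" using a F by (auto intro: rvn_simps)
    moreover have "(a - (\<Sum>v\<in>V. inner v (a \<cdot> vac) *\<^sub>R b v)) \<cdot> vac = 0"
      using expand[OF a] by (simp add: ap_simps ap.sum_left b)
    ultimately show ?thesis using separating by fastforce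
  qed
  have aV: "a \<cdot> v = (\<Sum>u\<in>V. inner u (a \<cdot> v) *\<^sub>R u)" if "a \<in> F" "v \<in> V" for a v
    using expand[OF mult[OF that(1) b(1)[OF that(2)]]] b(2)[OF that(2)] by simp
  have ab: "a * b v = (\<Sum>u\<in>V. inner u (a \<cdot> v) *\<^sub>R b u)" if "a \<in> F" "v \<in> V" for a v
    using coeff[OF mult[OF that(1) b(1)[OF that(2)]]] b(2)[OF that(2)] by simp
  define w where "w = (\<Sum>v\<in>V. b v * star (b v))"
  have wF: "w \<in> F" unfolding w_def by (intro subspace_sum[OF subF] mult b Fs)
  \<comment> \<open>In the orthonormal basis the matrices of \<open>a\<close> and
    \<open>star a\<close> are transposes of each other; this carries \<open>a\<close> from the first
    factor of \<open>b v * star (b v)\<close> to the second.\<close>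
  have w_comm: "w * a = a * w" if a: "a \<in> F" for a
  proof -
    have "a * w = (\<Sum>v\<in>V. \<Sum>u\<in>V. inner u (a \<cdot> v) *\<^sub>R (b u * star (b v)))"
      using a by (simp add: w_def sum_distrib_left mult.assoc[symmetric] ab sum_distrib_right)
    also have "\<dots> = (\<Sum>u\<in>V. b u * star (\<Sum>v\<in>V. inner v (star a \<cdot> u) *\<^sub>R b v))"
      by (subst sum.swap) (simp add: sum_distrib_left inner_star'[of _ "star a"] inner_commute)
    also have "\<dots> = (\<Sum>u\<in>V. b u * star (star a * b u))" using Fs[OF a] by (simp add: ab)
    also have "\<dots> = w * a" by (simp add: w_def sum_distrib_right mult.assoc)
    finally show ?thesis by simp
  qed
  have fw: "inner f (w \<cdot> f) = (\<Sum>v\<in>V. (norm (star (b v) \<cdot> f))\<^sup>2)" for f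
    by (simp add: w_def ap.sum_left inner_sum_right inner_star' power2_norm_eq_inner)
  \<comment> \<open>1 is a combination of the \<open>b v\<close> whose coefficients are those of the
    unit vector \<open>vac\<close> and so have square sum 1; Cauchy-Schwarz shows that
    \<open>w\<close> dominates the identity.\<close>
  have w_ge: "(norm f)\<^sup>2 \<le> inner f (w \<cdot> f)" for f
  proof -
    define c where "c v = inner v vac" for v
    have one: "1 = (\<Sum>v\<in>V. c v *\<^sub>R b v)" using coeff[OF F(2)] by (simp add: c_def)
    have "1 = star (\<Sum>v\<in>V. c v *\<^sub>R b v)" using one by (metis star_one)
    then have "f = (\<Sum>v\<in>V. c v *\<^sub>R star (b v)) \<cdot> f" by simp
    then have "f = (\<Sum>v\<in>V. c v *\<^sub>R (star (b v) \<cdot> f))" by (simp add: ap.sum_left ap_simps)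
    then have "norm f \<le> (\<Sum>v\<in>V. \<bar>c v\<bar> * norm (star (b v) \<cdot> f))"
      by (metis (mono_tags, lifting) norm_scaleR norm_sum sum.cong)
    then have "(norm f)\<^sup>2 \<le> (\<Sum>v\<in>V. \<bar>c v\<bar> * norm (star (b v) \<cdot> f))\<^sup>2" by (intro power_mono) auto
    also have "\<dots> \<le> (\<Sum>v\<in>V. \<bar>c v\<bar>\<^sup>2) * (\<Sum>v\<in>V. (norm (star (b v) \<cdot> f))\<^sup>2)"
      by (rule Cauchy_Schwarz_ineq_sum)
    also have "(\<Sum>v\<in>V. \<bar>c v\<bar>\<^sup>2) = inner vac vac"
      by (subst (2) ap_one[symmetric], subst expand[OF F(2)])
        (simp add: inner_sum_right c_def power2_eq_square inner_commute)
    also have "inner vac vac = 1" by (simp add: norm_\<delta> power2_norm_eq_inner[symmetric])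
    finally show ?thesis by (simp add: fw)
  qed
  define c where "c = norm w"
  have c: "1 \<le> c"
  proof -
    have "1 = (norm vac)\<^sup>2" by (simp add: norm_\<delta>)
    also have "\<dots> \<le> inner vac (w \<cdot> vac)" by (rule w_ge)
    also have "\<dots> \<le> norm vac * norm (w \<cdot> vac)" by (rule norm_cauchy_schwarz)
    also have "\<dots> \<le> norm vac * (norm w * norm vac)" by (intro mult_left_mono norm_ap) auto
    finally show ?thesis by (simp add: norm_\<delta> c_def)
  qed
  \<comment> \<open>The same operator at every stage, scaled by its norm to lie between 0 and
    1.\<close>
  define K where "K = (\<lambda>n::nat. (1/c) *\<^sub>R w)"
  have star_w: "star w = w" by (simp add: w_def)
  have posK: "pos (K n)" for n
    unfolding pos_def using c by (auto simp: K_def star_w ap_simps fw intro!: sum_nonneg divide_nonneg_nonneg)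
  have posK': "pos (1 - K n)" for n
    unfolding pos_def
  proof (intro conjI allI)
    fix x
    have "inner x (w \<cdot> x) \<le> norm x * norm (w \<cdot> x)" by (rule norm_cauchy_schwarz)
    also have "\<dots> \<le> norm x * (c * norm x)" unfolding c_def by (intro mult_left_mono norm_ap) auto
    finally have "inner x (w \<cdot> x) \<le> c * inner x x"
      by (simp add: power2_norm_eq_inner[symmetric] power2_eq_square ac_simps)
    then show "0 \<le> inner x ((1 - K n) \<cdot> x)"
      using c by (simp add: K_def ap_simps inner_diff_right field_simps)
  qed (simp add: K_def star_w)
  define r where "r n = resid K n" for n
  have r_star: "star (r n) = r n" for n unfolding r_def by (rule star_resid[of K, OF posK posK'])
  have r_sum: "(\<Sum>n<m. r n * K n * r n) = 1 - r m" for m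
    unfolding r_def by (rule resid_sum[of K, OF posK posK'])
  have r_comm: "r n * a = a * r n" if "a \<in> F" for a n
    unfolding r_def
    by (rule commutantD[OF resid_commutant[of K, OF posK posK'] that])
      (auto simp: K_def commutant_def w_comm)
  have r_rvn: "r n \<in> rvn" for n
    unfolding r_def rvn_def
    by (rule resid_commutant[of K, OF posK posK'])
      (use wF F in \<open>auto simp: K_def rvn_def[symmetric] intro!: rvn_simps\<close>)
  have "(\<lambda>n. inner (r n \<cdot> vac) (K n \<cdot> r n \<cdot> vac)) \<longlonglongrightarrow> 0"
    unfolding r_def by (rule summable_LIMSEQ_zero[OF resid_summable[of K, OF posK posK']])
  then have "\<forall>\<^sub>F n in sequentially. inner (r n \<cdot> vac) (K n \<cdot> r n \<cdot> vac) < \<epsilon>\<^sup>2 / c"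
    using \<epsilon> c by (intro order_tendstoD(2)) auto
  \<comment> \<open>Finitely many stages reach the tolerance: since \<open>w\<close> dominates the
    identity, smallness of this quadratic form bounds \<open>r m \<cdot> vac\<close> itself.\<close>
  then obtain m where "inner (r m \<cdot> vac) (K m \<cdot> r m \<cdot> vac) < \<epsilon>\<^sup>2 / c"
    by (auto simp: eventually_sequentially)
  then have "inner (r m \<cdot> vac) (w \<cdot> r m \<cdot> vac) < \<epsilon>\<^sup>2"
    using c by (simp add: K_def ap_simps field_simps)
  then have "(norm (r m \<cdot> vac))\<^sup>2 < \<epsilon>\<^sup>2" using w_ge[of "r m \<cdot> vac"] by simp
  then have rm: "norm (r m \<cdot> vac) < \<epsilon>" using \<epsilon> by (simp add: power2_less_imp_less)
  \<comment> \<open>The functional adds up, for \<open>n < m\<close>, the traces of the compressions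
    of \<open>r n * T * r n\<close> with weight \<open>1 / c\<close>. Each is central for
    \<open>F\<close>, because \<open>r n\<close> commutes with \<open>F\<close>.\<close>
  define I where "I = {..<m} \<times> V"
  define \<eta> where "\<eta> = (\<lambda>(n, v). (1 / sqrt c) *\<^sub>R (r n \<cdot> v))"
  have sum_I: "(\<Sum>j\<in>I. inner (\<eta> j) (T \<cdot> \<eta> j)) = (\<Sum>n<m. \<Sum>v\<in>V. (1/c) * inner (r n \<cdot> v) (T \<cdot> r n \<cdot> v))" for T
  proof -
    have "(1 / sqrt c) * ((1 / sqrt c) * z) = (1/c) * z" for z using c by simp
    then have "inner (\<eta> (n, v)) (T \<cdot> \<eta> (n, v)) = (1/c) * inner (r n \<cdot> v) (T \<cdot> r n \<cdot> v)" for n v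
      by (simp only: \<eta>_def prod.case ap_simps inner_scaleR_left inner_scaleR_right)
    moreover have "(\<Sum>j\<in>I. g j) = (\<Sum>n<m. \<Sum>v\<in>V. g (n, v))" for g :: "nat \<times> 'h \<Rightarrow> real"
      by (simp add: I_def sum.cartesian_product)
    ultimately show ?thesis by simp
  qed
  have trace_I: "(\<Sum>j\<in>I. inner (\<eta> j) (x \<cdot> \<eta> j)) = inner vac (x \<cdot> vac) - inner vac (x \<cdot> r m \<cdot> vac)"
    if x: "x \<in> rvn" for x
  proof -
    \<comment> \<open>The trace property gathers the products \<open>b v * star (b v)\<close> into
      \<open>w\<close>, and \<open>w\<close> divided by \<open>c\<close> is
      \<open>K n\<close>.\<close>
    have "(\<Sum>v\<in>V. (1/c) * inner (r n \<cdot> v) (x \<cdot> r n \<cdot> v)) = inner vac (x \<cdot> (r n * K n * r n) \<cdot> vac)" for n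
    proof -
      have "inner (r n \<cdot> v) (x \<cdot> r n \<cdot> v) = inner vac ((r n * x * r n * b v * star (b v)) \<cdot> vac)" if "v \<in> V" for v
      proof -
        have bv: "b v \<in> rvn" "star (b v) \<in> rvn" using b(1)[OF that] F star_rvn by auto
        have "inner (r n \<cdot> v) (x \<cdot> r n \<cdot> v) = inner (r n \<cdot> b v \<cdot> vac) (x \<cdot> r n \<cdot> b v \<cdot> vac)"
          by (simp add: b(2)[OF that])
        also have "\<dots> = inner vac (star (b v) \<cdot> (r n * x * r n * b v) \<cdot> vac)"
          by (simp add: inner_star r_star)
        also have "\<dots> = inner vac ((r n * x * r n * b v) \<cdot> star (b v) \<cdot> vac)"
          using bv x r_rvn by (intro trace) (auto intro!: rvn_simps)
        finally show ?thesis by simp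
      qed
      then have "(\<Sum>v\<in>V. (1/c) * inner (r n \<cdot> v) (x \<cdot> r n \<cdot> v)) =
          (\<Sum>v\<in>V. (1/c) * inner vac ((r n * x * r n * b v * star (b v)) \<cdot> vac))" by simp
      also have "\<dots> = inner vac ((r n * x * r n * ((1/c) *\<^sub>R w)) \<cdot> vac)"
        by (simp add: w_def ap_simps sum_distrib_left ap.sum_right inner_sum_right ap.sum_left sum_divide_distrib)
      also have "\<dots> = inner vac (r n \<cdot> (x * r n * K n) \<cdot> vac)" by (simp add: K_def mult.assoc ap_simps)
      also have "\<dots> = inner vac ((x * r n * K n) \<cdot> r n \<cdot> vac)"
        using x r_rvn wF F by (intro trace) (auto intro!: rvn_simps simp: K_def)
      finally show ?thesis by simp
    qed
    then have "(\<Sum>j\<in>I. inner (\<eta> j) (x \<cdot> \<eta> j)) = inner vac (x \<cdot> (\<Sum>n<m. r n * K n * r n) \<cdot> vac)"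
      by (simp only: sum_I ap.sum_left ap.sum_right inner_sum_right)
    then show ?thesis by (simp add: r_sum ap_simps inner_diff_right)
  qed
  have "(\<Sum>j\<in>I. (norm (\<eta> j))\<^sup>2) \<le> 1"
  proof -
    have "0 \<le> inner vac (r m \<cdot> vac)"
      using resid_pos[of K m, OF posK posK'] by (simp add: pos_def r_def)
    moreover have "inner vac vac = 1" by (simp add: norm_\<delta> power2_norm_eq_inner[symmetric])
    ultimately show ?thesis using trace_I[OF rvn_simps(1)] by (simp add: power2_norm_eq_inner)
  qed
  moreover have "(\<Sum>j\<in>I. inner (\<eta> j) ((a * T) \<cdot> \<eta> j)) = (\<Sum>j\<in>I. inner (\<eta> j) ((T * a) \<cdot> \<eta> j))"
    if a: "a \<in> F" for a T
  proof -
    have "(\<Sum>v\<in>V. inner (r n \<cdot> v) ((a * T) \<cdot> r n \<cdot> v)) = (\<Sum>v\<in>V. inner (r n \<cdot> v) ((T * a) \<cdot> r n \<cdot> v))" for n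
    proof -
      have ra: "a' \<cdot> r n \<cdot> v = r n \<cdot> a' \<cdot> v" if "a' \<in> F" for a' v using r_comm[OF that] by (metis ap_mult)
      have "inner (r n \<cdot> v) ((a * T) \<cdot> r n \<cdot> v) = (\<Sum>u\<in>V. inner u (star a \<cdot> v) * inner (r n \<cdot> u) (T \<cdot> r n \<cdot> v))"
        if v: "v \<in> V" for v
      proof -
        have "inner (r n \<cdot> v) ((a * T) \<cdot> r n \<cdot> v) = inner (r n \<cdot> star a \<cdot> v) (T \<cdot> r n \<cdot> v)"
          by (simp add: inner_star'[of _ a] ra[OF Fs[OF a]])
        also have "\<dots> = inner (r n \<cdot> (\<Sum>u\<in>V. inner u (star a \<cdot> v) *\<^sub>R u)) (T \<cdot> r n \<cdot> v)"
          by (simp only: aV[OF Fs[OF a] v, symmetric])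
        finally show ?thesis by (simp add: ap.sum_right ap_simps inner_sum_left)
      qed
      moreover have "inner (r n \<cdot> v) ((T * a) \<cdot> r n \<cdot> v) = (\<Sum>u\<in>V. inner u (a \<cdot> v) * inner (r n \<cdot> v) (T \<cdot> r n \<cdot> u))"
        if v: "v \<in> V" for v
      proof -
        have "inner (r n \<cdot> v) ((T * a) \<cdot> r n \<cdot> v) = inner (r n \<cdot> v) (T \<cdot> r n \<cdot> (\<Sum>u\<in>V. inner u (a \<cdot> v) *\<^sub>R u))"
          by (simp only: ap_mult ra[OF a] aV[OF a v, symmetric])
        then show ?thesis by (simp add: ap.sum_right ap_simps inner_sum_right)
      qed
      ultimately have "(\<Sum>v\<in>V. inner (r n \<cdot> v) ((a * T) \<cdot> r n \<cdot> v)) =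
          (\<Sum>v\<in>V. \<Sum>u\<in>V. inner u (star a \<cdot> v) * inner (r n \<cdot> u) (T \<cdot> r n \<cdot> v))"
        and *: "(\<Sum>v\<in>V. inner (r n \<cdot> v) ((T * a) \<cdot> r n \<cdot> v)) =
          (\<Sum>v\<in>V. \<Sum>u\<in>V. inner u (a \<cdot> v) * inner (r n \<cdot> v) (T \<cdot> r n \<cdot> u))" by simp_all
      note this(1)
      also have "(\<Sum>v\<in>V. \<Sum>u\<in>V. inner u (star a \<cdot> v) * inner (r n \<cdot> u) (T \<cdot> r n \<cdot> v)) =
          (\<Sum>u\<in>V. \<Sum>v\<in>V. inner u (star a \<cdot> v) * inner (r n \<cdot> u) (T \<cdot> r n \<cdot> v))"
        by (rule sum.swap)
      also have "\<dots> = (\<Sum>v\<in>V. \<Sum>u\<in>V. inner u (a \<cdot> v) * inner (r n \<cdot> v) (T \<cdot> r n \<cdot> u))"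
      proof -
        have "inner u (star a \<cdot> v) = inner v (a \<cdot> u)" for u v by (metis inner_commute inner_star)
        then show ?thesis by (simp only:)
      qed
      finally show ?thesis using * by simp
    qed
    then show ?thesis unfolding sum_I sum_distrib_left[symmetric] by simp
  qed
  moreover have "\<bar>(\<Sum>j\<in>I. inner (\<eta> j) (x \<cdot> \<eta> j)) - inner vac (x \<cdot> vac)\<bar> \<le> \<epsilon> * norm x" if x: "x \<in> rvn" for x
  proof -
    have "\<bar>inner vac (x \<cdot> r m \<cdot> vac)\<bar> \<le> norm vac * norm (x \<cdot> r m \<cdot> vac)" by (rule Cauchy_Schwarz_ineq2)
    also have "\<dots> \<le> norm vac * (norm x * norm (r m \<cdot> vac))" by (intro mult_left_mono norm_ap) auto
    also have "\<dots> \<le> norm x * \<epsilon>" using rm by (simp add: norm_\<delta> mult_left_mono)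
    finally show ?thesis by (simp add: trace_I[OF x] mult.commute)
  qed
  moreover have "finite I" using V(1) by (simp add: I_def)
  ultimately show ?thesis by blast
qed

text \<open>The limit of the functionals for the \<open>F k\<close> is central for each of them, as
  they increase. On \<open>rvn\<close>, \<open>\<phi> (a * T)\<close> and
  \<open>\<phi> (T * a)\<close> are bounded by \<open>norm (a \<cdot> vac) * norm T\<close>, so
  density at the single vector \<open>vac\<close> carries centrality over to
  \<open>Q\<close>.\<close>

lemma hypertrace_from_finite_dim:
  fixes F :: "nat \<Rightarrow> 'h endo set"
  assumes Q: "Q \<subseteq> rvn" and F: "\<And>k. F k \<subseteq> rvn" "\<And>k. 1 \<in> F k" "\<And>k. star_closed (F k)"
    and add: "\<And>k S T. S \<in> F k \<Longrightarrow> T \<in> F k \<Longrightarrow> S + T \<in> F k"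
    and mult: "\<And>k S T. S \<in> F k \<Longrightarrow> T \<in> F k \<Longrightarrow> S * T \<in> F k"
    and scale: "\<And>k x T. T \<in> F k \<Longrightarrow> x *\<^sub>R T \<in> F k"
    and fin: "\<And>k. \<exists>B. finite B \<and> F k \<subseteq> span B" and inc: "\<And>k. F k \<subseteq> F (Suc k)"
    and dense: "\<And>a \<epsilon>. a \<in> Q \<Longrightarrow> 0 < \<epsilon> \<Longrightarrow> \<exists>k. \<exists>b\<in>F k. norm ((a - b) \<cdot> vac) < \<epsilon>"
  shows "\<exists>\<phi>. hypertrace Q \<phi>"
proof -
  define Pr where "Pr k (I :: (nat \<times> 'h) set) \<eta> \<longleftrightarrow> finite I \<and> (\<Sum>j\<in>I. (norm (\<eta> j))\<^sup>2) \<le> 1 \<and>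
     (\<forall>a\<in>F k. \<forall>T. (\<Sum>j\<in>I. inner (\<eta> j) ((a * T) \<cdot> \<eta> j)) = (\<Sum>j\<in>I. inner (\<eta> j) ((T * a) \<cdot> \<eta> j))) \<and>
     (\<forall>x\<in>rvn. \<bar>(\<Sum>j\<in>I. inner (\<eta> j) (x \<cdot> \<eta> j)) - inner vac (x \<cdot> vac)\<bar> \<le> (1 / Suc k) * norm x)" for k I \<eta>
  have "\<exists>I \<eta>. Pr k I \<eta>" for k
  proof -
    obtain B where "finite B" "F k \<subseteq> span B" using fin by blast
    then show ?thesis unfolding Pr_def by (intro finite_dim_trace F add mult scale) auto
  qed
  then obtain I \<eta> where Pr: "\<And>k. Pr k (I k) (\<eta> k)" by metis
  then have \<eta>: "\<And>k. (\<Sum>j\<in>I k. (norm (\<eta> k j))\<^sup>2) \<le> 1"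
    and cen: "\<And>k a T. a \<in> F k \<Longrightarrow> (\<Sum>j\<in>I k. inner (\<eta> k j) ((a * T) \<cdot> \<eta> k j)) = (\<Sum>j\<in>I k. inner (\<eta> k j) ((T * a) \<cdot> \<eta> k j))"
    and tr: "\<And>k x. x \<in> rvn \<Longrightarrow> \<bar>(\<Sum>j\<in>I k. inner (\<eta> k j) (x \<cdot> \<eta> k j)) - inner vac (x \<cdot> vac)\<bar> \<le> (1 / Suc k) * norm x"
    unfolding Pr_def by blast+
  define \<psi> where "\<psi> k T = (\<Sum>j\<in>I k. inner (\<eta> k j) (T \<cdot> \<eta> k j))" for k T
  have cs: "(\<psi> k (star S * T))\<^sup>2 \<le> \<psi> k (star S * S) * (norm T)\<^sup>2" for k S T
  proof -
    have "\<bar>\<psi> k (star S * T)\<bar> \<le> (\<Sum>j\<in>I k. norm (S \<cdot> \<eta> k j) * (norm T * norm (\<eta> k j)))"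
      unfolding \<psi>_def
    proof (rule order_trans[OF sum_abs sum_mono])
      fix j
      have "\<bar>inner (\<eta> k j) ((star S * T) \<cdot> \<eta> k j)\<bar> = \<bar>inner (S \<cdot> \<eta> k j) (T \<cdot> \<eta> k j)\<bar>" by (simp add: inner_star)
      also have "\<dots> \<le> norm (S \<cdot> \<eta> k j) * norm (T \<cdot> \<eta> k j)" by (rule Cauchy_Schwarz_ineq2)
      also have "\<dots> \<le> norm (S \<cdot> \<eta> k j) * (norm T * norm (\<eta> k j))" by (intro mult_left_mono norm_ap) auto
      finally show "\<bar>inner (\<eta> k j) ((star S * T) \<cdot> \<eta> k j)\<bar> \<le> norm (S \<cdot> \<eta> k j) * (norm T * norm (\<eta> k j))" .
    qed
    then have "\<bar>\<psi> k (star S * T)\<bar>\<^sup>2 \<le> (\<Sum>j\<in>I k. norm (S \<cdot> \<eta> k j) * (norm T * norm (\<eta> k j)))\<^sup>2"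
      by (intro power_mono) auto
    also have "\<dots> \<le> (\<Sum>j\<in>I k. (norm (S \<cdot> \<eta> k j))\<^sup>2) * (\<Sum>j\<in>I k. (norm T * norm (\<eta> k j))\<^sup>2)"
      by (rule Cauchy_Schwarz_ineq_sum)
    also have "(\<Sum>j\<in>I k. (norm T * norm (\<eta> k j))\<^sup>2) = (norm T)\<^sup>2 * (\<Sum>j\<in>I k. (norm (\<eta> k j))\<^sup>2)"
      by (simp add: power_mult_distrib sum_distrib_left)
    also have "(\<Sum>j\<in>I k. (norm (S \<cdot> \<eta> k j))\<^sup>2) * \<dots> \<le> (\<Sum>j\<in>I k. (norm (S \<cdot> \<eta> k j))\<^sup>2) * ((norm T)\<^sup>2 * 1)"
      by (intro mult_left_mono \<eta> sum_nonneg) auto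
    also have "(\<Sum>j\<in>I k. (norm (S \<cdot> \<eta> k j))\<^sup>2) = \<psi> k (star S * S)"
      unfolding \<psi>_def by (intro sum.cong refl) (simp add: power2_norm_eq_inner inner_star)
    finally show ?thesis by simp
  qed
  have \<psi>_norm: "\<bar>\<psi> k T\<bar> \<le> norm T" for k T
  proof (rule power2_le_imp_le)
    have "\<psi> k 1 \<le> 1" using \<eta>[of k] by (simp add: \<psi>_def power2_norm_eq_inner)
    then have "\<psi> k 1 * (norm T)\<^sup>2 \<le> 1 * (norm T)\<^sup>2" by (intro mult_right_mono) auto
    then show "\<bar>\<psi> k T\<bar>\<^sup>2 \<le> (norm T)\<^sup>2" using cs[of k 1 T] by simp
  qed simp
  then have "\<exists>l. ((\<lambda>k. \<psi> k T) \<longlongrightarrow> l) ultra" for T by (rule ultra_convergent)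
  then obtain \<phi> where \<phi>: "\<And>T. ((\<lambda>k. \<psi> k T) \<longlongrightarrow> \<phi> T) ultra" by metis
  have eqI: "\<phi> T = l" if "((\<lambda>k. \<psi> k T) \<longlongrightarrow> l) ultra" for T l
    using tendsto_unique[OF ultra(1) \<phi> that] .
  have \<psi>_lin: "\<psi> k (S + T) = \<psi> k S + \<psi> k T" "\<psi> k (x *\<^sub>R T) = x * \<psi> k T" for k S T x
    by (simp_all add: \<psi>_def ap_simps inner_add_right sum.distrib sum_distrib_left)
  have \<phi>_add: "\<phi> (S + T) = \<phi> S + \<phi> T" for S T
    by (rule eqI) (simp add: \<psi>_lin, intro tendsto_intros \<phi>)
  have \<phi>_scale: "\<phi> (x *\<^sub>R T) = x * \<phi> T" for x T
    by (rule eqI) (simp add: \<psi>_lin, intro tendsto_intros \<phi>)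
  have \<phi>_diff: "\<phi> (S - T) = \<phi> S - \<phi> T" for S T
    using \<phi>_add[of "S - T" T] by simp
  have \<phi>_norm: "\<bar>\<phi> T\<bar> \<le> norm T" for T
    by (rule tendsto_upperbound[OF tendsto_rabs[OF \<phi>]]) (use \<psi>_norm in auto)
  have \<phi>_trace: "\<phi> x = inner vac (x \<cdot> vac)" if x: "x \<in> rvn" for x
  proof (rule eqI, rule tendsto_ultra, rule LIM_zero_cancel, rule Lim_null_comparison)
    show "\<forall>\<^sub>F k in sequentially. norm (\<psi> k x - inner vac (x \<cdot> vac)) \<le> (1 / Suc k) * norm x"
      using tr[OF x] by (simp add: \<psi>_def)
    have "(\<lambda>k. (1 / Suc k) * norm x) \<longlonglongrightarrow> 0 * norm x"
      by (intro tendsto_intros LIMSEQ_Suc lim_1_over_n)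
    then show "(\<lambda>k. (1 / Suc k) * norm x) \<longlonglongrightarrow> 0" by simp
  qed
  have \<phi>_cs: "(\<phi> (star S * T))\<^sup>2 \<le> \<phi> (star S * S) * (norm T)\<^sup>2" for S T
    by (rule tendsto_le[OF ultra(1), of "\<lambda>k. \<psi> k (star S * S) * (norm T)\<^sup>2" _ "\<lambda>k. (\<psi> k (star S * T))\<^sup>2"])
      (intro tendsto_intros \<phi> always_eventually allI cs)+
  have \<psi>_star: "\<psi> k (star T) = \<psi> k T" for k T
    unfolding \<psi>_def by (intro sum.cong refl) (metis inner_commute inner_star)
  have \<phi>_star: "\<phi> (star T) = \<phi> T" for T
    by (rule eqI) (simp add: \<psi>_star \<phi>)
  have small: "\<bar>\<phi> (a * T)\<bar> \<le> norm (a \<cdot> vac) * norm T" "\<bar>\<phi> (T * a)\<bar> \<le> norm (a \<cdot> vac) * norm T"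
    if a: "a \<in> rvn" for a T
  proof -
    have gen: "\<bar>\<phi> (star x * T)\<bar> \<le> norm (x \<cdot> vac) * norm T" if x: "x \<in> rvn" for x T
    proof (rule power2_le_imp_le)
      have "\<phi> (star x * x) = (norm (x \<cdot> vac))\<^sup>2"
        using x by (subst \<phi>_trace) (auto intro!: rvn_simps star_rvn simp: power2_norm_eq_inner inner_star)
      then show "\<bar>\<phi> (star x * T)\<bar>\<^sup>2 \<le> (norm (x \<cdot> vac) * norm T)\<^sup>2"
        using \<phi>_cs[of x T] by (simp add: power_mult_distrib)
    qed simp
    show "\<bar>\<phi> (a * T)\<bar> \<le> norm (a \<cdot> vac) * norm T"
      using gen[OF star_rvn[OF a], of T] by (simp add: norm_star_vac[OF a])
    show "\<bar>\<phi> (T * a)\<bar> \<le> norm (a \<cdot> vac) * norm T"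
      using gen[OF a, of "star T"] \<phi>_star[of "T * a"] by simp
  qed
  have central: "\<phi> (a * T) = \<phi> (T * a)" if a: "a \<in> Q" for a T
  proof -
    have "\<bar>\<phi> (a * T) - \<phi> (T * a)\<bar> \<le> 0 + \<epsilon>" if \<epsilon>: "0 < \<epsilon>" for \<epsilon>
    proof -
      \<comment> \<open>The summand 1 keeps the denominator positive when \<open>T\<close> is
        0.\<close>
      define \<epsilon>' where "\<epsilon>' = \<epsilon> / (2 * norm T + 1)"
      have e': "0 < \<epsilon>'" using \<epsilon> by (simp add: \<epsilon>'_def add_nonneg_pos)
      obtain k b where b: "b \<in> F k" "norm ((a - b) \<cdot> vac) < \<epsilon>'" using dense[OF a e'] by blast
      have Fk: "F k \<subseteq> F n" if "k \<le> n" for n using that inc by (rule lift_Suc_mono_le[rotated]) 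
      have "\<phi> (b * T) = \<phi> (T * b)"
      proof (rule eqI)
        have "\<psi> n (T * b) = \<psi> n (b * T)" if "k \<le> n" for n
          using cen[OF subsetD[OF Fk[OF that] b(1)], of T] by (simp only: \<psi>_def)
        then have "\<forall>\<^sub>F n in sequentially. \<psi> n (T * b) = \<psi> n (b * T)"
          by (auto simp: eventually_sequentially)
        then have "\<forall>\<^sub>F n in ultra. \<psi> n (T * b) = \<psi> n (b * T)" by (rule filter_leD[OF ultra(2)])
        then show "((\<lambda>n. \<psi> n (b * T)) \<longlongrightarrow> \<phi> (T * b)) ultra"
          by (rule Lim_transform_eventually[OF \<phi>])
      qed
      then have "\<phi> (a * T) - \<phi> (T * a) = \<phi> ((a - b) * T) - \<phi> (T * (a - b))"
        by (simp add: algebra_simps \<phi>_diff)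
      moreover have "a - b \<in> rvn"
        using a Q subsetD[OF F(1) b(1)] by (intro rvn_simps(3)) auto
      ultimately have "\<bar>\<phi> (a * T) - \<phi> (T * a)\<bar> \<le> 2 * (norm ((a - b) \<cdot> vac) * norm T)"
        using small[of "a - b" T] by linarith
      also have "\<dots> \<le> 2 * (\<epsilon>' * norm T)" using b(2) by (intro mult_left_mono mult_right_mono) auto
      also have "\<dots> \<le> \<epsilon>' * (2 * norm T + 1)" using e' by (simp add: algebra_simps)
      also have "\<dots> = \<epsilon>" by (simp add: \<epsilon>'_def add_nonneg_pos less_imp_neq[THEN not_sym])
      finally show ?thesis by simp
    qed
    then have "\<bar>\<phi> (a * T) - \<phi> (T * a)\<bar> \<le> 0" by (rule field_le_epsilon)
    then show ?thesis by simp
  qed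
  have "hypertrace Q \<phi>"
    unfolding hypertrace_def using \<phi>_add \<phi>_scale \<phi>_norm central \<phi>_trace by blast
  then show ?thesis by blast
qed

end


section \<open>Averaging over commuting unitaries\<close>

lemma commutant_wlim_eventually:
  assumes ev: "\<forall>\<^sub>F n in sequentially. X n * A = A * X n" and L: "wlim X L"
  shows "L * A = A * L"
proof (rule endo_eqI, rule inner_eqI)
  fix g f
  have ev': "\<forall>\<^sub>F n in ultra. inner f ((X n * A) \<cdot> g) = inner f ((A * X n) \<cdot> g)"
    by (rule filter_leD[OF ultra(2)]) (rule eventually_mono[OF ev], simp)
  have "((\<lambda>n. inner f ((A * X n) \<cdot> g)) \<longlongrightarrow> inner f ((L * A) \<cdot> g)) ultra"
    using wlimD[OF wlim_mult_right[OF L]] ev' by (rule Lim_transform_eventually)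
  then show "inner f ((L * A) \<cdot> g) = inner f ((A * L) \<cdot> g)"
    using wlimD[OF wlim_mult_left[OF L]] tendsto_unique[OF ultra(1)] by blast
qed

section \<open>Averaging over the powers of one unitary\<close>

definition cesaro :: "'a::{real_inner,banach} endo \<Rightarrow> 'a endo \<Rightarrow> nat \<Rightarrow> 'a endo" where
  "cesaro u T m = (1 / Suc m) *\<^sub>R (\<Sum>k\<le>m. star u ^ k * T * u ^ k)"

definition avg1 :: "'a::{real_inner,banach} endo \<Rightarrow> 'a endo \<Rightarrow> 'a endo" where
  "avg1 u T = ulim (cesaro u T)"

definition unitary :: "'a::{real_inner,banach} endo \<Rightarrow> bool" where
  "unitary u \<longleftrightarrow> star u * u = 1 \<and> u * star u = 1"

lemma norm_unitary:
  assumes "unitary u"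
  shows "norm (u \<cdot> f) = norm f"
proof -
  have "inner (u \<cdot> f) (u \<cdot> f) = inner f ((star u * u) \<cdot> f)" by (simp add: inner_star)
  also have "star u * u = 1" using assms by (simp add: unitary_def)
  finally show ?thesis by (simp add: norm_eq_sqrt_inner)
qed

lemma norm_unitary_le: "unitary u \<Longrightarrow> norm u \<le> 1"
  by (rule endo_bound) (auto simp: norm_unitary)

lemma commute_star_unitary:
  assumes u: "unitary u" and T: "T * u = u * T"
  shows "T * star u = star u * T"
proof -
  have "T * star u = star u * (u * T) * star u" using u by (simp add: unitary_def mult.assoc[symmetric])
  also have "\<dots> = star u * T * (u * star u)" by (simp add: T[symmetric] mult.assoc)
  finally show ?thesis using u by (simp add: unitary_def)
qed

lemma star_power: "star (u ^ k) = star u ^ k"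
  by (induction k) (simp_all add: power_commutes)

lemma norm_power_unitary: "unitary u \<Longrightarrow> norm (u ^ k) \<le> 1"
proof (induction k)
  case (Suc k)
  have "norm (u * u ^ k) \<le> norm u * norm (u ^ k)" by (rule norm_mult_ineq)
  also have "\<dots> \<le> 1 * 1" using Suc norm_unitary_le[of u] by (intro mult_mono) auto
  finally show ?case by simp
qed (simp add: norm_one_endo)

lemma norm_conj_power:
  assumes u: "unitary u"
  shows "norm (star u ^ k * T * u ^ k) \<le> norm T"
proof -
  have "norm (star u ^ k * T * u ^ k) \<le> norm (star u ^ k) * norm T * norm (u ^ k)"
    by (meson norm_mult_ineq mult_right_mono norm_ge_zero order_trans)
  also have "\<dots> \<le> 1 * norm T * 1"
    using norm_power_unitary[OF u, of k] norm_star[of "u ^ k"]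
    by (intro mult_mono) (auto simp: star_power)
  finally show ?thesis by simp
qed

lemma norm_cesaro:
  assumes u: "unitary u"
  shows "norm (cesaro u T m) \<le> norm T"
proof -
  have "norm (\<Sum>k\<le>m. star u ^ k * T * u ^ k) \<le> (\<Sum>k\<le>m. norm T)"
    by (rule order_trans[OF norm_sum sum_mono]) (rule norm_conj_power[OF u])
  also have "\<dots> = Suc m * norm T" by simp
  finally show ?thesis by (simp add: cesaro_def field_simps)
qed

context
  fixes u :: "'a::{real_inner,banach} endo"
  assumes u: "unitary u"
begin

lemma avg1_wlim: "wlim (cesaro u T) (avg1 u T)" and norm_avg1: "norm (avg1 u T) \<le> norm T"
  unfolding avg1_def using ulim[of "cesaro u T", OF norm_cesaro[OF u]] by auto

lemma avg1_eqI: "wlim (cesaro u T) S \<Longrightarrow> avg1 u T = S"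
  using avg1_wlim wlim_unique by blast

lemma avg1_add: "avg1 u (S + T) = avg1 u S + avg1 u T"
proof (rule avg1_eqI)
  have "cesaro u (S + T) = (\<lambda>m. cesaro u S m + cesaro u T m)"
    by (simp add: cesaro_def fun_eq_iff algebra_simps sum.distrib)
  then show "wlim (cesaro u (S + T)) (avg1 u S + avg1 u T)" by (simp add: wlim_add[OF avg1_wlim avg1_wlim])
qed

lemma avg1_left:
  assumes "a * u = u * a"
  shows "avg1 u (a * T) = a * avg1 u T"
proof (rule avg1_eqI)
  have c: "a * star u = star u * a" by (rule commute_star_unitary[OF u assms])
  have "star u ^ k * a = a * star u ^ k" for k using c by (metis power_commuting_commutes)
  then have "star u ^ k * (a * T) * u ^ k = a * (star u ^ k * T * u ^ k)" for k by (metis mult.assoc)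
  then have "cesaro u (a * T) = (\<lambda>m. a * cesaro u T m)"
    by (simp add: cesaro_def fun_eq_iff sum_distrib_left)
  then show "wlim (cesaro u (a * T)) (a * avg1 u T)" by (simp add: wlim_mult_left[OF avg1_wlim])
qed

lemma avg1_fixed:
  assumes "T * u = u * T"
  shows "avg1 u T = T"
proof (rule avg1_eqI)
  have "star u ^ k * T * u ^ k = T" for k
  proof (induction k)
    case (Suc k)
    have "star u ^ Suc k * T * u ^ Suc k = star u ^ k * (star u * (T * u)) * u ^ k"
      by (simp only: power_Suc[of u] power_Suc2[of "star u"] mult.assoc)
    also have "star u * (T * u) = T" using u assms by (simp add: unitary_def mult.assoc[symmetric])
    finally show ?case using Suc by simp
  qed simp
  then have "cesaro u T = (\<lambda>m. T)" by (simp add: cesaro_def fun_eq_iff sum_constant_scaleR)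
  then show "wlim (cesaro u T) T" by (simp add: wlim_const)
qed

text \<open>Conjugation by \<open>u\<close> changes a Cesaro mean only by its two end terms, which
  are divided by the length.\<close>

lemma avg1_commute: "avg1 u T * u = u * avg1 u T"
proof -
  have diff: "cesaro u T m - star u * cesaro u T m * u = (1 / Suc m) *\<^sub>R (T - star u ^ Suc m * T * u ^ Suc m)" for m
  proof -
    define f where "f k = star u ^ k * T * u ^ k" for k
    have "star u * f k * u = f (Suc k)" for k
      by (simp only: f_def power_Suc[of "star u"] power_Suc2[of u] mult.assoc)
    moreover have cf: "cesaro u T m = (1 / Suc m) *\<^sub>R (\<Sum>k\<le>m. f k)" by (simp only: cesaro_def f_def)
    ultimately have "star u * cesaro u T m * u = (1 / Suc m) *\<^sub>R (\<Sum>k\<le>m. f (Suc k))"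
      by (simp only: mult_scaleR_left mult_scaleR_right sum_distrib_left sum_distrib_right)
    then have "cesaro u T m - star u * cesaro u T m * u = (1 / Suc m) *\<^sub>R (\<Sum>k\<le>m. f k - f (Suc k))"
      by (simp only: cf scaleR_diff_right[symmetric] sum_subtractf)
    then have "cesaro u T m - star u * cesaro u T m * u = (1 / Suc m) *\<^sub>R (f 0 - f (Suc m))"
      by (simp only: sum_telescope[of f m])
    then show ?thesis by (simp add: f_def)
  qed
  have "norm (cesaro u T m - star u * cesaro u T m * u) \<le> (1 / Suc m) * (norm T + norm T)" for m
  proof -
    have "norm (T - star u ^ Suc m * T * u ^ Suc m) \<le> norm T + norm T"
      using norm_triangle_ineq4[of T "star u ^ Suc m * T * u ^ Suc m"] norm_conj_power[OF u, of "Suc m" T]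
      by linarith
    then have "\<bar>1 / Suc m\<bar> * norm (T - star u ^ Suc m * T * u ^ Suc m) \<le> \<bar>1 / Suc m\<bar> * (norm T + norm T)"
      by (rule mult_left_mono) (rule abs_ge_zero)
    then show ?thesis unfolding diff norm_scaleR by (simp only: abs_of_nonneg of_nat_0_le_iff zero_le_divide_1_iff)
  qed
  then have ev: "\<forall>\<^sub>F m in sequentially. norm (cesaro u T m - star u * cesaro u T m * u) \<le> (1 / Suc m) * (norm T + norm T)"
    by (intro always_eventually allI)
  have "(\<lambda>m. (1 / Suc m) * (norm T + norm T)) \<longlonglongrightarrow> 0 * (norm T + norm T)"
    by (intro tendsto_intros LIMSEQ_Suc lim_1_over_n)
  then have "(\<lambda>m. (1 / Suc m) * (norm T + norm T)) \<longlonglongrightarrow> 0" by (simp only: mult_zero_left)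
  with ev have "(\<lambda>m. cesaro u T m - star u * cesaro u T m * u) \<longlonglongrightarrow> 0"
    by (rule Lim_null_comparison)
  then have "wlim (\<lambda>m. cesaro u T m - star u * cesaro u T m * u) 0" by (rule tendsto_imp_wlim)
  moreover have "wlim (\<lambda>m. cesaro u T m - star u * cesaro u T m * u) (avg1 u T - star u * avg1 u T * u)"
    by (intro wlim_diff wlim_mult_right wlim_mult_left avg1_wlim)
  ultimately have "avg1 u T - star u * avg1 u T * u = 0" by (metis wlim_unique)
  then have "avg1 u T = star u * (avg1 u T * u)" by (simp add: mult.assoc)
  then have "u * avg1 u T = (u * star u) * (avg1 u T * u)" by (metis mult.assoc)
  then show ?thesis using u by (simp add: unitary_def)
qed

lemma avg1_preserves:
  assumes "T * A = A * T" "A * u = u * A"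
  shows "avg1 u T * A = A * avg1 u T"
proof -
  have su: "A * star u = star u * A" by (rule commute_star_unitary[OF u assms(2)])
  have pA: "u ^ k * A = A * u ^ k" "star u ^ k * A = A * star u ^ k" for k
    using assms(2) su by (metis power_commuting_commutes)+
  have "star u ^ k * T * u ^ k * A = A * (star u ^ k * T * u ^ k)" for k
  proof -
    have "star u ^ k * T * u ^ k * A = star u ^ k * (T * A) * u ^ k" by (simp add: mult.assoc pA(1))
    also have "\<dots> = (star u ^ k * A) * T * u ^ k" by (simp add: assms(1) mult.assoc)
    finally show ?thesis by (simp add: pA(2) mult.assoc)
  qed
  then have "cesaro u T m * A = A * cesaro u T m" for m
    by (simp add: cesaro_def sum_distrib_left sum_distrib_right)
  then show ?thesis by (intro commutant_wlim_eventually[OF _ avg1_wlim]) simp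
qed

end

section \<open>Averaging over a sequence of commuting unitaries\<close>

primrec avgs :: "(nat \<Rightarrow> 'a::{real_inner,banach} endo) \<Rightarrow> 'a endo \<Rightarrow> nat \<Rightarrow> 'a endo" where
  "avgs us T 0 = T"
| "avgs us T (Suc m) = avg1 (us m) (avgs us T m)"

text \<open>Because the unitaries commute, later averages preserve commutation with the earlier
  ones, so the limit commutes with all of them.\<close>

definition avg :: "(nat \<Rightarrow> 'a::{real_inner,banach} endo) \<Rightarrow> 'a endo \<Rightarrow> 'a endo" where
  "avg us T = ulim (avgs us T)"

context
  fixes us :: "nat \<Rightarrow> 'a::{real_inner,banach} endo"
  assumes us: "\<And>n. unitary (us n)" and comm: "\<And>m n. us m * us n = us n * us m"
begin

lemma norm_avgs: "norm (avgs us T m) \<le> norm T"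
  by (induction m) (auto intro: order_trans[OF norm_avg1[OF us]])

lemma avg_wlim: "wlim (avgs us T) (avg us T)" and norm_avg: "norm (avg us T) \<le> norm T"
  unfolding avg_def using ulim[of "avgs us T", OF norm_avgs] by auto

lemma avg_eqI: "wlim (avgs us T) S \<Longrightarrow> avg us T = S"
  using avg_wlim wlim_unique by blast

lemma avg_add: "avg us (S + T) = avg us S + avg us T"
proof (rule avg_eqI)
  have "avgs us (S + T) m = avgs us S m + avgs us T m" for m by (induction m) (auto simp: avg1_add[OF us])
  then have "avgs us (S + T) = (\<lambda>m. avgs us S m + avgs us T m)" by (rule ext)
  then show "wlim (avgs us (S + T)) (avg us S + avg us T)" by (simp add: wlim_add[OF avg_wlim avg_wlim])
qed

lemma avg_left:
  assumes "\<And>n. a * us n = us n * a"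
  shows "avg us (a * T) = a * avg us T"
proof (rule avg_eqI)
  have "avgs us (a * T) m = a * avgs us T m" for m by (induction m) (auto simp: avg1_left[OF us assms])
  then have "avgs us (a * T) = (\<lambda>m. a * avgs us T m)" by (rule ext)
  then show "wlim (avgs us (a * T)) (a * avg us T)" by (simp add: wlim_mult_left[OF avg_wlim])
qed

lemma avg_fixed:
  assumes "\<And>n. T * us n = us n * T"
  shows "avg us T = T"
proof (rule avg_eqI)
  have "avgs us T m = T" for m by (induction m) (auto simp: avg1_fixed[OF us assms])
  then have "avgs us T = (\<lambda>m. T)" by (rule ext)
  then show "wlim (avgs us T) T" by (simp add: wlim_const)
qed

lemma avg_commute: "avg us T * us n = us n * avg us T"
proof (rule commutant_wlim_eventually[OF _ avg_wlim])
  have "avgs us T (Suc n + k) * us n = us n * avgs us T (Suc n + k)" for k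
    by (induction k) (auto simp: avg1_commute[OF us] avg1_preserves[OF us _ comm])
  then have "avgs us T m * us n = us n * avgs us T m" if "Suc n \<le> m" for m
    using that le_Suc_ex by blast
  then show "\<forall>\<^sub>F m in sequentially. avgs us T m * us n = us n * avgs us T m"
    by (auto simp: eventually_sequentially)
qed

lemma avg_preserves:
  assumes "T * A = A * T" "\<And>n. A * us n = us n * A"
  shows "avg us T * A = A * avg us T"
proof (rule commutant_wlim_eventually[OF _ avg_wlim])
  have "avgs us T m * A = A * avgs us T m" for m
    by (induction m) (auto simp: assms(1) avg1_preserves[OF us _ assms(2)])
  then show "\<forall>\<^sub>F m in sequentially. avgs us T m * A = A * avgs us T m" by simp
qed

end


section \<open>Passing to square-summable sequences\<close>

text \<open>An enumeration of \<open>X\<close> identifies \<open>ell2 X\<close> with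
  \<open>complex l2\<close>; as \<open>X\<close> is infinite, it is a bijection with the natural
  numbers.\<close>

locale ell2_transport =
  fixes X :: "'x set"
  assumes countable_X: "countable X" and infinite_X: "infinite X"
begin

definition b :: "nat \<Rightarrow> 'x" where "b = from_nat_into X"

definition ix :: "'x \<Rightarrow> nat" where "ix = to_nat_on X"

lemma b: "b n \<in> X" "ix (b n) = n" "x \<in> X \<Longrightarrow> b (ix x) = x" "inj b"
  unfolding b_def ix_def using countable_X infinite_X
  by (auto simp: from_nat_into_to_nat_on from_nat_into to_nat_on_from_nat_into_infinite inj_on_def
      infinite_imp_nonempty)

lemma bij_b: "bij_betw b UNIV X"
  using b by (auto simp: bij_betw_def image_iff) metis

definition down_v :: "complex l2 \<Rightarrow> 'x \<Rightarrow> complex" where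
  "down_v h = (\<lambda>x. if x \<in> X then coord h (ix x) else 0)"

definition up_v :: "('x \<Rightarrow> complex) \<Rightarrow> complex l2" where
  "up_v f = mk_l2 (\<lambda>n. f (b n))"

lemma summable_on_nat_iff: "(\<lambda>n. (cmod (g n))\<^sup>2) summable_on UNIV \<longleftrightarrow> summable (\<lambda>n. (cmod (g n))\<^sup>2)"
  for g :: "nat \<Rightarrow> complex"
  by (rule summable_on_UNIV_nonneg_real_iff) simp

lemma ell2_iff: "f \<in> ell2 X \<longleftrightarrow> (\<forall>x. x \<notin> X \<longrightarrow> f x = 0) \<and> summable (\<lambda>n. (cmod (f (b n)))\<^sup>2)"
  using summable_on_reindex_bij_betw[OF bij_b, of "\<lambda>x. (cmod (f x))\<^sup>2"]
  by (simp add: ell2_def summable_on_nat_iff)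

lemma infsum_X:
  fixes g :: "'x \<Rightarrow> 'b::banach"
  assumes z: "\<And>x. x \<notin> X \<Longrightarrow> g x = 0" and s: "summable (\<lambda>n. norm (g (b n)))"
  shows "infsum g UNIV = (\<Sum>n. g (b n))"
proof -
  have "infsum g UNIV = infsum g X" using z by (intro infsum_cong_neutral) auto
  also have "\<dots> = infsum (\<lambda>n. g (b n)) UNIV" by (rule infsum_reindex_bij_betw[OF bij_b, symmetric])
  also have "\<dots> = (\<Sum>n. g (b n))"
    by (rule infsumI, rule norm_summable_imp_has_sum[OF s]) (rule summable_sums, rule summable_norm_cancel[OF s])
  finally show ?thesis .
qed

lemma coord_up: "f \<in> ell2 X \<Longrightarrow> coord (up_v f) n = f (b n)"
  by (simp add: up_v_def ell2_iff mk_l2_inverse)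

lemma up_down [simp]: "up_v (down_v h) = h"
proof (rule l2_eqI)
  have "down_v h \<in> ell2 X" using summable_coord[of h] by (auto simp: ell2_iff down_v_def b)
  then show "coord (up_v (down_v h)) n = coord h n" for n by (simp add: coord_up) (simp add: down_v_def b)
qed

lemma down_ell2 [simp]: "down_v h \<in> ell2 X"
  using summable_coord[of h] by (auto simp: ell2_iff down_v_def b)

lemma down_up [simp]: "f \<in> ell2 X \<Longrightarrow> down_v (up_v f) = f"
  by (auto simp: down_v_def fun_eq_iff coord_up b ell2_iff)

section \<open>Complex scalars as real linear operators\<close>

definition csc :: "complex \<Rightarrow> complex l2 endo" where
  "csc a = endo_of (\<lambda>f. mk_l2 (\<lambda>n. a * coord f n))"

lemma coord_csc: "coord (csc a \<cdot> f) n = a * coord f n"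
proof -
  define m where "m f = mk_l2 (\<lambda>n. a * coord f n)" for f
  have "(\<Sum>n<p. (norm (a * coord f n))\<^sup>2) \<le> (norm a * norm f)\<^sup>2" for p f
  proof -
    have "(\<Sum>n<p. (norm (a * coord f n))\<^sup>2) = (norm a)\<^sup>2 * (\<Sum>n<p. (norm (coord f n))\<^sup>2)"
      by (simp add: norm_mult power_mult_distrib sum_distrib_left)
    also have "\<dots> \<le> (norm a)\<^sup>2 * (norm f)\<^sup>2" by (intro mult_left_mono sum_coord_le) auto
    finally show ?thesis by (simp add: power_mult_distrib)
  qed
  from mk_l2_bounded[OF this] have m: "coord (m f) n = a * coord f n" "norm (m f) \<le> norm a * norm f" for f n
    by (auto simp: m_def fun_eq_iff)
  have "bounded_linear m"
  proof (rule bounded_linear_intro)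
    show "m (f + g) = m f + m g" for f g by (rule l2_eqI) (simp add: m(1) distrib_left)
    show "m (r *\<^sub>R f) = r *\<^sub>R m f" for r f by (rule l2_eqI) (simp add: m(1))
    show "norm (m f) \<le> norm f * norm a" for f using m(2)[of f] by (simp add: mult.commute)
  qed
  then have "csc a \<cdot> f = m f" unfolding csc_def m_def by (rule ap_endo_of)
  then show ?thesis by (simp add: m)
qed

definition ii :: "complex l2 endo" where "ii = csc \<i>"

lemma csc_alg: "csc a * csc c = csc (a * c)" "csc 1 = 1" "csc (of_real r) = r *\<^sub>R 1" "csc a + csc c = csc (a + c)"
  by (auto intro!: endo_eqI l2_eqI simp: coord_csc ap_simps algebra_simps scaleR_conv_of_real)

lemma csc_decomp: "csc a = Re a *\<^sub>R 1 + Im a *\<^sub>R ii"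
  by (intro endo_eqI l2_eqI) (simp add: ii_def coord_csc ap_simps complex_eq_iff)

lemma star_csc: "star (csc a) = csc (cnj a)"
  by (rule star_eqI) (auto simp: inner_l2_def coord_csc inner_complex_def algebra_simps)

lemma ii: "ii * ii = -1" "star ii = - ii"
  using csc_alg(3)[of "- 1"] by (auto simp: ii_def csc_alg star_csc intro!: endo_eqI l2_eqI simp: coord_csc ap_simps)

definition clin :: "complex l2 endo set" where "clin = commutant {ii}"

lemma csc_clin: "t \<in> clin \<Longrightarrow> t * csc a = csc a * t"
  by (simp add: csc_decomp clin_def commutant_def algebra_simps)

lemma up_lin:
  assumes "f \<in> ell2 X" "g \<in> ell2 X"
  shows "(\<lambda>x. a * f x + c * g x) \<in> ell2 X"
    and "up_v (\<lambda>x. a * f x + c * g x) = csc a \<cdot> up_v f + csc c \<cdot> up_v g"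
proof -
  let ?h = "csc a \<cdot> up_v f + csc c \<cdot> up_v g"
  have eq: "down_v ?h = (\<lambda>x. a * f x + c * g x)"
    using assms by (auto simp: down_v_def fun_eq_iff coord_csc coord_up b ell2_iff)
  show "(\<lambda>x. a * f x + c * g x) \<in> ell2 X" using down_ell2[of ?h] by (simp add: eq)
  show "up_v (\<lambda>x. a * f x + c * g x) = ?h" using up_down[of ?h] by (simp only: eq)
qed

lemma down_lin: "down_v (csc a \<cdot> f + csc c \<cdot> g) = (\<lambda>x. a * down_v f x + c * down_v g x)"
  by (auto simp: down_v_def fun_eq_iff coord_csc)

lemma ell2_norm_up: "f \<in> ell2 X \<Longrightarrow> ell2_norm f = norm (up_v f)"
  unfolding ell2_norm_def norm_eq_sqrt_inner inner_l2_def
  by (subst infsum_X) (auto simp: ell2_iff coord_up power2_norm_eq_inner[symmetric])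

text \<open>The complex inner product is conjugate linear in its first argument, which is therefore
  where \<open>ii\<close> stands in the imaginary part.\<close>

lemma ell2_inner_up:
  assumes f: "f \<in> ell2 X" and g: "g \<in> ell2 X"
  shows "ell2_inner f g = Complex (inner (up_v f) (up_v g)) (inner (ii \<cdot> up_v f) (up_v g))"
proof -
  have "summable (\<lambda>n. norm (cnj (f (b n)) * g (b n)))"
  proof (rule summable_comparison_test')
    show "summable (\<lambda>n. (cmod (f (b n)))\<^sup>2 + (cmod (g (b n)))\<^sup>2)"
      using f g by (intro summable_add) (auto simp: ell2_iff)
    fix n
    have "cmod (f (b n)) * cmod (g (b n)) \<le> (cmod (f (b n)))\<^sup>2 + (cmod (g (b n)))\<^sup>2"
      using sum_squares_bound[of "cmod (f (b n))" "cmod (g (b n))"]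
        mult_nonneg_nonneg[OF norm_ge_zero[of "f (b n)"] norm_ge_zero[of "g (b n)"]]
      by linarith
    then show "norm (norm (cnj (f (b n)) * g (b n))) \<le> (cmod (f (b n)))\<^sup>2 + (cmod (g (b n)))\<^sup>2"
      by (simp add: norm_mult)
  qed
  then have e: "ell2_inner f g = (\<Sum>n. cnj (f (b n)) * g (b n))" "summable (\<lambda>n. cnj (f (b n)) * g (b n))"
    unfolding ell2_inner_def using f by (auto intro!: infsum_X summable_norm_cancel simp: ell2_iff)
  have "Re (ell2_inner f g) = inner (up_v f) (up_v g)"
    unfolding e Re_suminf[OF e(2)] inner_l2_def using f g by (simp add: coord_up inner_complex_def)
  moreover have "Im (ell2_inner f g) = inner (ii \<cdot> up_v f) (up_v g)"
    unfolding e Im_suminf[OF e(2)] inner_l2_def using f g by (simp add: coord_up ii_def coord_csc inner_complex_def)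
  ultimately show ?thesis by (simp add: complex_eq_iff)
qed

section \<open>The correspondence between \<open>bounded_ops X\<close> and
  \<open>clin\<close>\<close>

definition up :: "'x operator \<Rightarrow> complex l2 endo" where "up T = endo_of (\<lambda>h. up_v (T (down_v h)))"

text \<open>Inverse to \<open>up\<close> between \<open>clin\<close> and
  \<open>bounded_ops X\<close>; the value 0 off \<open>ell2 X\<close> is the normalisation of
  bounded operators.\<close>

definition down :: "complex l2 endo \<Rightarrow> 'x operator" where
  "down t f = (if f \<in> ell2 X then down_v (t \<cdot> up_v f) else (\<lambda>x. 0))"

lemma real_lin_eq: "f + g = csc 1 \<cdot> f + csc 1 \<cdot> g" "r *\<^sub>R f = csc (of_real r) \<cdot> f + csc 0 \<cdot> f"
  by (auto intro!: l2_eqI simp: coord_csc scaleR_conv_of_real)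

lemma bounded_lin:
  assumes "T \<in> bounded_ops X" "f \<in> ell2 X" "g \<in> ell2 X"
  shows "T (\<lambda>x. a * f x + c * g x) = (\<lambda>x. a * T f x + c * T g x)"
  using assms unfolding bounded_ops_def by blast

lemma bounded_ell2: "T \<in> bounded_ops X \<Longrightarrow> f \<in> ell2 X \<Longrightarrow> T f \<in> ell2 X"
  unfolding bounded_ops_def by blast

lemma up_ap:
  assumes T: "T \<in> bounded_ops X"
  shows "up T \<cdot> h = up_v (T (down_v h))"
proof -
  note Te = bounded_ell2[OF T] and lin = bounded_lin[OF T]
  from T have "\<exists>C. \<forall>f\<in>ell2 X. ell2_norm (T f) \<le> C * ell2_norm f" unfolding bounded_ops_def by blast
  then obtain C where C: "\<And>f. f \<in> ell2 X \<Longrightarrow> ell2_norm (T f) \<le> C * ell2_norm f" by blast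
  define F where "F h = up_v (T (down_v h))" for h
  have Fl: "F (csc a \<cdot> f + csc c \<cdot> g) = csc a \<cdot> F f + csc c \<cdot> F g" for a c f g
    unfolding F_def down_lin by (simp add: lin up_lin Te)
  have "bounded_linear F"
  proof (rule bounded_linear_intro)
    show "F (f + g) = F f + F g" for f g
      using Fl[of 1 f 1 g] by (simp flip: real_lin_eq(1))
    show "F (r *\<^sub>R f) = r *\<^sub>R F f" for r f
      using Fl[of "of_real r" f 0 f] by (simp only: real_lin_eq(2)[symmetric])
    show "norm (F h) \<le> norm h * C" for h
      using C[of "down_v h"] by (simp add: F_def ell2_norm_up Te mult.commute)
  qed
  then show ?thesis unfolding up_def F_def by (rule ap_endo_of)
qed

lemma up_clin:
  assumes T: "T \<in> bounded_ops X"
  shows "up T \<in> clin"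
  unfolding clin_def
proof (rule commutantI, simp, rule endo_eqI)
  fix h
  have "up_v (T (down_v (csc \<i> \<cdot> h + csc 0 \<cdot> h))) = csc \<i> \<cdot> up_v (T (down_v h)) + csc 0 \<cdot> up_v (T (down_v h))"
    unfolding down_lin bounded_lin[OF T down_ell2 down_ell2]
    by (rule up_lin(2)) (simp_all add: bounded_ell2 T)
  moreover have "csc 0 \<cdot> k = 0" for k by (rule l2_eqI) (simp add: coord_csc)
  ultimately show "(up T * ii) \<cdot> h = (ii * up T) \<cdot> h" using T by (simp add: up_ap ii_def)
qed

lemma down_bounded:
  assumes t: "t \<in> clin"
  shows "down t \<in> bounded_ops X"
  unfolding bounded_ops_def
proof (intro CollectI conjI ballI allI impI)
  show "down t f \<in> ell2 X" if "f \<in> ell2 X" for f using that by (simp add: down_def)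
  show "down t f = (\<lambda>x. 0)" if "f \<notin> ell2 X" for f using that by (simp add: down_def)
  show "down t (\<lambda>x. a * f x + c * g x) = (\<lambda>x. a * down t f x + c * down t g x)"
    if "f \<in> ell2 X" "g \<in> ell2 X" for f g a c
  proof -
    have "t \<cdot> csc a \<cdot> h = csc a \<cdot> t \<cdot> h" for a h using csc_clin[OF t] by (metis ap_mult)
    then show ?thesis using that by (simp add: down_def up_lin ap_simps down_lin)
  qed
  show "\<exists>C. \<forall>f\<in>ell2 X. ell2_norm (down t f) \<le> C * ell2_norm f"
    by (rule exI[of _ "norm t"]) (auto simp: down_def ell2_norm_up norm_ap)
qed

lemma up_of_down: "t \<in> clin \<Longrightarrow> up (down t) = t"
  by (rule endo_eqI) (simp add: up_ap down_bounded, simp add: down_def)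

lemma down_of_up: "T \<in> bounded_ops X \<Longrightarrow> down (up T) = T"
  by (rule ext) (auto simp: down_def up_ap bounded_ops_def)

lemma up_up: "T \<in> bounded_ops X \<Longrightarrow> f \<in> ell2 X \<Longrightarrow> up T \<cdot> up_v f = up_v (T f)"
  by (simp add: up_ap)

lemma clin_alg: "s \<in> clin \<Longrightarrow> t \<in> clin \<Longrightarrow> s * t \<in> clin" "s \<in> clin \<Longrightarrow> t \<in> clin \<Longrightarrow> s + t \<in> clin"
  "1 \<in> clin" "csc a \<in> clin"
  by (auto simp: clin_def intro: commutant_mult commutant_add) (simp add: commutant_def ii_def csc_alg mult.commute)

lemma down_mult:
  assumes "s \<in> clin" "t \<in> clin"
  shows "down s \<circ> down t = down (s * t)"
proof
  fix f
  have d0: "down_v 0 = (\<lambda>x. 0)" by (auto simp: down_v_def fun_eq_iff)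
  then have "(\<lambda>x. 0) \<in> ell2 X" "up_v (\<lambda>x. 0) = 0" using down_ell2[of 0] up_down[of 0] by simp_all
  then show "(down s \<circ> down t) f = down (s * t) f" using d0 by (simp add: down_def)
qed

lemma down_lincomb:
  assumes "s \<in> clin" "t \<in> clin"
  shows "op_lincomb a (down s) c (down t) = down (csc a * s + csc c * t)"
  by (rule ext) (auto simp: op_lincomb_def down_def ap_simps down_lin)

lemma down_one: "op_id X = down 1"
  by (rule ext) (simp add: op_id_def down_def)

lemma star_clin: "t \<in> clin \<Longrightarrow> star t \<in> clin"
proof -
  assume "t \<in> clin"
  then have "star (t * ii) = star (ii * t)" by (simp add: clin_def commutant_def)
  then show ?thesis by (simp add: clin_def commutant_def ii)
qed

lemma is_adjoint_down:
  assumes "t \<in> clin"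
  shows "is_adjoint X (down (star t)) (down t)"
  unfolding is_adjoint_def
proof (intro conjI ballI)
  show "down (star t) \<in> bounded_ops X" by (intro down_bounded star_clin assms)
  fix f g assume f: "f \<in> ell2 X" and g: "g \<in> ell2 X"
  have "ii \<cdot> star t \<cdot> h = star t \<cdot> ii \<cdot> h" for h
    using star_clin[OF assms] by (metis ap_mult clin_def commutantD singletonI)
  then show "ell2_inner (down (star t) f) g = ell2_inner f (down t g)"
    using f g by (simp add: down_def ell2_inner_up inner_star)
qed

lemma is_adjoint_up:
  assumes "S \<in> bounded_ops X" "T \<in> bounded_ops X" "is_adjoint X S T"
  shows "up S = star (up T)"
proof -
  have "star (up S) = up T"
  proof (rule star_eqI)
    fix x y
    have "ell2_inner (S (down_v x)) (down_v y) = ell2_inner (down_v x) (T (down_v y))"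
      using assms(3) by (simp add: is_adjoint_def)
    then have "Re (ell2_inner (S (down_v x)) (down_v y)) = Re (ell2_inner (down_v x) (T (down_v y)))" by simp
    then show "inner (up S \<cdot> x) y = inner x (up T \<cdot> y)"
      using assms(1,2) by (simp add: ell2_inner_up bounded_ell2 up_ap)
  qed
  then show ?thesis by (metis star_star)
qed

lemma op_norm_up:
  assumes T: "T \<in> bounded_ops X"
  shows "op_norm X T = norm (up T)"
  unfolding op_norm_def
proof (rule antisym)
  have zero: "down_v 0 \<in> {f \<in> ell2 X. ell2_norm f \<le> 1}" by (simp add: ell2_norm_up)
  have le: "ell2_norm (T f) \<le> norm (up T)" if "f \<in> {f \<in> ell2 X. ell2_norm f \<le> 1}" for f
  proof -
    have f: "f \<in> ell2 X" "norm (up_v f) \<le> 1" using that by (auto simp: ell2_norm_up)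
    have "ell2_norm (T f) = norm (up T \<cdot> up_v f)" using T f by (simp add: ell2_norm_up bounded_ell2 up_up)
    also have "\<dots> \<le> norm (up T) * norm (up_v f)" by (rule norm_ap)
    also have "\<dots> \<le> norm (up T) * 1" using f by (intro mult_left_mono) auto
    finally show ?thesis by simp
  qed
  show "(SUP f\<in>{f \<in> ell2 X. ell2_norm f \<le> 1}. ell2_norm (T f)) \<le> norm (up T)"
    using zero le by (intro cSUP_least) blast+
  let ?s = "SUP f\<in>{f \<in> ell2 X. ell2_norm f \<le> 1}. ell2_norm (T f)"
  have up: "ell2_norm (T f) \<le> ?s" if "f \<in> {f \<in> ell2 X. ell2_norm f \<le> 1}" for f
    by (rule cSUP_upper[OF that]) (use le in \<open>auto intro!: bdd_aboveI[of _ "norm (up T)"]\<close>)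
  show "norm (up T) \<le> ?s"
  proof (rule endo_bound)
    show "0 \<le> ?s" using up[OF zero] T by (simp add: ell2_norm_up bounded_ell2) (meson norm_ge_zero order_trans)
    fix h
    show "norm (up T \<cdot> h) \<le> ?s * norm h"
    proof (cases "h = 0")
      case False
      let ?k = "inverse (norm h) *\<^sub>R h"
      have "ell2_norm (T (down_v ?k)) \<le> ?s" using False by (intro up) (simp add: ell2_norm_up)
      then have "norm (up T \<cdot> ?k) \<le> ?s" using T by (simp add: ell2_norm_up bounded_ell2 up_ap)
      then show ?thesis using False by (simp add: ap_simps field_simps)
    qed simp
  qed
qed

end


section \<open>Von Neumann algebras as bicommutants\<close>

text \<open>Passage from a subbasis to a basis. \<open>F\<close> is nonempty because the empty
  intersection would be the whole type instead of the space.\<close>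

lemma generate_topology_on_finite:
  assumes "generate_topology_on S U" "x \<in> U"
  shows "\<exists>F. finite F \<and> F \<subseteq> S \<and> x \<in> \<Inter>F \<and> \<Inter>F \<subseteq> U \<and> F \<noteq> {}"
  using assms
proof (induction rule: generate_topology_on.induct)
  case (Int a b)
  then obtain F F' where "finite F" "F \<subseteq> S" "x \<in> \<Inter>F" "\<Inter>F \<subseteq> a" "F \<noteq> {}"
    "finite F'" "F' \<subseteq> S" "x \<in> \<Inter>F'" "\<Inter>F' \<subseteq> b" by auto
  then show ?case by (intro exI[of _ "F \<union> F'"]) auto
next
  case (UN K)
  then obtain k where k: "k \<in> K" "x \<in> k" by auto
  from UN.IH[OF k] obtain F where "finite F \<and> F \<subseteq> S \<and> x \<in> \<Inter>F \<and> \<Inter>F \<subseteq> k \<and> F \<noteq> {}" by (rule exE)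
  then show ?case using k(1) by (intro exI[of _ F]) auto
next
  case (Basis s)
  then show ?case by (intro exI[of _ "{s}"]) auto
qed simp

context ell2_transport
begin

abbreviation subbasic :: "('x \<Rightarrow> complex) \<Rightarrow> ('x \<Rightarrow> complex) \<Rightarrow> complex set \<Rightarrow> 'x operator set" where
  "subbasic f g U \<equiv> {T \<in> bounded_ops X. ell2_inner f (T g) \<in> U}"

lemma openin_subbasic:
  "f \<in> ell2 X \<Longrightarrow> g \<in> ell2 X \<Longrightarrow> open U \<Longrightarrow> openin (weak_op_topology X) (subbasic f g U)"
  unfolding weak_op_topology_def openin_topology_generated_by_iff
  by (rule generate_topology_on.Basis) blast

lemma topspace_weak: "topspace (weak_op_topology X) = bounded_ops X"
proof -
  have "subbasic (down_v 0) (down_v 0) UNIV \<in>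
      {{T \<in> bounded_ops X. ell2_inner f (T g) \<in> U} | f g U. f \<in> ell2 X \<and> g \<in> ell2 X \<and> open U}"
    using down_ell2[of 0] open_UNIV by blast
  then show ?thesis
    unfolding weak_op_topology_def topology_generated_by_topspace by auto
qed

lemma inner_down:
  assumes "t \<in> clin"
  shows "Re (ell2_inner (down_v u) (down t (down_v v))) = inner u (t \<cdot> v)"
  using assms by (simp add: down_def ell2_inner_up)

text \<open>A subbasic weak neighbourhood contains a strong one given by the single vector
  \<open>up_v g\<close>; this links the weak topology to approximation at finitely many
  vectors.\<close>

lemma subbasic_nbhd:
  assumes t: "t \<in> clin" and f: "f \<in> ell2 X" and g: "g \<in> ell2 X" and U: "open U" "down t \<in> subbasic f g U"
  shows "\<exists>x d. 0 < d \<and> (\<forall>T\<in>bounded_ops X. norm ((t - up T) \<cdot> x) < d \<longrightarrow> T \<in> subbasic f g U)"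
proof -
  obtain \<epsilon> where \<epsilon>: "0 < \<epsilon>" "ball (ell2_inner f (down t g)) \<epsilon> \<subseteq> U"
    using U open_contains_ball by blast
  define c where "c = norm (up_v f) + norm (ii \<cdot> up_v f) + 1"
  have c: "0 < c" by (simp add: c_def add_nonneg_pos)
  have "T \<in> subbasic f g U" if T: "T \<in> bounded_ops X" and lt: "norm ((t - up T) \<cdot> up_v g) < \<epsilon> / c" for T
  proof -
    let ?d = "(t - up T) \<cdot> up_v g"
    let ?z = "ell2_inner f (down t g) - ell2_inner f (T g)"
    have "?z = Complex (inner (up_v f) ?d) (inner (ii \<cdot> up_v f) ?d)"
      using T t f g by (simp add: ell2_inner_up down_def bounded_ell2 up_up ap_simps inner_diff_right complex_eq_iff)
    then have "cmod ?z \<le> \<bar>inner (up_v f) ?d\<bar> + \<bar>inner (ii \<cdot> up_v f) ?d\<bar>"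
      using cmod_le[of ?z] by simp
    also have "\<dots> \<le> norm (up_v f) * norm ?d + norm (ii \<cdot> up_v f) * norm ?d"
      by (intro add_mono Cauchy_Schwarz_ineq2)
    also have "\<dots> \<le> c * norm ?d" by (simp add: c_def algebra_simps)
    also have "\<dots> < c * (\<epsilon> / c)" using lt c by (intro mult_strict_left_mono)
    finally have "cmod ?z < \<epsilon>" using c by simp
    then have "ell2_inner f (T g) \<in> U" using \<epsilon>(2) by (auto simp: dist_norm subset_iff)
    then show ?thesis using T by simp
  qed
  then show ?thesis using \<epsilon>(1) c by (intro exI[of _ "up_v g"] exI[of _ "\<epsilon> / c"]) auto
qed

lemma up_lincomb:
  assumes "S \<in> bounded_ops X" "T \<in> bounded_ops X"
  shows "up (op_lincomb a S c T) = csc a * up S + csc c * up T"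
proof -
  have "op_lincomb a S c T = down (csc a * up S + csc c * up T)"
    using down_lincomb[OF up_clin[OF assms(1)] up_clin[OF assms(2)]] assms by (simp add: down_of_up)
  then show ?thesis using assms by (simp add: up_of_down clin_alg up_clin)
qed

lemma up_comp:
  assumes "S \<in> bounded_ops X" "T \<in> bounded_ops X"
  shows "up (S \<circ> T) = up S * up T"
proof -
  have "S \<circ> T = down (up S * up T)"
    using down_mult[OF up_clin[OF assms(1)] up_clin[OF assms(2)]] assms by (simp add: down_of_up)
  then show ?thesis using assms by (simp add: up_of_down clin_alg up_clin)
qed

lemma up_id: "up (op_id X) = 1"
  by (simp add: down_one up_of_down clin_alg)

lemma star_subalgebra_up:
  assumes R: "star_subalgebra X R"
  shows "up ` R \<subseteq> clin" "star_closed (up ` R)"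
    "\<And>S T. S \<in> up ` R \<Longrightarrow> T \<in> up ` R \<Longrightarrow> S * T \<in> up ` R"
    "\<And>S T. S \<in> up ` R \<Longrightarrow> T \<in> up ` R \<Longrightarrow> csc a * S + csc c * T \<in> up ` R"
    "\<And>S T. S \<in> up ` R \<Longrightarrow> T \<in> up ` R \<Longrightarrow> S + T \<in> up ` R"
    "\<And>S x. S \<in> up ` R \<Longrightarrow> x *\<^sub>R S \<in> up ` R"
proof -
  have B: "R \<subseteq> bounded_ops X" and lc: "\<And>S T a c. S \<in> R \<Longrightarrow> T \<in> R \<Longrightarrow> op_lincomb a S c T \<in> R"
    and comp: "\<And>S T. S \<in> R \<Longrightarrow> T \<in> R \<Longrightarrow> S \<circ> T \<in> R"
    and adj: "\<And>T. T \<in> R \<Longrightarrow> \<exists>S\<in>R. is_adjoint X S T"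
    using R by (auto simp: star_subalgebra_def)
  show "up ` R \<subseteq> clin" using B up_clin by auto
  show "star_closed (up ` R)"
    unfolding star_closed_def
  proof safe
    fix T assume T: "T \<in> R"
    obtain S where S: "S \<in> R" "is_adjoint X S T" using adj[OF T] by blast
    then have "up S = star (up T)" using B T by (intro is_adjoint_up) auto
    then show "star (up T) \<in> up ` R" using S(1) by (metis image_eqI)
  qed
  show "S * T \<in> up ` R" if h: "S \<in> up ` R" "T \<in> up ` R" for S T
  proof -
    obtain S' T' where st: "S' \<in> R" "S = up S'" "T' \<in> R" "T = up T'" using h by blast
    then have "S * T = up (S' \<circ> T')" using B by (simp add: up_comp subset_iff)
    then show ?thesis using comp st by blast
  qed
  show lin: "csc a * S + csc c * T \<in> up ` R" if h: "S \<in> up ` R" "T \<in> up ` R" for S T a c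
  proof -
    obtain S' T' where st: "S' \<in> R" "S = up S'" "T' \<in> R" "T = up T'" using h by blast
    then have "csc a * S + csc c * T = up (op_lincomb a S' c T')" using B by (simp add: up_lincomb subset_iff)
    then show ?thesis using lc st by blast
  qed
  show "S + T \<in> up ` R" if "S \<in> up ` R" "T \<in> up ` R" for S T
    using lin[OF that, of 1 1] by (simp add: csc_alg)
  have "csc 0 = 0" using csc_alg(3)[of 0] by simp
  then show "x *\<^sub>R S \<in> up ` R" if "S \<in> up ` R" for S x
    using lin[OF that that, of "of_real x" 0] by (simp add: csc_alg)
qed

text \<open>The bicommutant theorem. An element of the bicommutant outside \<open>R\<close> would
  have a weak neighbourhood missing \<open>R\<close>; it contains a finite intersection of subbasic
  sets, into which \<open>bicommutant_approx\<close> puts an element of \<open>R\<close>.\<close>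

lemma vn_up:
  assumes "von_neumann_algebra X R"
  shows "R \<subseteq> bounded_ops X" "star_closed (up ` R)" "ii \<in> up ` R" "up ` R \<subseteq> clin"
    "commutant (commutant (up ` R)) = up ` R"
proof -
  have sa: "star_subalgebra X R" and id: "op_id X \<in> R" and cl: "closedin (weak_op_topology X) R"
    using assms by (auto simp: von_neumann_algebra_def)
  note alg = star_subalgebra_up[OF sa]
  show R: "R \<subseteq> bounded_ops X" using sa by (simp add: star_subalgebra_def)
  show sc: "star_closed (up ` R)" and Rc: "up ` R \<subseteq> clin" by (rule alg)+
  have one: "1 \<in> up ` R" using id up_id by (metis image_eqI)
  have "csc 0 = 0" using csc_alg(3)[of 0] by simp
  then show "ii \<in> up ` R" using alg(4)[OF one one, of \<i> 0] by (simp add: ii_def)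
  show "commutant (commutant (up ` R)) = up ` R"
  proof (rule equalityI[OF subsetI bicommutant_superset])
    fix t assume t: "t \<in> commutant (commutant (up ` R))"
    have "ii \<in> commutant (up ` R)" using Rc by (auto simp: clin_def commutant_def subset_iff)
    then have tc: "t \<in> clin" using t by (auto simp: clin_def commutant_def)
    have "down t \<in> R"
    proof (rule ccontr)
      assume "down t \<notin> R"
      then have dt: "down t \<in> bounded_ops X - R" using down_bounded[OF tc] by simp
      have "openin (weak_op_topology X) (bounded_ops X - R)"
        using cl by (simp add: closedin_def topspace_weak)
      then have gen: "generate_topology_on {{T \<in> bounded_ops X. ell2_inner f (T g) \<in> U} | f g U.
          f \<in> ell2 X \<and> g \<in> ell2 X \<and> open U} (bounded_ops X - R)"
        unfolding weak_op_topology_def openin_topology_generated_by_iff .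
      obtain F where F: "finite F \<and> F \<subseteq> {{T \<in> bounded_ops X. ell2_inner f (T g) \<in> U} | f g U.
          f \<in> ell2 X \<and> g \<in> ell2 X \<and> open U} \<and> down t \<in> \<Inter>F \<and> \<Inter>F \<subseteq> bounded_ops X - R \<and> F \<noteq> {}"
        using generate_topology_on_finite[OF gen dt] by (rule exE)
      note F = F[THEN conjunct1] F[THEN conjunct2, THEN conjunct2, THEN conjunct2, THEN conjunct2]
        F[THEN conjunct2, THEN conjunct2, THEN conjunct1] F[THEN conjunct2, THEN conjunct2, THEN conjunct2, THEN conjunct1]
        F[THEN conjunct2, THEN conjunct1]
      have "\<exists>x d. 0 < d \<and> (\<forall>T\<in>bounded_ops X. norm ((t - up T) \<cdot> x) < d \<longrightarrow> T \<in> s)" if s: "s \<in> F" for s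
      proof -
        obtain f g U where fg: "s = subbasic f g U" "f \<in> ell2 X" "g \<in> ell2 X" "open U" using F(5) s by blast
        have "down t \<in> s" using F(3) s by blast
        then show ?thesis using subbasic_nbhd[OF tc fg(2,3,4)] unfolding fg(1) by (simp only:)
      qed
      then obtain x d where xd: "\<And>s. s \<in> F \<Longrightarrow> 0 < d s"
        "\<And>s T. s \<in> F \<Longrightarrow> T \<in> bounded_ops X \<Longrightarrow> norm ((t - up T) \<cdot> x s) < d s \<Longrightarrow> T \<in> s" by metis
      obtain h where h: "bij_betw h {0..<card F} F" using ex_bij_betw_nat_finite[OF F(1)] by blast
      define e where "e = Min (d ` F)"
      have e: "0 < e" "\<And>s. s \<in> F \<Longrightarrow> e \<le> d s" using F xd(1) by (auto simp: e_def)
      obtain q where q: "q \<in> up ` R" "\<forall>j<card F. norm ((t - q) \<cdot> x (h j)) < e"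
        using bicommutant_approx[OF alg(5) alg(3) alg(6) one sc t e(1), where x = "\<lambda>j. x (h j)" and k = "card F"] by blast
      then obtain T where T: "T \<in> R" "q = up T" by blast
      have "T \<in> s" if s: "s \<in> F" for s
      proof -
        have "s \<in> h ` {0..<card F}" using h s by (simp add: bij_betw_def)
        then obtain j where "j < card F" "h j = s" by auto
        then have "norm ((t - up T) \<cdot> x s) < d s" using q(2) e(2)[OF s] T by fastforce
        then show ?thesis using xd(2)[OF s] T R by blast
      qed
      then show False using F(4) T by blast
    qed
    then show "t \<in> up ` R" using up_of_down[OF tc] by (metis image_eqI)
  qed
qed

text \<open>Commutants are weakly closed: if \<open>T\<close> fails to commute with
  \<open>s\<close>, two of its matrix coefficients differ, and disjoint open sets around them give a
  neighbourhood of operators that also fail.\<close>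

lemma vn_down:
  assumes S: "star_closed S" "ii \<in> S" "S \<subseteq> clin"
  shows "von_neumann_algebra X (down ` commutant S)"
proof -
  let ?Q = "commutant S"
  have Qc: "?Q \<subseteq> clin" using S by (auto simp: clin_def commutant_def)
  have iiQ: "ii \<in> ?Q" using S(3) by (auto simp: clin_def commutant_def)
  have csc: "csc a \<in> ?Q" for a
    unfolding csc_decomp by (intro commutant_add commutant_scaleR iiQ commutant_one)
  have sub: "down ` ?Q \<subseteq> bounded_ops X" using Qc down_bounded by blast
  have "star_subalgebra X (down ` ?Q)"
    unfolding star_subalgebra_def
  proof (intro conjI sub ballI allI)
    show "down ` ?Q \<noteq> {}" using commutant_one by blast
    fix A assume "A \<in> down ` ?Q"
    then obtain s where s: "s \<in> ?Q" "A = down s" by blast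
    have "star s \<in> ?Q" using star_closed_commutant[OF S(1)] s(1) by (simp add: star_closed_def)
    moreover have "is_adjoint X (down (star s)) A" unfolding s(2) using s(1) Qc by (intro is_adjoint_down) auto
    ultimately show "\<exists>B\<in>down ` ?Q. is_adjoint X B A" by blast
    fix B assume "B \<in> down ` ?Q"
    then obtain t where t: "t \<in> ?Q" "B = down t" by blast
    have c: "s \<in> clin" "t \<in> clin" using s t Qc by auto
    show "A \<circ> B \<in> down ` ?Q"
      unfolding s(2) t(2) down_mult[OF c] by (intro imageI commutant_mult s t)
    show "op_lincomb a A c B \<in> down ` ?Q" for a c
      unfolding s(2) t(2) down_lincomb[OF c] by (intro imageI commutant_add commutant_mult csc s t)
  qed
  moreover have "op_id X \<in> down ` ?Q" unfolding down_one by (intro imageI commutant_one)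
  moreover have "closedin (weak_op_topology X) (down ` ?Q)"
    unfolding closedin_def topspace_weak
  proof (intro conjI sub)
    show "openin (weak_op_topology X) (bounded_ops X - down ` ?Q)"
    proof (subst openin_subopen, intro ballI)
      fix T assume T: "T \<in> bounded_ops X - down ` ?Q"
      then have tc: "up T \<in> clin" by (simp add: up_clin)
      have "up T \<notin> ?Q" using T down_of_up[of T] by force
      then obtain s where s: "s \<in> S" "up T * s \<noteq> s * up T" by (auto simp: commutant_def)
      then obtain v where "(up T * s) \<cdot> v \<noteq> (s * up T) \<cdot> v" using endo_eqI by blast
      then obtain u where "inner u (up T \<cdot> s \<cdot> v) \<noteq> inner u (s \<cdot> up T \<cdot> v)" using inner_eqI by (metis ap_mult)
      then have "inner u (up T \<cdot> s \<cdot> v) \<noteq> inner (star s \<cdot> u) (up T \<cdot> v)" by (simp add: inner_star')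
      then obtain A B where AB: "open A" "open B" "inner u (up T \<cdot> s \<cdot> v) \<in> A"
        "inner (star s \<cdot> u) (up T \<cdot> v) \<in> B" "A \<inter> B = {}"
        using hausdorff by metis
      have opn: "open (Re -` A)" "open (Re -` B)"
        using AB by (auto intro!: open_vimage continuous_intros)
      let ?N = "subbasic (down_v u) (down_v (s \<cdot> v)) (Re -` A) \<inter> subbasic (down_v (star s \<cdot> u)) (down_v v) (Re -` B)"
      have re: "Re (ell2_inner (down_v x) (down t (down_v y))) = inner x (t \<cdot> y)" if "t \<in> clin" for x y t
        using inner_down[OF that] .
      show "\<exists>N. openin (weak_op_topology X) N \<and> T \<in> N \<and> N \<subseteq> bounded_ops X - down ` ?Q"
      proof (intro exI[of _ ?N] conjI)
        show "openin (weak_op_topology X) ?N" by (intro openin_Int openin_subbasic opn down_ell2)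
        show "T \<in> ?N" using T AB(3,4) re[OF tc] down_of_up[of T] by auto
        show "?N \<subseteq> bounded_ops X - down ` ?Q"
        proof
          fix T' assume T': "T' \<in> ?N"
          have "T' \<noteq> down t" if t: "t \<in> ?Q" for t
          proof
            assume eq: "T' = down t"
            have "t \<in> clin" using t Qc by auto
            then have "inner u (t \<cdot> s \<cdot> v) \<in> A" "inner (star s \<cdot> u) (t \<cdot> v) \<in> B"
              using T' re unfolding eq by auto
            moreover have "t \<cdot> s \<cdot> v = s \<cdot> t \<cdot> v" using commutantD[OF t s(1)] by (metis ap_mult)
            ultimately show False using AB(5) by (auto simp: inner_star')
          qed
          then show "T' \<in> bounded_ops X - down ` ?Q" using T' by auto
        qed
      qed
    qed
  qed
  ultimately show ?thesis by (simp add: von_neumann_algebra_def)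
qed

text \<open>The added adjoints make the set star closed, and \<open>ii\<close> makes its commutant
  complex linear, so that \<open>vn_down\<close> applies to that commutant.\<close>

lemma vn_generated_eq:
  assumes S: "S \<subseteq> bounded_ops X"
  shows "vn_generated X S =
    down ` commutant (commutant (insert ii (insert (- ii) (up ` S \<union> star ` up ` S))))" (is "_ = down ` commutant (commutant ?G)")
proof
  have upS: "up ` S \<subseteq> clin" using S up_clin by auto
  have G: "star_closed ?G" "ii \<in> ?G" "?G \<subseteq> clin"
  proof -
    show "star_closed ?G" by (auto simp: star_closed_def ii)
    have "star ` up ` S \<subseteq> clin" using upS star_clin by blast
    moreover have "ii \<in> clin" "- ii \<in> clin" by (auto simp: clin_def commutant_def)
    ultimately show "?G \<subseteq> clin" using upS by simp
  qed simp
  have "ii \<in> commutant ?G"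
  proof (rule commutantI)
    fix A assume "A \<in> ?G"
    then have "A \<in> clin" using G(3) by (rule subsetD[rotated])
    then show "ii * A = A * ii" by (simp add: clin_def commutant_def)
  qed
  moreover have "commutant ?G \<subseteq> clin" using G(2) by (auto simp: clin_def commutant_def)
  ultimately have vn: "von_neumann_algebra X (down ` commutant (commutant ?G))"
    by (intro vn_down star_closed_commutant G)
  have "T \<in> down ` commutant (commutant ?G)" if "T \<in> S" for T
  proof -
    have "up T \<in> commutant (commutant ?G)" using bicommutant_superset[of ?G] that by auto
    then show ?thesis using down_of_up[of T] that S by (metis image_eqI subsetD)
  qed
  then show "vn_generated X S \<subseteq> down ` commutant (commutant ?G)"
    unfolding vn_generated_def using vn by blast
  show "down ` commutant (commutant ?G) \<subseteq> vn_generated X S"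
    unfolding vn_generated_def
  proof (rule Inter_greatest)
    fix R assume "R \<in> {R. von_neumann_algebra X R \<and> S \<subseteq> R}"
    then have R: "von_neumann_algebra X R" "S \<subseteq> R" by auto
    note V = vn_up[OF R(1)]
    have "- ii \<in> up ` R" using star_closedD[OF V(2) V(3)] by (simp add: ii)
    then have "?G \<subseteq> up ` R" using V(2,3) R(2) by (auto simp: star_closed_def)
    then have "commutant (commutant ?G) \<subseteq> commutant (commutant (up ` R))" by (intro commutant_antimono)
    then have sub: "commutant (commutant ?G) \<subseteq> up ` R" by (simp add: V(5))
    show "down ` commutant (commutant ?G) \<subseteq> R"
    proof
      fix T assume "T \<in> down ` commutant (commutant ?G)"
      then obtain r where "r \<in> R" "T = down (up r)" using sub by blast
      then show "T \<in> R" using V(1) by (auto simp: down_of_up subset_iff)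
    qed
  qed
qed

text \<open>If \<open>up T \<cdot> v\<close> had a component orthogonal to the closed subspace
  spanned by the \<open>up S \<cdot> v\<close>, this component would define a weakly open half space
  containing \<open>T\<close> and missing \<open>F\<close>.\<close>

lemma closure_of_strong:
  assumes F: "F \<subseteq> bounded_ops X" and sub: "subspace (up ` F)"
    and T: "T \<in> weak_op_topology X closure_of F" and e: "0 < e"
  shows "\<exists>S\<in>F. norm ((up T - up S) \<cdot> v) < e"
proof -
  define W where "W = closure ((\<lambda>q. q \<cdot> v) ` up ` F)"
  have "subspace ((\<lambda>q. q \<cdot> v) ` up ` F)"
    by (rule linear_subspace_image[OF _ sub]) (rule bounded_linear.linear[OF ap.bounded_linear_left])
  then have W: "subspace W" "closed W" unfolding W_def by (auto intro: subspace_closure)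
  have TB: "T \<in> bounded_ops X" using T by (simp add: in_closure_of topspace_weak)
  define w where "w = up T \<cdot> v - proj W \<cdot> up T \<cdot> v"
  have perp: "inner w z = 0" if "z \<in> W" for z unfolding w_def by (rule proj_props(2)[OF W that])
  have "w = 0"
  proof (rule ccontr)
    assume "w \<noteq> 0"
    have "inner w (up T \<cdot> v) = inner w w"
      using perp[OF proj_props(1)[OF W, of "up T \<cdot> v"]] by (simp add: w_def inner_diff_right)
    then have "0 < inner w (up T \<cdot> v)" using \<open>w \<noteq> 0\<close> by simp
    then have c1: "T \<in> subbasic (down_v w) (down_v v) {z. 0 < Re z}"
      using inner_down[OF up_clin[OF TB], of w v] TB by (simp add: down_of_up)
    have c2: "openin (weak_op_topology X) (subbasic (down_v w) (down_v v) {z. 0 < Re z})"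
      by (intro openin_subbasic down_ell2 open_halfspace_Re_gt)
    have "\<exists>y. y \<in> F \<and> y \<in> N" if "T \<in> N" "openin (weak_op_topology X) N" for N
      using T that unfolding in_closure_of by blast
    from this[OF c1 c2] obtain S where S: "S \<in> F" "S \<in> subbasic (down_v w) (down_v v) {z. 0 < Re z}"
      by (elim exE conjE)
    have SB: "S \<in> bounded_ops X" using S F by auto
    then have "0 < inner w (up S \<cdot> v)" using inner_down[OF up_clin[OF SB], of w v] S(2) by (simp add: down_of_up)
    moreover have "up S \<cdot> v \<in> W" unfolding W_def using S(1) by (intro closure_subset[THEN subsetD] imageI)
    ultimately show False using perp by simp
  qed
  then have "up T \<cdot> v \<in> W" using proj_props(1)[OF W, of "up T \<cdot> v"] by (simp add: w_def)
  then have "\<exists>y\<in>(\<lambda>q. q \<cdot> v) ` up ` F. dist y (up T \<cdot> v) < e"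
    unfolding W_def closure_approachable using e by simp
  then show ?thesis by (auto simp: dist_norm ap_simps norm_minus_commute)
qed

end


section \<open>The regular representations of a countable group\<close>

text \<open>Contractions that are inverse to each other are isometric, and polarisation makes the
  inverse the adjoint.\<close>

lemma star_eq_inverse:
  fixes S T :: "'a::{real_inner,banach} endo"
  assumes ST: "S * T = 1" "T * S = 1" and c: "\<And>x. norm (S \<cdot> x) \<le> norm x" "\<And>x. norm (T \<cdot> x) \<le> norm x"
  shows "star S = T"
proof (rule star_eqI)
  have inv: "S \<cdot> T \<cdot> x = x" "T \<cdot> S \<cdot> x = x" for x
    using arg_cong[OF ST(1), of "\<lambda>A. A \<cdot> x"] arg_cong[OF ST(2), of "\<lambda>A. A \<cdot> x"] by simp_all
  have iso: "norm (S \<cdot> x) = norm x" for x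
    using c(1)[of x] c(2)[of "S \<cdot> x"] by (simp add: inv)
  have pol: "inner x y = ((norm (x + y))\<^sup>2 - (norm x)\<^sup>2 - (norm y)\<^sup>2) / 2" for x y :: 'a
    by (simp add: power2_norm_eq_inner inner_add_left inner_add_right inner_commute)
  fix x y
  have "inner (S \<cdot> x) y = inner (S \<cdot> x) (S \<cdot> T \<cdot> y)" by (simp add: inv)
  also have "\<dots> = inner x (T \<cdot> y)"
    unfolding pol[of "S \<cdot> x"] pol[of x] ap.add_right[symmetric] iso ..
  finally show "inner (S \<cdot> x) y = inner x (T \<cdot> y)" .
qed

text \<open>The weights \<open>c\<close> are only real linear because \<open>J\<close> is conjugate linear.\<close>

definition shift_op :: "(nat \<Rightarrow> complex \<Rightarrow> complex) \<Rightarrow> (nat \<Rightarrow> nat) \<Rightarrow> complex l2 endo" where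
  "shift_op c \<sigma> = endo_of (\<lambda>f. mk_l2 (\<lambda>n. c n (coord f (\<sigma> n))))"

lemma shift_op:
  assumes c: "\<And>n. linear (c n)" "\<And>n z. cmod (c n z) \<le> cmod z" and \<sigma>: "inj \<sigma>"
  shows "coord (shift_op c \<sigma> \<cdot> f) n = c n (coord f (\<sigma> n))" "norm (shift_op c \<sigma> \<cdot> f) \<le> norm f"
proof -
  define m where "m f = mk_l2 (\<lambda>n. c n (coord f (\<sigma> n)))" for f
  have "(\<Sum>n<p. (norm (c n (coord f (\<sigma> n))))\<^sup>2) \<le> (norm f)\<^sup>2" for p f
  proof -
    have "(\<Sum>n<p. (norm (c n (coord f (\<sigma> n))))\<^sup>2) \<le> (\<Sum>n<p. (norm (coord f (\<sigma> n)))\<^sup>2)"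
      by (intro sum_mono power_mono c) auto
    also have "\<dots> = (\<Sum>k\<in>\<sigma> ` {..<p}. (norm (coord f k))\<^sup>2)"
      using \<sigma> by (subst sum.reindex) (auto intro: inj_on_subset)
    also have "\<dots> \<le> (norm f)\<^sup>2"
      unfolding norm_l2_sq by (rule sum_le_suminf[OF summable_coord]) auto
    finally show ?thesis .
  qed
  from mk_l2_bounded[OF this] have m: "coord (m f) n = c n (coord f (\<sigma> n))" "norm (m f) \<le> norm f" for f n
    by (auto simp: m_def fun_eq_iff)
  have "bounded_linear m"
  proof (rule bounded_linear_intro)
    show "m (f + g) = m f + m g" for f g by (rule l2_eqI) (simp add: m(1) linear_add[OF c(1)])
    show "m (r *\<^sub>R f) = r *\<^sub>R m f" for r f by (rule l2_eqI) (simp add: m(1) linear_scale[OF c(1)])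
    show "norm (m f) \<le> norm f * 1" for f using m(2)[of f] by simp
  qed
  then have "shift_op c \<sigma> \<cdot> f = m f" unfolding shift_op_def m_def by (rule ap_endo_of)
  then show "coord (shift_op c \<sigma> \<cdot> f) n = c n (coord f (\<sigma> n))" "norm (shift_op c \<sigma> \<cdot> f) \<le> norm f"
    by (simp_all add: m)
qed

locale group_l2 = group G + ell2_transport "carrier G" for G (structure)
begin

definition lam :: "'a \<Rightarrow> nat \<Rightarrow> nat" where "lam g n = ix (inv g \<otimes> b n)"
definition rho :: "'a \<Rightarrow> nat \<Rightarrow> nat" where "rho g n = ix (b n \<otimes> g)"
definition jn :: "nat \<Rightarrow> nat" where "jn n = ix (inv (b n))"

definition L :: "'a \<Rightarrow> complex l2 endo" where "L g = shift_op (\<lambda>n z. z) (lam g)"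
definition R :: "'a \<Rightarrow> complex l2 endo" where "R g = shift_op (\<lambda>n z. z) (rho g)"
definition J :: "complex l2 endo" where "J = shift_op (\<lambda>n. cnj) jn"
definition P :: "'a set \<Rightarrow> complex l2 endo" where
  "P S = shift_op (\<lambda>n z. if b n \<in> S then z else 0) (\<lambda>n. n)"
definition \<delta> :: "'a \<Rightarrow> complex l2" where "\<delta> g = mk_l2 (\<lambda>n. if n = ix g then 1 else 0)"

lemma ix_eq: "x \<in> carrier G \<Longrightarrow> ix x = n \<longleftrightarrow> x = b n"
  using b by metis

lemma b_ix: "x \<in> carrier G \<Longrightarrow> b (ix x) = x"
  by (rule b)

lemma b_closed [simp]: "b n \<in> carrier G"
  by (rule b)

lemma b_lam: "g \<in> carrier G \<Longrightarrow> b (lam g n) = inv g \<otimes> b n"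
  and b_rho: "g \<in> carrier G \<Longrightarrow> b (rho g n) = b n \<otimes> g"
  and b_jn: "b (jn n) = inv (b n)"
  by (simp_all add: lam_def rho_def jn_def b_ix)

lemma b_inject: "b m = b n \<longleftrightarrow> m = n"
  using b by metis

lemma inj_maps: "g \<in> carrier G \<Longrightarrow> inj (lam g)" "g \<in> carrier G \<Longrightarrow> inj (rho g)" "inj jn"
proof -
  show "inj (lam g)" if "g \<in> carrier G"
    by (rule inj_on_inverseI[where g = "lam (inv g)"])
      (use that in \<open>simp add: b_inject[symmetric] b_lam m_assoc[symmetric]\<close>)
  show "inj (rho g)" if "g \<in> carrier G"
    by (rule inj_on_inverseI[where g = "rho (inv g)"])
      (use that in \<open>simp add: b_inject[symmetric] b_rho m_assoc\<close>)
  show "inj jn"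
    by (rule inj_on_inverseI[where g = jn]) (simp add: b_inject[symmetric] b_jn)
qed

lemma coord_L: "g \<in> carrier G \<Longrightarrow> coord (L g \<cdot> f) n = coord f (lam g n)"
  and coord_R: "g \<in> carrier G \<Longrightarrow> coord (R g \<cdot> f) n = coord f (rho g n)"
  and coord_J: "coord (J \<cdot> f) n = cnj (coord f (jn n))"
  and coord_P: "coord (P S \<cdot> f) n = (if b n \<in> S then coord f n else 0)"
  and norm_L: "g \<in> carrier G \<Longrightarrow> norm (L g \<cdot> f) \<le> norm f"
  and norm_R: "g \<in> carrier G \<Longrightarrow> norm (R g \<cdot> f) \<le> norm f"
  and norm_J: "norm (J \<cdot> f) \<le> norm f"
proof -
  have id: "linear (\<lambda>z::complex. z)" by (simp add: linear_iff)
  have cnj: "linear cnj" by (simp add: linear_iff)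
  have ind: "linear (\<lambda>z::complex. if b n \<in> S then z else 0)" for n by (simp add: linear_iff)
  note 1 = shift_op[where c = "\<lambda>n z. z", OF id order_refl]
  note 2 = shift_op[where c = "\<lambda>n. cnj", OF cnj _ inj_maps(3)]
  show "g \<in> carrier G \<Longrightarrow> coord (L g \<cdot> f) n = coord f (lam g n)" "g \<in> carrier G \<Longrightarrow> norm (L g \<cdot> f) \<le> norm f"
    unfolding L_def using 1[OF inj_maps(1)] by auto
  show "g \<in> carrier G \<Longrightarrow> coord (R g \<cdot> f) n = coord f (rho g n)" "g \<in> carrier G \<Longrightarrow> norm (R g \<cdot> f) \<le> norm f"
    unfolding R_def using 1[OF inj_maps(2)] by auto
  show "coord (J \<cdot> f) n = cnj (coord f (jn n))" "norm (J \<cdot> f) \<le> norm f"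
    unfolding J_def using 2 by auto
  show "coord (P S \<cdot> f) n = (if b n \<in> S then coord f n else 0)"
    unfolding P_def by (subst shift_op(1)[OF ind]) auto
qed

lemma coord_\<delta>: "coord (\<delta> g) n = (if n = ix g then 1 else 0)"
proof -
  have "summable (\<lambda>n. (norm (if n = ix g then 1 else 0 :: complex))\<^sup>2)"
    by (rule summable_finite[of "{ix g}"]) auto
  then show ?thesis by (simp add: \<delta>_def mk_l2_inverse)
qed

lemma coord_ii: "coord (ii \<cdot> f) n = \<i> * coord f n"
  by (simp add: ii_def coord_csc)

lemma inner_\<delta>: "inner (\<delta> g) f = Re (coord f (ix g))" "inner (ii \<cdot> \<delta> g) f = Im (coord f (ix g))"
proof -
  have "(\<lambda>n. if n = ix g then Re (coord f n) else 0) sums Re (coord f (ix g))" by (rule sums_single)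
  moreover have "inner (coord (\<delta> g) n) (coord f n) = (if n = ix g then Re (coord f n) else 0)" for n
    by (simp add: coord_\<delta> inner_complex_def)
  ultimately show "inner (\<delta> g) f = Re (coord f (ix g))"
    unfolding inner_l2_def by (simp add: sums_unique[symmetric])
  have "(\<lambda>n. if n = ix g then Im (coord f n) else 0) sums Im (coord f (ix g))" by (rule sums_single)
  moreover have "inner (coord (ii \<cdot> \<delta> g) n) (coord f n) = (if n = ix g then Im (coord f n) else 0)" for n
    by (simp add: coord_\<delta> coord_ii inner_complex_def)
  ultimately show "inner (ii \<cdot> \<delta> g) f = Im (coord f (ix g))"
    unfolding inner_l2_def by (simp add: sums_unique[symmetric])
qed

lemma group_rep: "group_rep G ii \<delta> L R J P"
proof
  have one: "lam \<one> n = n" "rho \<one> n = n" for n by (simp_all add: lam_def rho_def b)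
  have lam_mult: "lam h (lam g n) = lam (g \<otimes> h) n" if "g \<in> carrier G" "h \<in> carrier G" for g h n
    using that by (simp add: b_inject[symmetric] b_lam inv_mult_group m_assoc)
  have rho_mult: "rho h (rho g n) = rho (g \<otimes> h) n" if "g \<in> carrier G" "h \<in> carrier G" for g h n
    using that by (simp add: b_inject[symmetric] b_rho m_assoc)
  show L1: "L \<one> = 1" and R1: "R \<one> = 1"
    by (intro endo_eqI l2_eqI, simp add: coord_L coord_R one)+
  show LL: "L g * L h = L (g \<otimes> h)" if "g \<in> carrier G" "h \<in> carrier G" for g h
    by (intro endo_eqI l2_eqI) (simp add: coord_L lam_mult that)
  show RR: "R g * R h = R (g \<otimes> h)" if "g \<in> carrier G" "h \<in> carrier G" for g h
    by (intro endo_eqI l2_eqI) (simp add: coord_R rho_mult that)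
  show "star (L g) = L (inv g)" if "g \<in> carrier G" for g
    by (rule star_eq_inverse) (use that in \<open>auto simp: LL L1 norm_L\<close>)
  show "star (R g) = R (inv g)" if "g \<in> carrier G" for g
    by (rule star_eq_inverse) (use that in \<open>auto simp: RR R1 norm_R\<close>)
  show "L g * R h = R h * L g" if "g \<in> carrier G" "h \<in> carrier G" for g h
  proof -
    have "rho h (lam g n) = lam g (rho h n)" for n
      using that by (simp add: b_inject[symmetric] b_lam b_rho m_assoc)
    then show ?thesis by (intro endo_eqI l2_eqI) (simp add: coord_R coord_L that)
  qed
  show "ii * ii = - 1" "star ii = - ii" by (rule ii)+
  show "norm (\<delta> g) = 1" if "g \<in> carrier G" for g
    by (simp add: norm_eq_sqrt_inner inner_\<delta> coord_\<delta>)
  show "f = 0" if "\<And>g. g \<in> carrier G \<Longrightarrow> inner (\<delta> g) f = 0 \<and> inner (ii \<cdot> \<delta> g) f = 0" for f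
  proof (rule l2_eqI)
    fix n
    show "coord f n = coord 0 n" using that[of "b n"] by (simp add: inner_\<delta> b complex_eq_iff)
  qed
  show "L g * ii = ii * L g" "R g * ii = ii * R g" if "g \<in> carrier G" for g
    by (intro endo_eqI l2_eqI, simp add: coord_L coord_R coord_ii that)+
  show "L g \<cdot> \<delta> h = \<delta> (g \<otimes> h)" if "g \<in> carrier G" "h \<in> carrier G" for g h
  proof (rule l2_eqI)
    fix n
    have "lam g n = ix h \<longleftrightarrow> n = ix (g \<otimes> h)"
      using that by (simp add: b_inject[symmetric] b_lam b_ix) (metis b_closed inv_solve_left that)
    then show "coord (L g \<cdot> \<delta> h) n = coord (\<delta> (g \<otimes> h)) n" using that by (simp add: coord_L coord_\<delta>)
  qed
  show "R g \<cdot> \<delta> h = \<delta> (h \<otimes> inv g)" if "g \<in> carrier G" "h \<in> carrier G" for g h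
  proof (rule l2_eqI)
    fix n
    have "rho g n = ix h \<longleftrightarrow> n = ix (h \<otimes> inv g)"
      using that by (simp add: b_inject[symmetric] b_rho b_ix) (metis b_closed inv_solve_right' that)
    then show "coord (R g \<cdot> \<delta> h) n = coord (\<delta> (h \<otimes> inv g)) n" using that by (simp add: coord_R coord_\<delta>)
  qed
  show "J \<cdot> \<delta> g = \<delta> (inv g)" if "g \<in> carrier G" for g
  proof (rule l2_eqI)
    fix n
    have "jn n = ix g \<longleftrightarrow> n = ix (inv g)"
      using that by (simp add: b_inject[symmetric] b_jn b_ix) (metis b_closed inv_inv that)
    then show "coord (J \<cdot> \<delta> g) n = coord (\<delta> (inv g)) n" by (simp add: coord_J coord_\<delta>)
  qed
  show "J * ii = - (ii * J)"
    by (intro endo_eqI l2_eqI) (simp add: coord_J coord_ii ap_simps)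
  have "jn (jn n) = n" for n by (simp add: b_inject[symmetric] b_jn)
  then have "J * J = 1" by (intro endo_eqI l2_eqI) (simp add: coord_J)
  then show "star J = J" by (intro star_eq_inverse) (auto simp: norm_J)
  show "P S * ii = ii * P S" for S by (intro endo_eqI l2_eqI) (simp add: coord_P coord_ii)
  show "star (P S) = P S" for S by (rule star_eqI) (auto simp: inner_l2_def coord_P intro!: arg_cong[of _ _ suminf])
  show "P S * P S' = P (S \<inter> S')" for S S' by (intro endo_eqI l2_eqI) (simp add: coord_P)
  show "P (S \<union> S') = P S + P S'" if "S \<inter> S' = {}" for S S'
    using that by (intro endo_eqI l2_eqI) (auto simp: coord_P ap_simps)
  show "P (carrier G) = 1" by (intro endo_eqI l2_eqI) (simp add: coord_P)
  show "P S \<cdot> \<delta> g = (if g \<in> S then \<delta> g else 0)" if "g \<in> carrier G" for S g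
    using that by (intro l2_eqI) (auto simp: coord_P coord_\<delta> b_ix)
  show "L g * P S = P ((\<otimes>) g ` S) * L g" if "g \<in> carrier G" "S \<subseteq> carrier G" for g S
  proof (intro endo_eqI l2_eqI)
    fix f n
    have "inv g \<otimes> b n \<in> S \<longleftrightarrow> b n \<in> (\<otimes>) g ` S"
    proof
      assume "inv g \<otimes> b n \<in> S"
      moreover have "b n = g \<otimes> (inv g \<otimes> b n)" using that by (simp add: m_assoc[symmetric])
      ultimately show "b n \<in> (\<otimes>) g ` S" by blast
    next
      assume "b n \<in> (\<otimes>) g ` S"
      then obtain s where "s \<in> S" "b n = g \<otimes> s" by blast
      moreover from this have "inv g \<otimes> b n = s" using that by (simp add: m_assoc[symmetric] subset_iff)
      ultimately show "inv g \<otimes> b n \<in> S" by simp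
    qed
    then show "coord ((L g * P S) \<cdot> f) n = coord ((P ((\<otimes>) g ` S) * L g) \<cdot> f) n"
      using that by (simp add: coord_L coord_P b_lam)
  qed
qed

lemma L_clin: "g \<in> carrier G \<Longrightarrow> L g \<in> clin"
  unfolding clin_def by (intro commutantI, simp, intro endo_eqI l2_eqI) (simp add: coord_L coord_ii)

lemma left_regular_down: "g \<in> carrier G \<Longrightarrow> left_regular G g = down (L g)"
  by (auto simp: left_regular_def down_def down_v_def fun_eq_iff coord_L coord_up b_lam b_ix)

lemma left_regular_bounded: "g \<in> carrier G \<Longrightarrow> left_regular G g \<in> bounded_ops (carrier G)"
  by (simp add: left_regular_down down_bounded L_clin)

lemma up_left_regular: "g \<in> carrier G \<Longrightarrow> up (left_regular G g) = L g"
  by (simp add: left_regular_down up_of_down L_clin)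

end


section \<open>Subalgebras generated by a wandering abelian subgroup\<close>

sublocale group_l2 \<subseteq> rep: group_rep G ii \<delta> L R J P
  by (rule group_rep)

context group_l2
begin

lemma rep_clin [simp]: "rep.clin = clin"
  by (simp add: rep.clin_def clin_def)

text \<open>Decoding pairs makes each element recur infinitely often, once for each second
  component.\<close>

definition gs :: "nat \<Rightarrow> 'a" where "gs n = b (fst (prod_decode n))"

lemma gs: "gs n \<in> carrier G" "g \<in> carrier G \<Longrightarrow> \<exists>k\<ge>n. gs k = g"
proof -
  show "\<exists>k\<ge>n. gs k = g" if "g \<in> carrier G"
    using that by (intro exI[of _ "prod_encode (ix g, n)"]) (simp add: gs_def b_ix le_prod_encode_2)
qed (simp add: gs_def)

definition gen_ops :: "'a set \<Rightarrow> complex l2 endo set" where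
  "gen_ops \<Gamma> = insert ii (insert (- ii) (L ` \<Gamma> \<union> star ` L ` \<Gamma>))"

lemma gen_ops:
  assumes "\<Gamma> \<subseteq> carrier G"
  shows "star_closed (gen_ops \<Gamma>)" "ii \<in> gen_ops \<Gamma>" "gen_ops \<Gamma> \<subseteq> clin" "ii \<in> commutant (gen_ops \<Gamma>)"
proof -
  show "star_closed (gen_ops \<Gamma>)" by (auto simp: star_closed_def gen_ops_def ii)
  show "ii \<in> gen_ops \<Gamma>" by (simp add: gen_ops_def)
  have "L ` \<Gamma> \<subseteq> clin" using assms L_clin by auto
  then have "star ` L ` \<Gamma> \<subseteq> clin" using star_clin by blast
  moreover have "ii \<in> clin" "- ii \<in> clin" by (auto simp: clin_def commutant_def)
  ultimately show c: "gen_ops \<Gamma> \<subseteq> clin" using \<open>L ` \<Gamma> \<subseteq> clin\<close> by (simp add: gen_ops_def)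
  show "ii \<in> commutant (gen_ops \<Gamma>)"
  proof (rule commutantI)
    fix A assume "A \<in> gen_ops \<Gamma>"
    then have "A \<in> clin" using c by (rule subsetD[rotated])
    then show "ii * A = A * ii" by (simp add: clin_def commutant_def)
  qed
qed

lemma generated_eq:
  assumes "\<Gamma> \<subseteq> carrier G"
  shows "vn_generated (carrier G) (left_regular G ` \<Gamma>) = down ` commutant (commutant (gen_ops \<Gamma>))"
proof -
  have "left_regular G ` \<Gamma> \<subseteq> bounded_ops (carrier G)" using assms left_regular_bounded by auto
  moreover have "up ` left_regular G ` \<Gamma> = L ` \<Gamma>"
    unfolding image_image using assms by (intro image_cong refl) (auto simp: up_left_regular)
  ultimately show ?thesis using vn_generated_eq by (simp add: gen_ops_def)
qed

lemma generated_vn: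
  assumes "\<Gamma> \<subseteq> carrier G"
  shows "von_neumann_algebra (carrier G) (vn_generated (carrier G) (left_regular G ` \<Gamma>))"
proof -
  have "commutant (gen_ops \<Gamma>) \<subseteq> clin"
    using gen_ops(2)[OF assms] by (auto simp: clin_def commutant_def)
  then show ?thesis
    unfolding generated_eq[OF assms]
    by (intro vn_down star_closed_commutant gen_ops assms)
qed

lemma bicomm_clin: "\<Gamma> \<subseteq> carrier G \<Longrightarrow> commutant (commutant (gen_ops \<Gamma>)) \<subseteq> clin"
  using gen_ops(4)[of \<Gamma>] by (auto simp: clin_def commutant_def)

lemma up_generated:
  assumes "\<Gamma> \<subseteq> carrier G"
  shows "up ` vn_generated (carrier G) (left_regular G ` \<Gamma>) = commutant (commutant (gen_ops \<Gamma>))"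
proof -
  have "(\<lambda>t. up (down t)) ` commutant (commutant (gen_ops \<Gamma>)) = (\<lambda>t. t) ` commutant (commutant (gen_ops \<Gamma>))"
    using bicomm_clin[OF assms] by (intro image_cong refl) (auto simp: up_of_down)
  then show ?thesis by (simp add: generated_eq[OF assms] image_image)
qed

text \<open>Right translations commute with the generators of L(G) and therefore with the
  bicommutant of these.\<close>

lemma up_group_vn: "up ` group_vn G \<subseteq> rep.rvn"
proof -
  have "insert ii (R ` carrier G) \<subseteq> commutant (gen_ops (carrier G))"
  proof -
    have "R g \<in> commutant (gen_ops (carrier G))" if g: "g \<in> carrier G" for g
    proof (rule commutantI)
      fix A assume "A \<in> gen_ops (carrier G)"
      then consider "A = ii" | "A = - ii" | h where "h \<in> carrier G" "A = L h"
        | h where "h \<in> carrier G" "A = L (inv h)"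
        by (auto simp: gen_ops_def rep.star_L)
      then show "R g * A = A * R g"
        using g by cases (auto simp: rep.R_ii rep.LR)
    qed
    then show ?thesis using gen_ops(4)[of "carrier G"] by auto
  qed
  then show ?thesis
    unfolding group_vn_def up_generated[OF order_refl] rep.rvn_def by (rule commutant_antimono)
qed

lemma L_generate:
  assumes C: "star_closed (commutant C)" and \<Gamma>: "\<Gamma> \<subseteq> carrier G" "L ` \<Gamma> \<subseteq> commutant C"
    and g: "g \<in> generate G \<Gamma>"
  shows "L g \<in> commutant C"
  using g
proof (induction rule: generate.induct)
  case one
  then show ?case by (simp add: rep.L_one)
next
  case (incl h)
  then show ?case using \<Gamma> by auto
next
  case (inv h)
  then have "star (L h) \<in> commutant C" using \<Gamma> C by (auto simp: star_closed_def)
  then show ?case using inv \<Gamma> rep.star_L[of h] by auto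
next
  case (eng h1 h2)
  then have "h1 \<in> carrier G" "h2 \<in> carrier G" using generate_in_carrier[OF \<Gamma>(1)] by auto
  then show ?case using commutant_mult[OF eng.IH] by (simp add: rep.L_mult)
qed

end

text \<open>The combinatorial input in abstract form. \<open>Z\<close> is wandering under
  \<open>\<alpha>\<close> and so null for every hypertrace, and \<open>h\<close> maps the complement
  of one translate of \<open>Z\<close> into another. The witnesses may depend on
  \<open>h\<close>.\<close>

locale wandering = group_l2 +
  fixes \<Gamma> :: "'a set"
  assumes \<Gamma>: "\<Gamma> \<subseteq> carrier G" and \<Gamma>_comm: "x \<in> \<Gamma> \<Longrightarrow> y \<in> \<Gamma> \<Longrightarrow> x \<otimes> y = y \<otimes> x"
    and \<Gamma>_nontriv: "\<exists>\<gamma>\<in>\<Gamma>. \<gamma> \<noteq> \<one>"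
    and wandering: "h \<in> carrier G \<Longrightarrow> h \<notin> generate G \<Gamma> \<Longrightarrow>
      \<exists>Z \<alpha> l r. Z \<subseteq> carrier G \<and> \<alpha> \<in> generate G \<Gamma> \<and> l \<in> generate G \<Gamma> \<and> r \<in> generate G \<Gamma> \<and>
        (\<forall>k::nat. 0 < k \<longrightarrow> Z \<inter> (\<otimes>) (\<alpha> [^] k) ` Z = {}) \<and>
        (\<forall>x\<in>carrier G. r \<otimes> x \<notin> Z \<longrightarrow> inv l \<otimes> (h \<otimes> x) \<in> Z)"
begin

abbreviation A where "A \<equiv> vn_generated (carrier G) (left_regular G ` \<Gamma>)"

abbreviation upA where "upA \<equiv> commutant (commutant (gen_ops \<Gamma>))"

lemma generate_pow: "\<alpha> \<in> generate G \<Gamma> \<Longrightarrow> \<alpha> [^] (k::nat) \<in> generate G \<Gamma>"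
  by (induction k) (auto intro: generate.one generate.eng)

text \<open>Coefficients outside the generated subgroup vanish by \<open>coefficient_zero\<close>,
  used for \<open>a\<close> and for \<open>ii * a\<close> to cover real and imaginary parts;
  \<open>in_bicommutant\<close> concludes.\<close>

lemma in_upA:
  assumes Q: "star_closed Q" "commutant (commutant Q) = Q" "ii \<in> Q" "Q \<subseteq> rep.rvn"
    and LQ: "L ` \<Gamma> \<subseteq> Q" and \<phi>: "rep.hypertrace Q \<phi>"
  shows "Q \<subseteq> upA"
proof
  fix a assume a: "a \<in> Q"
  have LQ': "L g \<in> Q" if "g \<in> generate G \<Gamma>" for g
    using L_generate[of "commutant Q", OF _ \<Gamma> _ that] Q LQ by simp
  have gc: "g \<in> carrier G" if "g \<in> generate G \<Gamma>" for g using generate_in_carrier[OF \<Gamma> that] .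
  have coef: "inner (\<delta> h) (x \<cdot> \<delta> \<one>) = 0" if h: "h \<in> carrier G" "h \<notin> generate G \<Gamma>" and x: "x \<in> Q" for h x
  proof -
    obtain Z \<alpha> l r where Z: "Z \<subseteq> carrier G" and g: "\<alpha> \<in> generate G \<Gamma>" "l \<in> generate G \<Gamma>" "r \<in> generate G \<Gamma>"
      and w': "\<forall>k::nat. 0 < k \<longrightarrow> Z \<inter> (\<otimes>) (\<alpha> [^] k) ` Z = {}"
      and s': "\<forall>x\<in>carrier G. r \<otimes> x \<notin> Z \<longrightarrow> inv l \<otimes> (h \<otimes> x) \<in> Z"
      using wandering[OF h] by (elim exE conjE)
    note w = w'[rule_format] and s = s'[rule_format]
    have "\<phi> (P Z) = 0"
      using rep.\<phi>_wandering[OF Q(4,1) \<phi> gc[OF g(1)] LQ'[OF g(1)] Z w LQ'[OF generate_pow[OF g(1)]]] .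
    then show ?thesis
      using rep.coefficient_zero[OF Q(4,1) \<phi> Z _ h(1) gc[OF g(2)] LQ'[OF g(2)] gc[OF g(3)] LQ'[OF g(3)] s x] by blast
  qed
  have iia: "ii * a \<in> Q" using commutant_mult[of ii "commutant Q" a] Q a by simp
  show "a \<in> upA"
  proof (rule commutantI)
    fix T assume T: "T \<in> commutant (gen_ops \<Gamma>)"
    show "a * T = T * a"
    proof (rule rep.in_bicommutant)
      show "a \<in> rep.rvn" using a Q by auto
      show "T \<in> rep.clin" using T gen_ops(2)[OF \<Gamma>] by (auto simp: clin_def commutant_def)
      show "generate G \<Gamma> \<subseteq> carrier G" using gc by auto
      fix g assume g: "g \<in> carrier G - generate G \<Gamma>"
      have "inner (\<delta> g) ((ii * a) \<cdot> \<delta> \<one>) = 0" using g iia by (intro coef) auto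
      then have "inner (ii \<cdot> \<delta> g) (a \<cdot> \<delta> \<one>) = 0" by (simp add: inner_star'[of _ ii] ii ap_simps)
      then show "inner (\<delta> g) (a \<cdot> \<delta> \<one>) = 0 \<and> inner (ii \<cdot> \<delta> g) (a \<cdot> \<delta> \<one>) = 0"
        using coef[of g a] g a by blast
    next
      fix g assume g: "g \<in> generate G \<Gamma>"
      have "L ` \<Gamma> \<subseteq> upA" using bicommutant_superset[of "gen_ops \<Gamma>"] by (auto simp: gen_ops_def)
      then have "L g \<in> upA"
        by (intro L_generate[OF _ \<Gamma> _ g] star_closed_commutant gen_ops \<Gamma>)
      then show "T * L g = L g * T" using T by (simp add: commutant_def)
    qed
  qed
qed

lemma vn_sub_up:
  assumes "vn_subalgebra (carrier G) B (group_vn G)" "A \<subseteq> B"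
  shows "vn_sub G ii \<delta> L R J P (up ` B) gs" "L ` \<Gamma> \<subseteq> up ` B"
proof -
  have B: "von_neumann_algebra (carrier G) B" "B \<subseteq> group_vn G" using assms(1) by (auto simp: vn_subalgebra_def)
  have "up ` B \<subseteq> rep.rvn" using B(2) up_group_vn by blast
  then show "vn_sub G ii \<delta> L R J P (up ` B) gs"
    by unfold_locales (use vn_up[OF B(1)] gs in auto)
  have "L ` \<Gamma> \<subseteq> upA" using bicommutant_superset[of "gen_ops \<Gamma>"] by (auto simp: gen_ops_def)
  also have "\<dots> \<subseteq> up ` B" unfolding up_generated[OF \<Gamma>, symmetric] using assms(2) by blast
  finally show "L ` \<Gamma> \<subseteq> up ` B" .
qed

lemma up_subset_upA:
  assumes B: "von_neumann_algebra (carrier G) B" and "up ` B \<subseteq> upA"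
  shows "B \<subseteq> A"
proof
  fix T assume T: "T \<in> B"
  then have "up T \<in> upA" using assms(2) by blast
  then have "down (up T) \<in> A" unfolding generated_eq[OF \<Gamma>] by (rule imageI)
  then show "T \<in> A" using vn_up(1)[OF B] T by (auto simp: down_of_up)
qed

lemma injective_subset:
  assumes B: "vn_subalgebra (carrier G) B (group_vn G)" "A \<subseteq> B" and inj: "injective_vn (carrier G) B"
  shows "B \<subseteq> A"
proof -
  interpret vn_sub G ii \<delta> L R J P "up ` B" gs by (rule vn_sub_up[OF B])
  let ?X = "carrier G"
  obtain E where E: "norm_one_projection ?X B E" using inj by (auto simp: injective_vn_def)
  have lin: "\<And>S T a c. S \<in> bounded_ops ?X \<Longrightarrow> T \<in> bounded_ops ?X \<Longrightarrow>
      E (op_lincomb a S c T) = op_lincomb a (E S) c (E T)"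
    and img: "E ` bounded_ops ?X = B" and idem: "\<And>T. T \<in> bounded_ops ?X \<Longrightarrow> E (E T) = E T"
    and sup: "(SUP T\<in>{T \<in> bounded_ops ?X. op_norm ?X T \<le> 1}. ereal (op_norm ?X (E T))) = 1"
    using E by (auto simp: norm_one_projection_def)
  have vB: "von_neumann_algebra ?X B" using B(1) by (simp add: vn_subalgebra_def)
  have EB: "E T \<in> bounded_ops ?X" if "T \<in> bounded_ops ?X" for T using img vn_up(1)[OF vB] that by blast
  define F where "F t = up (E (down t))" for t
  have F_lin: "F (csc a * s + csc c * t) = csc a * F s + csc c * F t" if "s \<in> clin" "t \<in> clin" for a c s t
    using that by (simp add: F_def down_lincomb[symmetric] lin down_bounded up_lincomb EB)
  have F_scale: "F (csc a * t) = csc a * F t" if "t \<in> clin" for a t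
  proof -
    have "csc 0 = 0" using csc_alg(3)[of 0] by simp
    then show ?thesis using F_lin[OF that that, of a 0] by simp
  qed
  have csc_real: "csc (of_real x) * t = x *\<^sub>R t" for x t by (simp add: csc_alg)
  have F_real: "F (x *\<^sub>R t) = x *\<^sub>R F t" if "t \<in> clin" for x t
    using F_scale[OF that, of "of_real x"] unfolding csc_real .
  \<comment> \<open>The supremum in \<open>norm_one_projection\<close> bounds \<open>E\<close> on
    the unit ball; the rest is scaling.\<close>
  have F_norm: "norm (F t) \<le> norm t" if t: "t \<in> clin" for t
  proof (cases "t = 0")
    case True
    then show ?thesis using F_real[OF t, of 0] by simp
  next
    case False
    let ?u = "inverse (norm t) *\<^sub>R t"
    have uc: "?u \<in> clin" using t by (simp add: clin_def commutant_scaleR)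
    have "op_norm ?X (down ?u) \<le> 1"
      using False uc by (simp add: op_norm_up down_bounded up_of_down)
    then have "ereal (op_norm ?X (E (down ?u))) \<le> 1"
      unfolding sup[symmetric] using uc by (intro SUP_upper) (simp add: down_bounded)
    then have "norm (F ?u) \<le> 1" using uc by (simp add: op_norm_up F_def EB down_bounded)
    then show ?thesis using False t by (simp add: F_real field_simps)
  qed
  have "rep.hypertrace (up ` B) (\<lambda>T. inner (\<delta> \<one>) (F (\<theta> T) \<cdot> \<delta> \<one>))"
  proof (rule hypertrace_from_projection; (unfold rep_clin)?)
    show "F (S + T) = F S + F T" if "S \<in> clin" "T \<in> clin" for S T
      using F_lin[OF that, of 1 1] by (simp add: csc_alg)
    show "F (x *\<^sub>R T) = x *\<^sub>R F T" if "T \<in> clin" for x T by (rule F_real[OF that])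
    show "F (ii * T) = ii * F T" if "T \<in> clin" for T using F_scale[OF that, of \<i>] by (simp add: ii_def)
    show "norm (F T) \<le> norm T" if "T \<in> clin" for T by (rule F_norm[OF that])
    show "F T \<in> up ` B" if "T \<in> clin" for T using img down_bounded[OF that] by (auto simp: F_def)
    fix q assume "q \<in> up ` B"
    then obtain T where T: "T \<in> B" "q = up T" by blast
    then obtain S where "S \<in> bounded_ops ?X" "T = E S" using img by blast
    then show "F q = q" using T by (simp add: F_def down_of_up EB idem)
  qed
  then have "up ` B \<subseteq> upA"
    by (rule in_upA[OF Q_star Q_bicomm ii_Q Q_rvn vn_sub_up(2)[OF B]])
  then show ?thesis by (rule up_subset_upA[OF vB])
qed

lemma hyperfinite_subset:
  assumes B: "vn_subalgebra (carrier G) B (group_vn G)" "A \<subseteq> B" and hyp: "hyperfinite (carrier G) B"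
  shows "B \<subseteq> A"
proof -
  interpret vn_sub G ii \<delta> L R J P "up ` B" gs by (rule vn_sub_up[OF B])
  let ?X = "carrier G"
  have vB: "von_neumann_algebra ?X B" using B(1) by (simp add: vn_subalgebra_def)
  obtain F :: "nat \<Rightarrow> 'a operator set" where
    F: "\<And>k. star_subalgebra ?X (F k)" "\<And>k. finite_dim (F k)" "\<And>k. F k \<subseteq> F (Suc k)"
    and cl: "B = weak_op_topology ?X closure_of (\<Union>k. F k)"
    using hyp by (auto simp: hyperfinite_def)
  have FX: "F k \<subseteq> bounded_ops ?X" for k using F(1) by (simp add: star_subalgebra_def)
  have FB: "F k \<subseteq> B" for k
    unfolding cl using FX closure_of_subset[of "\<Union>k. F k" "weak_op_topology ?X"] by (auto simp: topspace_weak)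
  note alg = star_subalgebra_up[OF F(1)]
  have csc0: "csc 0 = 0" using csc_alg(3)[of 0] by simp
  have zero: "0 \<in> up ` F k" for k
  proof -
    obtain T where "T \<in> F k" using F(1)[of k] by (auto simp: star_subalgebra_def)
    then show ?thesis using alg(6)[of "up T" k 0] by simp
  qed
  have csc_mem: "csc a * s \<in> up ` F k" if "s \<in> up ` F k" for a s k
    using alg(4)[OF that that, of a 0] by (simp add: csc0)
  have csc_com: "s * csc a = csc a * s" if "s \<in> up ` F k" for a s k
    using csc_clin alg(1) that by blast
  \<comment> \<open>A \<open>star_subalgebra\<close> may lack the identity operator, so the scalars
    are adjoined to obtain \<open>1 \<in> H k\<close>.\<close>
  define H where "H k = {s + csc a | s a. s \<in> up ` F k}" for k
  have HI: "s + csc a \<in> H k" if "s \<in> up ` F k" for s a k using that by (auto simp: H_def)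
  have csc_rvn: "csc a \<in> rep.rvn" for a
    unfolding csc_decomp by (intro rep.rvn_simps)
  have "\<exists>\<phi>. rep.hypertrace (up ` B) \<phi>"
  proof (rule rep.hypertrace_from_finite_dim[where F = H])
    show "up ` B \<subseteq> rep.rvn" by (rule Q_rvn)
    show "H k \<subseteq> rep.rvn" for k
      using FB[of k] Q_rvn csc_rvn by (auto simp: H_def intro!: rep.rvn_simps)
    show "1 \<in> H k" for k using HI[OF zero, of 1] by (simp add: csc_alg)
    show "star_closed (H k)" for k
      using alg(2)[of k] by (auto simp: star_closed_def H_def star_csc) blast
    show "S + T \<in> H k" if "S \<in> H k" "T \<in> H k" for k S T
    proof -
      obtain s a t c where "S = s + csc a" "T = t + csc c" and st: "s \<in> up ` F k" "t \<in> up ` F k"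
        using \<open>S \<in> H k\<close> \<open>T \<in> H k\<close> unfolding H_def by blast
      then have "S + T = (s + t) + csc (a + c)" by (simp add: csc_alg(4)[symmetric])
      then show ?thesis using HI[OF alg(5)[OF st]] by simp
    qed
    show "S * T \<in> H k" if "S \<in> H k" "T \<in> H k" for k S T
    proof -
      obtain s a t c where S: "S = s + csc a" "T = t + csc c" and st: "s \<in> up ` F k" "t \<in> up ` F k"
        using \<open>S \<in> H k\<close> \<open>T \<in> H k\<close> unfolding H_def by blast
      have "S * T = (s * t + csc a * t) + (s * csc c + csc a * csc c)"
        by (simp only: S distrib_left distrib_right)
      also have "s * csc c = csc c * s" by (rule csc_com[OF st(1)])
      also have "csc a * csc c = csc (a * c)" by (rule csc_alg)
      also have "(s * t + csc a * t) + (csc c * s + csc (a * c)) = (s * t + (csc c * s + csc a * t)) + csc (a * c)"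
        by (simp only: ac_simps)
      finally have "S * T = (s * t + (csc c * s + csc a * t)) + csc (a * c)" .
      then show ?thesis using HI[OF alg(5)[OF alg(3)[OF st] alg(4)[OF st]]] by simp
    qed
    show "x *\<^sub>R T \<in> H k" if "T \<in> H k" for k x T
    proof -
      obtain t c where T: "T = t + csc c" and t: "t \<in> up ` F k" using \<open>T \<in> H k\<close> unfolding H_def by blast
      have "csc (of_real x * c) = x *\<^sub>R csc c" 
        by (intro endo_eqI l2_eqI) (simp add: coord_csc ap_simps scaleR_conv_of_real)
      then have "x *\<^sub>R T = x *\<^sub>R t + csc (of_real x * c)" by (simp add: T scaleR_add_right)
      then show ?thesis using HI[OF alg(6)[OF t]] by simp
    qed
    show "\<exists>C. finite C \<and> H k \<subseteq> span C" for k
    proof -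
      obtain C where C: "finite C" "C \<subseteq> F k" "\<And>T. T \<in> F k \<Longrightarrow> \<exists>c. T = (\<lambda>f x. \<Sum>S\<in>C. c S * S f x)"
        using F(2)[of k] by (auto simp: finite_dim_def)
      \<comment> \<open>A complex spanning set becomes a real one by adding its multiples by
        \<open>ii\<close>; 1 and \<open>ii\<close> account for the adjoined scalars.\<close>
      let ?D = "up ` C \<union> (\<lambda>t. ii * t) ` up ` C \<union> {1, ii}"
      have mem: "csc a * t \<in> span ?D" if "t \<in> insert 1 (up ` C)" for a t
      proof -
        have "csc a * t = Re a *\<^sub>R t + Im a *\<^sub>R (ii * t)" by (simp add: csc_decomp distrib_right)
        then show ?thesis using that by (auto intro!: span_add span_scale intro: span_base)
      qed
      have "up T \<in> span ?D" if T: "T \<in> F k" for T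
      proof -
        obtain c where c: "T = (\<lambda>f x. \<Sum>S\<in>C. c S * S f x)" using C(3)[OF T] by blast
        have CX: "S \<in> bounded_ops ?X" if "S \<in> C" for S using C(2) FX that by blast
        have "up T = (\<Sum>S\<in>C. csc (c S) * up S)"
        proof (intro endo_eqI l2_eqI)
          fix h n
          have "coord (up T \<cdot> h) n = T (down_v h) (b n)"
            using T FX by (simp add: up_ap subset_iff coord_up bounded_ell2)
          also have "\<dots> = (\<Sum>S\<in>C. c S * S (down_v h) (b n))" by (simp add: c)
          also have "\<dots> = (\<Sum>S\<in>C. coord ((csc (c S) * up S) \<cdot> h) n)"
            by (intro sum.cong refl) (simp add: coord_csc up_ap CX coord_up bounded_ell2)
          finally show "coord (up T \<cdot> h) n = coord ((\<Sum>S\<in>C. csc (c S) * up S) \<cdot> h) n"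
            by (simp add: ap.sum_left)
        qed
        also have "\<dots> \<in> span ?D" by (intro span_sum mem) simp
        finally show ?thesis .
      qed
      moreover have "csc a \<in> span ?D" for a using mem[of 1 a] by simp
      ultimately have "H k \<subseteq> span ?D" by (auto simp: H_def intro!: span_add)
      moreover have "finite ?D" using C(1) by simp
      ultimately show ?thesis by (intro exI[of _ ?D] conjI)
    qed
    show "H k \<subseteq> H (Suc k)" for k using F(3)[of k] unfolding H_def by blast
    fix a and \<epsilon> :: real assume a: "a \<in> up ` B" and \<epsilon>: "0 < \<epsilon>"
    obtain T where T: "T \<in> B" "a = up T" using a by blast
    have mono: "F k \<subseteq> F m" if "k \<le> m" for k m using that F(3) by (rule lift_Suc_mono_le[rotated])
    have "subspace (up ` (\<Union>k. F k))"
      unfolding subspace_def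
    proof (intro conjI ballI allI)
      show "0 \<in> up ` (\<Union>k. F k)" using zero[of 0] by blast
      fix S assume "S \<in> up ` (\<Union>k. F k)"
      then obtain k where k: "S \<in> up ` F k" by blast
      show "x *\<^sub>R S \<in> up ` (\<Union>k. F k)" for x using alg(6)[OF k, of x] by blast
      fix S' assume "S' \<in> up ` (\<Union>k. F k)"
      then obtain m where "S' \<in> up ` F m" by blast
      then have "S \<in> up ` F (max k m)" "S' \<in> up ` F (max k m)"
        using k mono[of k "max k m"] mono[of m "max k m"] by auto
      from alg(5)[OF this] show "S + S' \<in> up ` (\<Union>k. F k)" by blast
    qed
    then obtain S where S: "S \<in> (\<Union>k. F k)" "norm ((up T - up S) \<cdot> \<delta> \<one>) < \<epsilon>"
      using closure_of_strong[of "\<Union>k. F k" T \<epsilon> "\<delta> \<one>"] T \<epsilon> FX by (auto simp: cl)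
    then obtain k where k: "S \<in> F k" by blast
    have "up S \<in> H k" using HI[of "up S" k 0] k by (simp add: csc0)
    then show "\<exists>k. \<exists>b\<in>H k. norm ((a - b) \<cdot> \<delta> \<one>) < \<epsilon>" using S(2) T(2) by blast
  qed
  then obtain \<phi> where "rep.hypertrace (up ` B) \<phi>" by blast
  then have "up ` B \<subseteq> upA"
    by (rule in_upA[OF Q_star Q_bicomm ii_Q Q_rvn vn_sub_up(2)[OF B]])
  then show ?thesis by (rule up_subset_upA[OF vB])
qed

section \<open>The algebra \<open>A\<close> itself: abelian, injective, not a factor\<close>

lemma A_subalgebra: "vn_subalgebra (carrier G) A (group_vn G)"
proof -
  have "A \<subseteq> group_vn G" unfolding group_vn_def vn_generated_def using \<Gamma> by blast
  then show ?thesis using generated_vn[OF \<Gamma>] by (simp add: vn_subalgebra_def)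
qed

text \<open>The generators are commuting unitaries, so each commutes with the adjoints of the others
  too; hence \<open>gen_ops \<Gamma>\<close> lies in its own commutant.\<close>

lemma upA_abelian:
  assumes "p \<in> upA" "q \<in> upA"
  shows "p * q = q * p"
proof -
  have LL: "L g * L h = L h * L g" if "g \<in> \<Gamma>" "h \<in> \<Gamma>" for g h
    using that \<Gamma> \<Gamma>_comm[OF that] by (simp add: rep.L_mult subset_iff)
  have uni: "unitary (L g)" if "g \<in> \<Gamma>" for g
    using that \<Gamma> by (auto simp: unitary_def rep.star_L rep.L_mult rep.L_one)
  have 1: "L g \<in> commutant (gen_ops \<Gamma>)" if g: "g \<in> \<Gamma>" for g
  proof (rule commutantI)
    fix A assume "A \<in> gen_ops \<Gamma>"
    then consider "A = ii" | "A = - ii" | h where "h \<in> \<Gamma>" "A = L h" | h where "h \<in> \<Gamma>" "A = star (L h)"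
      by (auto simp: gen_ops_def)
    then show "L g * A = A * L g"
    proof cases
      case 4
      then show ?thesis using commute_star_unitary[OF uni[OF 4(1)] LL[OF g 4(1)]] by simp
    qed (use g \<Gamma> LL in \<open>auto simp: rep.L_ii subset_iff\<close>)
  qed
  have sc: "star_closed (commutant (gen_ops \<Gamma>))" by (intro star_closed_commutant gen_ops \<Gamma>)
  have "gen_ops \<Gamma> \<subseteq> commutant (gen_ops \<Gamma>)"
    using gen_ops(4)[OF \<Gamma>] 1 star_closedD[OF sc 1] commutant_minus[OF gen_ops(4)[OF \<Gamma>]]
    by (auto simp: gen_ops_def)
  then have "upA \<subseteq> commutant (gen_ops \<Gamma>)" by (rule commutant_antimono)
  then have "q \<in> commutant (gen_ops \<Gamma>)" using assms(2) by (rule subsetD)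
  then show ?thesis by (rule commutantD[OF assms(1)])
qed

lemma A_injective: "injective_vn (carrier G) A"
proof -
  let ?X = "carrier G"
  interpret vn_sub G ii \<delta> L R J P upA gs
    using vn_sub_up(1)[OF A_subalgebra order_refl] by (simp add: up_generated[OF \<Gamma>])
  have Q': "commutant upA = commutant (gen_ops \<Gamma>)" by simp
  have "countable \<Gamma>" using \<Gamma> countable_X by (rule countable_subset)
  moreover have "\<Gamma> \<noteq> {}" using \<Gamma>_nontriv by auto
  \<comment> \<open>For finite \<open>\<Gamma>\<close> the enumeration repeats elements; what counts
    is its range.\<close>
  ultimately have rng: "range (from_nat_into \<Gamma>) = \<Gamma>" by (intro range_from_nat_into)
  define us where "us n = L (from_nat_into \<Gamma> n)" for n
  have mem: "from_nat_into \<Gamma> n \<in> \<Gamma>" for n using rng by blast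
  have us_range: "range us = L ` \<Gamma>"
    unfolding us_def image_image[symmetric] by (simp add: rng image_comp[symmetric])
  have usA: "us n \<in> upA" for n
    using bicommutant_superset[of "gen_ops \<Gamma>"] mem[of n] by (auto simp: us_def gen_ops_def)
  have uni: "unitary (us n)" for n
    using mem[of n] \<Gamma> by (auto simp: us_def unitary_def rep.star_L rep.L_mult rep.L_one)
  have com: "us m * us n = us n * us m" for m n by (rule upA_abelian[OF usA usA])
  note av = avg_add[of us, OF uni com] avg_left[of us, OF uni com] avg_fixed[of us, OF uni com] avg_commute[of us, OF uni com]
    avg_preserves[of us, OF uni com] norm_avg[of us, OF uni com]
  have csc_upA: "csc a \<in> upA" for a
    unfolding csc_decomp by (intro Q_simps ii_Q)
  have usclin: "us n \<in> clin" for n using mem[of n] \<Gamma> by (auto simp: us_def L_clin)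
  define F where "F t = \<theta> (avg us t)" for t
  have avg_Q': "avg us t \<in> commutant upA" if t: "t \<in> clin" for t
    unfolding Q'
  proof (rule commutantI)
    fix A assume "A \<in> gen_ops \<Gamma>"
    then consider "A = ii" | "A = - ii" | n where "A = us n" | n where "A = star (us n)"
      unfolding gen_ops_def us_range[symmetric] by blast
    moreover have ii_c: "avg us t * ii = ii * avg us t"
      by (rule av(5)) (use t usclin in \<open>auto simp: clin_def commutant_def\<close>)
    ultimately show "avg us t * A = A * avg us t"
    proof cases
      case 4
      then show ?thesis using commute_star_unitary[OF uni av(4)] by simp
    next
      case (3 n)
      then show ?thesis using av(4)[of t n] by simp
    qed (simp_all add: ii_c)
  qed
  have FQ: "F t \<in> upA" if "t \<in> clin" for t
    unfolding F_def by (rule \<theta>_abelian[OF upA_abelian avg_Q'[OF that]])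
  have F_fixed: "F q = q" if "q \<in> upA" for q
    using that by (simp add: F_def av(3)[OF upA_abelian[OF that usA]] \<theta>_Q)
  have F_norm: "norm (F t) \<le> norm t" for t
    unfolding F_def using norm_\<theta>[of "avg us t"] av(6)[of t] by simp
  have F_lin: "F (csc a * s + csc c * t) = csc a * F s + csc c * F t" for a c s t
  proof -
    have "avg us (csc a * s) = csc a * avg us s" for a s
      by (rule av(2)) (rule upA_abelian[OF csc_upA usA])
    then show ?thesis by (simp add: F_def av(1) \<theta>_add \<theta>_left csc_upA)
  qed
  have upAclin: "upA \<subseteq> clin" by (rule bicomm_clin[OF \<Gamma>])
  define E where "E T = down (F (up T))" for T
  have "norm_one_projection ?X A E"
    unfolding norm_one_projection_def
  proof (intro conjI ballI allI)
    fix S T :: "'a operator" and a c assume st: "S \<in> bounded_ops ?X" "T \<in> bounded_ops ?X"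
    then have "F (up S) \<in> clin" "F (up T) \<in> clin" using FQ up_clin upAclin by blast+
    then show "E (op_lincomb a S c T) = op_lincomb a (E S) c (E T)"
      using st by (simp add: E_def up_lincomb F_lin down_lincomb)
  next
    show img: "E ` bounded_ops ?X = A"
    proof
      show "E ` bounded_ops ?X \<subseteq> A"
        unfolding generated_eq[OF \<Gamma>] E_def using FQ up_clin by blast
      show "A \<subseteq> E ` bounded_ops ?X"
      proof
        fix T assume "T \<in> A"
        then obtain t where t: "t \<in> upA" "T = down t" by (auto simp: generated_eq[OF \<Gamma>])
        then have "t \<in> clin" using upAclin by auto
        then have "T \<in> bounded_ops ?X" "E T = T" using t by (simp_all add: E_def up_of_down F_fixed down_bounded)
        then show "T \<in> E ` bounded_ops ?X" by (metis image_eqI)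
      qed
    qed
    show "E (E T) = E T" if "T \<in> bounded_ops ?X" for T
    proof -
      have "F (up T) \<in> upA" using FQ up_clin[OF that] by blast
      then show ?thesis using upAclin by (simp add: E_def up_of_down F_fixed subset_iff)
    qed
    show "(SUP T\<in>{T \<in> bounded_ops ?X. op_norm ?X T \<le> 1}. ereal (op_norm ?X (E T))) = 1"
    proof (rule antisym)
      have EX: "E T \<in> bounded_ops ?X" "up (E T) = F (up T)" if "T \<in> bounded_ops ?X" for T
        using FQ[OF up_clin[OF that]] upAclin by (auto simp: E_def down_bounded up_of_down subset_iff)
      show "(SUP T\<in>{T \<in> bounded_ops ?X. op_norm ?X T \<le> 1}. ereal (op_norm ?X (E T))) \<le> 1"
      proof (rule SUP_least)
        fix T assume T: "T \<in> {T \<in> bounded_ops ?X. op_norm ?X T \<le> 1}"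
        then have "op_norm ?X (E T) = norm (F (up T))" using EX by (simp add: op_norm_up)
        also have "\<dots> \<le> norm (up T)" by (rule F_norm)
        also have "\<dots> \<le> 1" using T by (auto simp: op_norm_up)
        finally show "ereal (op_norm ?X (E T)) \<le> 1" by simp
      qed
      \<comment> \<open>The supremum has to equal 1, and the identity attains it.\<close>
      have id: "op_id ?X \<in> bounded_ops ?X" by (simp add: down_one down_bounded clin_alg)
      have "norm (1 :: complex l2 endo) = 1"
      proof (rule antisym[OF norm_one_endo])
        have "norm (1 \<cdot> \<delta> \<one>) \<le> norm (1 :: complex l2 endo) * norm (\<delta> \<one>)" by (rule norm_ap)
        then show "1 \<le> norm (1 :: complex l2 endo)" by (simp add: rep.norm_\<delta>)
      qed
      moreover have "F 1 = 1" by (rule F_fixed) simp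
      ultimately have "op_norm ?X (op_id ?X) \<le> 1" "op_norm ?X (E (op_id ?X)) = 1"
        using id EX[OF id] by (simp_all add: op_norm_up up_id)
      then show "1 \<le> (SUP T\<in>{T \<in> bounded_ops ?X. op_norm ?X T \<le> 1}. ereal (op_norm ?X (E T)))"
        using id by (intro SUP_upper2[of "op_id ?X"]) auto
    qed
  qed
  then show ?thesis using A_subalgebra by (auto simp: injective_vn_def vn_subalgebra_def)
qed

text \<open>For nontrivial \<open>\<gamma>\<close> the translation \<open>L \<gamma>\<close> is
  central, as the algebra is abelian, and no scalar, as it moves \<open>\<delta> \<one>\<close> to
  \<open>\<delta> \<gamma>\<close>.\<close>

lemma A_not_factor: "\<not> vn_factor (carrier G) A"
proof
  assume "vn_factor (carrier G) A"
  then have centre: "{T \<in> A. \<forall>S\<in>A. S \<circ> T = T \<circ> S} = {\<lambda>f x. c * op_id (carrier G) f x | c. True}"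
    by (simp add: vn_factor_def)
  obtain \<gamma> where \<gamma>: "\<gamma> \<in> \<Gamma>" "\<gamma> \<noteq> \<one>" using \<Gamma>_nontriv by blast
  then have \<gamma>c: "\<gamma> \<in> carrier G" using \<Gamma> by auto
  have "L \<gamma> \<in> upA" using \<gamma>(1) bicommutant_superset[of "gen_ops \<Gamma>"] by (auto simp: gen_ops_def)
  then have LA: "down (L \<gamma>) \<in> A" by (simp add: generated_eq[OF \<Gamma>])
  have "S \<circ> down (L \<gamma>) = down (L \<gamma>) \<circ> S" if "S \<in> A" for S
  proof -
    obtain s where s: "s \<in> upA" "S = down s" using \<open>S \<in> A\<close> by (auto simp: generated_eq[OF \<Gamma>])
    then have "s \<in> clin" using bicomm_clin[OF \<Gamma>] by auto
    then show ?thesis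
      using upA_abelian[OF s(1) \<open>L \<gamma> \<in> upA\<close>] L_clin[OF \<gamma>c] by (simp add: s(2) down_mult)
  qed
  then have "down (L \<gamma>) \<in> {T \<in> A. \<forall>S\<in>A. S \<circ> T = T \<circ> S}" using LA by simp
  then obtain c where c: "down (L \<gamma>) = (\<lambda>f x. c * op_id (carrier G) f x)" unfolding centre by blast
  have "down (L \<gamma>) (down_v (\<delta> \<one>)) \<gamma> = 1"
    using \<gamma>c by (simp add: down_def rep.L_\<delta>) (simp add: down_v_def coord_\<delta>)
  moreover have "op_id (carrier G) (down_v (\<delta> \<one>)) \<gamma> = 0"
    using \<gamma> \<gamma>c by (simp add: op_id_def) (simp add: down_v_def coord_\<delta> ix_eq b_ix)
  ultimately show False by (simp add: c)
qed

theorem wandering_maximal_injective: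
  "maximal_injective (carrier G) A (group_vn G)"
  "\<not> (\<exists>B. vn_subalgebra (carrier G) B (group_vn G) \<and> vn_factor (carrier G) B \<and>
            hyperfinite (carrier G) B \<and> A \<subseteq> B)"
proof -
  show "maximal_injective (carrier G) A (group_vn G)"
    unfolding maximal_injective_def
    using A_subalgebra A_injective injective_subset by blast
  show "\<not> (\<exists>B. vn_subalgebra (carrier G) B (group_vn G) \<and> vn_factor (carrier G) B \<and>
            hyperfinite (carrier G) B \<and> A \<subseteq> B)"
    using A_not_factor hyperfinite_subset by (metis subset_antisym)
qed

end


section \<open>Products of free groups\<close>

lemma split_at_first_and_last:
  assumes "\<exists>c\<in>set w. \<not> Q c"
  shows "\<exists>u v s. w = u @ v @ s \<and> (\<forall>c\<in>set u. Q c) \<and> (\<forall>c\<in>set s. Q c) \<and> v \<noteq> [] \<and> \<not> Q (hd v) \<and> \<not> Q (last v)"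
proof -
  obtain u c w' where w: "w = u @ c # w'" "\<not> Q c" "\<forall>x\<in>set u. Q x"
    using split_list_first_prop[OF assms] by auto
  show ?thesis
  proof (cases "\<exists>c\<in>set w'. \<not> Q c")
    case True
    from split_list_last_prop[OF True] obtain m d s where "w' = m @ d # s" "\<not> Q d" "\<forall>x\<in>set s. Q x"
      by auto
    then show ?thesis using w
      by (intro exI[of _ u] exI[of _ "c # m @ [d]"] exI[of _ s]) auto
  next
    case False
    \<comment> \<open>Here the first and the last violating letter coincide.\<close>
    then show ?thesis using w by (intro exI[of _ u] exI[of _ "[c]"] exI[of _ w']) auto
  qed
qed

lemma foldr_red_cons_append: "reduced (v @ y) \<Longrightarrow> foldr red_cons v y = v @ y"
proof (induction v)
  case (Cons a v)
  then show ?case using red_cons_reduced[of a "v @ y"] reduced_tl[of a "v @ y"] by simp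
qed simp

lemma reduced_appendD: "reduced (u @ v) \<Longrightarrow> reduced u" "reduced (u @ v) \<Longrightarrow> reduced v"
  by (simp_all add: reduced_def successively_append_iff)

lemma reduced_replicate: "reduced (replicate k (s, False))"
  unfolding reduced_def successively_conv_nth by (simp add: flip_letter_def)

lemma free_group_simps:
  "x \<otimes>\<^bsub>free_group S\<^esub> y = foldr red_cons x y" "\<one>\<^bsub>free_group S\<^esub> = []"
  "x \<in> carrier (free_group S) \<longleftrightarrow> set x \<subseteq> S \<times> UNIV \<and> reduced x"
  by (simp_all add: free_group_def)

locale free_product_data =
  fixes N :: enat and n :: "nat \<Rightarrow> nat"
  assumes N: "1 \<le> N" and n: "i \<in> index_range N \<Longrightarrow> 2 \<le> n i"
begin

declare One_nat_def [simp del]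

abbreviation I where "I \<equiv> index_range N"
abbreviation Fr where "Fr i \<equiv> free_group {1..n i}"
abbreviation G where "G \<equiv> prod_free_groups N n"

lemma grp: "group (Fr i)"
  by (rule group_free_group)

lemma carrier_G: "carrier G = {x \<in> \<Pi>\<^sub>E i\<in>I. carrier (Fr i). finite {i \<in> I. x i \<noteq> []}}"
  unfolding prod_free_groups_def by (subst carrier_sum_group) (simp_all add: grp free_group_simps)

lemma one_G: "\<one>\<^bsub>G\<^esub> = (\<lambda>i\<in>I. [])"
  by (simp add: prod_free_groups_def free_group_simps)

lemma mult_G: "x \<otimes>\<^bsub>G\<^esub> y = (\<lambda>i\<in>I. foldr red_cons (x i) (y i))"
  by (simp add: prod_free_groups_def free_group_simps)

lemma group_G: "group G"
  unfolding prod_free_groups_def by (rule sum_group) (rule grp)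

lemma inv_G: "x \<in> carrier G \<Longrightarrow> inv\<^bsub>G\<^esub> x = (\<lambda>i\<in>I. inv\<^bsub>Fr i\<^esub> (x i))"
  unfolding prod_free_groups_def by (subst inv_sum_group) (simp_all add: grp)

sublocale group G by (rule group_G)

lemma G_reduced: "x \<in> carrier G \<Longrightarrow> i \<in> I \<Longrightarrow> reduced (x i)"
  by (auto simp: carrier_G free_group_simps)

lemma G_ext: "x \<in> carrier G \<Longrightarrow> y \<in> carrier G \<Longrightarrow> (\<And>i. i \<in> I \<Longrightarrow> x i = y i) \<Longrightarrow> x = y"
  by (auto simp: carrier_G intro: PiE_ext)

text \<open>Finite support gives countability even for infinite \<open>N\<close>: an element is
  determined by the finite set of its nontrivial coordinates, tagged with their indices.\<close>

lemma countable_G: "countable (carrier G)"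
proof -
  define h where "h x = {(i, x i) | i. i \<in> I \<and> x i \<noteq> []}" for x :: "nat \<Rightarrow> (nat \<times> bool) list"
  have "inj_on h (carrier G)"
  proof (rule inj_onI)
    fix x y assume xy: "x \<in> carrier G" "y \<in> carrier G" and eq: "h x = h y"
    show "x = y"
    proof (rule G_ext[OF xy])
      fix i assume i: "i \<in> I"
      have mem: "(i, w) \<in> h z \<longleftrightarrow> z i = w \<and> w \<noteq> []" for z w using i by (auto simp: h_def)
      have "(x i = w \<and> w \<noteq> []) \<longleftrightarrow> (y i = w \<and> w \<noteq> [])" for w using eq mem by metis
      then show "x i = y i" by metis
    qed
  qed
  moreover have "h ` carrier G \<subseteq> {A. finite A}"
  proof safe
    fix x assume "x \<in> carrier G"
    then have "finite {i \<in> I. x i \<noteq> []}" by (simp add: carrier_G)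
    moreover have "h x = (\<lambda>i. (i, x i)) ` {i \<in> I. x i \<noteq> []}" by (auto simp: h_def)
    ultimately show "finite (h x)" by simp
  qed
  then have "countable (h ` carrier G)"
    using countable_Collect_finite countable_subset by blast
  ultimately show ?thesis using countable_image_inj_on by blast
qed

definition emb :: "nat \<Rightarrow> (nat \<times> bool) list \<Rightarrow> nat \<Rightarrow> (nat \<times> bool) list" where
  "emb i w = (\<lambda>k\<in>I. if k = i then w else [])"

definition gen :: "nat \<Rightarrow> nat \<Rightarrow> (nat \<times> bool) list" where "gen i = std_gen N n i 1"

definition \<Gamma> where "\<Gamma> = gen ` I"

lemma gen_emb: "gen i = emb i [(1, False)]"
  by (simp add: gen_def std_gen_def emb_def free_gen_def free_group_simps restrict_def fun_eq_iff)

lemma reduced_Nil [simp]: "reduced []"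
  by (simp add: reduced_def)

lemma emb_closed: "i \<in> I \<Longrightarrow> w \<in> carrier (Fr i) \<Longrightarrow> emb i w \<in> carrier G"
proof -
  assume *: "i \<in> I" "w \<in> carrier (Fr i)"
  have "{k \<in> I. emb i w k \<noteq> []} \<subseteq> {i}" by (auto simp: emb_def)
  then have "finite {k \<in> I. emb i w k \<noteq> []}" by (rule finite_subset) simp
  then show ?thesis using * by (auto simp: carrier_G emb_def free_group_simps)
qed

lemma emb_mult: "emb i (foldr red_cons u v) = emb i u \<otimes>\<^bsub>G\<^esub> emb i v"
  by (auto simp: mult_G emb_def fun_eq_iff)

lemma one_le: "i \<in> I \<Longrightarrow> (1::nat) \<in> {1..n i}"
  using n[of i] by simp

lemma gen_closed: "i \<in> I \<Longrightarrow> gen i \<in> carrier G"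
  unfolding gen_emb using one_le by (intro emb_closed) (auto simp: free_group_simps reduced_def)

lemma \<Gamma>_closed: "\<Gamma> \<subseteq> carrier G"
  using gen_closed by (auto simp: \<Gamma>_def)

lemma gen_pow: "i \<in> I \<Longrightarrow> gen i [^]\<^bsub>G\<^esub> k = emb i (replicate k (1, False))"
proof (induction k)
  case 0
  then show ?case by (simp add: one_G emb_def)
next
  case (Suc k)
  have "gen i [^]\<^bsub>G\<^esub> Suc k = gen i \<otimes>\<^bsub>G\<^esub> gen i [^]\<^bsub>G\<^esub> k"
    using gen_closed[OF Suc.prems] by (rule nat_pow_Suc2)
  also have "gen i [^]\<^bsub>G\<^esub> k = emb i (replicate k (1, False))" using Suc by simp
  also have "gen i \<otimes>\<^bsub>G\<^esub> emb i (replicate k (1, False)) = emb i (foldr red_cons [(1, False)] (replicate k (1, False)))"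
    by (simp only: emb_mult gen_emb[of i])
  also have "foldr red_cons [(1, False)] (replicate k (1, False)) = replicate (Suc k) (1, False)"
    using foldr_red_cons_append[of "[(1, False)]" "replicate k (1, False)"] reduced_replicate[of "Suc k" 1] by simp
  finally show ?case .
qed

lemma one_in_I: "1 \<in> I"
  using N by (simp add: index_range_def one_enat_def)

lemma infinite_G: "infinite (carrier G)"
proof
  assume fin: "finite (carrier G)"
  have "inj (\<lambda>k::nat. gen 1 [^]\<^bsub>G\<^esub> k)"
  proof (rule injI)
    fix k m assume "gen 1 [^]\<^bsub>G\<^esub> (k::nat) = gen 1 [^]\<^bsub>G\<^esub> (m::nat)"
    then have "emb 1 (replicate k (1, False)) 1 = emb 1 (replicate m (1, False)) 1"
      by (simp add: gen_pow one_in_I)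
    then have "replicate k (1::nat, False) = replicate m (1, False)" using one_in_I by (simp add: emb_def)
    then show "k = m" by (metis length_replicate)
  qed
  moreover have "range (\<lambda>k::nat. gen 1 [^]\<^bsub>G\<^esub> k) \<subseteq> carrier G" using gen_closed[OF one_in_I] by auto
  ultimately have "finite (UNIV :: nat set)" using fin by (meson finite_imageD finite_subset)
  then show False by simp
qed

lemma gen_comm: "x \<in> \<Gamma> \<Longrightarrow> y \<in> \<Gamma> \<Longrightarrow> x \<otimes>\<^bsub>G\<^esub> y = y \<otimes>\<^bsub>G\<^esub> x"
  by (auto simp: \<Gamma>_def gen_emb mult_G emb_def fun_eq_iff)

lemma gen_nontriv: "\<exists>\<gamma>\<in>\<Gamma>. \<gamma> \<noteq> \<one>\<^bsub>G\<^esub>"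
proof -
  have "gen 1 1 \<noteq> \<one>\<^bsub>G\<^esub> 1" using one_in_I by (simp add: gen_emb emb_def one_G)
  then have "gen 1 \<noteq> \<one>\<^bsub>G\<^esub>" by metis
  then show ?thesis using one_in_I by (auto simp: \<Gamma>_def)
qed

lemma emb_generate:
  assumes i: "i \<in> I" and w: "reduced w" "\<forall>c\<in>set w. fst c = 1"
  shows "emb i w \<in> generate G \<Gamma>"
  using w
proof (induction w)
  case Nil
  have "emb i [] = \<one>\<^bsub>G\<^esub>" by (simp add: emb_def one_G)
  then show ?case using generate.one[of G \<Gamma>] by simp
next
  case (Cons c w)
  have "gen i \<in> \<Gamma>" using i by (simp add: \<Gamma>_def)
  have "emb i [c] \<in> generate G \<Gamma>"
  proof (cases "snd c")
    case False
    then have "emb i [c] = gen i" using Cons.prems by (simp add: gen_emb) (metis prod.collapse)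
    then show ?thesis using \<open>gen i \<in> \<Gamma>\<close> generate.incl by metis
  next
    case True
    then have c: "c = (1, True)" using Cons.prems by (simp add: prod_eq_iff)
    have cl: "emb i [c] \<in> carrier G"
      using i one_le by (intro emb_closed) (auto simp: c free_group_simps reduced_def)
    have "emb i [c] \<otimes>\<^bsub>G\<^esub> gen i = \<one>\<^bsub>G\<^esub>"
      unfolding gen_emb emb_mult[symmetric] by (simp add: c flip_letter_def) (simp add: emb_def one_G)
    then have "inv\<^bsub>G\<^esub> gen i = emb i [c]" by (rule inv_equality) (use gen_closed i cl in auto)
    then show ?thesis using generate.inv[OF \<open>gen i \<in> \<Gamma>\<close>, of G] by simp
  qed
  moreover have "emb i w \<in> generate G \<Gamma>"
    using Cons.IH[OF reduced_tl[OF Cons.prems(1)]] Cons.prems(2) by simp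
  moreover have "emb i (c # w) = emb i [c] \<otimes>\<^bsub>G\<^esub> emb i w"
    using Cons.prems(1) by (simp add: emb_mult[symmetric] red_cons_reduced)
  ultimately show ?case using generate.eng by metis
qed

text \<open>Induction on the finite support, splitting off one coordinate at a time.\<close>

lemma in_generate:
  assumes x: "x \<in> carrier G" and one: "\<And>i c. i \<in> I \<Longrightarrow> c \<in> set (x i) \<Longrightarrow> fst c = 1"
  shows "x \<in> generate G \<Gamma>"
proof -
  have "finite {i \<in> I. x i \<noteq> []}" using x by (simp add: carrier_G)
  then show ?thesis using x one
  proof (induction "{i \<in> I. x i \<noteq> []}" arbitrary: x rule: finite_psubset_induct)
    case psubset
    show ?case
    proof (cases "\<exists>i\<in>I. x i \<noteq> []")
      case False
      then have "x = \<one>\<^bsub>G\<^esub>" using psubset.prems(1) by (intro G_ext one_closed) (auto simp: one_G)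
      then show ?thesis using generate.one by metis
    next
      case True
      then obtain i where i: "i \<in> I" "x i \<noteq> []" by blast
      define y where "y = x(i := [])"
      have sub: "{k \<in> I. y k \<noteq> []} \<subset> {k \<in> I. x k \<noteq> []}" using i by (auto simp: y_def)
      have "y \<in> carrier G"
        using psubset.prems(1) i finite_subset[OF psubset_imp_subset[OF sub]]
        by (auto simp: carrier_G y_def PiE_iff extensional_def free_group_simps)
      moreover have "fst c = 1" if "k \<in> I" "c \<in> set (y k)" for k c
        using that psubset.prems(2)[of k c] by (auto simp: y_def split: if_splits)
      ultimately have "y \<in> generate G \<Gamma>" using psubset.hyps(2)[OF sub] by blast
      moreover have "emb i (x i) \<in> generate G \<Gamma>"
        using psubset.prems i by (intro emb_generate) (auto simp: G_reduced)
      moreover have "x = emb i (x i) \<otimes>\<^bsub>G\<^esub> y"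
      proof (rule G_ext[OF psubset.prems(1)])
        show "emb i (x i) \<otimes>\<^bsub>G\<^esub> y \<in> carrier G"
          using psubset.prems(1) i \<open>y \<in> carrier G\<close> by (intro m_closed emb_closed) (auto simp: carrier_G)
        show "x k = (emb i (x i) \<otimes>\<^bsub>G\<^esub> y) k" if "k \<in> I" for k
          using that G_reduced[OF psubset.prems(1) that]
          by (cases "k = i") (simp_all add: mult_G emb_def y_def foldr_red_cons_Nil)
      qed
      ultimately show ?thesis using generate.eng by metis
    qed
  qed
qed

text \<open>
  Write the bad component of \<open>h\<close> as \<open>u v s\<close> with \<open>u\<close>, \<open>s\<close> powers of the generator and \<open>v\<close> beginning
  and ending in other letters. Unless \<open>s x\<close> begins with another letter, nothing cancels in \<open>v (s x)\<close>.
\<close>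

lemma wandering_G:
  assumes h: "h \<in> carrier G" "h \<notin> generate G \<Gamma>"
  shows "\<exists>Z \<alpha> l r. Z \<subseteq> carrier G \<and> \<alpha> \<in> generate G \<Gamma> \<and> l \<in> generate G \<Gamma> \<and> r \<in> generate G \<Gamma> \<and>
        (\<forall>k::nat. 0 < k \<longrightarrow> Z \<inter> (\<otimes>\<^bsub>G\<^esub>) (\<alpha> [^]\<^bsub>G\<^esub> k) ` Z = {}) \<and>
        (\<forall>x\<in>carrier G. r \<otimes>\<^bsub>G\<^esub> x \<notin> Z \<longrightarrow> inv\<^bsub>G\<^esub> l \<otimes>\<^bsub>G\<^esub> (h \<otimes>\<^bsub>G\<^esub> x) \<in> Z)"
proof -
  obtain i where i: "i \<in> I" "\<exists>c\<in>set (h i). fst c \<noteq> 1" using in_generate[OF h(1)] h(2) by blast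
  obtain u v s where w: "h i = u @ v @ s" and us: "\<forall>c\<in>set u. fst c = 1" "\<forall>c\<in>set s. fst c = 1"
    and v: "v \<noteq> []" "fst (hd v) \<noteq> 1" "fst (last v) \<noteq> 1"
    using split_at_first_and_last[of "h i" "\<lambda>c. fst c = 1"] i(2) by blast
  have red: "reduced u" "reduced v" "reduced s"
    using G_reduced[OF h(1) i(1)] unfolding w by (auto dest: reduced_appendD)
  define Z where "Z = {x \<in> carrier G. x i = [] \<or> fst (hd (x i)) \<noteq> 1}"
  have gl: "emb i u \<in> generate G \<Gamma>" "emb i s \<in> generate G \<Gamma>"
    using us red i by (auto intro: emb_generate)
  have cl: "emb i u \<in> carrier G" "emb i s \<in> carrier G"
    using gl generate_in_carrier[OF \<Gamma>_closed] by auto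
  have comp: "(x \<otimes>\<^bsub>G\<^esub> y) i = foldr red_cons (x i) (y i)" for x y using i by (simp add: mult_G)
  have \<alpha>: "gen i \<in> generate G \<Gamma>" using i by (intro generate.incl) (simp add: \<Gamma>_def)
  have disj: "Z \<inter> (\<otimes>\<^bsub>G\<^esub>) (gen i [^]\<^bsub>G\<^esub> k) ` Z = {}" if k: "0 < k" for k :: nat
  proof (rule ccontr)
    assume "Z \<inter> (\<otimes>\<^bsub>G\<^esub>) (gen i [^]\<^bsub>G\<^esub> k) ` Z \<noteq> {}"
    then obtain y where y: "y \<in> Z" "gen i [^]\<^bsub>G\<^esub> k \<otimes>\<^bsub>G\<^esub> y \<in> Z" by blast
    \<comment> \<open>A word of \<open>Z\<close> does not begin with the generator or its inverse,
      so nothing cancels, and as \<open>k\<close> is positive the product begins with the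
      generator.\<close>
    have "reduced (replicate k (1, False) @ y i)"
      using y(1) G_reduced[of y i] i reduced_replicate[of k 1]
      by (cases "y i") (auto simp: Z_def reduced_def successively_append_iff flip_letter_def)
    then have "(gen i [^]\<^bsub>G\<^esub> k \<otimes>\<^bsub>G\<^esub> y) i = replicate k (1, False) @ y i"
      using i by (simp add: comp gen_pow emb_def foldr_red_cons_append del: foldr_replicate)
    then show False using y(2) k by (cases k) (auto simp: Z_def)
  qed
  have into: "inv\<^bsub>G\<^esub> emb i u \<otimes>\<^bsub>G\<^esub> (h \<otimes>\<^bsub>G\<^esub> x) \<in> Z" if x: "x \<in> carrier G" "emb i s \<otimes>\<^bsub>G\<^esub> x \<notin> Z" for x
  proof -
    define y where "y = foldr red_cons s (x i)"
    have sx: "(emb i s \<otimes>\<^bsub>G\<^esub> x) i = y" using i by (simp add: comp emb_def y_def)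
    have yr: "reduced y" unfolding y_def using x i by (intro reduced_foldr G_reduced)
    \<comment> \<open>The product lies in \<open>carrier G\<close>, so being outside
      \<open>Z\<close> is a statement about its \<open>i\<close>-th coordinate alone.\<close>
    have y: "y \<noteq> []" "fst (hd y) = 1" using x cl sx by (auto simp: Z_def)
    have "reduced (v @ y)"
    proof -
      have "hd y \<noteq> flip_letter (last v)" using v(3) y(2) by (metis fst_flip)
      then show ?thesis using red(2) yr by (auto simp: reduced_def successively_append_iff)
    qed
    then have vy: "foldr red_cons v y = v @ y" by (rule foldr_red_cons_append)
    have ui: "u \<in> carrier (Fr i)"
      using h(1) i(1) red(1) unfolding carrier_G by (auto simp: free_group_simps PiE_iff w dest!: bspec[of _ _ i])
    have vyi: "v @ y \<in> carrier (Fr i)"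
    proof -
      have "set (x i) \<subseteq> {1..n i} \<times> UNIV" "set (h i) \<subseteq> {1..n i} \<times> UNIV"
        using x(1) h(1) i(1) unfolding carrier_G by (auto simp: free_group_simps PiE_iff)
      then show ?thesis
        using set_foldr_red_cons[of s "x i"] \<open>reduced (v @ y)\<close> unfolding w y_def[symmetric]
        by (auto simp: free_group_simps)
    qed
    interpret Fi: group "Fr i" by (rule grp)
    \<comment> \<open>\<open>h i\<close> acts on \<open>x i\<close> by \<open>s\<close>, then
      \<open>v\<close>, then \<open>u\<close>; the left factor removes \<open>u\<close> and leaves a
      word that begins with the first letter of \<open>v\<close>.\<close>
    have "(inv\<^bsub>G\<^esub> emb i u \<otimes>\<^bsub>G\<^esub> (h \<otimes>\<^bsub>G\<^esub> x)) i = inv\<^bsub>Fr i\<^esub> u \<otimes>\<^bsub>Fr i\<^esub> (u \<otimes>\<^bsub>Fr i\<^esub> (v @ y))"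
      using i cl by (simp add: comp inv_G emb_def w vy free_group_simps flip: y_def)
    also have "\<dots> = v @ y" using ui vyi by (simp add: Fi.m_assoc[symmetric])
    finally have "(inv\<^bsub>G\<^esub> emb i u \<otimes>\<^bsub>G\<^esub> (h \<otimes>\<^bsub>G\<^esub> x)) i = v @ y" .
    moreover have "inv\<^bsub>G\<^esub> emb i u \<otimes>\<^bsub>G\<^esub> (h \<otimes>\<^bsub>G\<^esub> x) \<in> carrier G" using cl h x by simp
    ultimately show ?thesis using v by (simp add: Z_def)
  qed
  have "Z \<subseteq> carrier G" by (auto simp: Z_def)
  then show ?thesis
    using \<alpha> gl disj into
    by (intro exI[of _ Z] exI[of _ "gen i"] exI[of _ "emb i u"] exI[of _ "emb i s"] conjI allI impI ballI)
qed

lemma wandering: "wandering G \<Gamma>"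
proof -
  interpret ell2_transport "carrier G" by unfold_locales (rule countable_G, rule infinite_G)
  show ?thesis
    by unfold_locales (use \<Gamma>_closed gen_comm gen_nontriv wandering_G in blast)+
qed

end

theorem theorem4p1:
  fixes N :: enat and n :: "nat \<Rightarrow> nat"
  assumes "1 \<le> N"
    and "\<And>i. i \<in> index_range N \<Longrightarrow> 2 \<le> n i"
  defines "G \<equiv> prod_free_groups N n"
  defines "M \<equiv> group_vn G"
  defines "A \<equiv> vn_generated (carrier G)
                 ((\<lambda>i. left_regular G (std_gen N n i 1)) ` index_range N)"
  shows "maximal_injective (carrier G) A M \<and>
    \<not> (\<exists>R. vn_subalgebra (carrier G) R M \<and> vn_factor (carrier G) R \<and>
            hyperfinite (carrier G) R \<and> A \<subseteq> R)"
proof -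
  interpret free_product_data N n by unfold_locales (use assms(1,2) in auto)
  interpret W: wandering "prod_free_groups N n" \<Gamma> by (rule wandering)
  have "A = vn_generated (carrier G) (left_regular G ` \<Gamma>)"
    by (simp add: A_def \<Gamma>_def gen_def image_image)
  then show ?thesis
    using W.wandering_maximal_injective unfolding G_def M_def by simp
qed

end
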